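(* There exists an absolute constant $c>0$ such that for all integers $N\ge3$ and $g\ge1$, if $A\subseteq\{1^3,2^3,\ldots,N^3\}$ is a $B_3[g]$-set, then $$|A|\ll g^{1/9}N\exp\left(-c\,\frac{(\log N)^{1/2}}{\log\log N}\right).$$
   Context: For an integer $h\ge2$ and a set $A$ of integers, $R_{A,h}(m)$ is the number of tuples $(a_1,\ldots,a_h)\in A^h$ with $a_1\le a_2\le\cdots\le a_h$ and $a_1+\cdots+a_h=m$. $A$ is a $B_h[g]$-set if $R_{A,h}(m)\le g$ for all integers $m$. $X\ll Y$ means $X\le CY$ for an absolute constant $C>0$. *)

theory Defs
  imports Complex_Main
begin

text \<open>A tuple \<open>a\<^sub>1 \<le> \<dots> \<le> a\<^sub>h\<close> is a sorted list of length \<open>h\<close>.\<close>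

definition ordered_reps :: "int set \<Rightarrow> nat \<Rightarrow> int \<Rightarrow> int list set" where
  "ordered_reps A h m = {as. length as = h \<and> set as \<subseteq> A \<and> sorted as \<and> sum_list as = m}"

definition rep_count :: "int set \<Rightarrow> nat \<Rightarrow> int \<Rightarrow> nat" where
  "rep_count A h m = card (ordered_reps A h m)"

text \<open>Since \<^const>\<open>card\<close> is \<open>0\<close> on infinite sets, finiteness is required explicitly: an integer
  with infinitely many representations violates the bound. The notion is used for \<open>h \<ge> 2\<close>.\<close>

definition Bh_set :: "nat \<Rightarrow> nat \<Rightarrow> int set \<Rightarrow> bool" where
  "Bh_set h g A \<longleftrightarrow> (\<forall>m. finite (ordered_reps A h m) \<and> rep_count A h m \<le> g)"

end

theory Submission
  imports Defs "HOL-Number_Theory.Number_Theory" "HOL-Analysis.Analysis"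
begin

text \<open>For primes $p$ with an excess of solutions of $1 + y^3 + z^3 \equiv 0 \pmod p$, weighting the sums
  $a + b + c$ of three cubes by $1 + \eta(p [p \mid a + b + c] - 1)$ cannot be far from the
  equidistributed case: a reverse Hoelder inequality with cubes gains a factor
  $1 + \Omega(p^{-1/2})$. The inequality tensorises over a set of primes with product at most $N$;
  comparing with the upper bound from the $B_3[g]$ condition yields
  $|A|^9 \ll g N^9 \prod_p (1 + \Omega(p^{-1/2}))^{-1}$.

  The excess is $-2 \operatorname{Re} \pi_p - 2$, where $\pi_p$ is the primary prime of
  $\mathbb{Z}[\omega]$ given by a cubic Jacobi sum. Mertens-type estimates twisted by $(z/|z|)^j$
  for $j = 0, 1, 2$ show that a positive proportion of the primes in $(Y, K Y]$, in the sense of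
  $\sum \log p / p$, have $-\operatorname{Re} \pi_p \ge \varepsilon \sqrt p$; taking
  $Y \asymp \log N$ gives the exponential saving. The nonvanishing of the relevant $L$-values at
  $1$ is shown by direct summation over the lattice $1 + 3\mathbb{Z}[\omega]$.\<close>

section \<open>The gain from a single prime\<close>

text \<open>The obstacle is that A may be badly distributed modulo p and so avoid the residue
  triples responsible for the excess. Unequal distribution is itself a gain: the mean of a cube
  exceeds the cube of the mean by a multiple of the variance, whereas the trilinear weighted part
  loses at most a constant multiple of the variance plus O(1/p). With a small fixed \<eta> the first
  effect absorbs the loss, and an excess of relative size p^(-1/2) survives the O(1/p). Third powers
  let the argument iterate: f^3 = f for an indicator f, and a weighted sum of cubes of functions is
  bounded below by cubes of their fibre means, so these means can serve as the functions for the
  remaining primes. Three variables raised to the third power give the exponent 9. The size of the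
  saving is dictated by the constraint that the product of the primes stay below N: by Chebyshev
  they may reach a constant times log N, and the sum of p^(-1/2) over a positive proportion of the
  primes in (Y, KY] has order Y^(1/2) / log Y.\<close>

lemma cube_lower_bound:
  fixes u :: real assumes "u \<ge> 0"
  shows "u ^ 3 \<ge> 1 + 3 * (u - 1) + 2 * (u - 1)\<^sup>2"
proof -
  have "u ^ 3 - (1 + 3 * (u - 1) + 2 * (u - 1)\<^sup>2) = (u - 1)\<^sup>2 * u"
    by (simp add: power2_eq_square power3_eq_cube algebra_simps)
  moreover have "(u - 1)\<^sup>2 * u \<ge> 0" using assms by simp
  ultimately show ?thesis by linarith
qed

text \<open>Truncation keeps $|u^3 - 1|$ within a constant multiple of $|u - 1|$ even for large $u$.\<close>

definition trunc_cube :: "real \<Rightarrow> real" where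
  "trunc_cube u = (min u 2) ^ 3"

lemma trunc_cube_nonneg: "u \<ge> 0 \<Longrightarrow> trunc_cube u \<ge> 0"
  by (simp add: trunc_cube_def)

lemma trunc_cube_le: "u \<ge> 0 \<Longrightarrow> trunc_cube u \<le> u ^ 3"
  by (auto simp: trunc_cube_def intro!: power_mono)

lemma trunc_cube_le_8: "u \<ge> 0 \<Longrightarrow> trunc_cube u \<le> 8"
  using power_mono[of "min u 2" 2 3] by (simp add: trunc_cube_def)

text \<open>The linear term 3(u - 1) has to survive truncation, because it is the one that
  disappears on averaging when u has mean 1; the price is a negative quadratic term, which the
  variance controls. Beyond u = 2 the difference of the two sides is a quadratic in u with positive
  minimum 25/4.\<close>

lemma trunc_cube_lower:
  assumes "u \<ge> 0"
  shows "trunc_cube u - 1 \<ge> 3 * (u - 1) - 3 * (u - 1)\<^sup>2"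
proof (cases "u \<le> 2")
  case True
  have "u ^ 3 \<ge> 1 + 3 * (u - 1) + 2 * (u - 1)\<^sup>2" using assms by (rule cube_lower_bound)
  moreover have "trunc_cube u = u ^ 3" using True by (simp add: trunc_cube_def)
  ultimately show ?thesis using zero_le_power2[of "u - 1"] by linarith
next
  case False
  have "7 - 3 * (u - 1) + 3 * (u - 1)\<^sup>2 = 3 * (u - 3/2)\<^sup>2 + 25/4"
    by (simp add: power2_eq_square algebra_simps)
  moreover have "3 * (u - 3/2)\<^sup>2 \<ge> 0" by simp
  moreover have "trunc_cube u = 8" using False by (simp add: trunc_cube_def)
  ultimately show ?thesis by linarith
qed

lemma trunc_cube_abs:
  assumes "u \<ge> 0"
  shows "\<bar>trunc_cube u - 1\<bar> \<le> 7 * \<bar>u - 1\<bar>"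
proof -
  let ?m = "min u 2"
  have m: "0 \<le> ?m" "?m \<le> 2" using assms by auto
  have "trunc_cube u - 1 = (?m - 1) * (?m\<^sup>2 + ?m + 1)"
    by (simp add: trunc_cube_def power2_eq_square power3_eq_cube algebra_simps)
  hence "\<bar>trunc_cube u - 1\<bar> = \<bar>?m - 1\<bar> * \<bar>?m\<^sup>2 + ?m + 1\<bar>" by (simp add: abs_mult)
  also have "\<bar>?m\<^sup>2 + ?m + 1\<bar> \<le> 7"
    using power_mono[OF m(2) m(1), of 2] m by auto
  hence "\<bar>?m - 1\<bar> * \<bar>?m\<^sup>2 + ?m + 1\<bar> \<le> \<bar>?m - 1\<bar> * 7" by (intro mult_left_mono) auto
  also have "\<bar>?m - 1\<bar> \<le> \<bar>u - 1\<bar>" by auto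
  finally show ?thesis by simp
qed

text \<open>The model is the indicator of $p \mid x^3 + y^3 + z^3$: a residue has at most three cube roots, and
  scaling identifies all slices with $x \not\equiv 0$.\<close>

locale symmetric_kernel =
  fixes p :: nat and I :: "nat \<Rightarrow> nat \<Rightarrow> nat \<Rightarrow> real" and \<nu> :: real
  assumes p_pos: "p > 0"
  assumes I_nonneg: "I x y z \<ge> 0"
  assumes I_swap12: "I x y z = I y x z"
  assumes I_swap23: "I x y z = I x z y"
  assumes I_fibre: "x < p \<Longrightarrow> y < p \<Longrightarrow> (\<Sum>z<p. I x y z) \<le> 3"
  assumes I_slice: "0 < x \<Longrightarrow> x < p \<Longrightarrow> (\<Sum>y<p. \<Sum>z<p. I x y z) = \<nu>"
begin

section \<open>Trilinear forms of a symmetric kernel and the gain they produce\<close>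

definition T :: "(nat \<Rightarrow> real) \<Rightarrow> (nat \<Rightarrow> real) \<Rightarrow> (nat \<Rightarrow> real) \<Rightarrow> real" where
  "T f g h = (\<Sum>x<p. \<Sum>y<p. \<Sum>z<p. f x * g y * h z * I x y z)"

lemma T_swap12: "T f g h = T g f h"
  unfolding T_def by (subst sum.swap) (intro sum.cong refl, simp add: I_swap12[of _ _] mult_ac)

lemma T_swap23: "T f g h = T f h g"
proof -
  have "(\<Sum>y<p. \<Sum>z<p. f x * g y * h z * I x y z) = (\<Sum>y<p. \<Sum>z<p. f x * h y * g z * I x y z)" for x
    by (subst sum.swap, intro sum.cong refl) (metis I_swap23 mult.assoc mult.commute)
  thus ?thesis by (simp add: T_def)
qed

lemma T_add: "T (\<lambda>x. f x + f' x) g h = T f g h + T f' g h"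
  unfolding T_def by (simp add: sum.distrib algebra_simps)

lemma T_add2: "T f (\<lambda>x. g x + g' x) h = T f g h + T f g' h"
  unfolding T_def by (simp add: sum.distrib algebra_simps)

lemma T_add3: "T f g (\<lambda>x. h x + h' x) = T f g h + T f g h'"
  unfolding T_def by (simp add: sum.distrib algebra_simps)

lemma T_mono:
  assumes "\<And>x. x < p \<Longrightarrow> 0 \<le> f x \<and> f x \<le> f' x" "\<And>x. x < p \<Longrightarrow> 0 \<le> g x \<and> g x \<le> g' x"
    "\<And>x. x < p \<Longrightarrow> 0 \<le> h x \<and> h x \<le> h' x"
  shows "T f g h \<le> T f' g' h'"
  unfolding T_def
  by (intro sum_mono mult_right_mono mult_mono mult_nonneg_nonneg I_nonneg)
     (use assms in \<open>force intro: order_trans mult_nonneg_nonneg\<close>)+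

lemma T_abs: "\<bar>T f g h\<bar> \<le> T (\<lambda>x. \<bar>f x\<bar>) (\<lambda>x. \<bar>g x\<bar>) (\<lambda>x. \<bar>h x\<bar>)"
  unfolding T_def
  by (intro order_trans[OF sum_abs] sum_mono) (simp add: abs_mult I_nonneg)

text \<open>Summing out the third variable costs only the fibre bound 3, so two small factors enter
  through the product of their sums, without losing a power of p.\<close>

lemma T_pair:
  assumes "\<And>x. x < p \<Longrightarrow> f x \<ge> 0" "\<And>x. x < p \<Longrightarrow> g x \<ge> 0"
  shows "T f g (\<lambda>_. 1) \<le> 3 * (\<Sum>x<p. f x) * (\<Sum>x<p. g x)"
proof -
  have "T f g (\<lambda>_. 1) = (\<Sum>x<p. \<Sum>y<p. f x * g y * (\<Sum>z<p. I x y z))"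
    by (simp add: T_def sum_distrib_left)
  also have "\<dots> \<le> (\<Sum>x<p. \<Sum>y<p. f x * g y * 3)"
    by (intro sum_mono mult_left_mono I_fibre mult_nonneg_nonneg assms) auto
  also have "\<dots> = 3 * (\<Sum>x<p. f x) * (\<Sum>x<p. g x)"
    by (simp add: sum_product sum_distrib_left sum_distrib_right mult_ac)
  finally show ?thesis .
qed

lemma slice_le: "x < p \<Longrightarrow> (\<Sum>y<p. \<Sum>z<p. I x y z) \<le> 3 * p"
  using sum_mono[of "{..<p}" "\<lambda>y. \<Sum>z<p. I x y z" "\<lambda>_. 3"] I_fibre by simp

definition dev :: "(nat \<Rightarrow> real) \<Rightarrow> real" where
  "dev u = (\<Sum>x<p. (u x - 1)\<^sup>2) / p"

lemma dev_nonneg: "dev u \<ge> 0"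
  by (simp add: dev_def sum_nonneg)

lemma sum_abs_sq_le: "(\<Sum>x<p. \<bar>u x - 1\<bar>)\<^sup>2 \<le> (real p)\<^sup>2 * dev u"
proof -
  have "(\<Sum>x<p. \<bar>u x - 1\<bar>)\<^sup>2 = (\<Sum>x<p. 1 * \<bar>u x - 1\<bar>)\<^sup>2" by simp
  also have "\<dots> \<le> (\<Sum>x<p. 1\<^sup>2) * (\<Sum>x<p. \<bar>u x - 1\<bar>\<^sup>2)"
    by (rule Cauchy_Schwarz_ineq_sum)
  also have "\<dots> = (real p)\<^sup>2 * dev u"
    using p_pos by (simp add: dev_def power2_eq_square field_simps)
  finally show ?thesis .
qed

lemma sum_abs_prod_le:
  "(\<Sum>x<p. \<bar>u x - 1\<bar>) * (\<Sum>x<p. \<bar>v x - 1\<bar>) \<le> (real p)\<^sup>2 * (dev u + dev v) / 2"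
  (is "?a * ?b \<le> _")
proof -
  have "2 * (?a * ?b) \<le> ?a\<^sup>2 + ?b\<^sup>2"
    using sum_squares_bound[of ?a ?b] by simp
  also have "\<dots> \<le> (real p)\<^sup>2 * (dev u + dev v)"
    using sum_abs_sq_le[of u] sum_abs_sq_le[of v] by (simp add: algebra_simps)
  finally show ?thesis by simp
qed

lemma nu_le: "\<nu> \<le> 3 * p" if "p > 1"
  using slice_le[of 1] I_slice[of 1] that by simp

lemma nu_nonneg: "\<nu> \<ge> 0" if "p > 1"
  using I_slice[of 1] that by (metis I_nonneg sum_nonneg zero_less_one)

text \<open>All slices with x > 0 have the same mass \<open>\<nu>\<close>, so apart from x = 0 the
  form sees \<open>a\<close> only through its sum, in which the linear part cancels by the mean
  condition. The constant 24 collects 3 from the slice at 0, where \<open>a\<close> is at least -1,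
  and 3 * 7 from removing \<open>a 0\<close> from the sum, since \<open>\<nu>\<close> is at most
  3p.\<close>

lemma T_single_lower:
  fixes u :: "nat \<Rightarrow> real"
  assumes p1: "p > 1"
  assumes u: "\<And>x. x < p \<Longrightarrow> u x \<ge> 0" and mean: "(\<Sum>x<p. u x) = p"
  defines "a \<equiv> (\<lambda>x. trunc_cube (u x) - 1)"
  shows "T a (\<lambda>_. 1) (\<lambda>_. 1) \<ge> - 9 * (real p)\<^sup>2 * dev u - 24 * p"
proof -
  have "(\<Sum>x<p. a x) \<ge> (\<Sum>x<p. 3 * (u x - 1) - 3 * (u x - 1)\<^sup>2)"
    unfolding a_def by (intro sum_mono trunc_cube_lower u) auto
  also have "(\<Sum>x<p. 3 * (u x - 1) - 3 * (u x - 1)\<^sup>2) = - 3 * p * dev u"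
    using mean p_pos by (simp add: dev_def sum_subtractf flip: sum_distrib_left)
  finally have s: "(\<Sum>x<p. a x) \<ge> - 3 * p * dev u" .
  have split: "sum f {..<p} = f 0 + sum f {1..<p}" for f :: "nat \<Rightarrow> real"
    using p_pos by (metis atLeast0LessThan sum.atLeast_Suc_lessThan One_nat_def)
  have a0: "a 0 \<le> 7" "a 0 \<ge> -1"
    using u[of 0] p_pos trunc_cube_le_8[of "u 0"] trunc_cube_nonneg[of "u 0"] by (auto simp: a_def)
  define c where "c = (\<Sum>y<p. \<Sum>z<p. I 0 y z)"
  have c: "0 \<le> c" "c \<le> 3 * p"
    using slice_le[of 0] p_pos by (auto simp: c_def intro!: sum_nonneg I_nonneg)
  have "T a (\<lambda>_. 1) (\<lambda>_. 1) = (\<Sum>x<p. a x * (\<Sum>y<p. \<Sum>z<p. I x y z))"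
    by (simp add: T_def sum_distrib_left)
  also have "\<dots> = a 0 * c + (\<Sum>x=1..<p. a x * \<nu>)"
    by (subst split) (simp add: c_def I_slice)
  also have "\<dots> = a 0 * c + \<nu> * ((\<Sum>x<p. a x) - a 0)"
    using split[of a] by (simp add: sum_distrib_left mult_ac)
  finally have eq: "T a (\<lambda>_. 1) (\<lambda>_. 1) = a 0 * c + \<nu> * ((\<Sum>x<p. a x) - a 0)" .
  have "a 0 * c \<ge> -1 * c" using a0 c by (intro mult_right_mono) auto
  hence A: "a 0 * c \<ge> - 3 * real p" using c by linarith
  have "\<nu> * ((\<Sum>x<p. a x) - a 0) \<ge> \<nu> * (- 3 * p * dev u - 7)"
    using s a0 nu_nonneg[OF p1] by (intro mult_left_mono) linarith+
  moreover have "\<nu> * (- 3 * p * dev u - 7) \<ge> (3 * p) * (- 3 * p * dev u - 7)"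
    using mult_nonneg_nonneg[OF _ dev_nonneg[of u], of "3 * real p"] nu_le[OF p1]
    by (intro mult_right_mono_neg) auto
  ultimately show ?thesis using A eq by (simp add: power2_eq_square algebra_simps)
qed

text \<open>Two deviation factors are already of second order, so absolute values suffice. In 147/2
  the factor 49 comes from \<open>trunc_cube_abs\<close> used twice, 3 from the fibre bound and 1/2
  from bounding a product by the mean of two squares.\<close>

lemma T_double_lower:
  fixes u v h :: "nat \<Rightarrow> real"
  assumes u: "\<And>x. x < p \<Longrightarrow> u x \<ge> 0" and v: "\<And>x. x < p \<Longrightarrow> v x \<ge> 0"
  assumes h: "\<And>x. x < p \<Longrightarrow> \<bar>h x\<bar> \<le> B"
  shows "T (\<lambda>x. trunc_cube (u x) - 1) (\<lambda>x. trunc_cube (v x) - 1) h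
           \<ge> - (147/2) * B * (real p)\<^sup>2 * (dev u + dev v)"
proof -
  have B: "B \<ge> 0" using h[OF p_pos] by linarith
  define a b where "a = (\<lambda>x. trunc_cube (u x) - 1)" and "b = (\<lambda>x. trunc_cube (v x) - 1)"
  have "\<bar>T a b h\<bar> \<le> T (\<lambda>x. \<bar>a x\<bar>) (\<lambda>x. \<bar>b x\<bar>) (\<lambda>x. \<bar>h x\<bar>)" by (rule T_abs)
  also have "\<dots> \<le> T (\<lambda>x. 7 * \<bar>u x - 1\<bar>) (\<lambda>x. 7 * \<bar>v x - 1\<bar>) (\<lambda>_. B)"
    by (intro T_mono) (auto simp: a_def b_def u v h intro!: trunc_cube_abs)
  also have "\<dots> = 49 * B * T (\<lambda>x. \<bar>u x - 1\<bar>) (\<lambda>x. \<bar>v x - 1\<bar>) (\<lambda>_. 1)"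
    by (simp add: T_def sum_distrib_left mult_ac)
  also have "\<dots> \<le> 49 * B * (3 * (\<Sum>x<p. \<bar>u x - 1\<bar>) * (\<Sum>x<p. \<bar>v x - 1\<bar>))"
    using B by (intro mult_left_mono T_pair) auto
  also have "\<dots> = 147 * B * ((\<Sum>x<p. \<bar>u x - 1\<bar>) * (\<Sum>x<p. \<bar>v x - 1\<bar>))" by simp
  also have "\<dots> \<le> 147 * B * ((real p)\<^sup>2 * (dev u + dev v) / 2)"
    using B by (intro mult_left_mono sum_abs_prod_le) auto
  finally show ?thesis by (simp add: a_def b_def)
qed

text \<open>Each cube is replaced by its truncation, written as 1 plus a deviation, and the form is
  expanded into eight terms. The variances receive at most 9 from the single terms, 147 from the
  three double terms and 1029/2 from the triple term, whose third factor is bounded by 7; the total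
  670.5 is rounded up to 671, and 72 = 3 * 24.\<close>

lemma T_cubes_lower:
  fixes u v w :: "nat \<Rightarrow> real"
  assumes p1: "p > 1"
  assumes u: "\<And>x. x < p \<Longrightarrow> u x \<ge> 0" and v: "\<And>x. x < p \<Longrightarrow> v x \<ge> 0"
    and w: "\<And>x. x < p \<Longrightarrow> w x \<ge> 0"
  assumes mean: "(\<Sum>x<p. u x) = p" "(\<Sum>x<p. v x) = p" "(\<Sum>x<p. w x) = p"
  shows "T (\<lambda>x. u x ^ 3) (\<lambda>x. v x ^ 3) (\<lambda>x. w x ^ 3)
           \<ge> (real p - 1) * \<nu> - 72 * p - 671 * (real p)\<^sup>2 * (dev u + dev v + dev w)"
proof -
  define a b d where "a = (\<lambda>x. trunc_cube (u x) - 1)" and "b = (\<lambda>x. trunc_cube (v x) - 1)"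
    and "d = (\<lambda>x. trunc_cube (w x) - 1)"
  let ?o = "\<lambda>_::nat. 1::real"
  have bd: "\<bar>d x\<bar> \<le> 7" if "x < p" for x
    using trunc_cube_le_8[OF w[OF that]] trunc_cube_nonneg[OF w[OF that]] by (auto simp: d_def)
  have "T (\<lambda>x. u x ^ 3) (\<lambda>x. v x ^ 3) (\<lambda>x. w x ^ 3)
      \<ge> T (\<lambda>x. trunc_cube (u x)) (\<lambda>x. trunc_cube (v x)) (\<lambda>x. trunc_cube (w x))"
    by (intro T_mono conjI trunc_cube_nonneg trunc_cube_le u v w)
  also have "T (\<lambda>x. trunc_cube (u x)) (\<lambda>x. trunc_cube (v x)) (\<lambda>x. trunc_cube (w x)) =
      T (\<lambda>x. 1 + a x) (\<lambda>x. 1 + b x) (\<lambda>x. 1 + d x)"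
    by (simp add: a_def b_def d_def)
  also have "\<dots> = T ?o ?o ?o + (T a ?o ?o + T ?o b ?o + T ?o ?o d)
      + (T a b ?o + T a ?o d + T ?o b d) + T a b d"
    by (simp add: T_add T_add2 T_add3)
  also have "T ?o b ?o = T b ?o ?o" by (rule T_swap12)
  also have "T ?o ?o d = T d ?o ?o" by (metis T_swap12 T_swap23)
  also have "T a ?o d = T a d ?o" by (rule T_swap23)
  also have "T ?o b d = T b d ?o" by (metis T_swap12 T_swap23)
  finally have main: "T (\<lambda>x. u x ^ 3) (\<lambda>x. v x ^ 3) (\<lambda>x. w x ^ 3) \<ge>
      T ?o ?o ?o + (T a ?o ?o + T b ?o ?o + T d ?o ?o)
      + (T a b ?o + T a d ?o + T b d ?o) + T a b d" .
  have "T ?o ?o ?o \<ge> (\<Sum>x=1..<p. \<Sum>y<p. \<Sum>z<p. I x y z)"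
    unfolding T_def by simp (intro sum_mono2 sum_nonneg I_nonneg, auto)
  also have "(\<Sum>x=1..<p. \<Sum>y<p. \<Sum>z<p. I x y z) = (\<Sum>x=1..<p. \<nu>)"
    by (intro sum.cong refl I_slice) auto
  also have "\<dots> = (real p - 1) * \<nu>" using p_pos by (simp add: of_nat_diff)
  finally have t0: "T ?o ?o ?o \<ge> (real p - 1) * \<nu>" .
  let ?P = "(real p)\<^sup>2"
  have t1: "T a ?o ?o \<ge> - 9 * ?P * dev u - 24 * p" "T b ?o ?o \<ge> - 9 * ?P * dev v - 24 * p"
    "T d ?o ?o \<ge> - 9 * ?P * dev w - 24 * p"
    unfolding a_def b_def d_def by (intro T_single_lower p1 u v w mean; assumption)+
  have t2: "T a b ?o \<ge> - (147/2) * 1 * ?P * (dev u + dev v)"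
     "T a d ?o \<ge> - (147/2) * 1 * ?P * (dev u + dev w)"
     "T b d ?o \<ge> - (147/2) * 1 * ?P * (dev v + dev w)"
    unfolding a_def b_def d_def by (intro T_double_lower u v w; simp)+
  have t3: "T a b d \<ge> - (147/2) * 7 * ?P * (dev u + dev v)"
    unfolding a_def b_def by (intro T_double_lower u v bd)
  have nn: "?P * dev u \<ge> 0" "?P * dev v \<ge> 0" "?P * dev w \<ge> 0"
    by (simp_all add: dev_nonneg)
  define U V W where "U = ?P * dev u" and "V = ?P * dev v" and "W = ?P * dev w"
  note t1' = t1[unfolded mult.assoc, folded U_def V_def W_def]
  have t2': "T a b ?o \<ge> - (147/2) * (U + V)" "T a d ?o \<ge> - (147/2) * (U + W)"
     "T b d ?o \<ge> - (147/2) * (V + W)" "T a b d \<ge> - (1029/2) * (U + V)"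
    using t2 t3 by (simp_all add: U_def V_def W_def algebra_simps add_divide_distrib)
  have "671 * ?P * (dev u + dev v + dev w) = 671 * (U + V + W)"
    by (simp add: U_def V_def W_def algebra_simps)
  moreover have "T a ?o ?o + T b ?o ?o + T d ?o ?o \<ge> - 9 * (U + V + W) - 72 * real p"
    using t1' by simp
  moreover have "T a b ?o + T a d ?o + T b d ?o + T a b d \<ge> - 147 * (U + V + W) - (1029/2) * (U + V)"
  proof -
    define X Y Z where "X = T a b ?o" and "Y = T a d ?o" and "Z = T b d ?o"
    have "X \<ge> - (147/2) * (U + V)" "Y \<ge> - (147/2) * (U + W)" "Z \<ge> - (147/2) * (V + W)"
      "T a b d \<ge> - (1029/2) * (U + V)"
      using t2' by (simp_all add: X_def Y_def Z_def)
    hence "X + Y + Z + T a b d \<ge> - (147/2) * (U + V) - (147/2) * (U + W) - (147/2) * (V + W) - (1029/2) * (U + V)"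
      by linarith
    also have "- (147/2) * (U + V) - (147/2) * (U + W) - (147/2) * (V + W) - (1029/2) * (U + V) = - 147 * (U + V + W) - (1029/2) * (U + V)"
      by (simp add: field_simps)
    finally show ?thesis by (simp add: X_def Y_def Z_def)
  qed
  moreover have "U \<ge> 0" "V \<ge> 0" "W \<ge> 0" using nn by (simp_all add: U_def V_def W_def)
  hence "- 9 * (U + V + W) - 72 * real p - 147 * (U + V + W) - (1029/2) * (U + V) \<ge> - 72 * real p - 671 * (U + V + W)"
    by (simp add: algebra_simps)
  ultimately show ?thesis using main t0 unfolding of_nat_mult of_nat_numeral by linarith
qed

text \<open>Here the value \<eta> = 1/400 is decided. In units of p^3/400 the unweighted part has a
  surplus of 2 * 399 times the variances by \<open>cube_lower_bound\<close>, and the weighted part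
  loses at most 671 times the variances. The excess in \<open>\<nu>\<close> is then left over,
  halved by terms of lower order.\<close>

lemma normalised_gain:
  fixes u v w :: "nat \<Rightarrow> real"
  assumes eps: "0 < \<epsilon>" "\<epsilon> \<le> 1" and p_large: "sqrt p \<ge> 148 / \<epsilon>" and nu: "\<nu> \<ge> p + \<epsilon> * sqrt p"
  assumes u: "\<And>x. x < p \<Longrightarrow> u x \<ge> 0" and v: "\<And>x. x < p \<Longrightarrow> v x \<ge> 0"
    and w: "\<And>x. x < p \<Longrightarrow> w x \<ge> 0"
  assumes mean: "(\<Sum>x<p. u x) = p" "(\<Sum>x<p. v x) = p" "(\<Sum>x<p. w x) = p"
  shows "(399/400) * ((\<Sum>x<p. u x ^ 3) * (\<Sum>x<p. v x ^ 3) * (\<Sum>x<p. w x ^ 3))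
         + (1/400) * p * T (\<lambda>x. u x ^ 3) (\<lambda>x. v x ^ 3) (\<lambda>x. w x ^ 3)
       \<ge> (1 + \<epsilon> / (800 * sqrt p)) * real p ^ 3"
proof -
  have "148 / \<epsilon> \<ge> 148" using eps by (simp add: field_simps)
  hence sp: "sqrt p \<ge> 148" using p_large by linarith
  hence p1: "p > 1" by (metis One_nat_def Suc_lessI le_numeral_extra(4) not_numeral_le_zero of_nat_0 of_nat_1 p_pos real_sqrt_one one_le_numeral numeral_le_one_iff order_trans semiring_norm(69))
  have s3: "(\<Sum>x<p. f x ^ 3) \<ge> p * (1 + 2 * dev f)"
    if "\<And>x. x < p \<Longrightarrow> f x \<ge> 0" "(\<Sum>x<p. f x) = p" for f :: "nat \<Rightarrow> real"
  proof -
    have "(\<Sum>x<p. f x ^ 3) \<ge> (\<Sum>x<p. 1 + 3 * (f x - 1) + 2 * (f x - 1)\<^sup>2)"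
      by (intro sum_mono cube_lower_bound that) auto
    also have "(\<Sum>x<p. 1 + 3 * (f x - 1) + 2 * (f x - 1)\<^sup>2) = p * (1 + 2 * dev f)"
      using that(2) p_pos
      by (simp add: sum.distrib sum_subtractf dev_def flip: sum_distrib_left) (simp add: field_simps)
    finally show ?thesis .
  qed
  define S where "S = dev u + dev v + dev w"
  have S0: "S \<ge> 0" by (simp add: S_def dev_nonneg)
  have "(\<Sum>x<p. u x ^ 3) * (\<Sum>x<p. v x ^ 3) * (\<Sum>x<p. w x ^ 3) \<ge>
      (p * (1 + 2 * dev u)) * (p * (1 + 2 * dev v)) * (p * (1 + 2 * dev w))"
    by (intro mult_mono s3 u v w mean mult_nonneg_nonneg sum_nonneg)
       (auto simp: dev_nonneg u v w)
  also have "(p * (1 + 2 * dev u)) * (p * (1 + 2 * dev v)) * (p * (1 + 2 * dev w))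
     = real p ^ 3 * ((1 + 2 * dev u) * (1 + 2 * dev v) * (1 + 2 * dev w))"
    by (simp add: power3_eq_cube mult_ac)
  also have "(1 + 2 * dev u) * (1 + 2 * dev v) * (1 + 2 * dev w) \<ge> 1 + 2 * S"
    using dev_nonneg[of u] dev_nonneg[of v] dev_nonneg[of w]
    by (simp add: S_def algebra_simps)
  hence "real p ^ 3 * ((1 + 2 * dev u) * (1 + 2 * dev v) * (1 + 2 * dev w)) \<ge> real p ^ 3 * (1 + 2 * S)"
    by (intro mult_left_mono) auto
  finally have A: "(\<Sum>x<p. u x ^ 3) * (\<Sum>x<p. v x ^ 3) * (\<Sum>x<p. w x ^ 3) \<ge> real p ^ 3 * (1 + 2 * S)" .
  have "T (\<lambda>x. u x ^ 3) (\<lambda>x. v x ^ 3) (\<lambda>x. w x ^ 3)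
           \<ge> (real p - 1) * \<nu> - 72 * p - 671 * (real p)\<^sup>2 * S"
    unfolding S_def by (rule T_cubes_lower[OF p1 u v w mean])
  moreover have "(real p - 1) * \<nu> \<ge> (real p - 1) * (p + \<epsilon> * sqrt p)"
    using p1 nu by (intro mult_left_mono) auto
  moreover have "\<epsilon> * sqrt p \<le> p"
  proof -
    have "\<epsilon> * sqrt p \<le> 1 * sqrt p" using eps by (intro mult_right_mono) auto
    also have "\<dots> \<le> sqrt p * sqrt p" by (rule mult_right_mono) (use sp in linarith, simp)
    finally show ?thesis by simp
  qed
  \<comment> \<open>74 = 72 + 2: one p is lost in (p - 1) p, another in \<epsilon> sqrt p \<le>
    p.\<close>
  ultimately have "T (\<lambda>x. u x ^ 3) (\<lambda>x. v x ^ 3) (\<lambda>x. w x ^ 3)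
      \<ge> real p * p + \<epsilon> * p * sqrt p - 74 * p - 671 * (real p)\<^sup>2 * S"
    by (simp add: algebra_simps)
  hence "p * T (\<lambda>x. u x ^ 3) (\<lambda>x. v x ^ 3) (\<lambda>x. w x ^ 3)
      \<ge> p * (real p * p + \<epsilon> * p * sqrt p - 74 * p - 671 * (real p)\<^sup>2 * S)"
    by (intro mult_left_mono) auto
  also have "p * (real p * p + \<epsilon> * p * sqrt p - 74 * p - 671 * (real p)\<^sup>2 * S)
     = real p ^ 3 - 671 * (real p ^ 3 * S) + (real p)\<^sup>2 * (\<epsilon> * sqrt p - 74)"
    by (simp add: power2_eq_square power3_eq_cube algebra_simps)
  finally have B: "p * T (\<lambda>x. u x ^ 3) (\<lambda>x. v x ^ 3) (\<lambda>x. w x ^ 3) \<ge>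
     real p ^ 3 - 671 * (real p ^ 3 * S) + (real p)\<^sup>2 * (\<epsilon> * sqrt p - 74)" .
  \<comment> \<open>148 = 2 * 74, so that half of \<epsilon> sqrt p outweighs the lower-order
    term.\<close>
  have "\<epsilon> * sqrt p \<ge> 148" using p_large eps by (simp add: field_simps)
  hence "(real p)\<^sup>2 * (\<epsilon> * sqrt p - 74) \<ge> (real p)\<^sup>2 * (\<epsilon> * sqrt p / 2)"
    by (intro mult_left_mono) auto
  also have "(real p)\<^sup>2 * (\<epsilon> * sqrt p / 2) = \<epsilon> / (2 * sqrt p) * real p ^ 3"
  proof -
    have "real p * p * (\<epsilon> * sqrt p / 2) = \<epsilon> / (2 * sqrt p) * (real p * p * (sqrt p * sqrt p))"
      using p_pos by (simp add: field_simps del: real_sqrt_mult_self)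
    thus ?thesis by (simp add: power2_eq_square power3_eq_cube)
  qed
  finally have "(real p)\<^sup>2 * (\<epsilon> * sqrt p - 74) \<ge> \<epsilon> / (2 * sqrt p) * real p ^ 3" .
  moreover have "real p ^ 3 * S \<ge> 0" using S0 by simp
  moreover have "(1 + \<epsilon> / (800 * sqrt p)) * real p ^ 3 = real p ^ 3 + (1/400) * (\<epsilon> / (2 * sqrt p) * real p ^ 3)"
    by (simp add: algebra_simps)
  ultimately show ?thesis using A B by (simp add: algebra_simps)
qed

text \<open>Both sides are homogeneous of degree three in each function, so division by the means
  reduces to mean 1. If some mean is 0, the right-hand side vanishes and positivity is
  enough.\<close>

theorem gain:
  fixes u v w :: "nat \<Rightarrow> real"
  assumes eps: "0 < \<epsilon>" "\<epsilon> \<le> 1" and p_large: "sqrt p \<ge> 148 / \<epsilon>" and nu: "\<nu> \<ge> p + \<epsilon> * sqrt p"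
  assumes u: "\<And>x. x < p \<Longrightarrow> u x \<ge> 0" and v: "\<And>x. x < p \<Longrightarrow> v x \<ge> 0"
    and w: "\<And>x. x < p \<Longrightarrow> w x \<ge> 0"
  shows "(399/400) * ((\<Sum>x<p. u x ^ 3) * (\<Sum>x<p. v x ^ 3) * (\<Sum>x<p. w x ^ 3))
         + (1/400) * p * T (\<lambda>x. u x ^ 3) (\<lambda>x. v x ^ 3) (\<lambda>x. w x ^ 3)
       \<ge> (1 + \<epsilon> / (800 * sqrt p)) * real p ^ 3
           * ((\<Sum>x<p. u x) / p) ^ 3 * ((\<Sum>x<p. v x) / p) ^ 3 * ((\<Sum>x<p. w x) / p) ^ 3"
    (is "?L u v w \<ge> _")
proof -
  define a b c where "a = (\<Sum>x<p. u x) / p" and "b = (\<Sum>x<p. v x) / p" and "c = (\<Sum>x<p. w x) / p"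
  have nn: "a \<ge> 0" "b \<ge> 0" "c \<ge> 0" by (auto simp: a_def b_def c_def u v w intro!: sum_nonneg divide_nonneg_nonneg)
  have T0: "T (\<lambda>x. u x ^ 3) (\<lambda>x. v x ^ 3) (\<lambda>x. w x ^ 3) \<ge> 0"
    unfolding T_def by (intro sum_nonneg mult_nonneg_nonneg I_nonneg zero_le_power u v w) auto
  have L0: "?L u v w \<ge> 0"
    by (intro add_nonneg_nonneg mult_nonneg_nonneg sum_nonneg T0 zero_le_power u v w) auto
  show ?thesis
  proof (cases "a = 0 \<or> b = 0 \<or> c = 0")
    case True
    thus ?thesis using L0 by (auto simp: a_def b_def c_def)
  next
    case False
    with nn have pos: "a > 0" "b > 0" "c > 0" by auto
    have mean: "(\<Sum>x<p. u x / a) = p" "(\<Sum>x<p. v x / b) = p" "(\<Sum>x<p. w x / c) = p"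
      unfolding sum_divide_distrib[symmetric] using pos p_pos by (auto simp: a_def b_def c_def)
    have "?L (\<lambda>x. u x / a) (\<lambda>x. v x / b) (\<lambda>x. w x / c) \<ge> (1 + \<epsilon> / (800 * sqrt p)) * real p ^ 3"
      by (intro normalised_gain[OF eps p_large nu] mean divide_nonneg_nonneg u v w nn)
    also have "?L (\<lambda>x. u x / a) (\<lambda>x. v x / b) (\<lambda>x. w x / c) = ?L u v w / (a ^ 3 * b ^ 3 * c ^ 3)"
    proof -
      have "T (\<lambda>x. (u x / a) ^ 3) (\<lambda>x. (v x / b) ^ 3) (\<lambda>x. (w x / c) ^ 3) =
          T (\<lambda>x. u x ^ 3) (\<lambda>x. v x ^ 3) (\<lambda>x. w x ^ 3) / (a ^ 3 * b ^ 3 * c ^ 3)"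
        by (simp add: T_def sum_divide_distrib power_divide)
      thus ?thesis by (simp add: power_divide add_divide_distrib flip: sum_divide_distrib)
    qed
    finally show ?thesis using pos
      by (simp add: pos_le_divide_eq mult_ac flip: a_def b_def c_def)
  qed
qed

end

section \<open>Weights on sums of three cubes and the gain at one prime\<close>

text \<open>The average over a full set of residues modulo p is 399/400 + 1/400 = 1, so weighting
  does not change counts over complete periods; 1/400 is the value of \<eta> that the gain
  inequality permits.\<close>

definition wt :: "nat \<Rightarrow> nat \<Rightarrow> real" where
  "wt p m = 399/400 + (if p dvd m then p / 400 else 0)"

definition nu :: "nat \<Rightarrow> nat" where
  "nu p = card {(y, z). y < p \<and> z < p \<and> p dvd 1 + y ^ 3 + z ^ 3}"

text \<open>The cubic curve 1 + y^3 + z^3 = 0 has p affine points up to an error of order sqrt p, so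
  the demanded excess is of the largest possible order. The bound on sqrt p is the largeness
  condition of the gain inequality.\<close>

definition gain_prime :: "real \<Rightarrow> nat \<Rightarrow> bool" where
  "gain_prime \<epsilon> p \<longleftrightarrow> prime p \<and> sqrt p \<ge> 148 / \<epsilon> \<and> nu p \<ge> p + \<epsilon> * sqrt p"

definition gain_factor :: "real \<Rightarrow> nat \<Rightarrow> real" where
  "gain_factor \<epsilon> p = 1 + \<epsilon> / (800 * sqrt p)"

lemma bij_betw_affine_mod:
  fixes Q p r :: nat
  assumes "coprime Q p" "p > 0"
  shows "bij_betw (\<lambda>t. (r + t * Q) mod p) {..<p} {..<p}"
proof -
  have "inj_on (\<lambda>t. (r + t * Q) mod p) {..<p}"
  proof (rule inj_onI)
    fix s t assume st: "s \<in> {..<p}" "t \<in> {..<p}" "(r + s * Q) mod p = (r + t * Q) mod p"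
    hence "[r + s * Q = r + t * Q] (mod p)" by (simp add: unique_euclidean_semiring_class.cong_def)
    hence "[s * Q = t * Q] (mod p)" by (simp add: cong_add_lcancel_nat)
    hence "[s = t] (mod p)" using assms by (metis cong_mult_rcancel_nat)
    thus "s = t" using st by (simp add: unique_euclidean_semiring_class.cong_def)
  qed
  moreover have "(\<lambda>t. (r + t * Q) mod p) ` {..<p} \<subseteq> {..<p}" using assms by auto
  ultimately show ?thesis by (simp add: bij_betw_def endo_inj_surj)
qed

lemma dvd_cube_sum_cong:
  fixes p :: nat
  assumes "[x = x'] (mod p)" "[y = y'] (mod p)" "[z = z'] (mod p)"
  shows "p dvd x ^ 3 + y ^ 3 + z ^ 3 \<longleftrightarrow> p dvd x' ^ 3 + y' ^ 3 + z' ^ 3"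
  by (intro cong_dvd_iff cong_add cong_pow assms)

lemma wt_cong: "[m = n] (mod p) \<Longrightarrow> wt p m = wt p n"
  by (simp add: wt_def cong_dvd_iff)

lemma wt_nonneg: "wt p m \<ge> 0"
  by (simp add: wt_def)

lemma symmetric_kernel_cubes:
  assumes p: "prime p"
  shows "symmetric_kernel p (\<lambda>x y z. if p dvd x ^ 3 + y ^ 3 + z ^ 3 then 1 else 0) (nu p)"
proof
  have p0: "p > 0" using p by (simp add: prime_gt_0_nat)
  thus "0 < p" .
  fix x y z :: nat
  show "(if p dvd x ^ 3 + y ^ 3 + z ^ 3 then 1 else 0 :: real) \<ge> 0" by simp
  show "(if p dvd x ^ 3 + y ^ 3 + z ^ 3 then 1 else 0 :: real) = (if p dvd y ^ 3 + x ^ 3 + z ^ 3 then 1 else 0)"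
    by (simp add: add_ac)
  show "(if p dvd x ^ 3 + y ^ 3 + z ^ 3 then 1 else 0 :: real) = (if p dvd x ^ 3 + z ^ 3 + y ^ 3 then 1 else 0)"
    by (simp add: add_ac)
  assume x: "x < p"
  {
    assume "y < p"
    let ?s = "x ^ 3 + y ^ 3"
    \<comment> \<open>The residue of minus s modulo p; the factor p - 1 keeps it among the natural
      numbers.\<close>
    define c where "c = (p - 1) * ?s"
    have c: "[c + ?s = 0] (mod p)"
    proof -
      have "c + ?s = p * ?s" using p0 by (simp add: c_def diff_mult_distrib)
      thus ?thesis by (simp add: unique_euclidean_semiring_class.cong_def)
    qed
    have "{z \<in> {..<p}. p dvd ?s + z ^ 3} \<subseteq> {z \<in> {..<p}. [z ^ 3 = c] (mod p)}"
    proof safe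
      fix z assume "z < p" "p dvd ?s + z ^ 3"
      hence "[?s + z ^ 3 = c + ?s] (mod p)" using c by (simp add: unique_euclidean_semiring_class.cong_def mod_eq_0_iff_dvd)
      thus "[z ^ 3 = c] (mod p)" by (metis add.commute cong_add_lcancel_nat)
    qed
    hence "card {z \<in> {..<p}. p dvd ?s + z ^ 3} \<le> card {z \<in> {..<p}. [z ^ 3 = c] (mod p)}"
      by (intro card_mono) auto
    also have "\<dots> \<le> 3" using roots_mod_prime_bound[OF p, of 3 c] by simp
    finally have "card {z \<in> {..<p}. p dvd ?s + z ^ 3} \<le> 3" .
    thus "(\<Sum>z<p. if p dvd x ^ 3 + y ^ 3 + z ^ 3 then 1 else 0 :: real) \<le> 3"
      by (simp add: Int_def flip: sum.inter_filter)
  }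
  assume x0: "0 < x"
  have cop: "coprime x p" using p x x0
    by (metis coprime_commute nat_dvd_not_less prime_imp_coprime_nat)
  note bij = bij_betw_affine_mod[OF cop p0, of 0, simplified]
  have "(\<Sum>y<p. \<Sum>z<p. if p dvd x ^ 3 + y ^ 3 + z ^ 3 then 1 else 0 :: real) =
    (\<Sum>y<p. \<Sum>z<p. if p dvd x ^ 3 + (y * x mod p) ^ 3 + (z * x mod p) ^ 3 then 1 else 0)"
    by (subst sum.reindex_bij_betw[OF bij, symmetric])
       (intro sum.cong refl sum.reindex_bij_betw[OF bij, symmetric])
  also have "\<dots> = (\<Sum>y<p. \<Sum>z<p. if p dvd 1 + y ^ 3 + z ^ 3 then 1 else 0)"
  proof (intro sum.cong refl)
    fix y z
    have "p dvd x ^ 3 + (y * x mod p) ^ 3 + (z * x mod p) ^ 3 \<longleftrightarrow> p dvd x ^ 3 + (y * x) ^ 3 + (z * x) ^ 3"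
      by (intro dvd_cube_sum_cong) (auto simp: unique_euclidean_semiring_class.cong_def)
    also have "x ^ 3 + (y * x) ^ 3 + (z * x) ^ 3 = (1 + y ^ 3 + z ^ 3) * x ^ 3"
      by (simp add: algebra_simps)
    also have "p dvd \<dots> \<longleftrightarrow> p dvd 1 + y ^ 3 + z ^ 3"
      using cop by (intro coprime_dvd_mult_left_iff) (simp add: coprime_commute)
    finally show "(if p dvd x ^ 3 + (y * x mod p) ^ 3 + (z * x mod p) ^ 3 then 1 else 0 :: real) =
      (if p dvd 1 + y ^ 3 + z ^ 3 then 1 else 0)" by simp
  qed
  also have "\<dots> = (\<Sum>yz\<in>{..<p} \<times> {..<p}. if p dvd 1 + fst yz ^ 3 + snd yz ^ 3 then 1 else 0)"
    by (simp add: sum.cartesian_product case_prod_unfold)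
  also have "\<dots> = card {yz \<in> {..<p} \<times> {..<p}. p dvd 1 + fst yz ^ 3 + snd yz ^ 3}"
    by (simp add: Int_def flip: sum.inter_filter)
  also have "{yz \<in> {..<p} \<times> {..<p}. p dvd 1 + fst yz ^ 3 + snd yz ^ 3} = {(y, z). y < p \<and> z < p \<and> p dvd 1 + y ^ 3 + z ^ 3}"
    by auto
  finally show "(\<Sum>y<p. \<Sum>z<p. if p dvd x ^ 3 + y ^ 3 + z ^ 3 then 1 else 0) = real (nu p)"
    by (simp add: nu_def)
qed

lemma prime_gain:
  fixes u v w :: "nat \<Rightarrow> real"
  assumes eps: "0 < \<epsilon>" "\<epsilon> \<le> 1" and gp: "gain_prime \<epsilon> p"
  assumes u: "\<And>x. x < p \<Longrightarrow> u x \<ge> 0" and v: "\<And>x. x < p \<Longrightarrow> v x \<ge> 0"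
    and w: "\<And>x. x < p \<Longrightarrow> w x \<ge> 0"
  shows "(\<Sum>x<p. \<Sum>y<p. \<Sum>z<p. u x ^ 3 * v y ^ 3 * w z ^ 3 * wt p (x ^ 3 + y ^ 3 + z ^ 3))
       \<ge> gain_factor \<epsilon> p * real p ^ 3
           * ((\<Sum>x<p. u x) / p) ^ 3 * ((\<Sum>x<p. v x) / p) ^ 3 * ((\<Sum>x<p. w x) / p) ^ 3"
proof -
  from gp have p: "prime p" "sqrt p \<ge> 148 / \<epsilon>" "nu p \<ge> p + \<epsilon> * sqrt p" by (auto simp: gain_prime_def)
  interpret symmetric_kernel p "\<lambda>x y z. if p dvd x ^ 3 + y ^ 3 + z ^ 3 then 1 else 0" "nu p"
    by (rule symmetric_kernel_cubes[OF p(1)])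
  have "(\<Sum>x<p. \<Sum>y<p. \<Sum>z<p. u x ^ 3 * v y ^ 3 * w z ^ 3 * wt p (x ^ 3 + y ^ 3 + z ^ 3)) =
    (\<Sum>x<p. \<Sum>y<p. \<Sum>z<p. (399/400) * (u x ^ 3 * v y ^ 3 * w z ^ 3) +
       (1/400) * p * (u x ^ 3 * v y ^ 3 * w z ^ 3 * (if p dvd x ^ 3 + y ^ 3 + z ^ 3 then 1 else 0)))"
    by (intro sum.cong refl) (simp add: wt_def algebra_simps)
  also have "\<dots> = (399/400) * ((\<Sum>x<p. u x ^ 3) * (\<Sum>x<p. v x ^ 3) * (\<Sum>x<p. w x ^ 3))
         + (1/400) * p * T (\<lambda>x. u x ^ 3) (\<lambda>x. v x ^ 3) (\<lambda>x. w x ^ 3)"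
  proof -
    have "(\<Sum>x<p. u x ^ 3) * (\<Sum>x<p. v x ^ 3) * (\<Sum>x<p. w x ^ 3) =
        (\<Sum>x<p. \<Sum>y<p. \<Sum>z<p. u x ^ 3 * v y ^ 3 * w z ^ 3)"
      by (simp add: sum_distrib_left sum_distrib_right sum.swap[of "\<lambda>x y. u y ^ 3 * v x ^ 3"])
         (simp add: sum_distrib_left[symmetric] sum_distrib_right[symmetric] mult.assoc)
    thus ?thesis unfolding T_def by (simp add: sum.distrib sum_distrib_left)
  qed
  also have "\<dots> \<ge> gain_factor \<epsilon> p * real p ^ 3
           * ((\<Sum>x<p. u x) / p) ^ 3 * ((\<Sum>x<p. v x) / p) ^ 3 * ((\<Sum>x<p. w x) / p) ^ 3"
    unfolding gain_factor_def by (intro gain eps p u v w)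
  finally show ?thesis .
qed

section \<open>Tensorisation over primes\<close>

lemma sum_lessThan_mult:
  fixes f :: "nat \<Rightarrow> 'a::comm_monoid_add"
  shows "(\<Sum>x<n * k. f x) = (\<Sum>r<k. \<Sum>t<n. f (r + t * k))"
proof -
  have "(\<Sum>x<n * k. f x) = (\<Sum>t<n. \<Sum>x\<in>{t * k..<t * k + k}. f x)"
    by (rule sum.nat_group[symmetric])
  also have "\<dots> = (\<Sum>t<n. \<Sum>r<k. f (r + t * k))"
  proof (rule sum.cong[OF refl])
    fix t
    show "(\<Sum>x\<in>{t * k..<t * k + k}. f x) = (\<Sum>r<k. f (r + t * k))"
      using sum.shift_bounds_nat_ivl[of f 0 "t * k" k] by (simp add: add.commute atLeast0LessThan)
  qed
  also have "\<dots> = (\<Sum>r<k. \<Sum>t<n. f (r + t * k))" by (rule sum.swap)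
  finally show ?thesis .
qed

lemma sum_swap_three:
  fixes F :: "'a \<Rightarrow> 'b \<Rightarrow> 'a \<Rightarrow> 'b \<Rightarrow> 'a \<Rightarrow> 'b \<Rightarrow> 'c::comm_monoid_add"
  shows "(\<Sum>a\<in>A. \<Sum>s\<in>B. \<Sum>b\<in>A. \<Sum>t\<in>B. \<Sum>c\<in>A. \<Sum>u\<in>B. F a s b t c u) =
         (\<Sum>a\<in>A. \<Sum>b\<in>A. \<Sum>c\<in>A. \<Sum>s\<in>B. \<Sum>t\<in>B. \<Sum>u\<in>B. F a s b t c u)"
proof -
  have "(\<Sum>s\<in>B. \<Sum>b\<in>A. \<Sum>t\<in>B. \<Sum>c\<in>A. \<Sum>u\<in>B. F a s b t c u) =
      (\<Sum>b\<in>A. \<Sum>c\<in>A. \<Sum>s\<in>B. \<Sum>t\<in>B. \<Sum>u\<in>B. F a s b t c u)" for a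
  proof (subst sum.swap, intro sum.cong refl)
    fix b
    have "(\<Sum>s\<in>B. \<Sum>t\<in>B. \<Sum>c\<in>A. \<Sum>u\<in>B. F a s b t c u) =
        (\<Sum>s\<in>B. \<Sum>c\<in>A. \<Sum>t\<in>B. \<Sum>u\<in>B. F a s b t c u)"
      by (intro sum.cong refl sum.swap)
    also have "\<dots> = (\<Sum>c\<in>A. \<Sum>s\<in>B. \<Sum>t\<in>B. \<Sum>u\<in>B. F a s b t c u)" by (rule sum.swap)
    finally show "(\<Sum>s\<in>B. \<Sum>t\<in>B. \<Sum>c\<in>A. \<Sum>u\<in>B. F a s b t c u) =
       (\<Sum>c\<in>A. \<Sum>s\<in>B. \<Sum>t\<in>B. \<Sum>u\<in>B. F a s b t c u)" .
  qed
  thus ?thesis by simp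
qed

section \<open>Product weights over a finite set of primes\<close>

definition Wt :: "nat set \<Rightarrow> nat \<Rightarrow> real" where
  "Wt P m = (\<Prod>p\<in>P. wt p m)"

lemma Wt_nonneg: "Wt P m \<ge> 0"
  by (simp add: Wt_def prod_nonneg wt_nonneg)

lemma Wt_cong:
  assumes "[m = n] (mod \<Prod>P)" "finite P"
  shows "Wt P m = Wt P n"
  unfolding Wt_def
proof (intro prod.cong refl wt_cong)
  fix p assume "p \<in> P"
  hence "p dvd \<Prod>P" using dvd_prod_eqI[OF assms(2) _ refl, of p "\<lambda>x. x"] by simp
  thus "[m = n] (mod p)" using assms(1) by (rule cong_dvd_modulus_nat[rotated])
qed

lemma coprime_prod_prime:
  fixes p :: nat
  assumes "finite P" "\<forall>q\<in>P. prime q" "prime p" "p \<notin> P"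
  shows "coprime (\<Prod>P) p"
  using assms by (intro prod_coprime_left) (metis primes_coprime)

lemma sum_wt_shift:
  assumes "coprime Q p" "p > 0"
  shows "(\<Sum>t<p. wt p (r + t * Q)) = p"
proof -
  have "(\<Sum>t<p. wt p (r + t * Q)) = (\<Sum>t<p. wt p ((r + t * Q) mod p))"
    by (intro sum.cong refl wt_cong) (simp add: unique_euclidean_semiring_class.cong_def)
  also have "\<dots> = (\<Sum>t<p. wt p t)"
    by (rule sum.reindex_bij_betw[OF bij_betw_affine_mod[OF assms]])
  also have "\<dots> = (\<Sum>t<p. 399/400 + (if t = 0 then p / 400 else 0))"
    by (intro sum.cong refl) (auto simp: wt_def dest: nat_dvd_not_less)
  also have "\<dots> = p" using assms(2) by (simp add: sum.distrib)
  finally show ?thesis .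
qed

text \<open>A residue modulo pQ is r + tQ. The weights of the earlier primes depend on r alone,
  while for fixed r the residue modulo p runs through everything as t varies, so the averages
  multiply.\<close>

lemma sum_Wt_period:
  assumes "finite P" "\<forall>p\<in>P. prime p"
  shows "(\<Sum>m<\<Prod>P. Wt P m) = \<Prod>P"
  using assms
proof (induction P rule: finite_induct)
  case empty
  show ?case by (simp add: Wt_def)
next
  case (insert p P)
  define Q where "Q = \<Prod>P"
  have cop: "coprime Q p" "p > 0"
    using insert by (auto simp: Q_def prime_gt_0_nat intro!: coprime_prod_prime)
  have "(\<Sum>m<\<Prod>(insert p P). Wt (insert p P) m) = (\<Sum>m<p * Q. wt p m * Wt P m)"
    using insert by (simp add: Q_def Wt_def)
  also have "\<dots> = (\<Sum>r<Q. \<Sum>t<p. wt p (r + t * Q) * Wt P (r + t * Q))"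
    by (rule sum_lessThan_mult)
  also have "\<dots> = (\<Sum>r<Q. \<Sum>t<p. wt p (r + t * Q) * Wt P r)"
    by (intro sum.cong refl arg_cong2[of _ _ _ _ "(*)"] Wt_cong insert)
       (simp add: Q_def unique_euclidean_semiring_class.cong_def)
  also have "\<dots> = (\<Sum>r<Q. p * Wt P r)"
    by (simp add: sum_wt_shift[OF cop] flip: sum_distrib_right)
  also have "\<dots> = p * Q" using insert by (simp add: Q_def flip: sum_distrib_left)
  finally show ?case using insert by (simp add: Q_def)
qed

lemma sum_Wt_periods:
  assumes "finite P" "\<forall>p\<in>P. prime p"
  shows "(\<Sum>m<k * \<Prod>P. Wt P m) = k * \<Prod>P"
proof -
  have "(\<Sum>m<k * \<Prod>P. Wt P m) = (\<Sum>r<\<Prod>P. \<Sum>t<k. Wt P (r + t * \<Prod>P))"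
    by (rule sum_lessThan_mult)
  also have "\<dots> = (\<Sum>r<\<Prod>P. \<Sum>t<k. Wt P r)"
    by (intro sum.cong refl Wt_cong assms) (simp add: unique_euclidean_semiring_class.cong_def)
  also have "\<dots> = k * \<Prod>P"
    using sum_Wt_period[OF assms] by (simp flip: sum_distrib_left)
  finally show ?thesis .
qed

text \<open>This is the form used in the induction: the classes a, b, c modulo Q are frozen and only
  their lifts vary. Since Q is invertible modulo p, each lift map permutes the residues modulo p,
  and its inverse \<open>h'\<close> transports the functions to the setting of
  \<open>prime_gain\<close>.\<close>

lemma prime_gain_shift:
  fixes u v w :: "nat \<Rightarrow> real"
  assumes eps: "0 < \<epsilon>" "\<epsilon> \<le> 1" and gp: "gain_prime \<epsilon> p" and cop: "coprime Q p"
  assumes nn: "\<And>x. u x \<ge> 0" "\<And>x. v x \<ge> 0" "\<And>x. w x \<ge> 0"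
  shows "(\<Sum>s<p. \<Sum>t<p. \<Sum>t'<p. u s ^ 3 * v t ^ 3 * w t' ^ 3
             * wt p ((a + s * Q) ^ 3 + (b + t * Q) ^ 3 + (c + t' * Q) ^ 3))
       \<ge> gain_factor \<epsilon> p * real p ^ 3
           * ((\<Sum>x<p. u x) / p) ^ 3 * ((\<Sum>x<p. v x) / p) ^ 3 * ((\<Sum>x<p. w x) / p) ^ 3"
proof -
  have p0: "p > 0" using gp by (simp add: gain_prime_def prime_gt_0_nat)
  define h where "h = (\<lambda>r t. (r + t * Q) mod p)"
  have bij: "bij_betw (h r) {..<p} {..<p}" for r
    unfolding h_def by (rule bij_betw_affine_mod[OF cop p0])
  define h' where "h' = (\<lambda>r. the_inv_into {..<p} (h r))"
  have h'h: "h' r (h r t) = t" if "t < p" for r t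
    using bij[of r] that by (simp add: h'_def bij_betw_def the_inv_into_f_f)
  have hc: "[r + t * Q = h r t] (mod p)" for r t
    by (simp add: h_def unique_euclidean_semiring_class.cong_def)
  have sums: "(\<Sum>x<p. f (h' r x)) = (\<Sum>t<p. f t)" for f :: "nat \<Rightarrow> real" and r
    by (subst sum.reindex_bij_betw[OF bij[of r], symmetric]) (simp add: h'h)
  have "gain_factor \<epsilon> p * real p ^ 3
           * ((\<Sum>x<p. u (h' a x)) / p) ^ 3 * ((\<Sum>x<p. v (h' b x)) / p) ^ 3 * ((\<Sum>x<p. w (h' c x)) / p) ^ 3
     \<le> (\<Sum>x<p. \<Sum>y<p. \<Sum>z<p. u (h' a x) ^ 3 * v (h' b y) ^ 3 * w (h' c z) ^ 3 * wt p (x ^ 3 + y ^ 3 + z ^ 3))"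
    by (intro prime_gain eps gp nn)
  also have "\<dots> = (\<Sum>s<p. \<Sum>t<p. \<Sum>t'<p. u (h' a (h a s)) ^ 3 * v (h' b (h b t)) ^ 3 * w (h' c (h c t')) ^ 3
       * wt p (h a s ^ 3 + h b t ^ 3 + h c t' ^ 3))"
    apply (rule trans[OF sum.reindex_bij_betw[OF bij[of a], symmetric]], rule sum.cong[OF refl])
    apply (rule trans[OF sum.reindex_bij_betw[OF bij[of b], symmetric]], rule sum.cong[OF refl])
    apply (rule sum.reindex_bij_betw[OF bij[of c], symmetric])
    done
  also have "\<dots> = (\<Sum>s<p. \<Sum>t<p. \<Sum>t'<p. u s ^ 3 * v t ^ 3 * w t' ^ 3
             * wt p ((a + s * Q) ^ 3 + (b + t * Q) ^ 3 + (c + t' * Q) ^ 3))"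
    by (intro sum.cong refl arg_cong2[of _ _ _ _ "(*)"] wt_cong cong_add cong_pow)
       (auto simp: h'h intro: cong_sym[OF hc])
  finally show ?thesis by (simp only: sums)
qed

text \<open>Arbitrary nonnegative functions are allowed because the induction replaces u by its
  means over the lifts from Q to pQ, and means of an indicator are no longer indicators. The
  induction hypothesis is applied to these means; then the gain at p, used in every fibre, turns the
  product of the cubes of the means into the weighted sum of cubes.\<close>

theorem tensor_gain:
  fixes u v w :: "nat \<Rightarrow> real"
  assumes eps: "0 < \<epsilon>" "\<epsilon> \<le> 1" and "finite P" "\<forall>p\<in>P. gain_prime \<epsilon> p"
  assumes nn: "\<And>x. u x \<ge> 0" "\<And>x. v x \<ge> 0" "\<And>x. w x \<ge> 0"
  defines "Q \<equiv> \<Prod>P"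
  shows "(\<Sum>x<Q. \<Sum>y<Q. \<Sum>z<Q. u x ^ 3 * v y ^ 3 * w z ^ 3 * Wt P (x ^ 3 + y ^ 3 + z ^ 3))
       \<ge> (\<Prod>p\<in>P. gain_factor \<epsilon> p) * real Q ^ 3
           * ((\<Sum>x<Q. u x) / Q) ^ 3 * ((\<Sum>x<Q. v x) / Q) ^ 3 * ((\<Sum>x<Q. w x) / Q) ^ 3"
  using assms(3,4) nn unfolding Q_def
proof (induction P arbitrary: u v w rule: finite_induct)
  case empty
  show ?case by (simp add: Wt_def)
next
  case (insert p P)
  define Q where "Q = \<Prod>P"
  have gp: "gain_prime \<epsilon> p" and primes: "\<forall>p\<in>P. prime p" "prime p"
    using insert by (auto simp: gain_prime_def)
  have cop: "coprime Q p" and p0: "p > 0"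
    using insert primes by (auto simp: Q_def prime_gt_0_nat intro!: coprime_prod_prime)
  define U :: "(nat \<Rightarrow> real) \<Rightarrow> nat \<Rightarrow> real" where "U = (\<lambda>f r. (\<Sum>t<p. f (r + t * Q)) / p)"
  have U_nonneg: "U f r \<ge> 0" if "\<And>x. f x \<ge> 0" for f r
    using that by (auto simp: U_def intro!: divide_nonneg_nonneg sum_nonneg)
  have U_mean: "(\<Sum>r<Q. U f r) / Q = (\<Sum>x<p * Q. f x) / (p * Q)" for f
    by (simp add: sum_lessThan_mult U_def flip: sum_divide_distrib)
  define G where "G = (\<Prod>p\<in>P. gain_factor \<epsilon> p)"
  have gf: "gain_factor \<epsilon> q \<ge> 0" for q using eps by (simp add: gain_factor_def)
  let ?g = "gain_factor \<epsilon> p * real p ^ 3"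
  have "?g * (G * real Q ^ 3 * ((\<Sum>x<Q. U u x) / Q) ^ 3 * ((\<Sum>x<Q. U v x) / Q) ^ 3 * ((\<Sum>x<Q. U w x) / Q) ^ 3)
     \<le> ?g * (\<Sum>x<Q. \<Sum>y<Q. \<Sum>z<Q. U u x ^ 3 * U v y ^ 3 * U w z ^ 3 * Wt P (x ^ 3 + y ^ 3 + z ^ 3))"
    unfolding G_def Q_def using insert.prems
    by (intro mult_left_mono insert.IH U_nonneg[unfolded Q_def] mult_nonneg_nonneg gf) auto
  also have "\<dots> = (\<Sum>x<Q. \<Sum>y<Q. \<Sum>z<Q. (?g * U u x ^ 3 * U v y ^ 3 * U w z ^ 3) * Wt P (x ^ 3 + y ^ 3 + z ^ 3))"
    by (simp add: sum_distrib_left mult.assoc)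
  also have "\<dots> \<le> (\<Sum>x<Q. \<Sum>y<Q. \<Sum>z<Q. (\<Sum>s<p. \<Sum>t<p. \<Sum>t'<p.
       u (x + s * Q) ^ 3 * v (y + t * Q) ^ 3 * w (z + t' * Q) ^ 3
             * wt p ((x + s * Q) ^ 3 + (y + t * Q) ^ 3 + (z + t' * Q) ^ 3)) * Wt P (x ^ 3 + y ^ 3 + z ^ 3))"
    unfolding U_def
    by (intro sum_mono mult_right_mono Wt_nonneg prime_gain_shift eps gp cop) (use insert.prems in auto)
  also have "\<dots> = (\<Sum>x<Q. \<Sum>y<Q. \<Sum>z<Q. \<Sum>s<p. \<Sum>t<p. \<Sum>t'<p.
       u (x + s * Q) ^ 3 * v (y + t * Q) ^ 3 * w (z + t' * Q) ^ 3
             * Wt (insert p P) ((x + s * Q) ^ 3 + (y + t * Q) ^ 3 + (z + t' * Q) ^ 3))"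
    unfolding sum_distrib_right
  proof (intro sum.cong refl, goal_cases)
    case (1 x y z s t t')
    have "[x ^ 3 + y ^ 3 + z ^ 3 = (x + s * Q) ^ 3 + (y + t * Q) ^ 3 + (z + t' * Q) ^ 3] (mod Q)"
      by (intro cong_add cong_pow) (simp_all add: unique_euclidean_semiring_class.cong_def)
    hence "Wt P (x ^ 3 + y ^ 3 + z ^ 3) = Wt P ((x + s * Q) ^ 3 + (y + t * Q) ^ 3 + (z + t' * Q) ^ 3)"
      unfolding Q_def by (intro Wt_cong insert)
    thus ?case using insert by (simp add: Wt_def)
  qed
  also have "\<dots> = (\<Sum>x<Q. \<Sum>s<p. \<Sum>y<Q. \<Sum>t<p. \<Sum>z<Q. \<Sum>t'<p.
       u (x + s * Q) ^ 3 * v (y + t * Q) ^ 3 * w (z + t' * Q) ^ 3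
             * Wt (insert p P) ((x + s * Q) ^ 3 + (y + t * Q) ^ 3 + (z + t' * Q) ^ 3))"
    by (rule sum_swap_three[symmetric])
  also have "\<dots> = (\<Sum>x<p * Q. \<Sum>y<p * Q. \<Sum>z<p * Q. u x ^ 3 * v y ^ 3 * w z ^ 3
       * Wt (insert p P) (x ^ 3 + y ^ 3 + z ^ 3))"
    by (simp only: sum_lessThan_mult)
  finally show ?case
    using insert by (simp add: U_mean power_mult_distrib G_def mult_ac flip: Q_def)
qed

section \<open>From residue classes to sets of integers\<close>

lemma sum_cube_ge:
  fixes s :: "nat \<Rightarrow> real"
  assumes "\<And>b. s b \<ge> 0" "B > 0"
  shows "(\<Sum>b<B. s b ^ 3) \<ge> (\<Sum>b<B. s b) ^ 3 / real B ^ 2"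
proof -
  define \<mu> where "\<mu> = (\<Sum>b<B. s b) / B"
  have mu: "\<mu> \<ge> 0" using assms by (auto simp: \<mu>_def intro!: sum_nonneg divide_nonneg_nonneg)
  have "s b ^ 3 \<ge> \<mu> ^ 3 + 3 * \<mu>\<^sup>2 * (s b - \<mu>)" for b
  proof -
    have "s b ^ 3 - (\<mu> ^ 3 + 3 * \<mu>\<^sup>2 * (s b - \<mu>)) = (s b - \<mu>)\<^sup>2 * (s b + 2 * \<mu>)"
      by (simp add: power2_eq_square power3_eq_cube algebra_simps)
    moreover have "(s b - \<mu>)\<^sup>2 * (s b + 2 * \<mu>) \<ge> 0" using mu assms(1)[of b] by simp
    ultimately show ?thesis by linarith
  qed
  hence "(\<Sum>b<B. s b ^ 3) \<ge> (\<Sum>b<B. \<mu> ^ 3 + 3 * \<mu>\<^sup>2 * (s b - \<mu>))" by (intro sum_mono)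
  also have "(\<Sum>b<B. \<mu> ^ 3 + 3 * \<mu>\<^sup>2 * (s b - \<mu>)) = B * \<mu> ^ 3 + 3 * \<mu>\<^sup>2 * ((\<Sum>b<B. s b) - B * \<mu>)"
    by (simp add: sum.distrib sum_subtractf flip: sum_distrib_left)
  also have "(\<Sum>b<B. s b) - B * \<mu> = 0" using assms(2) by (simp add: \<mu>_def)
  also have "B * \<mu> ^ 3 + 3 * \<mu>\<^sup>2 * 0 = (\<Sum>b<B. s b) ^ 3 / real B ^ 2"
    using assms(2) by (simp add: \<mu>_def power2_eq_square power3_eq_cube)
  finally show ?thesis .
qed

text \<open>The interval is cut into B blocks of length Q. An indicator equals its own cube and the
  weight depends only on residues modulo Q, so \<open>tensor_gain\<close> applies to every triple of
  blocks, and convexity of the cube combines the block densities. The powers collect as Q^3 (card A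
  / Q)^9 / B^6 = card A ^ 9 / (BQ)^6.\<close>

lemma weighted_triples_lower:
  fixes A :: "nat set"
  assumes eps: "0 < \<epsilon>" "\<epsilon> \<le> 1" and P: "finite P" "\<forall>p\<in>P. gain_prime \<epsilon> p"
  assumes A: "A \<subseteq> {..<B * \<Prod>P}" and B: "B > 0"
  shows "(\<Sum>x\<in>A. \<Sum>y\<in>A. \<Sum>z\<in>A. Wt P (x ^ 3 + y ^ 3 + z ^ 3))
       \<ge> (\<Prod>p\<in>P. gain_factor \<epsilon> p) * real (card A) ^ 9 / real (B * \<Prod>P) ^ 6"
proof -
  define Q where "Q = \<Prod>P"
  have Q0: "Q > 0" using P by (auto simp: Q_def gain_prime_def intro!: prod_pos dest: prime_gt_0_nat)
  define f :: "nat \<Rightarrow> real" where "f = indicator A"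
  define G where "G = (\<Prod>p\<in>P. gain_factor \<epsilon> p)"
  have G0: "G \<ge> 0" using eps by (auto simp: G_def gain_factor_def intro!: prod_nonneg)
  have f_sum: "(\<Sum>x\<in>A. g x) = (\<Sum>x<B * Q. f x ^ 3 * g x)" for g :: "nat \<Rightarrow> real"
  proof -
    have "(\<Sum>x\<in>A. g x) = (\<Sum>x\<in>A. f x ^ 3 * g x)" by (simp add: f_def)
    also have "\<dots> = (\<Sum>x<B * Q. f x ^ 3 * g x)"
      using A by (intro sum.mono_neutral_left) (auto simp: f_def Q_def)
    finally show ?thesis .
  qed
  define s where "s = (\<lambda>b. (\<Sum>r<Q. f (r + b * Q)) / Q)"
  have s0: "s b \<ge> 0" for b by (auto simp: s_def f_def intro!: divide_nonneg_nonneg sum_nonneg)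
  have s_sum: "(\<Sum>b<B. s b) = card A / Q"
  proof -
    have "real (card A) = (\<Sum>x<B * Q. f x ^ 3 * 1)" by (subst f_sum[symmetric]) simp
    also have "\<dots> = (\<Sum>x<B * Q. f x)" by (intro sum.cong refl) (simp add: f_def indicator_def)
    also have "\<dots> = (\<Sum>b<B. \<Sum>r<Q. f (r + b * Q))" by (subst sum_lessThan_mult) (rule sum.swap)
    finally show ?thesis by (simp add: s_def flip: sum_divide_distrib)
  qed
  have "(\<Sum>x\<in>A. \<Sum>y\<in>A. \<Sum>z\<in>A. Wt P (x ^ 3 + y ^ 3 + z ^ 3)) =
    (\<Sum>x<B * Q. \<Sum>y<B * Q. \<Sum>z<B * Q. f x ^ 3 * f y ^ 3 * f z ^ 3 * Wt P (x ^ 3 + y ^ 3 + z ^ 3))"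
    by (simp add: f_sum sum_distrib_left mult.assoc)
  also have "\<dots> = (\<Sum>a<Q. \<Sum>b<B. \<Sum>a'<Q. \<Sum>b'<B. \<Sum>a''<Q. \<Sum>b''<B.
      f (a + b * Q) ^ 3 * f (a' + b' * Q) ^ 3 * f (a'' + b'' * Q) ^ 3
       * Wt P ((a + b * Q) ^ 3 + (a' + b' * Q) ^ 3 + (a'' + b'' * Q) ^ 3))"
    by (simp only: sum_lessThan_mult)
  also have "\<dots> = (\<Sum>b<B. \<Sum>a<Q. \<Sum>b'<B. \<Sum>a'<Q. \<Sum>b''<B. \<Sum>a''<Q.
      f (a + b * Q) ^ 3 * f (a' + b' * Q) ^ 3 * f (a'' + b'' * Q) ^ 3
       * Wt P ((a + b * Q) ^ 3 + (a' + b' * Q) ^ 3 + (a'' + b'' * Q) ^ 3))"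
    apply (rule trans[OF sum.swap], rule sum.cong[OF refl], rule sum.cong[OF refl])
    apply (rule trans[OF sum.swap], rule sum.cong[OF refl], rule sum.cong[OF refl])
    apply (rule sum.swap)
    done
  also have "\<dots> = (\<Sum>b<B. \<Sum>b'<B. \<Sum>b''<B. \<Sum>a<Q. \<Sum>a'<Q. \<Sum>a''<Q.
      f (a + b * Q) ^ 3 * f (a' + b' * Q) ^ 3 * f (a'' + b'' * Q) ^ 3
       * Wt P ((a + b * Q) ^ 3 + (a' + b' * Q) ^ 3 + (a'' + b'' * Q) ^ 3))"
    by (rule sum_swap_three)
  also have "\<dots> = (\<Sum>b<B. \<Sum>b'<B. \<Sum>b''<B. \<Sum>a<Q. \<Sum>a'<Q. \<Sum>a''<Q.
      f (a + b * Q) ^ 3 * f (a' + b' * Q) ^ 3 * f (a'' + b'' * Q) ^ 3 * Wt P (a ^ 3 + a' ^ 3 + a'' ^ 3))"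
    by (intro sum.cong refl arg_cong2[of _ _ _ _ "(*)"] Wt_cong P cong_add cong_pow)
       (simp_all add: unique_euclidean_semiring_class.cong_def Q_def)
  also have "\<dots> \<ge> (\<Sum>b<B. \<Sum>b'<B. \<Sum>b''<B. G * real Q ^ 3 * s b ^ 3 * s b' ^ 3 * s b'' ^ 3)"
    unfolding s_def G_def Q_def
    by (intro sum_mono tensor_gain eps P) (auto simp: f_def)
  also have "(\<Sum>b<B. \<Sum>b'<B. \<Sum>b''<B. G * real Q ^ 3 * s b ^ 3 * s b' ^ 3 * s b'' ^ 3)
     = G * real Q ^ 3 * (\<Sum>b<B. s b ^ 3) ^ 3"
    by (simp only: sum_distrib_left[symmetric] sum_distrib_right[symmetric]) (simp add: power3_eq_cube)
  finally have *: "G * real Q ^ 3 * (\<Sum>b<B. s b ^ 3) ^ 3 \<le> (\<Sum>x\<in>A. \<Sum>y\<in>A. \<Sum>z\<in>A. Wt P (x ^ 3 + y ^ 3 + z ^ 3))" .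
  have "G * real (card A) ^ 9 / real (B * Q) ^ 6 = G * real Q ^ 3 * ((card A / Q) ^ 3 / real B ^ 2) ^ 3"
    using Q0 B by (simp add: field_simps eval_nat_numeral)
  also have "\<dots> \<le> G * real Q ^ 3 * (\<Sum>b<B. s b ^ 3) ^ 3"
    unfolding s_sum[symmetric]
    by (intro mult_left_mono power_mono sum_cube_ge s0 B mult_nonneg_nonneg G0)
       (auto intro!: divide_nonneg_nonneg sum_nonneg s0 zero_le_power)
  finally show ?thesis using * by (simp add: G_def Q_def)
qed

text \<open>Grouped by their value, at most R triples share a value m, and the weights average to 1
  over complete periods. The range of m is rounded up to a multiple of Q, which adds at most Q \<le>
  N^3 to 3 N^3; hence the factor 4.\<close>

lemma weighted_triples_upper:
  fixes A :: "nat set"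
  assumes P: "finite P" "\<forall>p\<in>P. prime p" and A: "A \<subseteq> {1..N}" and Q: "\<Prod>P \<le> N"
  assumes reps: "\<And>m. card {(x, y, z) \<in> A \<times> A \<times> A. x ^ 3 + y ^ 3 + z ^ 3 = m} \<le> R"
  shows "(\<Sum>x\<in>A. \<Sum>y\<in>A. \<Sum>z\<in>A. Wt P (x ^ 3 + y ^ 3 + z ^ 3)) \<le> 4 * real R * real N ^ 3"
proof -
  define Q where "Q = \<Prod>P"
  have Q0: "Q > 0" using P by (auto simp: Q_def intro!: prod_pos dest: prime_gt_0_nat)
  define k where "k = 3 * N ^ 3 div Q + 1"
  have fin: "finite A" using A finite_subset by blast
  have lt: "x ^ 3 + y ^ 3 + z ^ 3 < k * Q" if "x \<in> A" "y \<in> A" "z \<in> A" for x y z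
  proof -
    have "x ^ 3 \<le> N ^ 3" "y ^ 3 \<le> N ^ 3" "z ^ 3 \<le> N ^ 3" using that A by (auto intro!: power_mono)
    moreover have "3 * N ^ 3 < k * Q" using Q0 dividend_less_div_times[of Q "3 * N ^ 3"] by (simp add: k_def)
    ultimately show ?thesis by linarith
  qed
  have "(\<Sum>x\<in>A. \<Sum>y\<in>A. \<Sum>z\<in>A. Wt P (x ^ 3 + y ^ 3 + z ^ 3)) =
      (\<Sum>t\<in>A \<times> A \<times> A. Wt P (case t of (x, y, z) \<Rightarrow> x ^ 3 + y ^ 3 + z ^ 3))"
    by (simp add: sum.cartesian_product case_prod_unfold)
  also have "\<dots> = (\<Sum>m<k * Q. \<Sum>t\<in>{t \<in> A \<times> A \<times> A. (case t of (x, y, z) \<Rightarrow> x ^ 3 + y ^ 3 + z ^ 3) = m}.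
      Wt P (case t of (x, y, z) \<Rightarrow> x ^ 3 + y ^ 3 + z ^ 3))"
    by (rule sum.group[symmetric]) (use fin lt in auto)
  also have "\<dots> = (\<Sum>m<k * Q. card {t \<in> A \<times> A \<times> A. (case t of (x, y, z) \<Rightarrow> x ^ 3 + y ^ 3 + z ^ 3) = m} * Wt P m)"
    by (intro sum.cong refl) simp
  also have "\<dots> \<le> (\<Sum>m<k * Q. R * Wt P m)"
  proof (intro sum_mono mult_right_mono Wt_nonneg)
    fix m
    have "{t \<in> A \<times> A \<times> A. (case t of (x, y, z) \<Rightarrow> x ^ 3 + y ^ 3 + z ^ 3) = m} =
      {(x, y, z) \<in> A \<times> A \<times> A. x ^ 3 + y ^ 3 + z ^ 3 = m}" by auto
    thus "real (card {t \<in> A \<times> A \<times> A. (case t of (x, y, z) \<Rightarrow> x ^ 3 + y ^ 3 + z ^ 3) = m}) \<le> R"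
      using reps[of m] by simp
  qed
  also have "\<dots> = real R * (k * Q)"
    using sum_Wt_periods[OF P, of k] by (simp add: Q_def flip: sum_distrib_left)
  also have "k * Q \<le> 3 * N ^ 3 + Q" by (simp add: k_def)
  also have "Q \<le> N ^ 3" using Q self_le_power[of N 3] by (cases "N = 0") (auto simp: Q_def)
  finally show ?thesis by (simp add: mult_left_mono mult.assoc)
qed

section \<open>Ordered representations and the bound for sets of cubes\<close>

definition perms3 :: "int list \<Rightarrow> (int \<times> int \<times> int) set" where
  "perms3 xs = (let a = xs ! 0; b = xs ! 1; c = xs ! 2
     in {(a, b, c), (a, c, b), (b, a, c), (b, c, a), (c, a, b), (c, b, a)})"

lemma card_perms3: "finite (perms3 xs)" "card (perms3 xs) \<le> 6"
proof -
  show "finite (perms3 xs)" by (simp add: perms3_def Let_def)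
  show "card (perms3 xs) \<le> 6"
    using card_length[of "let a = xs ! 0; b = xs ! 1; c = xs ! 2
      in [(a, b, c), (a, c, b), (b, a, c), (b, c, a), (c, a, b), (c, b, a)]"]
    by (simp add: perms3_def Let_def)
qed

lemma mem_perms3_sort: "(a, b, c) \<in> perms3 (sort [a, b, c])"
  by (auto simp: perms3_def Let_def)

lemma int_cube_inject: "int x ^ 3 = int y ^ 3 \<longleftrightarrow> x = y"
  by (metis of_nat_eq_iff of_nat_power power_inject_base zero_le numeral_3_eq_3)

text \<open>A triple of cubes is a permutation of its sorted list, which is an ordered
  representation, and at most six triples have the same sorted list.\<close>

lemma card_triples_le:
  assumes B: "Bh_set 3 g A" and A': "A' = {n \<in> {1..N}. int n ^ 3 \<in> A}"
  shows "card {(x, y, z) \<in> A' \<times> A' \<times> A'. x ^ 3 + y ^ 3 + z ^ 3 = m} \<le> 6 * g"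
proof -
  let ?T = "{(x, y, z) \<in> A' \<times> A' \<times> A'. x ^ 3 + y ^ 3 + z ^ 3 = m}"
  let ?R = "ordered_reps A 3 (int m)"
  define \<Phi> :: "nat \<times> nat \<times> nat \<Rightarrow> int \<times> int \<times> int" where "\<Phi> = (\<lambda>(x, y, z). (int x ^ 3, int y ^ 3, int z ^ 3))"
  have fin: "finite ?R" "card ?R \<le> g" using B by (auto simp: Bh_set_def rep_count_def)
  have "inj \<Phi>"
  proof (rule injI)
    fix s t assume "\<Phi> s = \<Phi> t"
    thus "s = t" by (cases s, cases t) (simp add: \<Phi>_def int_cube_inject del: of_nat_power)
  qed
  hence "card ?T = card (\<Phi> ` ?T)"
    by (intro card_image[symmetric]) (rule inj_on_subset, assumption, rule subset_UNIV)
  also have "\<dots> \<le> card (\<Union>xs\<in>?R. perms3 xs)"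
  proof (intro card_mono finite_UN_I fin card_perms3 subsetI)
    fix t assume "t \<in> \<Phi> ` ?T"
    then obtain x y z where t: "t = (int x ^ 3, int y ^ 3, int z ^ 3)" "x \<in> A'" "y \<in> A'" "z \<in> A'"
      "x ^ 3 + y ^ 3 + z ^ 3 = m" by (auto simp: \<Phi>_def)
    define l where "l = [int x ^ 3, int y ^ 3, int z ^ 3]"
    have "sum_list (sort l) = sum_list l" by (metis mset_sort sum_mset_sum_list)
    also have "\<dots> = int m" using t(5)[symmetric] by (simp add: l_def)
    finally have "sort l \<in> ?R" using t(2-4)
      by (simp add: ordered_reps_def) (simp add: l_def A')
    moreover have "t \<in> perms3 (sort l)" using mem_perms3_sort t(1) by (simp only: l_def)
    ultimately show "t \<in> (\<Union>xs\<in>?R. perms3 xs)" by blast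
  qed
  also have "\<dots> \<le> (\<Sum>xs\<in>?R. card (perms3 xs))" by (rule card_UN_le[OF fin(1)])
  also have "\<dots> \<le> (\<Sum>xs\<in>?R. 6)" by (intro sum_mono card_perms3)
  also have "\<dots> \<le> 6 * g" using fin by simp
  finally show ?thesis .
qed

theorem Bh_cubes_bound:
  assumes eps: "0 < \<epsilon>" "\<epsilon> \<le> 1" and P: "finite P" "\<forall>p\<in>P. gain_prime \<epsilon> p" and Q: "\<Prod>P \<le> N"
  assumes A: "A \<subseteq> {int n ^ 3 | n. n \<in> {1..N}}" and B: "Bh_set 3 g A"
  shows "(\<Prod>p\<in>P. gain_factor \<epsilon> p) * real (card A) ^ 9 \<le> 1536 * real g * real N ^ 9"
proof -
  define A' where "A' = {n \<in> {1..N}. int n ^ 3 \<in> A}"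
  have img: "A = (\<lambda>n. int n ^ 3) ` A'" using A by (auto simp: A'_def)
  have "card A = card A'" unfolding img
    by (intro card_image inj_onI) (auto simp: int_cube_inject)
  define Q where "Q = \<Prod>P"
  have primes: "\<forall>p\<in>P. prime p" using P by (auto simp: gain_prime_def)
  have Q0: "Q > 0" using P primes by (auto simp: Q_def intro!: prod_pos dest: prime_gt_0_nat)
  hence N0: "N > 0" using Q by (simp add: Q_def)
  \<comment> \<open>The number of blocks: kQ exceeds N, so the blocks cover all of {1..N}, and it is
    at most 2N because Q \<le> N. The final constant is 1536 = 4 * 6 * 2^6.\<close>
  define k where "k = N div Q + 1"
  have "N < N div Q * Q + Q" using Q0 dividend_less_div_times[of Q N] by simp
  moreover have "N div Q * Q \<le> N" by simp
  moreover have "k * Q = N div Q * Q + Q" by (simp add: k_def)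
  moreover have "Q \<le> N" using Q by (simp add: Q_def)
  ultimately have kQ: "N < k * Q" "k * Q \<le> 2 * N" by linarith+
  have "(\<Prod>p\<in>P. gain_factor \<epsilon> p) * real (card A') ^ 9 / real (k * Q) ^ 6
      \<le> (\<Sum>x\<in>A'. \<Sum>y\<in>A'. \<Sum>z\<in>A'. Wt P (x ^ 3 + y ^ 3 + z ^ 3))"
    unfolding Q_def
  proof (rule weighted_triples_lower[OF eps P])
    show "A' \<subseteq> {..<k * \<Prod>P}" using kQ by (auto simp: A'_def Q_def)
  qed (simp add: k_def)
  also have "\<dots> \<le> 4 * real (6 * g) * real N ^ 3"
    by (intro weighted_triples_upper P primes Q card_triples_le[OF B A'_def]) (auto simp: A'_def)
  finally have "(\<Prod>p\<in>P. gain_factor \<epsilon> p) * real (card A') ^ 9 \<le> 4 * real (6 * g) * real N ^ 3 * real (k * Q) ^ 6"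
    using kQ N0 by (subst (asm) pos_divide_le_eq) (simp_all only: of_nat_0_less_iff zero_less_power)
  also have "\<dots> \<le> 4 * real (6 * g) * real N ^ 3 * real (2 * N) ^ 6"
    using kQ by (intro mult_left_mono power_mono) (simp_all del: of_nat_mult)
  also have "\<dots> = 1536 * real g * real N ^ 9" by (simp add: eval_nat_numeral)
  finally show ?thesis using \<open>card A = card A'\<close> by simp
qed

section \<open>Cubic Jacobi sums\<close>

definition \<omega> :: complex where "\<omega> = Complex (-1/2) (sqrt 3 / 2)"

lemma omega_sq: "\<omega> ^ 2 = - 1 - \<omega>"
  by (simp add: \<omega>_def power2_eq_square complex_eq_iff)

lemma omega_cube: "\<omega> ^ 3 = 1"
proof -
  have "\<omega> ^ 3 = \<omega> * \<omega> ^ 2" by (simp add: power3_eq_cube power2_eq_square)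
  also have "\<dots> = - \<omega> - \<omega> ^ 2" by (subst omega_sq) (simp add: algebra_simps power2_eq_square)
  also have "\<dots> = 1" by (simp add: omega_sq)
  finally show ?thesis .
qed

lemma omega_neq_1: "\<omega> \<noteq> 1"
  by (simp add: \<omega>_def complex_eq_iff)

lemma cube_root_unity:
  fixes z :: complex assumes "z ^ 3 = 1"
  shows "z = 1 \<or> z = \<omega> \<or> z = \<omega> ^ 2"
proof -
  have "(z - 1) * (z - \<omega>) * (z - \<omega> ^ 2) = (z - 1) * (z\<^sup>2 - (\<omega> + \<omega> ^ 2) * z + \<omega> ^ 3)"
    by (simp add: power2_eq_square power3_eq_cube algebra_simps)
  also have "\<omega> + \<omega> ^ 2 = -1" by (simp add: omega_sq)
  also have "(z - 1) * (z\<^sup>2 - - 1 * z + \<omega> ^ 3) = z ^ 3 - 1"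
    unfolding omega_cube by (simp add: power2_eq_square power3_eq_cube algebra_simps)
  finally have "(z - 1) * (z - \<omega>) * (z - \<omega> ^ 2) = z ^ 3 - 1" .
  hence "(z - 1) * (z - \<omega>) * (z - \<omega> ^ 2) = 0" by (simp only: assms diff_self)
  thus ?thesis unfolding mult_eq_0_iff right_minus_eq by blast
qed

definition eisenstein :: "complex set" where
  "eisenstein = {of_int a + of_int b * \<omega> | a b. True}"

lemma eisenstein_intro: "of_int a + of_int b * \<omega> \<in> eisenstein"
  by (auto simp: eisenstein_def)

lemma eisenstein_of_int: "of_int a \<in> eisenstein"
  using eisenstein_intro[of a 0] by simp

lemma eisenstein_add: "x \<in> eisenstein \<Longrightarrow> y \<in> eisenstein \<Longrightarrow> x + y \<in> eisenstein"
proof -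
  assume "x \<in> eisenstein" "y \<in> eisenstein"
  then obtain a b c d where "x = of_int a + of_int b * \<omega>" "y = of_int c + of_int d * \<omega>"
    by (auto simp: eisenstein_def)
  hence "x + y = of_int (a + c) + of_int (b + d) * \<omega>" by (simp add: algebra_simps)
  thus ?thesis by (simp only: eisenstein_intro)
qed

lemma eisenstein_mult_coords:
  "(of_int a + of_int b * \<omega>) * (of_int c + of_int d * \<omega>) =
     of_int (a * c - b * d) + of_int (a * d + b * c - b * d) * \<omega>"
proof -
  have "(of_int a + of_int b * \<omega>) * (of_int c + of_int d * \<omega>) =
     of_int (a * c) + of_int (a * d + b * c) * \<omega> + of_int (b * d) * \<omega> ^ 2"
    by (simp add: algebra_simps power2_eq_square)
  thus ?thesis unfolding omega_sq by (simp add: algebra_simps)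
qed

lemma eisenstein_mult: "x \<in> eisenstein \<Longrightarrow> y \<in> eisenstein \<Longrightarrow> x * y \<in> eisenstein"
  using eisenstein_mult_coords eisenstein_intro unfolding eisenstein_def by (smt (verit) mem_Collect_eq)

lemma eisenstein_sum: "(\<And>i. i \<in> I \<Longrightarrow> f i \<in> eisenstein) \<Longrightarrow> (\<Sum>i\<in>I. f i) \<in> eisenstein"
  using eisenstein_of_int[of 0]
  by (induction I rule: infinite_finite_induct) (auto intro: eisenstein_add)

lemma eisenstein_parts:
  "Re (of_int a + of_int b * \<omega>) = a - b / 2" "Im (of_int a + of_int b * \<omega>) = b * sqrt 3 / 2"
  by (simp_all add: \<omega>_def)

lemma cmod_eisenstein: "(cmod (of_int a + of_int b * \<omega>))\<^sup>2 = of_int (a\<^sup>2 - a * b + b\<^sup>2)"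
  unfolding cmod_power2 eisenstein_parts
  by (simp add: power2_eq_square field_simps)

lemma omega_powers_eisenstein: "\<omega> \<in> eisenstein" "\<omega> ^ 2 \<in> eisenstein" "1 \<in> eisenstein" "0 \<in> eisenstein"
  using eisenstein_intro[of 0 1] eisenstein_intro[of "-1" "-1"] eisenstein_intro[of 1 0] eisenstein_intro[of 0 0]
  by (simp_all add: omega_sq)

section \<open>Orthogonality and autocorrelation of a cubic character\<close>

text \<open>The character takes complex values and is extended by 0 to the multiples of p. The
  element g is a witness of nontriviality: multiplication by it is the substitution behind the
  orthogonality relation \<open>sum_chi\<close>.\<close>

locale cubic_character =
  fixes p :: nat and ch :: "int \<Rightarrow> complex" and g :: int
  assumes p: "prime p"
  assumes chi_zero_iff: "ch a = 0 \<longleftrightarrow> int p dvd a"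
  assumes chi_mod: "ch (a mod int p) = ch a"
  assumes chi_mult: "ch (a * b) = ch a * ch b"
  assumes chi_cube: "\<not> int p dvd a \<Longrightarrow> ch a ^ 3 = 1"
  assumes chi_g: "\<not> int p dvd g" "ch g \<noteq> 1"
begin

abbreviation R :: "int set" where "R \<equiv> {0..<int p}"

lemma p_gt_1: "p > 1" using p by (rule prime_gt_1_nat)

lemma prime_p: "prime (int p)" using p by simp

lemma chi_cong: "[a = b] (mod int p) \<Longrightarrow> ch a = ch b"
  by (metis chi_mod unique_euclidean_semiring_class.cong_def)

lemma chi_1: "ch 1 = 1"
proof -
  have "ch 1 * ch 1 = ch 1" using chi_mult[of 1 1] by simp
  moreover have "ch 1 \<noteq> 0" using p_gt_1 by (simp add: chi_zero_iff)
  ultimately show ?thesis by simp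
qed

lemma chi_minus: "ch (- a) = ch a"
proof -
  have n: "\<not> int p dvd -1" using p_gt_1 by simp
  have "ch (-1) * ch (-1) = 1" using chi_mult[of "-1" "-1"] chi_1 by simp
  moreover have "ch (-1) ^ 3 = 1" using chi_cube[OF n] .
  ultimately have "ch (-1) = 1" by (simp add: power3_eq_cube)
  thus ?thesis using chi_mult[of "-1" a] by simp
qed

lemma chi_cases: "ch a = 0 \<or> ch a = 1 \<or> ch a = \<omega> \<or> ch a = \<omega> ^ 2"
  using chi_zero_iff chi_cube cube_root_unity by blast

lemma cnj_omega: "cnj \<omega> = \<omega> ^ 2"
  unfolding omega_sq by (simp add: \<omega>_def complex_eq_iff)

lemma omega_pow4: "(\<omega> ^ 2) ^ 2 = \<omega>"
proof -
  have "(\<omega> ^ 2) ^ 2 = \<omega> ^ 3 * \<omega>" by (simp add: eval_nat_numeral)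
  thus ?thesis by (simp add: omega_cube)
qed

lemma cnj_chi: "cnj (ch a) = ch a ^ 2"
  using chi_cases[of a] cnj_omega omega_pow4 by (elim disjE) auto

lemma chi_mult_cnj: "ch a * cnj (ch a) = (if int p dvd a then 0 else 1)"
  using chi_cube[of a] chi_zero_iff[of a] by (auto simp: cnj_chi power3_eq_cube power2_eq_square mult.assoc)

lemma bij_affine:
  assumes "\<not> int p dvd m"
  shows "bij_betw (\<lambda>a. (c + m * a) mod int p) R R"
proof -
  have cop: "coprime m (int p)" using assms prime_p by (metis coprime_commute prime_imp_coprime)
  have "inj_on (\<lambda>a. (c + m * a) mod int p) R"
  proof (rule inj_onI)
    fix s t assume st: "s \<in> R" "t \<in> R" "(c + m * s) mod int p = (c + m * t) mod int p"
    hence "int p dvd (c + m * s) - (c + m * t)" by (simp add: mod_eq_dvd_iff)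
    hence "int p dvd m * (s - t)" by (simp add: algebra_simps)
    hence "int p dvd s - t" using cop by (metis coprime_commute coprime_dvd_mult_right_iff)
    hence "s mod int p = t mod int p" by (simp add: mod_eq_dvd_iff)
    thus "s = t" using st by simp
  qed
  moreover have "(\<lambda>a. (c + m * a) mod int p) ` R \<subseteq> R" using p_gt_1 by auto
  ultimately show ?thesis by (simp add: bij_betw_def endo_inj_surj)
qed

lemma sum_affine:
  fixes F :: "int \<Rightarrow> 'a::comm_monoid_add"
  assumes "\<not> int p dvd m" "\<And>a. F (a mod int p) = F a"
  shows "(\<Sum>a\<in>R. F (c + m * a)) = (\<Sum>a\<in>R. F a)"
proof -
  have "(\<Sum>a\<in>R. F (c + m * a)) = (\<Sum>a\<in>R. F ((c + m * a) mod int p))" by (simp add: assms(2))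
  also have "\<dots> = (\<Sum>a\<in>R. F a)" by (rule sum.reindex_bij_betw[OF bij_affine[OF assms(1)]])
  finally show ?thesis .
qed

lemma one_nd: "\<not> int p dvd 1" using p_gt_1 by simp

lemma sum_chi: "(\<Sum>a\<in>R. ch a) = 0"
proof -
  have "(\<Sum>a\<in>R. ch a) = (\<Sum>a\<in>R. ch (0 + g * a))" by (rule sum_affine[where F = ch, OF chi_g(1) chi_mod, symmetric])
  also have "\<dots> = ch g * (\<Sum>a\<in>R. ch a)" by (simp add: chi_mult sum_distrib_left)
  finally show ?thesis using chi_g(2) by (simp add: algebra_simps)
qed

lemma sum_cnj_chi: "(\<Sum>a\<in>R. cnj (ch a)) = 0"
  by (metis sum_chi cnj_sum complex_cnj_zero)

lemma sum_principal: "(\<Sum>a\<in>R. if int p dvd a then 0 else 1 :: complex) = of_nat p - 1"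
proof -
  have "(\<Sum>a\<in>R. if int p dvd a then 0 else 1 :: complex) = (\<Sum>a\<in>R. 1 - (if a = 0 then 1 else 0))"
    by (intro sum.cong refl) (auto dest: zdvd_not_zless[rotated] simp: zdvd_not_zless)
  also have "\<dots> = of_nat p - 1" using p_gt_1 by (simp add: sum_subtractf)
  finally show ?thesis .
qed

definition corr :: "int \<Rightarrow> complex" where
  "corr e = (\<Sum>m\<in>R. ch (m + e) * cnj (ch m))"

lemma chi_mod_add: "ch (a mod int p + b) = ch (a + b)" "ch (b + a mod int p) = ch (b + a)"
  "ch (b - a mod int p) = ch (b - a)" "ch (a mod int p - b) = ch (a - b)"
  by (auto intro!: chi_cong simp: unique_euclidean_semiring_class.cong_def mod_simps)

lemma corr_0: "corr 0 = of_nat p - 1"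
  using sum_principal by (simp add: corr_def chi_mult_cnj)

lemma corr_eq:
  assumes "\<not> int p dvd e"
  shows "corr e = corr 1"
proof -
  have "corr e = (\<Sum>m\<in>R. ch ((0 + e * m) + e) * cnj (ch (0 + e * m)))"
    unfolding corr_def by (rule sum_affine[OF assms, symmetric]) (simp add: chi_mod_add chi_mod)
  also have "\<dots> = (\<Sum>m\<in>R. (ch e * cnj (ch e)) * (ch (m + 1) * cnj (ch m)))"
  proof (intro sum.cong refl)
    fix m
    have "0 + e * m + e = e * (m + 1)" by (simp add: algebra_simps)
    thus "ch (0 + e * m + e) * cnj (ch (0 + e * m)) = (ch e * cnj (ch e)) * (ch (m + 1) * cnj (ch m))"
      by (simp only: chi_mult) (simp add: chi_mult)
  qed
  also have "\<dots> = corr 1" using assms by (simp add: corr_def chi_mult_cnj)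
  finally show ?thesis .
qed

text \<open>Summed over all shifts e the autocorrelations give 0, by orthogonality. The shift 0
  contributes p - 1 and the p - 1 other shifts contribute equally, so each of them contributes
  -1.\<close>

lemma corr_1: "corr 1 = -1"
proof -
  have split: "sum f R = f 0 + sum f (R - {0})" for f :: "int \<Rightarrow> complex"
    using p_gt_1 by (intro sum.remove) auto
  have "0 = (\<Sum>m\<in>R. (\<Sum>e\<in>R. ch (m + 1 * e)) * cnj (ch m))"
    by (subst sum_affine[where F = ch, OF one_nd chi_mod]) (simp add: sum_chi)
  also have "\<dots> = (\<Sum>e\<in>R. corr e)"
    unfolding corr_def sum_distrib_right by (subst sum.swap) simp
  also have "\<dots> = (of_nat p - 1) + (\<Sum>e\<in>R - {0}. corr 1)"
    by (subst split, subst corr_0, intro arg_cong2[of _ _ _ _ "(+)"] refl sum.cong corr_eq)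
       (auto simp: zdvd_not_zless)
  also have "\<dots> = (of_nat p - 1) * (1 + corr 1)"
    using p_gt_1 by (simp add: algebra_simps of_nat_diff)
  finally have "(of_nat p - 1) * (1 + corr 1) = 0" by simp
  moreover have "of_nat p - 1 \<noteq> (0::complex)" using p_gt_1 by simp
  ultimately have "1 + corr 1 = 0" by (metis mult_eq_0_iff)
  thus ?thesis by (simp add: add_eq_0_iff)
qed

section \<open>The Jacobi sum and its absolute value\<close>

definition J :: complex where "J = (\<Sum>a\<in>R. ch a * ch (1 - a))"

definition J' :: "int \<Rightarrow> complex" where "J' m = (\<Sum>a\<in>R. ch a * ch (m - a))"

lemma J'_eq: "\<not> int p dvd m \<Longrightarrow> J' m = ch m ^ 2 * J"
proof -
  assume m: "\<not> int p dvd m"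
  have "J' m = (\<Sum>a\<in>R. ch (0 + m * a) * ch (m - (0 + m * a)))"
    unfolding J'_def by (rule sum_affine[OF m, symmetric]) (simp add: chi_mod_add chi_mod)
  also have "\<dots> = (\<Sum>a\<in>R. ch m ^ 2 * (ch a * ch (1 - a)))"
  proof (intro sum.cong refl)
    fix a
    have "m - (0 + m * a) = m * (1 - a)" by (simp add: algebra_simps)
    thus "ch (0 + m * a) * ch (m - (0 + m * a)) = ch m ^ 2 * (ch a * ch (1 - a))"
      by (simp only: chi_mult) (simp add: chi_mult power2_eq_square)
  qed
  finally show ?thesis by (simp add: J_def sum_distrib_left)
qed

lemma J'_0: "J' 0 = 0"
  using sum_cnj_chi by (simp add: J'_def chi_minus cnj_chi power2_eq_square)

text \<open>The sum of |J' m|^2 over all m is evaluated twice. Scaling gives J' m = ch(m)^2 J, hence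
  (p - 1) |J|^2; opening the square and summing over m first produces autocorrelations, hence p (p -
  1).\<close>

lemma norm_J: "J * cnj J = of_nat p"
proof -
  have "(\<Sum>m\<in>R. J' m * cnj (J' m)) =
      (\<Sum>m\<in>R. \<Sum>a\<in>R. \<Sum>c\<in>R. (ch a * ch (m - a)) * cnj (ch c * ch (m - c)))"
    by (simp add: J'_def sum_product cnj_sum)
  also have "\<dots> = (\<Sum>a\<in>R. \<Sum>m\<in>R. \<Sum>c\<in>R. (ch a * ch (m - a)) * cnj (ch c * ch (m - c)))"
    by (rule sum.swap)
  also have "\<dots> = (\<Sum>a\<in>R. \<Sum>c\<in>R. \<Sum>m\<in>R. (ch a * ch (m - a)) * cnj (ch c * ch (m - c)))"
    by (intro sum.cong refl sum.swap)
  also have "\<dots> = (\<Sum>a\<in>R. \<Sum>c\<in>R. ch a * cnj (ch c) * (\<Sum>m\<in>R. ch (m - a) * cnj (ch (m - c))))"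
    by (simp add: sum_distrib_left mult_ac)
  also have "\<dots> = (\<Sum>a\<in>R. \<Sum>c\<in>R. ch a * cnj (ch c) * ((if a = c then of_nat p else 0) - 1))"
  proof (intro sum.cong refl arg_cong2[of _ _ _ _ "(*)"])
    fix a c assume ac: "a \<in> R" "c \<in> R"
    have "(\<Sum>m\<in>R. ch (m - a) * cnj (ch (m - c))) = (\<Sum>m\<in>R. ch ((c + 1 * m) - a) * cnj (ch ((c + 1 * m) - c)))"
      by (rule sum_affine[OF one_nd, symmetric]) (simp add: chi_mod_add)
    also have "\<dots> = corr (c - a)" by (simp add: corr_def algebra_simps)
    also have "\<dots> = (if a = c then of_nat p else 0) - 1"
    proof (cases "a = c")
      case False
      have "\<not> int p dvd c - a"
      proof
        assume "int p dvd c - a"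
        hence "c mod int p = a mod int p" by (simp add: mod_eq_dvd_iff)
        thus False using ac False by simp
      qed
      thus ?thesis using False corr_eq corr_1 by simp
    qed (simp add: corr_0)
    finally show "(\<Sum>m\<in>R. ch (m - a) * cnj (ch (m - c))) = (if a = c then of_nat p else 0) - 1" .
  qed
  also have "\<dots> = (\<Sum>a\<in>R. of_nat p * (ch a * cnj (ch a)) - ch a * (\<Sum>c\<in>R. cnj (ch c)))"
  proof (intro sum.cong refl)
    fix a assume "a \<in> R"
    have "(\<Sum>c\<in>R. ch a * cnj (ch c) * ((if a = c then of_nat p else 0) - 1)) =
      (\<Sum>c\<in>R. (if a = c then of_nat p * (ch a * cnj (ch c)) else 0)) - (\<Sum>c\<in>R. ch a * cnj (ch c))"
      unfolding sum_subtractf[symmetric] by (intro sum.cong refl) (simp add: algebra_simps)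
    thus "(\<Sum>c\<in>R. ch a * cnj (ch c) * ((if a = c then of_nat p else 0) - 1)) =
      of_nat p * (ch a * cnj (ch a)) - ch a * (\<Sum>c\<in>R. cnj (ch c))"
      using \<open>a \<in> R\<close> by (simp add: sum_distrib_left)
  qed
  also have "\<dots> = of_nat p * (of_nat p - 1)"
    using sum_principal by (simp add: sum_cnj_chi chi_mult_cnj flip: sum_distrib_left)
  finally have 1: "(\<Sum>m\<in>R. J' m * cnj (J' m)) = of_nat p * (of_nat p - 1)" .
  have "J' m * cnj (J' m) = (if int p dvd m then 0 else 1) * (J * cnj J)" if "m \<in> R" for m
  proof (cases "int p dvd m")
    case True
    hence "m = 0" using that by (auto simp: zdvd_not_zless dest: zdvd_imp_le)
    thus ?thesis by (simp add: J'_0)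
  next
    case False
    have "ch m ^ 2 * cnj (ch m ^ 2) = (ch m * cnj (ch m)) ^ 2" by (simp add: power_mult_distrib)
    thus ?thesis using False by (simp add: J'_eq chi_mult_cnj mult_ac)
  qed
  hence "(\<Sum>m\<in>R. J' m * cnj (J' m)) = (\<Sum>m\<in>R. (if int p dvd m then 0 else 1) * (J * cnj J))"
    by (intro sum.cong refl)
  also have "\<dots> = (of_nat p - 1) * (J * cnj J)"
    by (simp add: sum_principal flip: sum_distrib_right)
  finally have e: "(\<Sum>m\<in>R. J' m * cnj (J' m)) = (of_nat p - 1) * (J * cnj J)" .
  have "(of_nat p - 1) * (J * cnj J) = (of_nat p - 1) * of_nat p"
    by (rule trans[OF e[symmetric] trans[OF 1 mult.commute]])
  moreover have "of_nat p - 1 \<noteq> (0::complex)" using p_gt_1 by simp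
  ultimately show ?thesis using mult_left_cancel[THEN iffD1] by blast
qed

lemma J_eisenstein: "J \<in> eisenstein"
proof -
  have "ch a \<in> eisenstein" for a using chi_cases[of a] omega_powers_eisenstein by metis
  thus ?thesis unfolding J_def by (intro eisenstein_sum eisenstein_mult)
qed

section \<open>Counting solutions of the cubic congruence\<close>

definition roots :: "int \<Rightarrow> int set" where
  "roots a = {y \<in> R. int p dvd y ^ 3 - a}"

lemma card_roots_le: "card (roots a) \<le> 3"
proof -
  define c where "c = nat (a mod int p)"
  have c: "int c = a mod int p" using p_gt_1 by (simp add: c_def)
  have "roots a \<subseteq> int ` {x \<in> {..<p}. [x ^ 3 = c] (mod p)}"
  proof
    fix y assume y: "y \<in> roots a"
    then obtain x where x: "y = int x" "x < p" by (auto simp: roots_def elim!: nonneg_int_cases)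
    have "y ^ 3 mod int p = a mod int p" using y by (simp add: roots_def mod_eq_dvd_iff)
    hence "int (x ^ 3) mod int p = int c mod int p" using x c by simp
    hence "[x ^ 3 = c] (mod p)" by (metis of_nat_eq_iff of_nat_mod unique_euclidean_semiring_class.cong_def)
    thus "y \<in> int ` {x \<in> {..<p}. [x ^ 3 = c] (mod p)}" using x by auto
  qed
  hence "card (roots a) \<le> card (int ` {x \<in> {..<p}. [x ^ 3 = c] (mod p)})" by (intro card_mono) auto
  also have "\<dots> \<le> card {x \<in> {..<p}. [x ^ 3 = c] (mod p)}" by (intro card_image_le) auto
  also have "\<dots> \<le> 3" using roots_mod_prime_bound[OF p, of 3 c] by simp
  finally show ?thesis .
qed

lemma finite_roots: "finite (roots a)"
  by (rule finite_subset[of _ R]) (auto simp: roots_def)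

lemma roots_zero: assumes "int p dvd a" shows "card (roots a) = 1"
proof -
  have "roots a = {0}"
  proof
    show "roots a \<subseteq> {0}"
    proof
      fix y assume "y \<in> roots a"
      hence y: "y \<in> R" "int p dvd y ^ 3 - a" by (auto simp: roots_def)
      hence "int p dvd (y ^ 3 - a) + a" using assms by (intro dvd_add) auto
      hence "int p dvd y" using prime_p by (simp add: prime_dvd_power_iff)
      thus "y \<in> {0}" using y by (auto dest: zdvd_imp_le)
    qed
  next
    show "{0} \<subseteq> roots a" using assms p_gt_1 by (auto simp: roots_def)
  qed
  thus ?thesis by simp
qed

lemma chi_sum_cases: "1 + ch a + cnj (ch a) = of_nat (if int p dvd a then 1 else if ch a = 1 then 3 else 0)"
proof (cases "int p dvd a")
  case True thus ?thesis using chi_zero_iff[of a] by simp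
next
  case False
  hence "ch a = 1 \<or> ch a = \<omega> \<or> ch a = \<omega> ^ 2" using chi_cases[of a] chi_zero_iff[of a] by auto
  moreover have "1 + \<omega> + \<omega> ^ 2 = 0" by (simp add: omega_sq)
  moreover have "\<omega> ^ 2 \<noteq> 1" by (metis omega_cube omega_neq_1 power3_eq_cube power2_eq_square mult_1)
  ultimately show ?thesis using False omega_neq_1 cnj_omega omega_pow4
    by (auto simp: cnj_chi add_ac)
qed

text \<open>Only the upper bound is proved pointwise: no roots unless ch a is 0 or 1, one root at 0,
  and at most three otherwise. Both the numbers of roots and the bounds sum to p, the latter by
  orthogonality, so every bound is attained. In particular ch a = 1 forces three cube roots.\<close>

lemma card_roots: "of_nat (card (roots a)) = 1 + ch a + cnj (ch a)" if "a \<in> R" for a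
proof -
  define n where "n = (\<lambda>a. if int p dvd a then 1 else if ch a = 1 then 3 else 0 :: nat)"
  have le: "card (roots a) \<le> n a" for a
  proof (cases "int p dvd a \<or> ch a = 1")
    case True thus ?thesis using card_roots_le[of a] roots_zero[of a] by (auto simp: n_def)
  next
    case False
    have "roots a = {}"
    proof (rule ccontr)
      assume "roots a \<noteq> {}"
      then obtain y where y: "int p dvd y ^ 3 - a" by (auto simp: roots_def)
      hence eq: "ch a = ch (y ^ 3)" by (intro chi_cong) (simp add: cong_iff_dvd_diff dvd_diff_commute)
      have "ch (y ^ 3) = ch y ^ 3" by (simp add: chi_mult power3_eq_cube)
      thus False using eq False chi_zero_iff[of a] chi_cube[of y] chi_zero_iff[of y] by (cases "int p dvd y") auto
    qed
    thus ?thesis by simp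
  qed
  have "(\<Sum>a\<in>R. card (roots a)) = card (\<Union>a\<in>R. roots a)"
  proof (intro card_UN_disjoint[symmetric] ballI impI finite_roots)
    fix a b assume ab: "a \<in> R" "b \<in> R" "a \<noteq> b"
    show "roots a \<inter> roots b = {}"
    proof (rule ccontr)
      assume "roots a \<inter> roots b \<noteq> {}"
      then obtain y where "int p dvd y ^ 3 - a" "int p dvd y ^ 3 - b" by (auto simp: roots_def)
      hence "y ^ 3 mod int p = a mod int p" "y ^ 3 mod int p = b mod int p" by (auto simp: mod_eq_dvd_iff)
      thus False using ab by simp
    qed
  qed simp
  also have "(\<Union>a\<in>R. roots a) = R"
  proof
    show "R \<subseteq> (\<Union>a\<in>R. roots a)"
    proof
      fix y assume y: "y \<in> R"
      have "y \<in> roots (y ^ 3 mod int p)" using y by (simp add: roots_def mod_eq_dvd_iff[symmetric])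
      moreover have "y ^ 3 mod int p \<in> R" using p_gt_1 by simp
      ultimately show "y \<in> (\<Union>a\<in>R. roots a)" by blast
    qed
  qed (auto simp: roots_def)
  finally have total: "(\<Sum>a\<in>R. card (roots a)) = p" by simp
  have "of_nat (\<Sum>a\<in>R. n a) = (\<Sum>a\<in>R. 1 + ch a + cnj (ch a))"
    unfolding chi_sum_cases by (simp add: n_def)
  also have "\<dots> = (of_nat p :: complex)"
    by (simp add: sum.distrib sum_chi sum_cnj_chi)
  finally have "(\<Sum>a\<in>R. n a) = p" by (simp only: of_nat_eq_iff)
  hence "(\<Sum>a\<in>R. n a - card (roots a)) = 0"
    using total le by (simp add: sum_subtractf_nat)
  hence "n a - card (roots a) = 0" using that by simp
  hence "n a = card (roots a)" using le[of a] by simp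
  thus ?thesis unfolding chi_sum_cases by (simp add: n_def)
qed

lemma roots_mod: "roots (a mod int p) = roots a"
  by (auto simp: roots_def simp flip: mod_eq_dvd_iff)

lemma card_roots': "of_nat (card (roots a)) = 1 + ch a + cnj (ch a)"
  using card_roots[of "a mod int p"] p_gt_1 by (simp add: roots_mod chi_mod)

lemma nu_eq_sum: "nu p = (\<Sum>a\<in>R. card (roots a) * card (roots (-1 - a)))"
proof -
  have "nu p = card {(y, z). y \<in> R \<and> z \<in> R \<and> int p dvd 1 + y ^ 3 + z ^ 3}"
    unfolding nu_def
  proof (rule bij_betw_same_card[of "\<lambda>(y, z). (int y, int z)"], rule bij_betw_imageI)
    show "inj_on (\<lambda>(y, z). (int y, int z)) {(y, z). y < p \<and> z < p \<and> p dvd 1 + y ^ 3 + z ^ 3}"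
      by (auto simp: inj_on_def)
    have iff: "int p dvd 1 + int y ^ 3 + int z ^ 3 \<longleftrightarrow> p dvd 1 + y ^ 3 + z ^ 3" for y z
    proof -
      have "1 + int y ^ 3 + int z ^ 3 = int (1 + y ^ 3 + z ^ 3)" by simp
      thus ?thesis by (simp only: int_dvd_int_iff)
    qed
    show "(\<lambda>(y, z). (int y, int z)) ` {(y, z). y < p \<and> z < p \<and> p dvd 1 + y ^ 3 + z ^ 3} =
       {(y, z). y \<in> R \<and> z \<in> R \<and> int p dvd 1 + y ^ 3 + z ^ 3}"
    proof safe
      fix y z assume "y \<in> R" "z \<in> R" "int p dvd 1 + y ^ 3 + z ^ 3"
      moreover from this obtain a b where "y = int a" "z = int b" by (metis atLeastLessThan_iff nonneg_int_cases)
      ultimately show "(y, z) \<in> (\<lambda>(y, z). (int y, int z)) ` {(y, z). y < p \<and> z < p \<and> p dvd 1 + y ^ 3 + z ^ 3}"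
        by (intro image_eqI[of _ _ "(a, b)"]) (auto simp: iff)
    qed (auto simp: iff)
  qed
  also have "{(y, z). y \<in> R \<and> z \<in> R \<and> int p dvd 1 + y ^ 3 + z ^ 3} = (\<Union>a\<in>R. roots a \<times> roots (-1 - a))"
  proof safe
    fix y z assume yz: "y \<in> R" "z \<in> R" "int p dvd 1 + y ^ 3 + z ^ 3"
    have "y \<in> roots (y ^ 3 mod int p)" using yz by (simp add: roots_def mod_eq_dvd_iff[symmetric])
    moreover have "z \<in> roots (-1 - y ^ 3 mod int p)"
    proof -
      have "int p dvd (1 + y ^ 3 + z ^ 3) - (y ^ 3 - y ^ 3 mod int p)"
        by (rule dvd_diff[OF yz(3) dvd_minus_mod])
      thus ?thesis using yz by (simp add: roots_def algebra_simps)
    qed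
    moreover have "y ^ 3 mod int p \<in> R" using p_gt_1 by simp
    ultimately show "(y, z) \<in> (\<Union>a\<in>R. roots a \<times> roots (-1 - a))" by blast
  next
    fix a y z assume "a \<in> R" "y \<in> roots a" "z \<in> roots (-1 - a)"
    hence "int p dvd (y ^ 3 - a) + (z ^ 3 - (-1 - a))" by (intro dvd_add) (auto simp: roots_def)
    thus "int p dvd 1 + y ^ 3 + z ^ 3" by (simp add: algebra_simps)
  qed (auto simp: roots_def)
  also have "card \<dots> = (\<Sum>a\<in>R. card (roots a \<times> roots (-1 - a)))"
  proof (intro card_UN_disjoint ballI impI)
    fix a b assume ab: "a \<in> R" "b \<in> R" "a \<noteq> b"
    have "roots a \<inter> roots b = {}"
    proof (rule ccontr)
      assume "roots a \<inter> roots b \<noteq> {}"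
      then obtain y where "int p dvd y ^ 3 - a" "int p dvd y ^ 3 - b" by (auto simp: roots_def)
      hence "y ^ 3 mod int p = a mod int p" "y ^ 3 mod int p = b mod int p" by (auto simp: mod_eq_dvd_iff)
      thus False using ab by simp
    qed
    thus "roots a \<times> roots (-1 - a) \<inter> roots b \<times> roots (-1 - b) = {}" by blast
  qed (auto simp: finite_roots)
  finally show ?thesis by (simp add: card_cartesian_product)
qed

text \<open>With a = y^3 and z^3 = -1 - a, each number of cube roots is a sum of three characters
  and the product has nine terms. The single characters cancel, the products of equal characters
  give J and its conjugate because ch(-1) = 1, and the two mixed products are autocorrelations equal
  to -1.\<close>

lemma nu_eq_J: "of_nat (nu p) = of_nat p - 2 + J + cnj J"
proof -
  have m1: "\<not> int p dvd -1" using p_gt_1 by simp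
  have sh: "(\<Sum>a\<in>R. ch (-1 - a)) = 0"
    using sum_affine[where F = ch and c = "-1", OF m1 chi_mod] sum_chi by simp
  hence sh': "(\<Sum>a\<in>R. cnj (ch (-1 - a))) = 0" by (metis cnj_sum complex_cnj_zero)
  have jj: "(\<Sum>a\<in>R. ch a * ch (-1 - a)) = J"
    using J'_eq[OF m1] chi_minus[of 1] chi_1 by (simp add: J'_def)
  hence jj': "(\<Sum>a\<in>R. cnj (ch a) * cnj (ch (-1 - a))) = cnj J" by (simp flip: jj add: cnj_sum)
  have "(\<Sum>a\<in>R. ch (-1 - a) * cnj (ch a)) = corr 1"
    unfolding corr_def
  proof (intro sum.cong refl)
    fix a :: int have "-1 - a = - (a + 1)" by simp
    thus "ch (-1 - a) * cnj (ch a) = ch (a + 1) * cnj (ch a)" by (simp only: chi_minus[of "a + 1"])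
  qed
  hence k: "(\<Sum>a\<in>R. ch (-1 - a) * cnj (ch a)) = -1" by (simp add: corr_1)
  hence "cnj (\<Sum>a\<in>R. ch (-1 - a) * cnj (ch a)) = -1" by simp
  hence k': "(\<Sum>a\<in>R. ch a * cnj (ch (-1 - a))) = -1" by (simp add: cnj_sum mult.commute)
  have "of_nat (nu p) = (\<Sum>a\<in>R. (1 + ch a + cnj (ch a)) * (1 + ch (-1 - a) + cnj (ch (-1 - a))))"
    by (simp only: nu_eq_sum of_nat_sum of_nat_mult card_roots')
  also have "\<dots> = (\<Sum>a\<in>R. 1 + ch a + cnj (ch a) + ch (-1 - a) + cnj (ch (-1 - a)) + ch a * ch (-1 - a)
      + cnj (ch a) * cnj (ch (-1 - a)) + ch a * cnj (ch (-1 - a)) + ch (-1 - a) * cnj (ch a))"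
    by (intro sum.cong refl) (simp add: algebra_simps)
  also have "\<dots> = of_nat p + J + cnj J - 1 - 1"
    by (simp add: sum.distrib sum_chi sum_cnj_chi sh sh' jj jj' k k')
  finally show ?thesis by simp
qed

text \<open>Away from a = 0 and a = -1 the two fibres have 0 or 3 points each, so their product is
  divisible by 9; the two exceptional values contribute 1 * 3 each. The congruence serves to
  identify which associate of a prime the Jacobi sum is.\<close>

lemma nu_mod_9: "nu p mod 9 = 6"
proof -
  have m1: "int p - 1 \<in> R" "int p - 1 \<noteq> 0" "0 \<in> R" using p_gt_1 prime_p by auto
  have c: "card (roots a) = (if int p dvd a then 1 else if ch a = 1 then 3 else 0)" for a
    using card_roots'[of a] unfolding chi_sum_cases of_nat_eq_iff .
  have n1: "\<not> int p dvd -1" "ch (-1) = 1" using p_gt_1 chi_minus[of 1] chi_1 by auto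
  have r0: "card (roots 0) * card (roots (-1 - 0)) = 3" using n1 by (simp add: c)
  have r1: "card (roots (int p - 1)) * card (roots (-1 - (int p - 1))) = 3"
  proof -
    have "\<not> int p dvd int p - 1"
    proof
      assume "int p dvd int p - 1"
      hence "int p dvd int p - (int p - 1)" by (rule dvd_diff[OF dvd_refl])
      thus False using one_nd by simp
    qed
    moreover have "ch (int p - 1) = ch (-1)" by (rule chi_cong) (simp add: cong_iff_dvd_diff)
    ultimately show ?thesis using n1 by (simp add: c)
  qed
  have rest: "9 dvd card (roots a) * card (roots (-1 - a))" if "a \<in> R - {0} - {int p - 1}" for a
  proof -
    have "\<not> int p dvd a" using that by (auto dest: zdvd_imp_le)
    moreover have "\<not> int p dvd -1 - a"
    proof
      assume "int p dvd -1 - a"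
      hence "int p dvd - (-1 - a)" by (simp only: dvd_minus_iff)
      hence "int p dvd a + 1" by (simp add: add.commute)
      thus False using that by (auto dest: zdvd_imp_le)
    qed
    ultimately show ?thesis by (auto simp: c)
  qed
  have "nu p = 3 + (3 + (\<Sum>a\<in>R - {0} - {int p - 1}. card (roots a) * card (roots (-1 - a))))"
    unfolding nu_eq_sum using m1 r0 r1
    by (subst sum.remove[of _ 0], simp, simp, subst sum.remove[of _ "int p - 1"]) auto
  moreover have "9 dvd (\<Sum>a\<in>R - {0} - {int p - 1}. card (roots a) * card (roots (-1 - a)))"
    by (intro dvd_sum rest)
  ultimately show ?thesis by (auto elim!: dvdE)
qed

text \<open>A + B\<omega> is the Jacobi sum itself. Substituting p = A^2 - AB + B^2 into the count
  modulo 9 leaves a congruence in A and B alone, settled by inspecting all residues modulo 9. The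
  outcome A = 2, B = 0 modulo 3 says that the negated Jacobi sum is primary.\<close>

theorem nu_primary:
  "\<exists>A B :: int. A\<^sup>2 - A * B + B\<^sup>2 = int p \<and> A mod 3 = 2 \<and> B mod 3 = 0 \<and> int (nu p) = int p - 2 + 2 * A - B"
proof -
  obtain A B where J: "J = of_int A + of_int B * \<omega>" using J_eisenstein by (auto simp: eisenstein_def)
  have "complex_of_real ((cmod J)\<^sup>2) = of_nat p" using norm_J by (simp only: complex_norm_square)
  hence "(cmod J)\<^sup>2 = p" by (metis of_real_eq_iff of_real_of_nat_eq)
  hence "of_int (A\<^sup>2 - A * B + B\<^sup>2) = real p" by (simp only: J cmod_eisenstein)
  hence N: "A\<^sup>2 - A * B + B\<^sup>2 = int p" by linarith
  have "complex_of_real (of_int (int (nu p))) = of_real (of_int (int p - 2 + 2 * A - B))"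
    using nu_eq_J by (simp add: J complex_eq_iff \<omega>_def)
  hence nu: "int (nu p) = int p - 2 + 2 * A - B" by (metis of_int_eq_iff of_real_eq_iff)
  have "int (nu p) mod 9 = 6" using nu_mod_9 by (metis of_nat_mod of_nat_numeral)
  hence h: "(A\<^sup>2 - A * B + B\<^sup>2 - 2 + 2 * A - B) mod 9 = 6" by (simp only: nu N)
  have "A mod 3 = 2 \<and> B mod 3 = 0"
  proof -
    define a b where "a = A mod 9" and "b = B mod 9"
    have "[a * a - a * b + b * b - 2 + 2 * a - b = A * A - A * B + B * B - 2 + 2 * A - B] (mod 9)"
      by (intro cong_diff cong_add cong_mult cong_refl)
         (simp_all add: a_def b_def unique_euclidean_semiring_class.cong_def)
    hence "(a * a - a * b + b * b - 2 + 2 * a - b) mod 9 = 6"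
      using h by (simp add: power2_eq_square unique_euclidean_semiring_class.cong_def)
    moreover have "a \<in> {0..8}" "b \<in> {0..8}" by (auto simp: a_def b_def)
    hence "a \<in> {0,1,2,3,4,5,6,7,8}" "b \<in> {0,1,2,3,4,5,6,7,8}" by auto
    moreover have "\<forall>a\<in>{0,1,2,3,4,5,6,7,8::int}. \<forall>b\<in>{0,1,2,3,4,5,6,7,8::int}.
        (a * a - a * b + b * b - 2 + 2 * a - b) mod 9 = 6 \<longrightarrow> a mod 3 = 2 \<and> b mod 3 = 0"
      by simp
    ultimately have "a mod 3 = 2 \<and> b mod 3 = 0" by blast
    thus ?thesis by (simp add: a_def b_def mod_mod_cancel)
  qed
  thus ?thesis using N nu by (intro exI[of _ A] exI[of _ B]) simp
qed

end

text \<open>The character sends the i-th power of a primitive root to \<omega>^i. This is well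
  defined because exponents matter modulo p - 1, which is divisible by 3.\<close>

lemma cubic_character_exists:
  fixes p :: nat
  assumes p: "prime p" and p3: "p mod 3 = 1"
  shows "\<exists>ch g. cubic_character p ch g"
proof -
  have p1: "p > 1" using p by (rule prime_gt_1_nat)
  obtain g where g: "residue_primroot p g" using prime_primitive_root_exists[OF p1 p] by blast
  have ord: "ord p g = p - 1" and cop: "coprime p g"
    using g p by (auto simp: residue_primroot_def totient_prime)
  have bij: "bij_betw (\<lambda>i. g ^ i mod p) {..<p - 1} (totatives p)"
    using residue_primroot_is_generator[OF p1 g] p by (simp add: totient_prime)
  define ind where "ind = (\<lambda>a :: int. SOME i. [int g ^ i = a] (mod int p))"
  have ind: "[int g ^ ind a = a] (mod int p)" if "\<not> int p dvd a" for a
  proof -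
    define b where "b = nat (a mod int p)"
    have b: "int b = a mod int p" using p1 by (simp add: b_def)
    have "\<not> p dvd b"
      using that b by (metis dvd_mod_iff dvd_refl int_dvd_int_iff)
    hence "b > 0" by (intro Nat.gr0I) simp
    moreover have "int b < int p" unfolding b using p1 by simp
    ultimately have "b \<in> totatives p" using p by (simp add: totatives_prime)
    hence "b \<in> (\<lambda>i. g ^ i mod p) ` {..<p - 1}"
      by (simp only: bij_betw_imp_surj_on[OF bij])
    then obtain i where "b = g ^ i mod p" by (rule imageE)
    hence "g ^ i mod p = b" by (rule sym)
    hence "int (g ^ i mod p) = a mod int p" using b by simp
    hence "[int g ^ i = a] (mod int p)"
      by (simp add: unique_euclidean_semiring_class.cong_def of_nat_mod)
    thus ?thesis unfolding ind_def by (rule someI)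
  qed
  have exp: "\<omega> ^ i = \<omega> ^ j" if "[int g ^ i = int g ^ j] (mod int p)" for i j
  proof -
    have "[g ^ i = g ^ j] (mod p)" using that by (metis cong_int_iff of_nat_power)
    hence "[i = j] (mod (p - 1))" using order_divides_expdiff[OF cop] ord by simp
    moreover have "3 dvd p - 1" using p3 p1 by (simp add: dvd_eq_mod_eq_0 mod_diff_right_eq) presburger
    ultimately have "[i = j] (mod 3)" by (rule cong_dvd_modulus_nat)
    hence ij: "i mod 3 = j mod 3" by (simp add: unique_euclidean_semiring_class.cong_def)
    have "\<omega> ^ n = \<omega> ^ (n mod 3)" for n
      by (subst mult_div_mod_eq[of 3 n, symmetric], subst power_add, subst power_mult) (simp add: omega_cube)
    thus ?thesis using ij by metis
  qed
  define ch where "ch = (\<lambda>a. if int p dvd a then 0 else \<omega> ^ ind a)"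
  have om0: "\<omega> \<noteq> 0" using omega_cube by auto
  have gnd: "\<not> int p dvd int g"
  proof
    assume "int p dvd int g"
    hence "p dvd g" by simp
    hence "is_unit p" using cop by (meson coprime_common_divisor dvd_refl)
    thus False using p1 by simp
  qed
  have cong: "ch a = \<omega> ^ i" if "[int g ^ i = a] (mod int p)" for a i
  proof -
    have "prime (int p)" using p by simp
    hence "\<not> int p dvd int g ^ i" using gnd prime_dvd_power by blast
    hence nd: "\<not> int p dvd a" using that cong_dvd_iff by blast
    have "[int g ^ ind a = int g ^ i] (mod int p)" using ind[OF nd] that cong_sym cong_trans by blast
    thus ?thesis using nd exp by (simp add: ch_def)
  qed
  have "cubic_character p ch (int g)"
  proof
    show "prime p" by (rule p)
    show "ch a = 0 \<longleftrightarrow> int p dvd a" for a using om0 by (simp add: ch_def)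
    show "ch (a mod int p) = ch a" for a
    proof (cases "int p dvd a")
      case False
      have "[int g ^ ind a = a mod int p] (mod int p)" using ind[OF False]
        by (simp add: unique_euclidean_semiring_class.cong_def)
      thus ?thesis using cong False by (simp add: ch_def)
    qed (simp add: ch_def)
    show "ch (a * b) = ch a * ch b" for a b
    proof (cases "int p dvd a \<or> int p dvd b")
      case False
      have "[int g ^ (ind a + ind b) = a * b] (mod int p)"
        unfolding power_add using False by (intro cong_mult ind) auto
      hence "ch (a * b) = \<omega> ^ (ind a + ind b)" by (rule cong)
      moreover have "ch a * ch b = \<omega> ^ (ind a + ind b)" using False by (simp add: ch_def power_add)
      ultimately show ?thesis by simp
    qed (auto simp: ch_def)
    show "ch a ^ 3 = 1" if "\<not> int p dvd a" for a
      using that by (simp add: ch_def flip: power_mult) (simp add: mult.commute[of _ 3] power_mult omega_cube)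
    show "\<not> int p dvd int g" by (rule gnd)
    have "ch (int g) = \<omega> ^ 1" by (rule cong) simp
    thus "ch (int g) \<noteq> 1" using omega_neq_1 by simp
  qed
  thus ?thesis by blast
qed

theorem nu_primary:
  fixes p :: nat
  assumes "prime p" "p mod 3 = 1"
  shows "\<exists>A B :: int. A\<^sup>2 - A * B + B\<^sup>2 = int p \<and> A mod 3 = 2 \<and> B mod 3 = 0 \<and> int (nu p) = int p - 2 + 2 * A - B"
proof -
  obtain ch g where "cubic_character p ch g" using cubic_character_exists[OF assms] by blast
  thus ?thesis by (rule cubic_character.nu_primary)
qed

section \<open>Primary Eisenstein integers\<close>

text \<open>Each ideal of $\mathbb{Z}[\omega]$ prime to $3$ has exactly one generator in $1 + 3\mathbb{Z}[\omega]$, so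
  the primary numbers form a multiplicative monoid with unique factorisation and no units but $1$.\<close>

definition primary :: "complex set" where
  "primary = {of_int a + of_int b * \<omega> | a b. a mod 3 = 1 \<and> b mod 3 = 0}"

lemma primary_intro: "a mod 3 = 1 \<Longrightarrow> b mod 3 = 0 \<Longrightarrow> of_int a + of_int b * \<omega> \<in> primary"
  unfolding primary_def by (rule CollectI, rule exI[of _ a], rule exI[of _ b]) simp

text \<open>The floor serves only as a conversion to the natural numbers: the squared absolute value
  of an Eisenstein integer is already an integer.\<close>

definition enorm :: "complex \<Rightarrow> nat" where
  "enorm z = nat \<lfloor>(cmod z)\<^sup>2\<rfloor>"

lemma coords_inject:
  "of_int a + of_int b * \<omega> = of_int c + of_int d * \<omega> \<longleftrightarrow> a = c \<and> b = d"
proof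
  assume h: "of_int a + of_int b * \<omega> = of_int c + of_int d * \<omega>"
  hence "Im (of_int a + of_int b * \<omega>) = Im (of_int c + of_int d * \<omega>)" by simp
  hence "b = d" unfolding eisenstein_parts by simp
  thus "a = c \<and> b = d" using h by simp
qed simp

lemma eisenstein_form_nonneg: "a\<^sup>2 - a * b + b\<^sup>2 \<ge> (0::int)"
proof -
  have "4 * (a\<^sup>2 - a * b + b\<^sup>2) = (2 * a - b)\<^sup>2 + 3 * b\<^sup>2"
    by (simp add: power2_eq_square algebra_simps)
  also have "\<dots> \<ge> 0" by simp
  finally show ?thesis by simp
qed

lemma enorm_coords: "int (enorm (of_int a + of_int b * \<omega>)) = a\<^sup>2 - a * b + b\<^sup>2"
  unfolding enorm_def cmod_eisenstein floor_of_int using eisenstein_form_nonneg[of a b] by simp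

lemma primary_eisenstein: "z \<in> primary \<Longrightarrow> z \<in> eisenstein"
  by (auto simp: primary_def eisenstein_def)

lemma of_nat_enorm: "z \<in> eisenstein \<Longrightarrow> real (enorm z) = (cmod z)\<^sup>2"
proof -
  assume "z \<in> eisenstein"
  then obtain a b where z: "z = of_int a + of_int b * \<omega>" by (auto simp: eisenstein_def)
  show ?thesis unfolding z cmod_eisenstein by (simp flip: enorm_coords[of a b])
qed

lemma enorm_mult: "z \<in> eisenstein \<Longrightarrow> w \<in> eisenstein \<Longrightarrow> enorm (z * w) = enorm z * enorm w"
proof -
  assume h: "z \<in> eisenstein" "w \<in> eisenstein"
  have "real (enorm (z * w)) = real (enorm z * enorm w)"
    using h by (simp add: of_nat_enorm eisenstein_mult norm_mult power_mult_distrib)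
  thus ?thesis by (simp only: of_nat_eq_iff)
qed

lemma primary_mult: "z \<in> primary \<Longrightarrow> w \<in> primary \<Longrightarrow> z * w \<in> primary"
proof -
  assume "z \<in> primary" "w \<in> primary"
  then obtain a b c d where zw: "z = of_int a + of_int b * \<omega>" "w = of_int c + of_int d * \<omega>"
    "a mod 3 = 1" "b mod 3 = 0" "c mod 3 = 1" "d mod 3 = 0" by (auto simp: primary_def)
  have b: "3 dvd b" "3 dvd d" using zw by auto
  have "(a * c - b * d) mod 3 = (a * c) mod 3"
    using b by (simp add: mod_eq_dvd_iff)
  also have "\<dots> = 1" using zw by (simp add: mod_mult_eq[of a 3 c, symmetric])
  finally have "(a * c - b * d) mod 3 = 1" .
  moreover have "(a * d + b * c - b * d) mod 3 = 0" using b by auto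
  ultimately show ?thesis unfolding zw eisenstein_mult_coords by (rule primary_intro)
qed

lemma one_primary: "1 \<in> primary"
proof -
  have "1 = of_int 1 + of_int 0 * \<omega>" by simp
  thus ?thesis unfolding primary_def by (intro CollectI exI[of _ 1] exI[of _ 0]) simp
qed

lemma primary_power: "z \<in> primary \<Longrightarrow> z ^ k \<in> primary"
  by (induction k) (auto simp: one_primary primary_mult)

lemma enorm_1: "enorm 1 = 1" by (simp add: enorm_def)

lemma enorm_power: "z \<in> primary \<Longrightarrow> enorm (z ^ k) = enorm z ^ k"
  by (induction k) (auto simp: enorm_1 enorm_mult primary_eisenstein primary_power)

text \<open>A primary number is 1 modulo 3, so multiplying by it does not change residues modulo 3.
  Consequently divisibility with a primary cofactor agrees with ordinary divisibility between
  primary numbers.\<close>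

lemma primary_cancel:
  assumes "z \<in> primary" "e \<in> eisenstein" "z * e \<in> primary"
  shows "e \<in> primary"
proof -
  obtain a b c d where zw: "z = of_int a + of_int b * \<omega>" "e = of_int c + of_int d * \<omega>"
    "a mod 3 = 1" "b mod 3 = 0" using assms by (auto simp: primary_def eisenstein_def)
  obtain a' b' where "z * e = of_int a' + of_int b' * \<omega>" "a' mod 3 = 1" "b' mod 3 = 0"
    using assms(3) by (auto simp: primary_def)
  hence h: "(a * c - b * d) mod 3 = 1" "(a * d + b * c - b * d) mod 3 = 0"
    unfolding zw eisenstein_mult_coords coords_inject by auto
  have b: "3 dvd b" using zw by auto
  have "c mod 3 = (a * c) mod 3" using zw(3) by (simp add: mod_mult_left_eq[of a 3 c, symmetric])
  also have "\<dots> = (a * c - b * d) mod 3" using b by (simp add: mod_eq_dvd_iff)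
  finally have c: "c mod 3 = 1" using h by simp
  have "d mod 3 = (a * d) mod 3" using zw(3) by (simp add: mod_mult_left_eq[of a 3 d, symmetric])
  also have "\<dots> = (a * d + b * c - b * d) mod 3" using b by (simp add: mod_eq_dvd_iff)
  finally have d: "d mod 3 = 0" using h by simp
  show ?thesis using c d unfolding zw by (rule primary_intro)
qed

lemma primary_nonzero: "z \<in> primary \<Longrightarrow> z \<noteq> 0"
proof
  assume "z \<in> primary" "z = 0"
  then obtain a b where "of_int a + of_int b * \<omega> = of_int 0 + of_int 0 * \<omega>" "a mod 3 = 1"
    unfolding primary_def by auto
  thus False unfolding coords_inject by simp
qed

lemma enorm_primary_not_dvd_3: "z \<in> primary \<Longrightarrow> \<not> 3 dvd enorm z"
proof
  assume "z \<in> primary" "3 dvd enorm z"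
  then obtain a b where z: "z = of_int a + of_int b * \<omega>" "a mod 3 = 1" "b mod 3 = 0"
    unfolding primary_def by auto
  have "int 3 dvd int (enorm z)" using \<open>3 dvd enorm z\<close> by (simp only: int_dvd_int_iff)
  hence 1: "3 dvd a\<^sup>2 - a * b + b\<^sup>2" unfolding z enorm_coords by simp
  have "3 dvd b" using z by auto
  hence "3 dvd a * b - b\<^sup>2" by (simp add: power2_eq_square)
  from dvd_add[OF 1 this] have "3 dvd a\<^sup>2" by simp
  hence "3 dvd a" by (simp add: prime_dvd_power_iff)
  thus False using z by auto
qed

lemma enorm_pos: "z \<in> primary \<Longrightarrow> enorm z > 0"
  using enorm_primary_not_dvd_3 by (intro Nat.gr0I) fastforce

lemma primary_enorm_1: "z \<in> primary \<Longrightarrow> enorm z = 1 \<Longrightarrow> z = 1"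
proof -
  assume "z \<in> primary" and e: "enorm z = 1"
  then obtain a b where z: "z = of_int a + of_int b * \<omega>" "a mod 3 = 1" "b mod 3 = 0"
    unfolding primary_def by auto
  have 1: "a\<^sup>2 - a * b + b\<^sup>2 = 1" using e unfolding z using enorm_coords[of a b] by simp
  have "4 * (a\<^sup>2 - a * b + b\<^sup>2) = (2 * a - b)\<^sup>2 + 3 * b\<^sup>2"
    by (simp add: power2_eq_square algebra_simps)
  hence "4 = (2 * a - b)\<^sup>2 + 3 * b\<^sup>2" unfolding 1 by simp
  hence "3 * b\<^sup>2 \<le> 4" using zero_le_power2[of "2 * a - b"] by linarith
  have "b = 0"
  proof (rule ccontr)
    assume "b \<noteq> 0"
    moreover have "3 dvd b" using z by auto
    ultimately have "\<bar>b\<bar> \<ge> 3" using dvd_imp_le_int by fastforce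
    hence "b\<^sup>2 \<ge> 3\<^sup>2" by (metis abs_le_square_iff abs_numeral)
    thus False using \<open>3 * b\<^sup>2 \<le> 4\<close> by simp
  qed
  hence "a\<^sup>2 = 1" using 1 by simp
  hence "a = 1 \<or> a = -1" by (simp add: power2_eq_1_iff)
  thus ?thesis using z \<open>b = 0\<close> by auto
qed

definition pdvd :: "complex \<Rightarrow> complex \<Rightarrow> bool" (infix "pdvd" 50) where
  "d pdvd z \<longleftrightarrow> (\<exists>e\<in>primary. z = d * e)"

lemma pdvd_mult: "d pdvd z \<Longrightarrow> w \<in> primary \<Longrightarrow> d pdvd z * w"
  by (auto simp: pdvd_def mult.assoc primary_mult)

lemma pdvd_self: "d pdvd d" using one_primary by (auto simp: pdvd_def)

lemma pdvd_enorm: "d pdvd z \<Longrightarrow> d \<in> primary \<Longrightarrow> enorm d dvd enorm z"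
  by (auto simp: pdvd_def enorm_mult primary_eisenstein)

definition pprime :: "complex \<Rightarrow> bool" where
  "pprime \<pi> \<longleftrightarrow> \<pi> \<in> primary \<and> enorm \<pi> > 1 \<and>
     (\<forall>x\<in>primary. \<forall>y\<in>primary. \<pi> pdvd x * y \<longrightarrow> \<pi> pdvd x \<or> \<pi> pdvd y)"

section \<open>Prime elements above split and inert primes\<close>

text \<open>Modulo \<pi> the ring becomes the field with p elements, \<omega> being sent to -a/b.
  The image of c + d\<omega> is then (bc - ad)/b, which explains the criterion; that b is invertible
  is the first claim, since otherwise p^2 would divide the norm p.\<close>

lemma pprime_split_aux:
  assumes p: "prime p" and \<pi>: "\<pi> = of_int a + of_int b * \<omega>" "\<pi> \<in> primary" "enorm \<pi> = p"
  shows "\<not> int p dvd b"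
    and "z = of_int c + of_int d * \<omega> \<Longrightarrow> z \<in> primary \<Longrightarrow> \<pi> pdvd z \<longleftrightarrow> int p dvd b * c - a * d"
proof -
  have N: "a\<^sup>2 - a * b + b\<^sup>2 = int p" using \<pi> enorm_coords[of a b] by simp
  have pp: "prime (int p)" using p by simp
  show nb: "\<not> int p dvd b"
  proof
    assume pb: "int p dvd b"
    hence "int p dvd int p + (a * b - b\<^sup>2)" by (simp add: power2_eq_square)
    hence "int p dvd a\<^sup>2" by (simp flip: N)
    hence pa: "int p dvd a" using pp by (simp add: prime_dvd_power_iff)
    have "int p * int p dvd a\<^sup>2 - a * b + b\<^sup>2"
      unfolding power2_eq_square using pa pb by (intro dvd_add dvd_diff mult_dvd_mono)
    hence "int p * int p dvd int p * 1" unfolding N by simp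
    hence "int p dvd 1" using p prime_gt_0_nat[OF p] by (metis dvd_times_left_cancel_iff of_nat_0_less_iff less_int_code(1) less_irrefl)
    thus False using p by (simp add: prime_nat_iff)
  qed
  assume z: "z = of_int c + of_int d * \<omega>" "z \<in> primary"
  show "\<pi> pdvd z \<longleftrightarrow> int p dvd b * c - a * d"
  proof
    assume "\<pi> pdvd z"
    then obtain e f where "z = \<pi> * (of_int e + of_int f * \<omega>)" by (auto simp: pdvd_def primary_def)
    hence cd: "c = a * e - b * f" "d = a * f + b * e - b * f"
      unfolding z \<pi> eisenstein_mult_coords coords_inject by auto
    have "b * c - a * d = - (f * (a\<^sup>2 - a * b + b\<^sup>2))"
      unfolding cd by (simp add: power2_eq_square algebra_simps)
    thus "int p dvd b * c - a * d" by (simp add: N)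
  next
    assume h: "int p dvd b * c - a * d"
    \<comment> \<open>The expression a c - b c + b d and its companion a d - b c are the coordinates
      of z times the conjugate of \<pi>. Both being divisible by p, the quotient is the cofactor
      z/\<pi> = e - f\<omega>.\<close>
    have "b * (a * c - b * c + b * d) = (a - b) * (b * c - a * d) + d * (a\<^sup>2 - a * b + b\<^sup>2)"
      by (simp add: power2_eq_square algebra_simps)
    also have "int p dvd \<dots>" unfolding N using h by simp
    finally have "int p dvd a * c - b * c + b * d" using nb pp by (simp add: prime_dvd_mult_iff)
    then obtain e where e: "a * c - b * c + b * d = int p * e" by (auto elim: dvdE)
    from h obtain f where f: "b * c - a * d = int p * f" by (auto elim: dvdE)
    have "int p * (a * e + b * f) = int p * c"
    proof -
      have "int p * (a * e + b * f) = a * (int p * e) + b * (int p * f)" by (simp add: algebra_simps)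
      also have "\<dots> = c * (a\<^sup>2 - a * b + b\<^sup>2)" unfolding e[symmetric] f[symmetric]
        by (simp add: power2_eq_square algebra_simps)
      finally show ?thesis by (simp add: N mult.commute)
    qed
    hence 1: "a * e - b * (-f) = c" using p by (simp add: prime_gt_0_nat)
    have "int p * (a * (-f) + b * e + b * f) = int p * d"
    proof -
      have "int p * (a * (-f) + b * e + b * f) = - a * (int p * f) + b * (int p * e) + b * (int p * f)"
        by (simp add: algebra_simps)
      also have "\<dots> = d * (a\<^sup>2 - a * b + b\<^sup>2)" unfolding e[symmetric] f[symmetric]
        by (simp add: power2_eq_square algebra_simps)
      finally show ?thesis by (simp add: N mult.commute)
    qed
    hence 2: "a * (-f) + b * e - b * (-f) = d" using p by (simp add: prime_gt_0_nat)
    have eq: "z = \<pi> * (of_int e + of_int (-f) * \<omega>)"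
      unfolding \<pi> eisenstein_mult_coords 1 2 z by simp
    have "of_int e + of_int (-f) * \<omega> \<in> primary"
      by (rule primary_cancel[OF \<pi>(2) eisenstein_intro]) (use eq z(2) in \<open>simp only:\<close>)
    thus "\<pi> pdvd z" using eq by (auto simp: pdvd_def)
  qed
qed

text \<open>Up to the unit factor b, the form bc - ad is a ring homomorphism to the field with p
  elements, hence multiplicative: b times its value at xy agrees modulo p with the product of its
  values at x and y.\<close>

lemma pprime_split:
  assumes p: "prime p" and \<pi>: "\<pi> \<in> primary" "enorm \<pi> = p"
  shows "pprime \<pi>"
  unfolding pprime_def
proof (intro conjI ballI impI)
  obtain a b where ab: "\<pi> = of_int a + of_int b * \<omega>" using \<pi> by (auto simp: primary_def)
  have N: "a\<^sup>2 - a * b + b\<^sup>2 = int p" using \<pi> enorm_coords[of a b] ab by simp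
  note aux = pprime_split_aux[OF p ab \<pi>]
  show "\<pi> \<in> primary" "1 < enorm \<pi>" using \<pi> prime_gt_1_nat[OF p] by simp_all
  fix x y assume xy: "x \<in> primary" "y \<in> primary" "\<pi> pdvd x * y"
  obtain c d c' d' where x: "x = of_int c + of_int d * \<omega>" and y: "y = of_int c' + of_int d' * \<omega>"
    using xy by (auto simp: primary_def)
  have "int p dvd b * (c * c' - d * d') - a * (c * d' + d * c' - d * d')"
    using aux(2)[OF _ primary_mult[OF xy(1,2)]] xy(3) unfolding x y eisenstein_mult_coords by blast
  hence "int p dvd b * (b * (c * c' - d * d') - a * (c * d' + d * c' - d * d')) + d * d' * int p" by simp
  also have "b * (b * (c * c' - d * d') - a * (c * d' + d * c' - d * d')) + d * d' * int p =
     (b * c - a * d) * (b * c' - a * d')"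
    unfolding N[symmetric] by (simp add: power2_eq_square algebra_simps)
  finally have "int p dvd b * c - a * d \<or> int p dvd b * c' - a * d'"
    using p by (simp add: prime_dvd_mult_iff)
  thus "\<pi> pdvd x \<or> \<pi> pdvd y" using aux(2)[OF x xy(1)] aux(2)[OF y xy(2)] by simp
qed

text \<open>For q = 3k + 2 cubing is injective modulo q, because x (x^3)^k = x^(q-1) = 1 for x prime
  to q. The form divides c^3 + d^3, so a zero with d prime to q would force c = -d and then 3 d^2 =
  0 modulo q. The case q = 2 is a matter of parity.\<close>

lemma inert_dvd:
  assumes q: "prime q" "q mod 3 = 2" and d: "int q dvd c\<^sup>2 - c * d + d\<^sup>2"
  shows "int q dvd c \<and> int q dvd d"
proof (cases "q = 2")
  case True
  hence "even (c\<^sup>2 - c * d + d\<^sup>2)" using d by simp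
  hence "even c \<and> even d" by (cases "even c"; cases "even d") (auto simp: power2_eq_square)
  thus ?thesis using True by simp
next
  case False
  have qq: "prime (int q)" using q by simp
  have q1: "q > 2" using False q(1) prime_ge_2_nat[of q] by linarith
  have dd: "int q dvd d" if *: "int q dvd c\<^sup>2 - c * d + d\<^sup>2" for c d :: int
  proof (rule ccontr)
    assume nd: "\<not> int q dvd d"
    have "c ^ 3 + d ^ 3 = (c + d) * (c\<^sup>2 - c * d + d\<^sup>2)"
      by (simp add: power2_eq_square power3_eq_cube algebra_simps)
    hence "int q dvd c ^ 3 + d ^ 3" using * by simp
    hence cd: "[c ^ 3 = (- d) ^ 3] (mod int q)" by (simp add: cong_iff_dvd_diff)
    have nc: "\<not> int q dvd c"
    proof
      assume c: "int q dvd c"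
      hence "int q dvd (c\<^sup>2 - c * d + d\<^sup>2) - (c\<^sup>2 - c * d)" using * by (intro dvd_diff) (auto simp: power2_eq_square)
      thus False using nd qq by (simp add: prime_dvd_power_iff)
    qed
    define k where "k = q div 3"
    have k: "q = 3 * k + 2" using q(2) unfolding k_def by presburger
    have fermat: "[x ^ (3 * k + 1) = 1] (mod int q)" if "\<not> int q dvd x" for x :: int
    proof -
      define m where "m = nat (x mod int q)"
      have m: "int m = x mod int q" using q1 by (simp add: m_def)
      have "\<not> int q dvd int m" unfolding m using that by (simp add: dvd_mod_iff)
      hence "[m ^ (q - 1) = 1] (mod q)" using fermat_theorem[OF q(1)] by simp
      hence "[int (m ^ (q - 1)) = int 1] (mod int q)" by (simp only: cong_int_iff)
      hence "[int m ^ (q - 1) = 1] (mod int q)" by simp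
      moreover have "[int m ^ (q - 1) = x ^ (q - 1)] (mod int q)"
        by (rule cong_pow) (simp add: m unique_euclidean_semiring_class.cong_def)
      ultimately have "[x ^ (q - 1) = 1] (mod int q)" by (rule cong_trans[OF cong_sym, rotated])
      thus ?thesis by (simp add: k)
    qed
    have pw: "x * (x ^ 3) ^ k = x ^ (3 * k + 1)" for x :: int by (simp add: power_mult)
    have "\<not> int q dvd - d" using nd by simp
    hence "[c * (c ^ 3) ^ k = (- d) * ((- d) ^ 3) ^ k] (mod int q)"
      unfolding pw by (rule cong_trans[OF fermat[OF nc] cong_sym[OF fermat]])
    moreover have "[(- d) * ((- d) ^ 3) ^ k = (- d) * (c ^ 3) ^ k] (mod int q)"
      by (intro cong_scalar_left cong_pow cong_sym[OF cd])
    ultimately have "[c * (c ^ 3) ^ k = (- d) * (c ^ 3) ^ k] (mod int q)"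
      by (rule cong_trans)
    moreover have "coprime ((c ^ 3) ^ k) (int q)"
      using prime_imp_coprime[OF qq nc] by (simp add: coprime_commute)
    ultimately have "[c = - d] (mod int q)" using cong_mult_rcancel by blast
    hence "int q dvd c + d" by (simp add: cong_iff_dvd_diff)
    hence "int q dvd (c + d) * (2 * d - c) + (c\<^sup>2 - c * d + d\<^sup>2)" using * by simp
    also have "(c + d) * (2 * d - c) + (c\<^sup>2 - c * d + d\<^sup>2) = 3 * (d * d)"
      by (simp add: power2_eq_square algebra_simps)
    finally have "int q dvd 3" using nd qq by (simp add: prime_dvd_mult_iff)
    hence "int q dvd int 3" by simp
    hence "q dvd 3" by (simp only: int_dvd_int_iff)
    hence "q = 3" using q1 dvd_imp_le[of q 3] by simp
    thus False using q(2) by simp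
  qed
  have "int q dvd d" using dd[OF d] .
  moreover have "int q dvd d\<^sup>2 - d * c + c\<^sup>2" using d by (simp add: algebra_simps)
  hence "int q dvd c" using dd by blast
  ultimately show ?thesis by simp
qed

lemma inert_primary: "q mod 3 = 2 \<Longrightarrow> - of_nat q \<in> primary" "enorm (- of_nat q) = q ^ 2"
proof -
  have eq: "- of_nat q = of_int (- int q) + of_int 0 * \<omega>" by simp
  show "- of_nat q \<in> primary" if "q mod 3 = 2"
  proof -
    have "(- int q) mod 3 = 1" using that by presburger
    thus ?thesis unfolding eq by (rule primary_intro) simp
  qed
  have "int (enorm (- of_nat q)) = int (q ^ 2)" unfolding eq enorm_coords by simp
  thus "enorm (- of_nat q) = q ^ 2" by (simp only: of_nat_eq_iff)
qed

lemma inert_pdvd: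
  assumes q: "prime q" "q mod 3 = 2" and z: "z \<in> primary" and d: "q dvd enorm z"
  shows "- of_nat q pdvd z"
proof -
  obtain c d where cd: "z = of_int c + of_int d * \<omega>" using z by (auto simp: primary_def)
  have "int q dvd int (enorm z)" using d by simp
  hence "int q dvd c \<and> int q dvd d" unfolding cd enorm_coords by (rule inert_dvd[OF q])
  then obtain e f where ef: "c = int q * e" "d = int q * f" by (auto elim!: dvdE)
  have eq: "z = - of_nat q * (of_int (-e) + of_int (-f) * \<omega>)"
    unfolding cd ef by (simp add: algebra_simps)
  hence "of_int (-e) + of_int (-f) * \<omega> \<in> primary"
    by (intro primary_cancel[OF inert_primary(1)[OF q(2)] eisenstein_intro]) (subst eq[symmetric], rule z)
  thus ?thesis using eq by (auto simp: pdvd_def)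
qed

lemma pprime_inert:
  assumes q: "prime q" "q mod 3 = 2"
  shows "pprime (- of_nat q)"
  unfolding pprime_def
proof (intro conjI ballI impI)
  show "- of_nat q \<in> primary" by (rule inert_primary(1)[OF q(2)])
  show "1 < enorm (- of_nat q)"
    unfolding inert_primary(2) by (rule one_less_power[OF prime_gt_1_nat[OF q(1)]]) simp
  fix x y assume xy: "x \<in> primary" "y \<in> primary" "- of_nat q pdvd x * y"
  have "q ^ 2 dvd enorm x * enorm y"
    using pdvd_enorm[OF xy(3) inert_primary(1)[OF q(2)]] xy by (simp add: inert_primary enorm_mult primary_eisenstein)
  hence "q dvd enorm x * enorm y" by (rule dvd_trans[rotated]) (simp add: power2_eq_square)
  hence "q dvd enorm x \<or> q dvd enorm y" using q(1) by (simp add: prime_dvd_mult_iff)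
  thus "- of_nat q pdvd x \<or> - of_nat q pdvd y" using inert_pdvd[OF q] xy by blast
qed

lemma cnj_coords: "cnj (of_int a + of_int b * \<omega>) = of_int (a - b) + of_int (-b) * \<omega>"
  by (simp add: complex_eq_iff \<omega>_def)

lemma cnj_primary: "z \<in> primary \<Longrightarrow> cnj z \<in> primary"
proof -
  assume "z \<in> primary"
  then obtain a b where z: "z = of_int a + of_int b * \<omega>" "a mod 3 = 1" "b mod 3 = 0" by (auto simp: primary_def)
  have "(a - b) mod 3 = 1" "(-b) mod 3 = 0" using z by presburger+
  thus ?thesis unfolding z cnj_coords by (rule primary_intro)
qed

lemma enorm_cnj: "enorm (cnj z) = enorm z" by (simp add: enorm_def)

text \<open>By \<open>pprime_split_aux\<close>, divisibility by \<pi> and by its conjugate are two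
  linear congruences. The product of the two linear forms is d^2 N(\<pi>) - b^2 N(z), which p
  divides, so one of them vanishes modulo p.\<close>

lemma split_pdvd:
  assumes p: "prime p" and \<pi>: "\<pi> \<in> primary" "enorm \<pi> = p" and z: "z \<in> primary" "p dvd enorm z"
  shows "\<pi> pdvd z \<or> cnj \<pi> pdvd z"
proof -
  obtain a b where ab: "\<pi> = of_int a + of_int b * \<omega>" using \<pi> by (auto simp: primary_def)
  obtain c d where cd: "z = of_int c + of_int d * \<omega>" using z by (auto simp: primary_def)
  have N: "a\<^sup>2 - a * b + b\<^sup>2 = int p" using \<pi> enorm_coords[of a b] ab by simp
  have pp: "prime (int p)" using p by simp
  have "int p dvd int (enorm z)" using z by simp
  hence Nz: "int p dvd c\<^sup>2 - c * d + d\<^sup>2" unfolding cd enorm_coords .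
  have i1: "\<pi> pdvd z \<longleftrightarrow> int p dvd b * c - a * d"
    using pprime_split_aux(2)[OF p ab \<pi> cd z(1)] .
  have cab: "cnj \<pi> = of_int (a - b) + of_int (- b) * \<omega>" unfolding ab by (rule cnj_coords)
  have i2: "cnj \<pi> pdvd z \<longleftrightarrow> int p dvd (-b) * c - (a - b) * d"
    by (rule pprime_split_aux(2)[OF p cab cnj_primary[OF \<pi>(1)] _ cd z(1)]) (simp add: enorm_cnj \<pi>)
  have "(b * c - a * d) * ((-b) * c - (a - b) * d) = d\<^sup>2 * (a\<^sup>2 - a * b + b\<^sup>2) - b\<^sup>2 * (c\<^sup>2 - c * d + d\<^sup>2)"
    by (simp add: power2_eq_square algebra_simps)
  also have "int p dvd \<dots>" unfolding N using Nz by simp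
  finally show ?thesis unfolding i1 i2 using pp by (simp only: prime_dvd_mult_iff)
qed

text \<open>For $p \equiv 1 \pmod 3$ a witness is the negated Jacobi sum of a cubic character modulo $p$.\<close>

definition pi_of :: "nat \<Rightarrow> complex" where
  "pi_of p = (SOME z. z \<in> primary \<and> enorm z = p \<and> real (nu p) = real p - 2 - 2 * Re z)"

lemma pi_of:
  assumes "prime p" "p mod 3 = 1"
  shows "pi_of p \<in> primary" "enorm (pi_of p) = p" "real (nu p) = real p - 2 - 2 * Re (pi_of p)"
proof -
  obtain A B :: int where AB: "A\<^sup>2 - A * B + B\<^sup>2 = int p" "A mod 3 = 2" "B mod 3 = 0"
    "int (nu p) = int p - 2 + 2 * A - B" using nu_primary[OF assms]
    by (elim exE conjE) (rule that)
  define z where "z = of_int (-A) + of_int (-B) * \<omega>"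
  have "(-A) mod 3 = 1" "(-B) mod 3 = 0" using AB by presburger+
  hence "z \<in> primary" unfolding z_def by (rule primary_intro)
  moreover have "int (enorm z) = int p" unfolding z_def enorm_coords using AB(1) by simp
  hence "enorm z = p" by simp
  moreover have "real (nu p) = real p - 2 - 2 * Re z"
  proof -
    have "real (nu p) = real_of_int (int (nu p))" by simp
    also have "\<dots> = real p - 2 - 2 * Re z" unfolding AB(4) z_def eisenstein_parts by simp
    finally show ?thesis .
  qed
  ultimately have "\<exists>z. z \<in> primary \<and> enorm z = p \<and> real (nu p) = real p - 2 - 2 * Re z" by blast
  from someI_ex[OF this] show "pi_of p \<in> primary" "enorm (pi_of p) = p" "real (nu p) = real p - 2 - 2 * Re (pi_of p)"
    unfolding pi_of_def by auto
qed

lemma pi_of_neq_cnj: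
  assumes "prime p" "p mod 3 = 1"
  shows "pi_of p \<noteq> cnj (pi_of p)"
proof
  assume h: "pi_of p = cnj (pi_of p)"
  obtain a b where ab: "pi_of p = of_int a + of_int b * \<omega>" using pi_of(1)[OF assms] by (auto simp: primary_def)
  have "b = 0" using h unfolding ab cnj_coords coords_inject by simp
  moreover have "\<not> int p dvd b" using pprime_split_aux(1)[OF assms(1) ab pi_of(1,2)[OF assms]] .
  ultimately show False by simp
qed

section \<open>The set of primary primes and factorisation\<close>

definition split_primes :: "complex set" where
  "split_primes = {z. \<exists>p. prime p \<and> p mod 3 = 1 \<and> (z = pi_of p \<or> z = cnj (pi_of p))}"

definition inert_primes :: "complex set" where
  "inert_primes = {- of_nat q | q. prime q \<and> q mod 3 = 2}"

definition pprimes :: "complex set" where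
  "pprimes = split_primes \<union> inert_primes"

lemma split_primesD:
  assumes "z \<in> split_primes"
  shows "z \<in> primary" "prime (enorm z)" "enorm z mod 3 = 1" "z = pi_of (enorm z) \<or> z = cnj (pi_of (enorm z))"
  using assms pi_of by (auto simp: split_primes_def enorm_cnj cnj_primary)

lemma inert_primesD:
  assumes "z \<in> inert_primes"
  obtains q where "z = - of_nat q" "prime q" "q mod 3 = 2" "enorm z = q ^ 2" "z \<in> primary"
  using assms inert_primary by (auto simp: inert_primes_def)

lemma pprimes_pprime: "\<pi> \<in> pprimes \<Longrightarrow> pprime \<pi>"
  unfolding pprimes_def
  using pprime_split split_primesD inert_primesD pprime_inert by (metis UnE)

lemma pprimes_primary: "\<pi> \<in> pprimes \<Longrightarrow> \<pi> \<in> primary"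
  using pprimes_pprime pprime_def by blast

lemma pprimes_enorm: "\<pi> \<in> pprimes \<Longrightarrow> enorm \<pi> > 1"
  using pprimes_pprime pprime_def by blast

text \<open>The norm exceeds 1 because 1 is the only primary unit, so some rational prime divides
  it. That prime is not 3, as primary norms are prime to 3, and the other two classes modulo 3 are
  the split and the inert case.\<close>

lemma exists_pprime_dvd:
  assumes z: "z \<in> primary" "z \<noteq> 1"
  shows "\<exists>\<pi>\<in>pprimes. \<pi> pdvd z"
proof -
  have "enorm z \<noteq> 1" using z primary_enorm_1 by blast
  then obtain q where q: "prime q" "q dvd enorm z" using prime_factor_nat by blast
  have "q mod 3 \<noteq> 0"
  proof
    assume "q mod 3 = 0"
    hence "3 dvd q" by auto
    hence "3 dvd enorm z" using q(2) dvd_trans by blast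
    thus False using enorm_primary_not_dvd_3 z by blast
  qed
  hence "q mod 3 = 1 \<or> q mod 3 = 2" by linarith
  thus ?thesis
  proof
    assume q1: "q mod 3 = 1"
    hence "pi_of q pdvd z \<or> cnj (pi_of q) pdvd z"
      using split_pdvd[OF q(1) pi_of(1,2)[OF q(1)]] z q by blast
    moreover have "pi_of q \<in> pprimes" "cnj (pi_of q) \<in> pprimes"
      using q q1 by (auto simp: pprimes_def split_primes_def)
    ultimately show ?thesis by blast
  next
    assume "q mod 3 = 2"
    moreover from this have "- of_nat q \<in> pprimes" using q by (auto simp: pprimes_def inert_primes_def)
    ultimately show ?thesis using inert_pdvd[OF q(1) _ z(1) q(2)] by blast
  qed
qed

lemma pdvd_pprimes_eq:
  assumes "\<rho> \<in> pprimes" "\<pi> \<in> pprimes" "\<rho> pdvd \<pi>"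
  shows "\<rho> = \<pi>"
proof -
  obtain e where e: "e \<in> primary" "\<pi> = \<rho> * e" using assms(3) by (auto simp: pdvd_def)
  have \<rho>: "\<rho> \<in> primary" "enorm \<rho> > 1" "pprime \<pi>" "\<pi> \<in> primary"
    using assms pprimes_primary pprimes_enorm pprimes_pprime by auto
  have "\<pi> pdvd \<rho> * e" using e pdvd_self by simp
  hence "\<pi> pdvd \<rho> \<or> \<pi> pdvd e" using \<rho>(3) \<rho>(1) e(1) by (auto simp: pprime_def)
  have enorm: "enorm \<pi> = enorm \<rho> * enorm e" using e \<rho> by (simp add: enorm_mult primary_eisenstein)
  have e1: "enorm e \<ge> 1" using enorm_pos[OF e(1)] by simp
  show ?thesis
  proof (rule disjE[OF \<open>\<pi> pdvd \<rho> \<or> \<pi> pdvd e\<close>])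
    assume "\<pi> pdvd \<rho>"
    hence "enorm \<pi> dvd enorm \<rho>" using pdvd_enorm \<rho>(4) by blast
    hence "enorm \<rho> * enorm e \<le> enorm \<rho>" using \<rho>(2) enorm dvd_imp_le by auto
    hence "enorm e = 1" using \<rho>(2) e1 by simp
    thus ?thesis using e primary_enorm_1 by simp
  next
    assume "\<pi> pdvd e"
    hence "enorm \<pi> dvd enorm e" using pdvd_enorm \<rho>(4) by blast
    hence "enorm \<rho> * enorm e \<le> enorm e" using e1 enorm dvd_imp_le by auto
    thus ?thesis using \<rho>(2) e1 by simp
  qed
qed

lemma pdvd_mult_cancel:
  assumes "\<pi> \<in> primary" shows "\<pi> * x pdvd \<pi> * y \<longleftrightarrow> x pdvd y"
  using primary_nonzero[OF assms] by (auto simp: pdvd_def mult.assoc)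

lemma pdvd_trans: "x pdvd y \<Longrightarrow> y pdvd z \<Longrightarrow> x pdvd z"
  by (auto simp: pdvd_def mult.assoc intro: primary_mult)

lemma power_pdvd_mult_prime:
  assumes "\<rho> \<in> pprimes" "\<pi> \<in> pprimes" "\<rho> \<noteq> \<pi>" "x \<in> primary" "\<rho> ^ k pdvd \<pi> * x"
  shows "\<rho> ^ k pdvd x"
  using assms(4,5)
proof (induction k arbitrary: x)
  case 0
  thus ?case by (auto simp: pdvd_def)
next
  case (Suc k)
  have \<rho>: "\<rho> \<in> primary" "\<pi> \<in> primary" using assms pprimes_primary by auto
  have "\<rho> pdvd \<rho> ^ Suc k" using primary_power[OF \<rho>(1)] by (auto simp: pdvd_def)
  hence "\<rho> pdvd \<pi> * x" using Suc.prems pdvd_trans by blast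
  hence "\<rho> pdvd x"
    using pprimes_pprime[OF assms(1)] pdvd_pprimes_eq[OF assms(1,2)] assms(3) Suc.prems \<rho>
    by (auto simp: pprime_def)
  then obtain y where y: "y \<in> primary" "x = \<rho> * y" by (auto simp: pdvd_def)
  have "\<rho> * \<rho> ^ k pdvd \<rho> * (\<pi> * y)" using Suc.prems y by (simp add: mult_ac)
  hence "\<rho> ^ k pdvd \<pi> * y" using pdvd_mult_cancel[OF \<rho>(1)] by blast
  hence "\<rho> ^ k pdvd y" using Suc.IH y by blast
  thus ?case using y pdvd_mult_cancel[OF \<rho>(1)] by simp
qed

definition prime_powers_dvd :: "complex \<Rightarrow> (complex \<times> nat) set" where
  "prime_powers_dvd z = {(\<pi>, k). \<pi> \<in> pprimes \<and> k \<ge> 1 \<and> \<pi> ^ k pdvd z}"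

text \<open>This is the identity log = \<Lambda> * 1 for primary numbers, and the only form in which
  unique factorisation is used. The induction on the norm splits off one prime \<pi>: the prime
  powers dividing \<pi> x are those dividing x, with the exponents of \<pi> raised by one, together
  with \<pi> itself.\<close>

theorem log_norm_sum:
  assumes "z \<in> primary"
  shows "finite (prime_powers_dvd z) \<and> (\<Sum>(\<pi>, k)\<in>prime_powers_dvd z. ln (real (enorm \<pi>))) = ln (real (enorm z))"
  using assms
proof (induction "enorm z" arbitrary: z rule: less_induct)
  case less
  show ?case
  proof (cases "z = 1")
    case True
    have "prime_powers_dvd z = {}"
    proof -
      have "\<not> \<pi> ^ k pdvd 1" if "\<pi> \<in> pprimes" "k \<ge> 1" for \<pi> k
      proof
        assume "\<pi> ^ k pdvd 1"
        hence "enorm \<pi> ^ k dvd 1" using pdvd_enorm[of "\<pi> ^ k" 1] pprimes_primary[OF that(1)]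
          by (simp add: primary_power enorm_power enorm_1)
        thus False using pprimes_enorm[OF that(1)] that(2) by simp
      qed
      thus ?thesis using True by (auto simp: prime_powers_dvd_def)
    qed
    thus ?thesis using True by (simp add: enorm_1)
  next
    case False
    then obtain \<pi> where "\<pi> \<in> pprimes" "\<pi> pdvd z" using exists_pprime_dvd[OF less.prems] by blast
    moreover from this obtain x where "x \<in> primary" "z = \<pi> * x" by (auto simp: pdvd_def)
    ultimately have \<pi>: "\<pi> \<in> pprimes" "x \<in> primary" "z = \<pi> * x" by auto
    have \<pi>': "\<pi> \<in> primary" "enorm \<pi> > 1" using \<pi> pprimes_primary pprimes_enorm by auto
    have enorm: "enorm z = enorm \<pi> * enorm x" using \<pi> \<pi>' by (simp add: enorm_mult primary_eisenstein)
    hence "enorm x < enorm z" using \<pi>'(2) enorm_pos[OF \<pi>(2)] by simp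
    note IH = less.hyps[OF this \<pi>(2)]
    define F where "F = (\<lambda>(\<rho>, k). (\<rho>, if \<rho> = \<pi> then Suc k else k))"
    have injF: "inj_on F A" for A by (auto simp: F_def inj_on_def split: if_splits)
    have D: "prime_powers_dvd z = insert (\<pi>, 1) (F ` prime_powers_dvd x)"
    proof
      show "prime_powers_dvd z \<subseteq> insert (\<pi>, 1) (F ` prime_powers_dvd x)"
      proof safe
        fix \<rho> k assume h: "(\<rho>, k) \<in> prime_powers_dvd z" "(\<rho>, k) \<notin> F ` prime_powers_dvd x"
        hence \<rho>: "\<rho> \<in> pprimes" "k \<ge> 1" "\<rho> ^ k pdvd \<pi> * x" by (auto simp: prime_powers_dvd_def \<pi>)
        have "\<rho> = \<pi> \<and> k = 1"
        proof (cases "\<rho> = \<pi>")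
          case False
          hence "(\<rho>, k) \<in> prime_powers_dvd x"
            using power_pdvd_mult_prime[OF \<rho>(1) \<pi>(1) _ \<pi>(2) \<rho>(3)] \<rho> by (simp add: prime_powers_dvd_def)
          hence "F (\<rho>, k) \<in> F ` prime_powers_dvd x" by blast
          thus ?thesis using h False by (simp add: F_def)
        next
          case True
          obtain j where j: "k = Suc j" using \<rho>(2) by (cases k) auto
          have "\<pi> ^ j pdvd x" using \<rho>(3) True pdvd_mult_cancel[OF \<pi>'(1)] by (simp add: j)
          hence "j \<ge> 1 \<Longrightarrow> (\<pi>, j) \<in> prime_powers_dvd x" using \<pi>(1) by (simp add: prime_powers_dvd_def)
          hence "j \<ge> 1 \<Longrightarrow> F (\<pi>, j) \<in> F ` prime_powers_dvd x" by blast
          thus ?thesis using h True by (cases j) (auto simp: F_def j)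
        qed
        thus "\<rho> = \<pi>" "k = 1" by auto
      qed
    next
      have "F (\<rho>, k) \<in> prime_powers_dvd z" if "(\<rho>, k) \<in> prime_powers_dvd x" for \<rho> k
      proof (cases "\<rho> = \<pi>")
        case True
        thus ?thesis using that pdvd_mult_cancel[OF \<pi>'(1)] by (auto simp: prime_powers_dvd_def F_def \<pi>)
      next
        case False
        thus ?thesis using that pdvd_mult[of "\<rho> ^ k" x \<pi>] \<pi>'
          by (auto simp: prime_powers_dvd_def F_def \<pi> mult.commute)
      qed
      moreover have "(\<pi>, 1) \<in> prime_powers_dvd z" using \<pi> by (auto simp: prime_powers_dvd_def pdvd_def)
      ultimately show "insert (\<pi>, 1) (F ` prime_powers_dvd x) \<subseteq> prime_powers_dvd z" by auto
    qed
    have notin: "(\<pi>, 1) \<notin> F ` prime_powers_dvd x"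
      by (auto simp: F_def prime_powers_dvd_def split: if_splits)
    have "(\<Sum>(\<pi>, k)\<in>prime_powers_dvd z. ln (real (enorm \<pi>))) = ln (enorm \<pi>) + (\<Sum>(\<pi>, k)\<in>F ` prime_powers_dvd x. ln (real (enorm \<pi>)))"
      unfolding D using IH notin by (subst sum.insert) auto
    also have "(\<Sum>(\<pi>, k)\<in>F ` prime_powers_dvd x. ln (real (enorm \<pi>))) = (\<Sum>(\<pi>, k)\<in>prime_powers_dvd x. ln (real (enorm \<pi>)))"
      by (subst sum.reindex[OF injF]) (auto simp: F_def intro!: sum.cong)
    also have "\<dots> = ln (enorm x)" using IH by simp
    also have "ln (enorm \<pi>) + ln (enorm x) = ln (real (enorm z))"
      using \<pi>' enorm_pos[OF \<pi>(2)] by (simp add: enorm ln_mult)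
    finally show ?thesis using IH D by simp
  qed
qed

section \<open>The lattice of primary numbers\<close>

text \<open>The numbers $1 + 3a + 3b\omega$ are arranged in horizontal rows $n = b$, with spacing $3$ within a row.\<close>

definition row_offset :: "int \<Rightarrow> real" where "row_offset n = (if even n then 1 else -1/2)"

definition lattice_point :: "int \<Rightarrow> int \<Rightarrow> complex" where
  "lattice_point n m = Complex (row_offset n + 3 * m) (3 * sqrt 3 / 2 * n)"

definition row_height_sq :: "int \<Rightarrow> real" where "row_height_sq n = 27/4 * (real_of_int n)\<^sup>2"

lemma Re_lattice_point: "Re (lattice_point n m) = row_offset n + 3 * m" and Im_lattice_point: "Im (lattice_point n m) = 3 * sqrt 3 / 2 * n"
  by (simp_all add: lattice_point_def)

lemma Im_lattice_point_sq: "(Im (lattice_point n m))\<^sup>2 = row_height_sq n"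
  by (simp add: Im_lattice_point row_height_sq_def power_mult_distrib power_divide)

lemma cmod_lattice_point_sq: "(cmod (lattice_point n m))\<^sup>2 = (row_offset n + 3 * m)\<^sup>2 + row_height_sq n"
  unfolding cmod_power2 Im_lattice_point_sq by (simp add: Re_lattice_point)

lemma row_height_sq_nonneg: "row_height_sq n \<ge> 0" by (simp add: row_height_sq_def)

text \<open>The real part of 1 + 3a + 3n\<omega> is 1 + 3a - 3n/2. With m = a - n div 2 as position
  in the row, the offset is 1 for even n and -1/2 for odd n.\<close>

lemma lattice_point_coords: "lattice_point n m = of_int (1 + 3 * (m + n div 2)) + of_int (3 * n) * \<omega>"
proof (rule complex_eqI)
  have "real_of_int n = 2 * of_int (n div 2) + (if even n then 0 else 1)"
  proof -
    have "n = 2 * (n div 2) + (if even n then 0 else 1)" by (auto simp: odd_two_times_div_two_succ)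
    hence "real_of_int n = real_of_int (2 * (n div 2) + (if even n then 0 else 1))" by (rule arg_cong)
    thus ?thesis by simp
  qed
  thus "Re (lattice_point n m) = Re (of_int (1 + 3 * (m + n div 2)) + of_int (3 * n) * \<omega>)"
    unfolding eisenstein_parts Re_lattice_point row_offset_def by (simp add: algebra_simps)
  show "Im (lattice_point n m) = Im (of_int (1 + 3 * (m + n div 2)) + of_int (3 * n) * \<omega>)"
    unfolding eisenstein_parts Im_lattice_point by simp
qed

lemma lattice_point_primary: "lattice_point n m \<in> primary"
  unfolding lattice_point_coords by (rule primary_intro) presburger+

lemma primary_ptE:
  assumes "z \<in> primary" obtains n m where "z = lattice_point n m"
proof -
  obtain a b where ab: "z = of_int a + of_int b * \<omega>" "a mod 3 = 1" "b mod 3 = 0"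
    using assms by (auto simp: primary_def)
  define n where "n = b div 3"
  define m where "m = a div 3 - n div 2"
  have "b = 3 * n" using ab(3) unfolding n_def by presburger
  moreover have "a = 1 + 3 * (m + n div 2)" using ab(2) unfolding m_def by presburger
  ultimately have "z = lattice_point n m" unfolding ab(1) lattice_point_coords by simp
  thus ?thesis by (rule that)
qed

lemma lattice_point_inject: "lattice_point n m = lattice_point n' m' \<longleftrightarrow> n = n' \<and> m = m'"
  unfolding lattice_point_coords coords_inject by auto

section \<open>Primary numbers in a disc, row by row\<close>

definition primary_upto :: "real \<Rightarrow> complex set" where
  "primary_upto X = {z \<in> primary. (cmod z)\<^sup>2 \<le> X}"

definition lattice_rows :: "real \<Rightarrow> int set" where "lattice_rows X = {n. row_height_sq n \<le> X}"

definition lattice_row :: "real \<Rightarrow> int \<Rightarrow> int set" where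
  "lattice_row X n = {m. (row_offset n + 3 * m)\<^sup>2 \<le> X - row_height_sq n}"

lemma abs_le_of_sq_le: "(x::real)\<^sup>2 \<le> X \<Longrightarrow> \<bar>x\<bar> \<le> sqrt X"
  using real_sqrt_le_mono[of "x\<^sup>2" X] by simp

lemma lattice_rows_subset: "lattice_rows X \<subseteq> {- \<lfloor>sqrt X\<rfloor>..\<lfloor>sqrt X\<rfloor>}"
proof
  fix n assume "n \<in> lattice_rows X"
  hence "27/4 * (real_of_int n)\<^sup>2 \<le> X" by (simp add: lattice_rows_def row_height_sq_def)
  hence "(real_of_int n)\<^sup>2 \<le> X" using zero_le_power2[of "real_of_int n"] by linarith
  hence "\<bar>real_of_int n\<bar> \<le> sqrt X" by (rule abs_le_of_sq_le)
  hence "real_of_int n \<le> sqrt X" "real_of_int (- n) \<le> sqrt X" by auto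
  hence "n \<le> \<lfloor>sqrt X\<rfloor>" "- n \<le> \<lfloor>sqrt X\<rfloor>" by (simp_all only: le_floor_iff)
  thus "n \<in> {- \<lfloor>sqrt X\<rfloor>..\<lfloor>sqrt X\<rfloor>}" by simp
qed

lemma finite_lattice_rows: "finite (lattice_rows X)"
  by (rule finite_subset[OF lattice_rows_subset]) simp

lemma card_lattice_rows_le:
  assumes "X \<ge> 1" shows "real (card (lattice_rows X)) \<le> 3 * sqrt X"
proof -
  have s1: "sqrt X \<ge> 1" using assms by simp
  have "card (lattice_rows X) \<le> card {- \<lfloor>sqrt X\<rfloor>..\<lfloor>sqrt X\<rfloor>}" by (rule card_mono[OF _ lattice_rows_subset]) simp
  also have "\<dots> = nat (2 * \<lfloor>sqrt X\<rfloor> + 1)" by simp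
  finally have "real (card (lattice_rows X)) \<le> real (nat (2 * \<lfloor>sqrt X\<rfloor> + 1))" by (simp only: of_nat_le_iff)
  also have "\<dots> = real_of_int (2 * \<lfloor>sqrt X\<rfloor> + 1)" using s1 by simp
  also have "\<dots> \<le> 2 * sqrt X + 1" by simp
  finally show ?thesis using s1 by linarith
qed

lemma lattice_row_eq:
  assumes "n \<in> lattice_rows X"
  shows "lattice_row X n = {\<lceil>(- sqrt (X - row_height_sq n) - row_offset n) / 3\<rceil>..\<lfloor>(sqrt (X - row_height_sq n) - row_offset n) / 3\<rfloor>}"
proof -
  have nn: "X - row_height_sq n \<ge> 0" using assms by (simp add: lattice_rows_def)
  have "(row_offset n + 3 * m)\<^sup>2 \<le> X - row_height_sq n \<longleftrightarrow> \<lceil>(- sqrt (X - row_height_sq n) - row_offset n) / 3\<rceil> \<le> m \<and> m \<le> \<lfloor>(sqrt (X - row_height_sq n) - row_offset n) / 3\<rfloor>" for m :: int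
  proof -
    have "(row_offset n + 3 * m)\<^sup>2 \<le> X - row_height_sq n \<longleftrightarrow> \<bar>row_offset n + 3 * m\<bar> \<le> sqrt (X - row_height_sq n)"
    proof
      assume "\<bar>row_offset n + 3 * m\<bar> \<le> sqrt (X - row_height_sq n)"
      hence "\<bar>row_offset n + 3 * m\<bar>\<^sup>2 \<le> (sqrt (X - row_height_sq n))\<^sup>2" by (rule power_mono) simp
      thus "(row_offset n + 3 * m)\<^sup>2 \<le> X - row_height_sq n" using nn by simp
    qed (rule abs_le_of_sq_le)
    also have "\<dots> \<longleftrightarrow> (- sqrt (X - row_height_sq n) - row_offset n) / 3 \<le> m \<and> m \<le> (sqrt (X - row_height_sq n) - row_offset n) / 3"
    proof
      assume "\<bar>row_offset n + 3 * m\<bar> \<le> sqrt (X - row_height_sq n)"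
      thus "(- sqrt (X - row_height_sq n) - row_offset n) / 3 \<le> m \<and> m \<le> (sqrt (X - row_height_sq n) - row_offset n) / 3"
        unfolding of_int_mult of_int_numeral by argo
    next
      assume "(- sqrt (X - row_height_sq n) - row_offset n) / 3 \<le> m \<and> m \<le> (sqrt (X - row_height_sq n) - row_offset n) / 3"
      thus "\<bar>row_offset n + 3 * m\<bar> \<le> sqrt (X - row_height_sq n)"
        unfolding of_int_mult of_int_numeral by argo
    qed
    finally show ?thesis by (simp only: ceiling_le_iff le_floor_iff)
  qed
  thus ?thesis unfolding lattice_row_def atLeastAtMost_iff[symmetric] by (simp only: Collect_mem_eq)
qed

lemma lattice_row_empty: "n \<notin> lattice_rows X \<Longrightarrow> lattice_row X n = {}"
proof -
  assume "n \<notin> lattice_rows X"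
  hence "X - row_height_sq n < 0" by (simp add: lattice_rows_def)
  hence "\<not> (row_offset n + 3 * real_of_int m)\<^sup>2 \<le> X - row_height_sq n" for m
    using zero_le_power2[of "row_offset n + 3 * real_of_int m"] by linarith
  thus ?thesis by (simp add: lattice_row_def)
qed

lemma finite_lattice_row: "finite (lattice_row X n)"
  by (cases "n \<in> lattice_rows X") (simp_all add: lattice_row_eq lattice_row_empty)

lemma primary_upto_eq: "primary_upto X = (\<lambda>(n, m). lattice_point n m) ` (SIGMA n:lattice_rows X. lattice_row X n)"
proof (intro equalityI subsetI)
  fix z assume z: "z \<in> primary_upto X"
  then obtain n m where nm: "z = lattice_point n m" by (auto simp: primary_upto_def elim: primary_ptE)
  have "(row_offset n + 3 * m)\<^sup>2 + row_height_sq n \<le> X" using z by (simp add: primary_upto_def nm cmod_lattice_point_sq)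
  moreover have "0 \<le> (row_offset n + 3 * m)\<^sup>2" by (rule zero_le_power2)
  ultimately have "(row_offset n + 3 * m)\<^sup>2 \<le> X - row_height_sq n" "row_height_sq n \<le> X" by linarith+
  hence "m \<in> lattice_row X n" "n \<in> lattice_rows X" unfolding lattice_row_def lattice_rows_def by simp_all
  hence "(n, m) \<in> (SIGMA n:lattice_rows X. lattice_row X n)" by simp
  thus "z \<in> (\<lambda>(n, m). lattice_point n m) ` (SIGMA n:lattice_rows X. lattice_row X n)" unfolding nm by (rule rev_image_eqI) simp
next
  fix z assume "z \<in> (\<lambda>(n, m). lattice_point n m) ` (SIGMA n:lattice_rows X. lattice_row X n)"
  then obtain n m where nm: "z = lattice_point n m" "m \<in> lattice_row X n" by auto
  thus "z \<in> primary_upto X" by (simp add: primary_upto_def lattice_point_primary cmod_lattice_point_sq lattice_row_def)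
qed

lemma finite_primary_upto: "finite (primary_upto X)"
  unfolding primary_upto_eq by (intro finite_imageI finite_SigmaI finite_lattice_rows finite_lattice_row)

lemma sum_primary_upto: "(\<Sum>z\<in>primary_upto X. f z) = (\<Sum>n\<in>lattice_rows X. \<Sum>m\<in>lattice_row X n. f (lattice_point n m))"
proof -
  have inj: "inj_on (\<lambda>(n, m). lattice_point n m) (SIGMA n:lattice_rows X. lattice_row X n)"
    by (rule inj_onI) (simp add: lattice_point_inject split: prod.splits)
  have "(\<Sum>z\<in>primary_upto X. f z) = (\<Sum>(n, m)\<in>(SIGMA n:lattice_rows X. lattice_row X n). f (lattice_point n m))"
    unfolding primary_upto_eq by (subst sum.reindex[OF inj]) (simp add: case_prod_unfold)
  also have "\<dots> = (\<Sum>n\<in>lattice_rows X. \<Sum>m\<in>lattice_row X n. f (lattice_point n m))"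
    by (rule sum.Sigma[symmetric]) (auto intro: finite_lattice_rows finite_lattice_row)
  finally show ?thesis .
qed

lemma sum_symmetric_int:
  fixes f :: "int \<Rightarrow> real"
  shows "(\<Sum>m\<in>{- int K..int K}. f m) = f 0 + (\<Sum>i=1..K. f (int i) + f (- int i))"
proof (induction K)
  case (Suc K)
  have "{- int (Suc K)..int (Suc K)} = insert (int (Suc K)) (insert (- int (Suc K)) {- int K..int K})"
    by auto
  thus ?case using Suc by (simp add: add_ac)
qed simp

lemma lattice_point_lower: "real_of_int \<bar>m\<bar> + 1 \<le> 4 * cmod (lattice_point n m)" "real_of_int \<bar>n\<bar> + 1 \<le> 4 * cmod (lattice_point n m)"
proof -
  have x: "\<bar>row_offset n + 3 * m\<bar> \<le> cmod (lattice_point n m)" using abs_Re_le_cmod[of "lattice_point n m"] by (simp add: Re_lattice_point)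
  have xb: "row_offset n \<le> 1" "row_offset n \<ge> -1/2" "\<bar>row_offset n\<bar> \<ge> 1/2" by (auto simp: row_offset_def)
  have x2: "real_of_int \<bar>m\<bar> + 1 \<le> 4 * \<bar>row_offset n + 3 * m\<bar> \<and> 1/2 \<le> \<bar>row_offset n + 3 * m\<bar>"
  proof (cases "m = 0")
    case True
    thus ?thesis using xb by simp
  next
    case False
    hence "real_of_int m \<ge> 1 \<or> real_of_int m \<le> -1" by linarith
    thus ?thesis using xb unfolding of_int_abs of_int_mult of_int_numeral
      by argo
  qed
  show "real_of_int \<bar>m\<bar> + 1 \<le> 4 * cmod (lattice_point n m)" using x x2 by argo
  have "sqrt 3 \<ge> 1" by simp
  hence "1 \<le> 3 * sqrt 3 / 2" by argo
  hence "\<bar>real_of_int n\<bar> * 1 \<le> \<bar>real_of_int n\<bar> * (3 * sqrt 3 / 2)" by (rule mult_left_mono) simp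
  also have "\<dots> = \<bar>Im (lattice_point n m)\<bar>" by (simp add: Im_lattice_point abs_mult)
  also have "\<dots> \<le> cmod (lattice_point n m)" by (rule abs_Im_le_cmod)
  finally show "real_of_int \<bar>n\<bar> + 1 \<le> 4 * cmod (lattice_point n m)" using x x2 unfolding of_int_abs by argo
qed

lemma lattice_point_cmod_pos: "cmod (lattice_point n m) > 0"
  using lattice_point_lower(1)[of m n] by linarith

lemma primary_cmod_ge_1: "z \<in> primary \<Longrightarrow> cmod z \<ge> 1"
proof -
  assume z: "z \<in> primary"
  have "(cmod z)\<^sup>2 = real (enorm z)" using of_nat_enorm[OF primary_eisenstein[OF z]] by simp
  also have "\<dots> \<ge> 1\<^sup>2" using enorm_pos[OF z] by simp
  finally show ?thesis by (rule power2_le_imp_le) simp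
qed

section \<open>Absolute convergence and limits with a rate\<close>

text \<open>Since 4|z| dominates both |n| + 1 and |m| + 1, the term is at most 64 (|n| + 1)^(-3/2)
  (|m| + 1)^(-3/2), and the double sum is bounded by the square of one convergent series.\<close>

lemma sum_inv_cube_bounded:
  "\<exists>K>0. \<forall>T. finite T \<longrightarrow> T \<subseteq> primary \<longrightarrow> (\<Sum>z\<in>T. 1 / cmod z ^ 3) \<le> K"
proof -
  define a where "a = (\<lambda>m :: int. (real_of_int \<bar>m\<bar> + 1) powr (-3/2))"
  define s where "s = (\<lambda>i :: nat. real (Suc i) powr (-3/2))"
  have "summable (\<lambda>i. real i powr (-3/2))" by (subst summable_real_powr_iff) simp
  hence summ: "summable s" unfolding s_def by (subst summable_Suc_iff)
  have s0: "s i \<ge> 0" for i by (simp add: s_def)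
  define B where "B = 2 * suminf s"
  have aB: "(\<Sum>m\<in>{- int K..int K}. a m) \<le> B" for K
  proof -
    have "(\<Sum>m\<in>{- int K..int K}. a m) = s 0 + (\<Sum>i=1..K. s i + s i)"
      unfolding sum_symmetric_int by (simp add: a_def s_def add.commute)
    also have "\<dots> = s 0 + ((\<Sum>i=1..K. s i) + (\<Sum>i=1..K. s i))" by (simp only: sum.distrib)
    also have "\<dots> \<le> 2 * (s 0 + (\<Sum>i=1..K. s i))" using s0[of 0] by argo
    also have "s 0 + (\<Sum>i=1..K. s i) = (\<Sum>i\<le>K. s i)"
      by (simp add: atMost_atLeast0 sum.atLeast_Suc_atMost)
    also have "\<dots> \<le> suminf s" by (rule sum_le_suminf[OF summ]) (auto intro: s0)
    finally show ?thesis by (simp add: B_def)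
  qed
  have B0: "B \<ge> 0" using suminf_nonneg[OF summ s0] by (simp add: B_def)
  have bound: "1 / cmod (lattice_point n m) ^ 3 \<le> 64 * (a n * a m)" for n m
  proof -
    let ?c = "cmod (lattice_point n m)"
    define u v where "u = real_of_int \<bar>n\<bar> + 1" and "v = real_of_int \<bar>m\<bar> + 1"
    have uv: "u \<ge> 1" "v \<ge> 1" "u \<le> 4 * ?c" "v \<le> 4 * ?c" using lattice_point_lower[of m n] lattice_point_lower[of n] by (auto simp: u_def v_def)
    have "u powr (3/2) * v powr (3/2) \<le> (4 * ?c) powr (3/2) * (4 * ?c) powr (3/2)"
      using uv by (intro mult_mono powr_mono2) auto
    also have "\<dots> = (4 * ?c) ^ 3"
    proof -
      have "(4 * ?c) powr (3/2) * (4 * ?c) powr (3/2) = (4 * ?c) powr (3/2 + 3/2)" by (rule powr_add[symmetric])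
      also have "(3/2 + 3/2 :: real) = 3" by simp
      also have "(4 * ?c) powr 3 = (4 * ?c) ^ 3" by (rule powr_numeral) (use lattice_point_cmod_pos[of n m] in simp)
      finally show ?thesis .
    qed
    also have "\<dots> = 64 * ?c ^ 3" by (simp add: power_mult_distrib)
    finally have le: "u powr (3/2) * v powr (3/2) \<le> 64 * ?c ^ 3" .
    have eq: "a n * a m = 1 / (u powr (3/2) * v powr (3/2))"
      by (simp add: a_def u_def v_def powr_minus_divide)
    have pos: "u powr (3/2) * v powr (3/2) > 0" using uv by simp
    have "1 / ?c ^ 3 = 64 / (64 * ?c ^ 3)" by simp
    also have "\<dots> \<le> 64 / (u powr (3/2) * v powr (3/2))"
      using le pos lattice_point_cmod_pos[of n m] by (intro divide_left_mono mult_pos_pos zero_less_power) auto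
    finally show ?thesis unfolding eq by simp
  qed
  have "(\<Sum>z\<in>T. 1 / cmod z ^ 3) \<le> 64 * B\<^sup>2 + 1" if T: "finite T" "T \<subseteq> primary" for T
  proof -
    define S where "S = {(n, m). lattice_point n m \<in> T}"
    have inj: "inj_on (\<lambda>(n, m). lattice_point n m) S" by (rule inj_onI) (simp add: lattice_point_inject split: prod.splits)
    have TS: "T = (\<lambda>(n, m). lattice_point n m) ` S"
    proof (intro equalityI subsetI)
      fix z assume z: "z \<in> T"
      then obtain n m where "z = lattice_point n m" using T(2) primary_ptE by blast
      thus "z \<in> (\<lambda>(n, m). lattice_point n m) ` S" using z by (intro image_eqI[of _ _ "(n, m)"]) (simp_all add: S_def)
    qed (auto simp: S_def)
    have finS: "finite S" using T(1) unfolding TS by (rule finite_imageD[OF _ inj])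
    define K where "K = nat (Max (insert 0 ((\<lambda>(n, m). max \<bar>n\<bar> \<bar>m\<bar>) ` S)))"
    have sub: "S \<subseteq> {- int K..int K} \<times> {- int K..int K}"
    proof
      fix s assume s: "s \<in> S"
      obtain n m where nm: "s = (n, m)" by (cases s)
      have "max \<bar>n\<bar> \<bar>m\<bar> \<le> Max (insert 0 ((\<lambda>(n, m). max \<bar>n\<bar> \<bar>m\<bar>) ` S))"
        using s finS by (intro Max_ge) (auto simp: nm intro!: rev_image_eqI)
      moreover have "0 \<le> Max (insert 0 ((\<lambda>(n, m). max \<bar>n\<bar> \<bar>m\<bar>) ` S))"
        using finS by (intro Max_ge) auto
      ultimately have "max \<bar>n\<bar> \<bar>m\<bar> \<le> int K" unfolding K_def by linarith
      thus "s \<in> {- int K..int K} \<times> {- int K..int K}" by (auto simp: nm)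
    qed
    have "(\<Sum>z\<in>T. 1 / cmod z ^ 3) = (\<Sum>(n, m)\<in>S. 1 / cmod (lattice_point n m) ^ 3)"
      unfolding TS by (subst sum.reindex[OF inj]) (simp add: case_prod_unfold)
    also have "\<dots> \<le> (\<Sum>(n, m)\<in>S. 64 * (a n * a m))"
      by (rule sum_mono) (use bound in \<open>auto simp: case_prod_unfold\<close>)
    also have "\<dots> \<le> (\<Sum>(n, m)\<in>{- int K..int K} \<times> {- int K..int K}. 64 * (a n * a m))"
      by (rule sum_mono2[OF _ sub]) (auto simp: a_def)
    also have "\<dots> = (\<Sum>n\<in>{- int K..int K}. \<Sum>m\<in>{- int K..int K}. 64 * (a n * a m))"
      by (rule sum.cartesian_product[symmetric])
    also have "\<dots> = 64 * ((\<Sum>m\<in>{- int K..int K}. a m) * (\<Sum>m\<in>{- int K..int K}. a m))"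
      by (simp only: sum_distrib_left[symmetric] sum_distrib_right[symmetric])
    also have "\<dots> \<le> 64 * (B * B)"
      by (intro mult_left_mono mult_mono aB B0 sum_nonneg) (auto simp: a_def)
    finally show ?thesis by (simp add: power2_eq_square)
  qed
  thus ?thesis by (intro exI[of _ "64 * B\<^sup>2 + 1"]) (auto intro!: add_nonneg_pos)
qed

text \<open>A Cauchy estimate with rate yields a limit approached with the same constant at every
  real X, not only along the integers. The real argument matters later, where X is divided by norms
  of prime powers.\<close>

lemma cauchy_limit:
  fixes F :: "real \<Rightarrow> complex"
  assumes "\<And>X X'. 1 \<le> X \<Longrightarrow> X \<le> X' \<Longrightarrow> cmod (F X' - F X) \<le> C / sqrt X"
  shows "\<exists>L. (\<lambda>n. F (real n)) \<longlonglongrightarrow> L \<and> (\<forall>X\<ge>1. cmod (F X - L) \<le> C / sqrt X)"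
proof -
  have "filterlim (\<lambda>n. sqrt (real n)) at_top sequentially"
    by (rule filterlim_compose[OF sqrt_at_top filterlim_real_sequentially])
  hence lim0: "(\<lambda>n. C / sqrt (real n)) \<longlonglongrightarrow> 0"
    by (intro tendsto_divide_0[OF tendsto_const] filterlim_at_top_imp_at_infinity)
  have C0: "C \<ge> 0" using assms[of 1 1] by simp
  have "Cauchy (\<lambda>n. F (real n))"
  proof (rule CauchyI)
    fix e :: real assume e: "e > 0"
    have "\<forall>\<^sub>F n in sequentially. C / sqrt (real n) < e / 2" using lim0 e by (intro order_tendstoD) auto
    then obtain M where M: "\<And>n. n \<ge> M \<Longrightarrow> C / sqrt (real n) < e / 2" by (auto simp: eventually_sequentially)
    define M' where "M' = max M 1"
    have near: "cmod (F (real n) - F (real M')) < e / 2" if "n \<ge> M'" for n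
    proof -
      have "cmod (F (real n) - F (real M')) \<le> C / sqrt (real M')" using that by (intro assms) (auto simp: M'_def)
      also have "\<dots> < e / 2" by (rule M) (simp add: M'_def)
      finally show ?thesis .
    qed
    show "\<exists>M. \<forall>m\<ge>M. \<forall>n\<ge>M. cmod (F (real m) - F (real n)) < e"
    proof (intro exI[of _ M'] allI impI)
      fix m n assume "m \<ge> M'" "n \<ge> M'"
      have "cmod (F (real m) - F (real n)) \<le> cmod (F (real m) - F (real M')) + cmod (F (real n) - F (real M'))"
        using norm_triangle_ineq4[of "F (real m) - F (real M')" "F (real n) - F (real M')"] by simp
      also have "\<dots> < e / 2 + e / 2" using near[OF \<open>m \<ge> M'\<close>] near[OF \<open>n \<ge> M'\<close>] by (rule add_strict_mono)
      finally show "cmod (F (real m) - F (real n)) < e" by simp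
    qed
  qed
  then obtain L where L: "(\<lambda>n. F (real n)) \<longlonglongrightarrow> L" using Cauchy_convergent convergent_def by blast
  have "cmod (F X - L) \<le> C / sqrt X" if X: "X \<ge> 1" for X
  proof (rule tendsto_upperbound)
    show "(\<lambda>n. cmod (F X - F (real n))) \<longlonglongrightarrow> cmod (F X - L)" by (intro tendsto_intros L)
    show "\<forall>\<^sub>F n in sequentially. cmod (F X - F (real n)) \<le> C / sqrt X"
    proof (rule eventually_sequentiallyI[of "nat \<lceil>X\<rceil>"])
      fix n assume "n \<ge> nat \<lceil>X\<rceil>"
      hence "X \<le> real n" by linarith
      hence "cmod (F (real n) - F X) \<le> C / sqrt X" by (rule assms[OF X])
      thus "cmod (F X - F (real n)) \<le> C / sqrt X" by (subst norm_minus_commute)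
    qed
  qed simp
  thus ?thesis using L by blast
qed

section \<open>The number of lattice points in a disc\<close>

text \<open>The sum is a Riemann sum for the area under a half circle. For a decreasing function the
  sum and the integral differ by at most the value at 0, here sqrt X; after doubling and subtracting
  the central row the error stays within sqrt X on both sides. The integral I is \<pi>/4, but the
  estimates 1/2 \<le> I \<le> 1 are what enters, and I \<le> 1 gives the stated bound on c.\<close>

lemma sum_sqrt_rows:
  "\<exists>c>0. c \<le> 4 / (3 * sqrt 3) \<and>
     (\<forall>X\<ge>1. \<bar>(\<Sum>n\<in>lattice_rows X. sqrt (X - row_height_sq n)) - c * X\<bar> \<le> sqrt X)"
proof -
  define h where "h = 3 * sqrt 3 / 2"
  have h: "h > 0" "h\<^sup>2 = 27/4" by (simp_all add: h_def power_mult_distrib power_divide)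
  define \<psi> where "\<psi> = (\<lambda>s :: real. sqrt (max 0 (1 - s\<^sup>2)))"
  have cont: "continuous_on S \<psi>" for S
    unfolding \<psi>_def by (intro continuous_intros)
  have int: "\<psi> integrable_on {a..b}" for a b by (rule integrable_continuous_real[OF cont])
  define I where "I = integral {0..1} \<psi>"
  have I_ext: "integral {0..u} \<psi> = I" if "u \<ge> 1" for u
  proof -
    have "integral {0..1} \<psi> + integral {1..u} \<psi> = integral {0..u} \<psi>"
      by (rule Henstock_Kurzweil_Integration.integral_combine) (use that int in auto)
    moreover have "integral {1..u} \<psi> = integral {1..u} (\<lambda>_. 0)"
    proof (rule Henstock_Kurzweil_Integration.integral_cong)
      fix s :: real assume "s \<in> {1..u}"
      hence "1 \<le> s\<^sup>2" by (intro one_le_power) simp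
      thus "\<psi> s = 0" by (simp add: \<psi>_def)
    qed
    ultimately show ?thesis by (simp add: I_def)
  qed
  have I_le: "I \<le> 1"
  proof -
    have "I \<le> integral {0..1::real} (\<lambda>_. 1 :: real)"
      unfolding I_def
    proof (rule Henstock_Kurzweil_Integration.integral_le)
      show "\<psi> integrable_on {0..1}" by (rule int)
      show "(\<lambda>_. 1 :: real) integrable_on {0..1::real}" by (intro integrable_continuous_real continuous_intros)
    qed (auto simp: \<psi>_def)
    thus ?thesis by simp
  qed
  have I_pos: "I > 0"
  proof -
    have "((\<lambda>s. 1 - s) has_integral (1 - 1/2)) {0..1::real}"
      using has_integral_diff[OF has_integral_const_real[of 1 0 1] ident_has_integral[of 0 1]] by simp
    hence "1/2 = integral {0..1} (\<lambda>s. 1 - s :: real)" by (simp add: integral_unique)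
    also have "\<dots> \<le> I" unfolding I_def
    proof (rule Henstock_Kurzweil_Integration.integral_le)
      show "(\<lambda>s. 1 - s :: real) integrable_on {0..1}" by (intro integrable_continuous_real continuous_intros)
      fix s :: real assume s: "s \<in> {0..1}"
      have "(1 - s)\<^sup>2 \<le> 1 - s\<^sup>2"
      proof -
        have "s * s \<le> s * 1" using s by (intro mult_left_mono) auto
        thus ?thesis by (simp add: power2_eq_square algebra_simps)
      qed
      hence "(1 - s)\<^sup>2 \<le> max 0 (1 - s\<^sup>2)" by simp
      thus "1 - s \<le> \<psi> s" unfolding \<psi>_def by (rule real_le_rsqrt)
    qed (rule int)
    finally show ?thesis by simp
  qed
  define c where "c = 2 / h * I"
  have "\<bar>(\<Sum>n\<in>lattice_rows X. sqrt (X - row_height_sq n)) - c * X\<bar> \<le> sqrt X" if X: "X \<ge> 1" for X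
  proof -
    define f where "f = (\<lambda>t :: real. sqrt (max 0 (X - 27/4 * t\<^sup>2)))"
    interpret antimono_fun_sum_integral_diff f
    proof
      fix x y :: real assume "0 \<le> x" "x \<le> y"
      hence "x\<^sup>2 \<le> y\<^sup>2" by (intro power_mono)
      thus "f y \<le> f x" unfolding f_def by (intro real_sqrt_le_mono max.mono) auto
    qed (auto simp: f_def intro!: continuous_intros)
    define K where "K = nat \<lceil>sqrt X\<rceil>"
    have K: "real K \<ge> sqrt X" unfolding K_def by linarith
    have s1: "sqrt X \<ge> 1" using X by simp
    have "sum_integral_diff_series K \<ge> 0" by (rule sum_integral_diff_series_nonneg)
    moreover have "sum_integral_diff_series K \<le> sum_integral_diff_series 0"
      by (rule sum_integral_diff_series_antimono) simp
    moreover have "sum_integral_diff_series 0 = f 0" by (simp add: sum_integral_diff_series_def)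
    moreover have "f 0 = sqrt X" using X by (simp add: f_def)
    ultimately have diff: "0 \<le> (\<Sum>k\<le>K. f (real k)) - integral {0..real K} f"
      "(\<Sum>k\<le>K. f (real k)) - integral {0..real K} f \<le> sqrt X"
      by (simp_all add: sum_integral_diff_series_def)
    have "integral {0..real K} f = X / h * I"
    proof -
      \<comment> \<open>Rescaling by h / sqrt X sends the rows of the disc to the unit interval;
        beyond s = 1 the integrand is 0, so the upper end m K may overshoot.\<close>
      define m where "m = h / sqrt X"
      have m: "m > 0" using h s1 by (simp add: m_def)
      have u: "m * K \<ge> 1"
      proof -
        have "sqrt 3 \<ge> 1" by simp
        hence "h \<ge> 1" unfolding h_def by argo
        have "m * K \<ge> m * sqrt X" using m K by (intro mult_left_mono) auto
        also have "m * sqrt X = h" using s1 by (simp add: m_def)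
        finally show ?thesis using \<open>h \<ge> 1\<close> by linarith
      qed
      have "(\<psi> has_integral I) {0..m * K}"
        using I_ext[OF u] integrable_integral[OF int[of 0 "m * K"]] by simp
      hence "(\<psi> has_integral I) (cbox 0 (m * K))" by simp
      from has_integral_affinity[OF this, of m 0]
      have "((\<lambda>t. \<psi> (m * t)) has_integral (1 / m * I)) ((\<lambda>x. x / m) ` {0..m * K})"
        using m by simp
      also have "(\<lambda>x. x / m) ` {0..m * K} = {0..real K}"
      proof (intro equalityI subsetI)
        fix x assume "x \<in> {0..real K}"
        hence "m * x \<in> {0..m * K}" "x = m * x / m" using m by auto
        thus "x \<in> (\<lambda>x. x / m) ` {0..m * K}" by (rule rev_image_eqI)
      qed (use m in \<open>auto simp: field_simps\<close>)
      finally have "((\<lambda>t. sqrt X * \<psi> (m * t)) has_integral (sqrt X * (1 / m * I))) {0..real K}"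
        by (rule has_integral_mult_right)
      also have "(\<lambda>t. sqrt X * \<psi> (m * t)) = f"
      proof
        fix t
        have "sqrt X * \<psi> (m * t) = sqrt (X * max 0 (1 - (m * t)\<^sup>2))"
          unfolding \<psi>_def by (simp add: real_sqrt_mult)
        also have "X * max 0 (1 - (m * t)\<^sup>2) = max 0 (X * (1 - (m * t)\<^sup>2))"
          using X by (simp add: max_mult_distrib_left)
        also have "X * (1 - (m * t)\<^sup>2) = X - 27/4 * t\<^sup>2"
          using X by (simp add: m_def power_mult_distrib power_divide h(2) algebra_simps)
        finally show "sqrt X * \<psi> (m * t) = f t" by (simp add: f_def)
      qed
      also have "sqrt X * (1 / m * I) = X / h * I" using X by (simp add: m_def)
      finally show ?thesis by (rule integral_unique)
    qed
    hence I1: "0 \<le> (\<Sum>k\<le>K. f (real k)) - X / h * I" "(\<Sum>k\<le>K. f (real k)) - X / h * I \<le> sqrt X"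
      using diff by simp_all
    have "(\<Sum>n\<in>lattice_rows X. sqrt (X - row_height_sq n)) = (\<Sum>n\<in>lattice_rows X. f (real_of_int n))"
      by (intro sum.cong refl) (simp add: f_def lattice_rows_def row_height_sq_def max_def)
    also have "\<dots> = (\<Sum>n\<in>{- int K..int K}. f (real_of_int n))"
    proof (rule sum.mono_neutral_left)
      have "\<lfloor>sqrt X\<rfloor> \<le> int K" unfolding K_def by linarith
      thus "lattice_rows X \<subseteq> {- int K..int K}" using lattice_rows_subset[of X] by auto
      show "\<forall>i\<in>{- int K..int K} - lattice_rows X. f (real_of_int i) = 0"
        by (auto simp: f_def lattice_rows_def row_height_sq_def)
    qed simp
    also have "\<dots> = f 0 + (\<Sum>i=1..K. f (real i) + f (real i))"
      unfolding sum_symmetric_int by (simp add: f_def)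
    also have "\<dots> = 2 * (\<Sum>k\<le>K. f (real k)) - f 0"
    proof -
      have "(\<Sum>i=1..K. f (real i) + f (real i)) = (\<Sum>i=1..K. f (real i)) + (\<Sum>i=1..K. f (real i))"
        by (rule sum.distrib)
      moreover have "(\<Sum>k\<le>K. f (real k)) = f 0 + (\<Sum>i=1..K. f (real i))"
        by (simp add: atMost_atLeast0 sum.atLeast_Suc_atMost)
      ultimately show ?thesis by argo
    qed
    also have "f 0 = sqrt X" using X by (simp add: f_def)
    finally have "(\<Sum>n\<in>lattice_rows X. sqrt (X - row_height_sq n)) = 2 * (\<Sum>k\<le>K. f (real k)) - sqrt X" .
    moreover have "c * X = 2 * (X / h * I)" by (simp add: c_def)
    ultimately show ?thesis using I1 by (simp add: abs_le_iff)
  qed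
  moreover have "c > 0" using h I_pos by (simp add: c_def)
  moreover have "c \<le> 4 / (3 * sqrt 3)"
  proof -
    have "c \<le> 2 / h * 1" unfolding c_def using h I_le by (intro mult_left_mono) auto
    thus ?thesis by (simp add: h_def)
  qed
  ultimately show ?thesis by (intro exI[of _ c]) blast
qed

lemma card_lattice_row:
  assumes "n \<in> lattice_rows X"
  shows "\<bar>real (card (lattice_row X n)) - 2 / 3 * sqrt (X - row_height_sq n)\<bar> \<le> 1"
proof -
  define R where "R = sqrt (X - row_height_sq n)"
  have R: "R \<ge> 0" using assms by (simp add: R_def lattice_rows_def)
  define lo hi where "lo = \<lceil>(- R - row_offset n) / 3\<rceil>" and "hi = \<lfloor>(R - row_offset n) / 3\<rfloor>"
  have lattice_row: "lattice_row X n = {lo..hi}" using lattice_row_eq[OF assms] by (simp add: lo_def hi_def R_def)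
  have b: "real_of_int lo < (- R - row_offset n) / 3 + 1" "real_of_int lo \<ge> (- R - row_offset n) / 3"
    "real_of_int hi > (R - row_offset n) / 3 - 1" "real_of_int hi \<le> (R - row_offset n) / 3"
    unfolding lo_def hi_def by linarith+
  have b': "real_of_int (hi - lo) > 2 / 3 * R - 2" "real_of_int (hi - lo) \<le> 2 / 3 * R"
    unfolding of_int_diff using b by argo+
  have "real_of_int (hi - lo) > -2" using b'(1) R by linarith
  hence "hi - lo + 1 \<ge> 0" by linarith
  hence "real (card (lattice_row X n)) = real_of_int (hi - lo + 1)" unfolding lattice_row by simp
  thus ?thesis using b' unfolding R_def[symmetric] by (simp add: abs_le_iff)
qed

text \<open>A row of half-length R contains 2R/3 points up to an error 1, and at most 3 sqrt X rows
  meet the disc. This is the counting input for the untwisted Mertens estimate.\<close>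

theorem card_primary_upto:
  "\<exists>c>0. \<forall>X\<ge>1. \<bar>real (card (primary_upto X)) - c * X\<bar> \<le> 4 * sqrt X"
proof -
  obtain c where c: "c > 0" "\<And>X. X \<ge> 1 \<Longrightarrow> \<bar>(\<Sum>n\<in>lattice_rows X. sqrt (X - row_height_sq n)) - c * X\<bar> \<le> sqrt X"
    using sum_sqrt_rows by blast
  have "\<bar>real (card (primary_upto X)) - (2 / 3 * c) * X\<bar> \<le> 4 * sqrt X" if X: "X \<ge> 1" for X
  proof -
    have "real (card (primary_upto X)) = (\<Sum>n\<in>lattice_rows X. real (card (lattice_row X n)))"
      using sum_primary_upto[of "\<lambda>_. 1 :: real" X] by simp
    hence "real (card (primary_upto X)) - 2 / 3 * (\<Sum>n\<in>lattice_rows X. sqrt (X - row_height_sq n))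
       = (\<Sum>n\<in>lattice_rows X. real (card (lattice_row X n)) - 2 / 3 * sqrt (X - row_height_sq n))"
      by (simp add: sum_subtractf sum_distrib_left)
    moreover have "\<bar>\<Sum>n\<in>lattice_rows X. real (card (lattice_row X n)) - 2 / 3 * sqrt (X - row_height_sq n)\<bar> \<le> (\<Sum>n\<in>lattice_rows X. 1)"
      by (rule order_trans[OF sum_abs sum_mono]) (rule card_lattice_row)
    ultimately have "\<bar>real (card (primary_upto X)) - 2 / 3 * (\<Sum>n\<in>lattice_rows X. sqrt (X - row_height_sq n))\<bar> \<le> (\<Sum>n\<in>lattice_rows X. 1)"
      by (simp only:)
    hence "\<bar>real (card (primary_upto X)) - 2 / 3 * (\<Sum>n\<in>lattice_rows X. sqrt (X - row_height_sq n))\<bar> \<le> 3 * sqrt X"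
      using card_lattice_rows_le[OF X] by simp
    thus ?thesis using c(2)[OF X] unfolding mult.assoc by argo
  qed
  thus ?thesis using c(1) by (intro exI[of _ "2 / 3 * c"]) simp
qed

section \<open>The sum of the inverse squares\<close>

lemma sum_telescope_int:
  fixes t :: "int \<Rightarrow> 'a::ab_group_add"
  assumes "lo \<le> hi + 1"
  shows "(\<Sum>m\<in>{lo..hi}. t m - t (m + 1)) = t lo - t (hi + 1)"
proof -
  have "(\<Sum>m\<in>{lo..h - 1}. t m - t (m + 1)) = t lo - t h" if "h \<ge> lo" for h
    using that
  proof (induction h rule: int_ge_induct)
    case (step h)
    have "{lo..h + 1 - 1} = insert h {lo..h - 1}" using step.hyps by auto
    thus ?case using step by simp
  qed simp
  from this[of "hi + 1"] assms show ?thesis by simp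
qed

text \<open>The comparison function $1/(z^2 - 9/4) = \frac13 (1/(z - 3/2) - 1/(z + 3/2))$ telescopes along a row.\<close>

definition D2 :: "complex \<Rightarrow> complex" where "D2 z = 1 / (z ^ 2 - 9/4)"

text \<open>Removing the telescoping part leaves -(9/4) / (z^2 (z^2 - 9/4)), of order |z|^(-4). This
  part converges absolutely, which the sum of inverse squares itself does not.\<close>

definition E2 :: "complex \<Rightarrow> complex" where "E2 z = 1 / z ^ 2 - D2 z"

lemma Re_lattice_point_neq: "2 * Re (lattice_point n m) \<noteq> 3" "2 * Re (lattice_point n m) \<noteq> -3"
proof -
  have "2 * Re (lattice_point n m) = real_of_int (if even n then 2 + 6 * m else -1 + 6 * m)"
    by (simp add: Re_lattice_point row_offset_def)
  moreover have "(if even n then 2 + 6 * m else -1 + 6 * m) \<noteq> 3" "(if even n then 2 + 6 * m else -1 + 6 * m) \<noteq> -3"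
    by presburger+
  ultimately show "2 * Re (lattice_point n m) \<noteq> 3" "2 * Re (lattice_point n m) \<noteq> -3" by linarith+
qed

lemma lattice_point_shift: "lattice_point n (m + 1) = lattice_point n m + 3"
  by (simp add: lattice_point_def complex_eq_iff)

lemma lattice_point_neq: "lattice_point n m - 3/2 \<noteq> 0" "lattice_point n m + 3/2 \<noteq> 0"
proof -
  show "lattice_point n m - 3/2 \<noteq> 0"
  proof
    assume "lattice_point n m - 3/2 = 0"
    hence "Re (lattice_point n m) = 3/2" by (simp add: complex_eq_iff)
    thus False using Re_lattice_point_neq(1)[of n m] by simp
  qed
  show "lattice_point n m + 3/2 \<noteq> 0"
  proof
    assume "lattice_point n m + 3/2 = 0"
    hence "Re (lattice_point n m) = - 3/2" by (simp add: complex_eq_iff)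
    thus False using Re_lattice_point_neq(2)[of n m] by simp
  qed
qed

lemma partial_fraction_3:
  fixes a b :: complex
  assumes "a \<noteq> 0" "b \<noteq> 0" "b - a = 3"
  shows "1 / (a * b) = 1 / (3 * a) - 1 / (3 * b)"
proof -
  have "1 / (3 * a) - 1 / (3 * b) = (b - a) / (3 * (a * b))" using assms(1,2) by (simp add: divide_simps)
  thus ?thesis unfolding assms(3) by simp
qed

lemma D2_telescope: "D2 (lattice_point n m) = 1 / (3 * (lattice_point n m - 3/2)) - 1 / (3 * (lattice_point n (m + 1) - 3/2))"
proof -
  let ?w = "lattice_point n m"
  have e: "lattice_point n (m + 1) - 3/2 = ?w + 3/2" by (simp add: lattice_point_shift)
  have "?w ^ 2 - 9/4 = (?w - 3/2) * (?w + 3/2)" by (simp add: power2_eq_square algebra_simps)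
  hence "D2 ?w = 1 / ((?w - 3/2) * (?w + 3/2))" by (simp add: D2_def)
  also have "\<dots> = 1 / (3 * (?w - 3/2)) - 1 / (3 * (?w + 3/2))"
    by (rule partial_fraction_3[OF lattice_point_neq[of n m]]) simp
  finally show ?thesis by (simp only: e)
qed

lemma inverse_near:
  fixes a b :: complex
  assumes X: "X \<ge> 9" and a: "cmod a = sqrt X" and ab: "cmod (b - a) \<le> 3/2"
  shows "cmod (1 / b - 1 / a) \<le> 3 / X"
proof -
  have "sqrt X \<ge> sqrt 9" using X by (rule real_sqrt_le_mono)
  moreover have "sqrt 9 = (3::real)" by (rule real_sqrt_unique) simp_all
  ultimately have s3: "sqrt X \<ge> 3" by simp
  have "cmod a \<le> cmod b + cmod (b - a)" using norm_triangle_sub[of a b] by (simp add: norm_minus_commute)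
  hence b: "cmod b \<ge> sqrt X / 2" using a ab s3 by linarith
  have "cmod a > 0" "cmod b > 0" using a b s3 by linarith+
  hence nz: "a \<noteq> 0" "b \<noteq> 0" by auto
  have "1 / b - 1 / a = (a - b) / (b * a)" using nz by (simp add: divide_simps)
  hence "cmod (1 / b - 1 / a) = cmod (b - a) / (cmod b * cmod a)"
    by (simp add: norm_divide norm_mult norm_minus_commute)
  also have "\<dots> \<le> (3/2) / (sqrt X / 2 * sqrt X)"
    using ab b a s3 X by (intro frac_le mult_mono mult_pos_pos) auto
  also have "sqrt X / 2 * sqrt X = X / 2" using X by simp
  also have "(3/2) / (X / 2) = 3 / X" by simp
  finally show ?thesis .
qed

text \<open>Telescoping leaves two end terms, and each end point shifted by 3/2 lies within 3/2 of a
  point a or a' where the row meets the circle. Since a a' = -X and a' - a = 2R, the difference 1/a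
  - 1/a' is exactly -2R/X; the replacement of the end points costs O(1/X).\<close>

lemma lattice_row_D2:
  assumes X: "X \<ge> 9" and n: "n \<in> lattice_rows X"
  shows "cmod ((\<Sum>m\<in>lattice_row X n. D2 (lattice_point n m)) + of_real (2 / (3 * X) * sqrt (X - row_height_sq n))) \<le> 2 / X"
proof -
  define R where "R = sqrt (X - row_height_sq n)"
  have nn: "X - row_height_sq n \<ge> 0" using n by (simp add: lattice_rows_def)
  have R: "R \<ge> 0" using nn by (simp add: R_def)
  define y where "y = 3 * sqrt 3 / 2 * real_of_int n"
  have y2: "y\<^sup>2 = row_height_sq n" unfolding y_def row_height_sq_def by (simp add: power_mult_distrib power_divide)
  have RX: "R\<^sup>2 + y\<^sup>2 = X" using nn by (simp add: R_def y2)
  define lo hi where "lo = \<lceil>(- R - row_offset n) / 3\<rceil>" and "hi = \<lfloor>(R - row_offset n) / 3\<rfloor>"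
  have lattice_row: "lattice_row X n = {lo..hi}" using lattice_row_eq[OF n] by (simp add: lo_def hi_def R_def)
  have b: "real_of_int lo < (- R - row_offset n) / 3 + 1" "real_of_int lo \<ge> (- R - row_offset n) / 3"
    "real_of_int hi > (R - row_offset n) / 3 - 1" "real_of_int hi \<le> (R - row_offset n) / 3"
    unfolding lo_def hi_def by linarith+
  have "lo \<le> hi + 1"
  proof -
    have "real_of_int lo < (- R - row_offset n) / 3 + 1" by (rule b(1))
    also have "\<dots> \<le> (R - row_offset n) / 3 - 1 + 2" using R by argo
    also have "\<dots> < real_of_int hi + 2" using b(3) by argo
    finally have "real_of_int lo < real_of_int (hi + 2)" by simp
    thus ?thesis unfolding of_int_less_iff by simp
  qed
  define a a' where "a = Complex (- R) y" and "a' = Complex R y"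
  define v v' where "v = lattice_point n lo - 3/2" and "v' = lattice_point n (hi + 1) - 3/2"
  have ca: "cmod a = sqrt X" "cmod a' = sqrt X"
    using RX by (simp_all add: a_def a'_def cmod_def)
  have "v - a = of_real (row_offset n + 3 * of_int lo - 3/2 + R)"
    by (simp add: v_def a_def complex_eq_iff Re_lattice_point Im_lattice_point y_def)
  hence "cmod (v - a) = \<bar>row_offset n + 3 * of_int lo - 3/2 + R\<bar>" by (simp only: norm_of_real)
  also have "\<dots> \<le> 3/2" using b(1,2) by argo
  finally have "cmod (v - a) \<le> 3/2" .
  hence va: "cmod (1 / v - 1 / a) \<le> 3 / X" by (rule inverse_near[OF X ca(1)])
  have "v' - a' = of_real (row_offset n + 3 * (of_int hi + 1) - 3/2 - R)"
    by (simp add: v'_def a'_def complex_eq_iff Re_lattice_point Im_lattice_point y_def)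
  hence "cmod (v' - a') = \<bar>row_offset n + 3 * (of_int hi + 1) - 3/2 - R\<bar>" by (simp only: norm_of_real)
  also have "\<dots> \<le> 3/2" using b(3,4) by argo
  finally have "cmod (v' - a') \<le> 3/2" .
  hence va': "cmod (1 / v' - 1 / a') \<le> 3 / X" by (rule inverse_near[OF X ca(2)])
  have aa: "1 / a - 1 / a' = - of_real (2 * R / X)"
  proof -
    have nz: "a \<noteq> 0" "a' \<noteq> 0" using ca X by auto
    have "a * a' = - of_real X" using RX
      by (simp add: a_def a'_def complex_eq_iff power2_eq_square)
    moreover have "a' - a = of_real (2 * R)" by (simp add: a_def a'_def complex_eq_iff)
    moreover have "1 / a - 1 / a' = (a' - a) / (a * a')" using nz by (simp add: divide_simps)
    ultimately show ?thesis by simp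
  qed
  have "(\<Sum>m\<in>lattice_row X n. D2 (lattice_point n m)) = 1 / (3 * v) - 1 / (3 * v')"
    unfolding lattice_row D2_telescope v_def v'_def
    by (rule sum_telescope_int[of lo hi "\<lambda>m. 1 / (3 * (lattice_point n m - 3/2))", OF \<open>lo \<le> hi + 1\<close>])
  also have "\<dots> = (1/3) * ((1 / v - 1 / a) - (1 / v' - 1 / a') + (1 / a - 1 / a'))" by simp
  also have "\<dots> = (1/3) * ((1 / v - 1 / a) - (1 / v' - 1 / a')) - of_real (2 / (3 * X) * R)"
    unfolding aa by (simp add: algebra_simps)
  finally have "(\<Sum>m\<in>lattice_row X n. D2 (lattice_point n m)) + of_real (2 / (3 * X) * R)
     = (1/3) * ((1 / v - 1 / a) - (1 / v' - 1 / a'))" by simp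
  hence "cmod ((\<Sum>m\<in>lattice_row X n. D2 (lattice_point n m)) + of_real (2 / (3 * X) * R))
     = cmod ((1/3) * ((1 / v - 1 / a) - (1 / v' - 1 / a')))" by (rule arg_cong)
  also have "\<dots> = (1/3) * cmod ((1 / v - 1 / a) - (1 / v' - 1 / a'))"
    unfolding norm_mult by simp
  also have "\<dots> \<le> (1/3) * (3 / X + 3 / X)"
    by (rule mult_left_mono[OF order_trans[OF norm_triangle_ineq4 add_mono[OF va va']]]) simp
  finally show ?thesis by (simp add: R_def)
qed

text \<open>Adding the row values -2R/(3X) brings in the sum of the half-lengths R, which is cX up
  to sqrt X. The limit -2c/3 is thus an effect of the circular cut-off; it is negative and has to be
  compared with the absolutely convergent part. For X < 9 a crude bound is absorbed into the
  constant.\<close>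

lemma sum_D2:
  assumes c: "\<And>X. X \<ge> 1 \<Longrightarrow> \<bar>(\<Sum>n\<in>lattice_rows X. sqrt (X - row_height_sq n)) - c * X\<bar> \<le> sqrt X"
  shows "\<exists>C. \<forall>X\<ge>1. cmod ((\<Sum>z\<in>primary_upto X. D2 z) + of_real (2 / 3 * c)) \<le> C / sqrt X"
proof -
  have big: "cmod ((\<Sum>z\<in>primary_upto X. D2 z) + of_real (2 / 3 * c)) \<le> 7 / sqrt X" if X: "X \<ge> 9" for X
  proof -
    define S where "S = (\<Sum>n\<in>lattice_rows X. sqrt (X - row_height_sq n))"
    have sX: "sqrt X > 0" "sqrt X * sqrt X = X" using X by simp_all
    have "(\<Sum>z\<in>primary_upto X. D2 z) + of_real (2 / (3 * X) * S) =
       (\<Sum>n\<in>lattice_rows X. (\<Sum>m\<in>lattice_row X n. D2 (lattice_point n m)) + of_real (2 / (3 * X) * sqrt (X - row_height_sq n)))"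
      by (simp add: sum_primary_upto S_def sum.distrib sum_distrib_left)
    also have "cmod \<dots> \<le> (\<Sum>n\<in>lattice_rows X. 2 / X)"
      by (rule sum_norm_le) (rule lattice_row_D2[OF X])
    also have "\<dots> = real (card (lattice_rows X)) * (2 / X)" by simp
    also have "\<dots> \<le> (3 * sqrt X) * (2 / X)" using X by (intro mult_right_mono card_lattice_rows_le) auto
    also have "\<dots> = 6 / sqrt X" using sX by (simp add: divide_simps)
    finally have 1: "cmod ((\<Sum>z\<in>primary_upto X. D2 z) + of_real (2 / (3 * X) * S)) \<le> 6 / sqrt X" .
    have "2 / 3 * c - 2 / (3 * X) * S = - (2 / (3 * X) * (S - c * X))" using X by (simp add: field_simps)
    hence "\<bar>2 / 3 * c - 2 / (3 * X) * S\<bar> = 2 / (3 * X) * \<bar>S - c * X\<bar>"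
    proof -
      have u: "0 \<le> 2 / (3 * X)" using X by simp
      assume e: "2 / 3 * c - 2 / (3 * X) * S = - (2 / (3 * X) * (S - c * X))"
      show ?thesis by (simp only: e abs_minus_cancel abs_mult abs_of_nonneg[OF u])
    qed
    also have "\<dots> \<le> 2 / (3 * X) * sqrt X" using c[of X] X by (intro mult_left_mono) (auto simp: S_def)
    also have "\<dots> \<le> 1 / sqrt X"
      unfolding pos_le_divide_eq[OF sX(1)] mult.assoc sX(2) using X by simp
    finally have 2: "\<bar>2 / 3 * c - 2 / (3 * X) * S\<bar> \<le> 1 / sqrt X" .
    have "(\<Sum>z\<in>primary_upto X. D2 z) + of_real (2 / 3 * c) =
       ((\<Sum>z\<in>primary_upto X. D2 z) + of_real (2 / (3 * X) * S)) + of_real (2 / 3 * c - 2 / (3 * X) * S)" by simp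
    also have "cmod \<dots> \<le> 6 / sqrt X + 1 / sqrt X"
      by (rule norm_triangle_mono[OF 1]) (simp only: norm_of_real 2)
    finally show ?thesis by simp
  qed
  define B where "B = (\<Sum>z\<in>primary_upto 9. cmod (D2 z)) + \<bar>2 / 3 * c\<bar>"
  have B0: "B \<ge> 0" by (simp add: B_def sum_nonneg)
  have "cmod ((\<Sum>z\<in>primary_upto X. D2 z) + of_real (2 / 3 * c)) \<le> (3 * B + 7) / sqrt X" if X: "X \<ge> 1" for X
  proof (cases "X \<ge> 9")
    case True
    have "7 / sqrt X \<le> (3 * B + 7) / sqrt X" using B0 X by (intro divide_right_mono) auto
    thus ?thesis using big[OF True] by linarith
  next
    case False
    have "cmod ((\<Sum>z\<in>primary_upto X. D2 z) + of_real (2 / 3 * c)) \<le> (\<Sum>z\<in>primary_upto X. cmod (D2 z)) + \<bar>2 / 3 * c\<bar>"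
      by (rule norm_triangle_mono) (simp_all only: norm_of_real norm_sum order_refl)
    also have "(\<Sum>z\<in>primary_upto X. cmod (D2 z)) \<le> (\<Sum>z\<in>primary_upto 9. cmod (D2 z))"
      using False by (intro sum_mono2 finite_primary_upto) (auto simp: primary_upto_def)
    finally have "cmod ((\<Sum>z\<in>primary_upto X. D2 z) + of_real (2 / 3 * c)) \<le> B" by (simp add: B_def)
    also have "B \<le> (3 * B + 7) / sqrt X"
    proof -
      have "sqrt X \<le> sqrt 9" using False by (intro real_sqrt_le_mono) simp
      moreover have "sqrt 9 = (3::real)" by (rule real_sqrt_unique) simp_all
      ultimately have "B * sqrt X \<le> B * 3" using B0 by (intro mult_left_mono) auto
      thus ?thesis using X by (simp add: pos_le_divide_eq)
    qed
    finally show ?thesis .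
  qed
  thus ?thesis by blast
qed

section \<open>Numerical bounds for the absolutely convergent part\<close>

text \<open>The points 1 and -2 dominate and are evaluated exactly; the gap up to squared modulus 7
  makes the remaining terms small enough for a crude estimate.\<close>

lemma primary_cmod_sq_cases:
  assumes "z \<in> primary" shows "z = 1 \<or> z = -2 \<or> (cmod z)\<^sup>2 \<ge> 7"
proof -
  obtain n m where z: "z = lattice_point n m" using assms primary_ptE by blast
  show ?thesis
  proof (cases "n = 0")
    case True
    have "m = 0 \<or> m = -1 \<or> m \<ge> 1 \<or> m \<le> -2" by linarith
    thus ?thesis
    proof (elim disjE)
      assume "m = 0" thus ?thesis using True by (simp add: z lattice_point_def row_offset_def complex_eq_iff)
    next
      assume "m = -1" thus ?thesis using True by (simp add: z lattice_point_def row_offset_def complex_eq_iff)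
    next
      assume "m \<ge> 1"
      hence "4 \<le> 1 + 3 * real_of_int m" by linarith
      hence "4\<^sup>2 \<le> (1 + 3 * real_of_int m)\<^sup>2" by (intro power_mono) auto
      thus ?thesis using True by (simp add: z cmod_lattice_point_sq row_offset_def row_height_sq_def)
    next
      assume "m \<le> -2"
      hence "5 \<le> - (1 + 3 * real_of_int m)" by linarith
      hence "5\<^sup>2 \<le> (- (1 + 3 * real_of_int m))\<^sup>2" by (intro power_mono) auto
      hence "25 \<le> (1 + 3 * real_of_int m)\<^sup>2" by (simp only: power2_minus) simp
      thus ?thesis using True by (simp add: z cmod_lattice_point_sq row_offset_def row_height_sq_def)
    qed
  next
    case False
    hence "1 \<le> \<bar>n\<bar>" by linarith
    hence "1 \<le> \<bar>real_of_int n\<bar>" by linarith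
    hence "1\<^sup>2 \<le> \<bar>real_of_int n\<bar>\<^sup>2" by (intro power_mono) auto
    hence n1: "1 \<le> (real_of_int n)\<^sup>2" by simp
    define k where "k = (if even n then 2 + 6 * m else -1 + 6 * m)"
    have "2 * (row_offset n + 3 * of_int m) = real_of_int k"
      by (simp add: row_offset_def k_def)
    moreover have "\<bar>k\<bar> \<ge> 1" unfolding k_def by presburger
    hence "\<bar>real_of_int k\<bar> \<ge> 1" by linarith
    ultimately have "1/2 \<le> \<bar>row_offset n + 3 * m\<bar>" unfolding of_int_mult of_int_numeral by argo
    hence "(1/2)\<^sup>2 \<le> \<bar>row_offset n + 3 * m\<bar>\<^sup>2" by (intro power_mono) auto
    hence "1/4 \<le> (row_offset n + 3 * m)\<^sup>2" by (simp add: power2_eq_square)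
    hence "7 \<le> (row_offset n + 3 * m)\<^sup>2 + row_height_sq n" unfolding row_height_sq_def using n1 by linarith
    thus ?thesis by (simp add: z cmod_lattice_point_sq)
  qed
qed

text \<open>For N \<ge> 7 one has N - 9/4 \<ge> (1 - 9/28) N = 19/28 N, and 63/19 is (9/4) /
  (19/28).\<close>

lemma norm_E2_le:
  assumes N: "(cmod z)\<^sup>2 \<ge> 7" shows "cmod (E2 z) \<le> 63/19 / cmod z ^ 4"
proof -
  define N where "N = (cmod z)\<^sup>2"
  have N7: "N \<ge> 7" using assms by (simp add: N_def)
  have z0: "z \<noteq> 0" using N by auto
  have d: "cmod (z ^ 2 - 9/4) \<ge> N - 9/4"
    using norm_triangle_ineq2[of "z ^ 2" "9/4"] by (simp add: N_def norm_power)
  have d0: "z ^ 2 - 9/4 \<noteq> 0"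
  proof
    assume "z ^ 2 - 9/4 = 0"
    hence "cmod (z ^ 2 - 9/4) = 0" by (simp only: norm_zero)
    thus False using d N7 by linarith
  qed
  have "E2 z = - (9/4) / (z ^ 2 * (z ^ 2 - 9/4))"
    unfolding E2_def D2_def using z0 d0 by (simp add: divide_simps)
  hence "cmod (E2 z) = (9/4) / (N * cmod (z ^ 2 - 9/4))"
    by (simp add: norm_divide norm_mult norm_power N_def)
  also have "\<dots> \<le> (9/4) / (N * (19/28 * N))"
  proof -
    have p: "0 < cmod (z ^ 2 - 9/4)" using d0 by (simp only: zero_less_norm_iff not_False_eq_True)
    have "N * (19/28 * N) \<le> N * cmod (z ^ 2 - 9/4)" using d N7 by (intro mult_left_mono) auto
    moreover have "0 < N * cmod (z ^ 2 - 9/4) * (N * (19/28 * N))" using p N7 by (intro mult_pos_pos) auto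
    ultimately show ?thesis by (intro divide_left_mono) auto
  qed
  also have "\<dots> = 63/19 / cmod z ^ 4"
    by (simp add: N_def power2_eq_square power4_eq_xxxx)
  finally show ?thesis .
qed

lemma norm_E2_le': "\<exists>C. \<forall>z\<in>primary. cmod (E2 z) \<le> C / cmod z ^ 4"
proof -
  define C where "C = 63/19 + cmod (E2 1) + 16 * cmod (E2 (-2))"
  have "cmod (E2 z) \<le> C / cmod z ^ 4" if "z \<in> primary" for z
    using primary_cmod_sq_cases[OF that]
  proof (elim disjE)
    assume "(cmod z)\<^sup>2 \<ge> 7"
    hence "cmod (E2 z) \<le> 63/19 / cmod z ^ 4" by (rule norm_E2_le)
    also have "\<dots> \<le> C / cmod z ^ 4" by (intro divide_right_mono) (auto simp: C_def)
    finally show ?thesis .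
  qed (simp_all add: C_def)
  thus ?thesis by blast
qed

lemma sum_int_split_le:
  fixes f :: "int \<Rightarrow> real"
  assumes "finite S" "\<And>m. f m \<ge> 0"
    and A: "\<And>K. (\<Sum>i<K. f (s + int i)) \<le> a" and B: "\<And>K. (\<Sum>i<K. f (s - 1 - int i)) \<le> b"
  shows "(\<Sum>m\<in>S. f m) \<le> a + b"
proof -
  define K where "K = nat (Max (insert 0 ((\<lambda>m. \<bar>m - s\<bar> + 1) ` S)))"
  have K: "\<bar>m - s\<bar> < int K" if "m \<in> S" for m
  proof -
    have "\<bar>m - s\<bar> + 1 \<le> Max (insert 0 ((\<lambda>m. \<bar>m - s\<bar> + 1) ` S))"
      using that assms(1) by (intro Max_ge) auto
    thus ?thesis unfolding K_def by linarith
  qed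
  have sub: "S \<subseteq> (\<lambda>i. s + int i) ` {..<K} \<union> (\<lambda>i. s - 1 - int i) ` {..<K}"
  proof
    fix m assume m: "m \<in> S"
    show "m \<in> (\<lambda>i. s + int i) ` {..<K} \<union> (\<lambda>i. s - 1 - int i) ` {..<K}"
    proof (cases "m \<ge> s")
      case True
      hence "m = s + int (nat (m - s))" "nat (m - s) < K" using K[OF m] by auto
      thus ?thesis by blast
    next
      case False
      hence "m = s - 1 - int (nat (s - 1 - m))" "nat (s - 1 - m) < K" using K[OF m] by auto
      thus ?thesis by blast
    qed
  qed
  have "(\<Sum>m\<in>S. f m) \<le> (\<Sum>m\<in>(\<lambda>i. s + int i) ` {..<K} \<union> (\<lambda>i. s - 1 - int i) ` {..<K}. f m)"
    by (rule sum_mono2[OF _ sub]) (auto simp: assms(2))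
  also have "\<dots> \<le> (\<Sum>m\<in>(\<lambda>i. s + int i) ` {..<K}. f m) + (\<Sum>m\<in>(\<lambda>i. s - 1 - int i) ` {..<K}. f m)"
    using sum.union_inter[of "(\<lambda>i. s + int i) ` {..<K}" "(\<lambda>i. s - 1 - int i) ` {..<K}" f]
      sum_nonneg[of "(\<lambda>i. s + int i) ` {..<K} \<inter> (\<lambda>i. s - 1 - int i) ` {..<K}" f] assms(2) by simp
  also have "(\<Sum>m\<in>(\<lambda>i. s + int i) ` {..<K}. f m) = (\<Sum>i<K. f (s + int i))"
    by (subst sum.reindex) (auto simp: inj_on_def)
  also have "(\<Sum>m\<in>(\<lambda>i. s - 1 - int i) ` {..<K}. f m) = (\<Sum>i<K. f (s - 1 - int i))"
    by (subst sum.reindex) (auto simp: inj_on_def)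
  also have "(\<Sum>i<K. f (s + int i)) + (\<Sum>i<K. f (s - 1 - int i)) \<le> a + b" by (intro add_mono A B)
  finally show ?thesis .
qed

lemma sum_inverse_quadratic_le:
  fixes a :: real assumes a: "a > 0"
  shows "(\<Sum>i<K. 1 / ((a + 3 * real i + 3)\<^sup>2 - 9/4)) \<le> 1 / (3 * (a + 3/2))"
proof -
  have "(\<Sum>i<K. 1 / ((a + 3 * real i + 3)\<^sup>2 - 9/4)) = 1 / (3 * (a + 3/2)) - 1 / (3 * (a + 3 * real K + 3/2))"
  proof (induction K)
    case (Suc K)
    define u where "u = a + 3 * real K + 3/2"
    have u: "u > 0" using a by (simp add: u_def)
    have "(a + 3 * real K + 3)\<^sup>2 - 9/4 = u * (u + 3)" by (simp add: u_def power2_eq_square field_simps)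
    hence "1 / ((a + 3 * real K + 3)\<^sup>2 - 9/4) = 1 / (3 * u) - 1 / (3 * (u + 3))"
      using u by (simp add: divide_simps)
    moreover have "u + 3 = a + 3 * real (Suc K) + 3/2" by (simp add: u_def)
    ultimately show ?case using Suc by (simp add: u_def)
  qed simp
  also have "\<dots> \<le> 1 / (3 * (a + 3/2))" using a by simp
  finally show ?thesis .
qed

lemma sum_inverse_quadratic_le':
  fixes a :: real assumes a: "a > 0"
  shows "(\<Sum>i<K. 1 / ((a + 3 * real i)\<^sup>2 + 27/4)) \<le> 1 / (a\<^sup>2 + 27/4) + 1 / (3 * (a + 3/2))"
proof (cases K)
  case (Suc k)
  have "(\<Sum>i<K. 1 / ((a + 3 * real i)\<^sup>2 + 27/4)) = 1 / (a\<^sup>2 + 27/4) + (\<Sum>i<k. 1 / ((a + 3 * real i + 3)\<^sup>2 + 27/4))"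
    unfolding Suc sum.lessThan_Suc_shift by (simp add: algebra_simps)
  also have "(\<Sum>i<k. 1 / ((a + 3 * real i + 3)\<^sup>2 + 27/4)) \<le> (\<Sum>i<k. 1 / ((a + 3 * real i + 3)\<^sup>2 - 9/4))"
  proof (rule sum_mono)
    fix i
    have "3 \<le> a + 3 * real i + 3" using a by simp
    hence "3\<^sup>2 \<le> (a + 3 * real i + 3)\<^sup>2" by (intro power_mono) auto
    hence "9 \<le> (a + 3 * real i + 3)\<^sup>2" by simp
    thus "1 / ((a + 3 * real i + 3)\<^sup>2 + 27/4) \<le> 1 / ((a + 3 * real i + 3)\<^sup>2 - 9/4)"
      by (intro divide_left_mono mult_pos_pos) linarith+
  qed
  also have "\<dots> \<le> 1 / (3 * (a + 3/2))" by (rule sum_inverse_quadratic_le[OF a])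
  finally show ?thesis by simp
qed (use a in simp)

text \<open>Each row is split into its positive and negative real parts, whose absolute values start
  at 1 and 2 in an even row, at 1/2 and 5/2 in an odd one. The first term of each half is kept and
  the rest is bounded by a telescoping sum; the odd row, with about 0.4698, is the worse.\<close>

lemma sum_lattice_row_inverse_quadratic:
  assumes "finite S"
  shows "(\<Sum>m\<in>S. 1 / ((row_offset n + 3 * real_of_int m)\<^sup>2 + 27/4)) \<le> 47/100"
proof (cases "even n")
  case True
  have "(\<Sum>m\<in>S. 1 / ((row_offset n + 3 * real_of_int m)\<^sup>2 + 27/4)) \<le>
     (1 / (1\<^sup>2 + 27/4) + 1 / (3 * (1 + 3/2))) + (1 / (2\<^sup>2 + 27/4) + 1 / (3 * (2 + 3/2)))"
  proof (rule sum_int_split_le[OF assms, where s = 0])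
    fix K
    show "(\<Sum>i<K. 1 / ((row_offset n + 3 * real_of_int (0 + int i))\<^sup>2 + 27/4)) \<le> 1 / (1\<^sup>2 + 27/4) + 1 / (3 * (1 + 3/2))"
      using sum_inverse_quadratic_le'[of 1 K] True by (simp add: row_offset_def)
    have "(row_offset n + 3 * real_of_int (0 - 1 - int i))\<^sup>2 = (2 + 3 * real i)\<^sup>2" for i
      using True by (simp add: row_offset_def power2_eq_square algebra_simps)
    thus "(\<Sum>i<K. 1 / ((row_offset n + 3 * real_of_int (0 - 1 - int i))\<^sup>2 + 27/4)) \<le> 1 / (2\<^sup>2 + 27/4) + 1 / (3 * (2 + 3/2))"
      using sum_inverse_quadratic_le'[of 2 K] by (simp only:)
  qed (auto intro!: divide_nonneg_nonneg add_nonneg_nonneg)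
  also have "\<dots> \<le> 47/100" by (simp add: power2_eq_square)
  finally show ?thesis .
next
  case False
  have "(\<Sum>m\<in>S. 1 / ((row_offset n + 3 * real_of_int m)\<^sup>2 + 27/4)) \<le>
     (1 / ((5/2)\<^sup>2 + 27/4) + 1 / (3 * (5/2 + 3/2))) + (1 / ((1/2)\<^sup>2 + 27/4) + 1 / (3 * (1/2 + 3/2)))"
  proof (rule sum_int_split_le[OF assms, where s = 1])
    fix K
    have "(row_offset n + 3 * real_of_int (1 + int i))\<^sup>2 = (5/2 + 3 * real i)\<^sup>2" for i
      using False by (simp add: row_offset_def power2_eq_square algebra_simps)
    thus "(\<Sum>i<K. 1 / ((row_offset n + 3 * real_of_int (1 + int i))\<^sup>2 + 27/4)) \<le> 1 / ((5/2)\<^sup>2 + 27/4) + 1 / (3 * (5/2 + 3/2))"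
      using sum_inverse_quadratic_le'[of "5/2" K] by (simp only:)
    have "(row_offset n + 3 * real_of_int (1 - 1 - int i))\<^sup>2 = (1/2 + 3 * real i)\<^sup>2" for i
      using False by (simp add: row_offset_def power2_eq_square algebra_simps)
    thus "(\<Sum>i<K. 1 / ((row_offset n + 3 * real_of_int (1 - 1 - int i))\<^sup>2 + 27/4)) \<le> 1 / ((1/2)\<^sup>2 + 27/4) + 1 / (3 * (1/2 + 3/2))"
      using sum_inverse_quadratic_le'[of "1/2" K] by (simp only:)
  qed (auto intro!: divide_nonneg_nonneg add_nonneg_nonneg)
  also have "\<dots> \<le> 47/100" by (simp add: power2_eq_square)
  finally show ?thesis .
qed

text \<open>Comparison with 1/(i^2 - 1/4), which telescopes. The first term is kept exactly, which
  gives 1 + 1/(3/2) = 5/3; the strengthened bound with - 1/(K + 1/2) carries the induction.\<close>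

lemma sum_inverse_squares_le: "(\<Sum>i=1..K. 1 / (real i)\<^sup>2) \<le> 5/3"
proof -
  have "(\<Sum>i=1..K. 1 / (real i)\<^sup>2) \<le> 5/3 - 1 / (real K + 1/2) \<or> K = 0"
  proof (induction K)
    case (Suc K)
    show ?case
    proof (cases "K = 0")
      case False
      define u where "u = real K + 1/2"
      have u: "u \<ge> 3/2" using False by (simp add: u_def)
      have "1 / (real (Suc K))\<^sup>2 \<le> 1 / (u * (u + 1))"
        using u by (intro divide_left_mono mult_pos_pos zero_less_power)
          (auto simp: u_def power2_eq_square algebra_simps)
      also have "\<dots> = 1 / u - 1 / (u + 1)" using u by (simp add: divide_simps)
      finally have "1 / (real (Suc K))\<^sup>2 \<le> 1 / u - 1 / (u + 1)" .
      moreover have "u + 1 = real (Suc K) + 1/2" by (simp add: u_def)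
      moreover have "(\<Sum>i=1..Suc K. 1 / (real i)\<^sup>2) = (\<Sum>i=1..K. 1 / (real i)\<^sup>2) + 1 / (real (Suc K))\<^sup>2" by simp
      ultimately show ?thesis using Suc False by (simp add: u_def)
    qed simp
  qed simp
  thus ?thesis
  proof
    assume "(\<Sum>i=1..K. 1 / (real i)\<^sup>2) \<le> 5/3 - 1 / (real K + 1/2)"
    moreover have "1 / (real K + 1/2) \<ge> 0" by simp
    ultimately show ?thesis by linarith
  qed simp
qed

lemma sum_lattice_rows_inverse_squares: "(\<Sum>n\<in>lattice_rows X - {0}. 1 / (real_of_int n)\<^sup>2) \<le> 10/3"
proof -
  define K where "K = nat \<lfloor>sqrt X\<rfloor>"
  have "lattice_rows X - {0} \<subseteq> {- int K..int K} - {0}" using lattice_rows_subset[of X] by (auto simp: K_def)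
  hence "(\<Sum>n\<in>lattice_rows X - {0}. 1 / (real_of_int n)\<^sup>2) \<le> (\<Sum>n\<in>{- int K..int K} - {0}. 1 / (real_of_int n)\<^sup>2)"
    by (intro sum_mono2) auto
  also have "\<dots> \<le> (\<Sum>n\<in>{- int K..int K}. 1 / (real_of_int n)\<^sup>2)"
    by (intro sum_mono2) auto
  also have "\<dots> = (\<Sum>i=1..K. 1 / (real i)\<^sup>2 + 1 / (real i)\<^sup>2)"
    unfolding sum_symmetric_int by simp
  also have "\<dots> = (\<Sum>i=1..K. 1 / (real i)\<^sup>2) + (\<Sum>i=1..K. 1 / (real i)\<^sup>2)" by (rule sum.distrib)
  also have "\<dots> \<le> 5/3 + 5/3" by (intro add_mono sum_inverse_squares_le)
  finally show ?thesis by simp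
qed

lemma sum_row0_fourth_powers:
  assumes "finite S" "0 \<notin> S" "-1 \<notin> S"
  shows "(\<Sum>m\<in>S. 1 / (1 + 3 * real_of_int m) ^ 4) \<le> 1/69"
proof -
  define f where "f = (\<lambda>m :: int. if m = 0 \<or> m = -1 then 0 else 1 / (1 + 3 * real_of_int m) ^ 4)"
  have le: "1 / x ^ 4 \<le> (1/16) * (1 / (x\<^sup>2 - 9/4))" if "x \<ge> 4" for x :: real
  proof -
    have x2: "x\<^sup>2 \<ge> 16" using power_mono[OF that, of 2] by simp
    have "16 * (x\<^sup>2 - 9/4) \<le> x\<^sup>2 * x\<^sup>2" using mult_right_mono[OF x2, of "x\<^sup>2"] x2 by simp
    also have "\<dots> = x ^ 4" by (simp add: power2_eq_square power4_eq_xxxx)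
    finally have "1 / x ^ 4 \<le> 1 / (16 * (x\<^sup>2 - 9/4))"
      using x2 that by (intro divide_left_mono mult_pos_pos zero_less_power) auto
    thus ?thesis by simp
  qed
  have side: "(\<Sum>i<K. 1 / (a + 3 * real i + 3) ^ 4) \<le> (1/16) * (1 / (3 * (a + 3/2)))" if "a \<ge> 1" for a :: real and K
  proof -
    have "(\<Sum>i<K. 1 / (a + 3 * real i + 3) ^ 4) \<le> (\<Sum>i<K. (1/16) * (1 / ((a + 3 * real i + 3)\<^sup>2 - 9/4)))"
      by (intro sum_mono le) (use that in auto)
    also have "\<dots> = (1/16) * (\<Sum>i<K. 1 / ((a + 3 * real i + 3)\<^sup>2 - 9/4))" by (rule sum_distrib_left[symmetric])
    also have "\<dots> \<le> (1/16) * (1 / (3 * (a + 3/2)))"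
      using that by (intro mult_left_mono sum_inverse_quadratic_le) auto
    finally show ?thesis .
  qed
  have "(\<Sum>m\<in>S. 1 / (1 + 3 * real_of_int m) ^ 4) = (\<Sum>m\<in>S. f m)"
    using assms(2,3) by (intro sum.cong refl) (auto simp: f_def)
  also have "\<dots> \<le> (1/16) * (1 / (3 * (1 + 3/2))) + (1/16) * (1 / (3 * (2 + 3/2)))"
  proof (rule sum_int_split_le[OF assms(1), where s = 0])
    fix K
    show "(\<Sum>i<K. f (0 + int i)) \<le> (1/16) * (1 / (3 * (1 + 3/2)))"
    proof (cases K)
      case (Suc k)
      have "(\<Sum>i<K. f (0 + int i)) = (\<Sum>i<k. 1 / (1 + 3 * real i + 3) ^ 4)"
        unfolding Suc sum.lessThan_Suc_shift by (simp add: f_def algebra_simps)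
      thus ?thesis using side[of 1 k] by simp
    qed simp
    show "(\<Sum>i<K. f (0 - 1 - int i)) \<le> (1/16) * (1 / (3 * (2 + 3/2)))"
    proof (cases K)
      case (Suc k)
      have "f (0 - 1 - int (Suc i)) = 1 / (2 + 3 * real i + 3) ^ 4" for i
      proof -
        have "1 + 3 * real_of_int (0 - 1 - int (Suc i)) = - (2 + 3 * real i + 3)" by simp
        hence "(1 + 3 * real_of_int (0 - 1 - int (Suc i))) ^ 4 = (2 + 3 * real i + 3) ^ 4"
          by (simp only: power_minus_even even_numeral)
        thus ?thesis unfolding f_def by simp
      qed
      moreover have "f (0 - 1 - int 0) = 0" by (simp add: f_def)
      ultimately have "(\<Sum>i<K. f (0 - 1 - int i)) = (\<Sum>i<k. 1 / (2 + 3 * real i + 3) ^ 4)"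
        unfolding Suc sum.lessThan_Suc_shift by (simp only: add_0)
      thus ?thesis using side[of 2 k] by simp
    qed simp
  qed (auto simp: f_def)
  also have "\<dots> \<le> 1/69" by simp
  finally show ?thesis .
qed

text \<open>In a row n \<noteq> 0 with squared height Y, the fourth power of |z| is at least Y (x^2
  + 27/4), x being the real part: one factor gives a sum over n, the other a sum within the row.
  Together 1/69 from the central row and (4/27) (47/100) (10/3) from the others stay just below
  0.2466.\<close>

lemma sum_inverse_fourth_powers:
  "(\<Sum>z\<in>primary_upto X - {1, -2}. 1 / cmod z ^ 4) \<le> 2466/10000"
proof -
  define g where "g = (\<lambda>z. if z = 1 \<or> z = -2 then 0 else 1 / cmod z ^ 4)"
  have g0: "g z \<ge> 0" for z by (simp add: g_def)
  have "(\<Sum>z\<in>primary_upto X - {1, -2}. 1 / cmod z ^ 4) = (\<Sum>z\<in>primary_upto X - {1, -2}. g z)"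
    by (intro sum.cong refl) (simp add: g_def)
  also have "\<dots> \<le> (\<Sum>z\<in>primary_upto X. g z)" by (intro sum_mono2 finite_primary_upto) (auto simp: g0)
  also have "\<dots> = (\<Sum>n\<in>lattice_rows X. \<Sum>m\<in>lattice_row X n. g (lattice_point n m))" by (rule sum_primary_upto)
  also have "\<dots> \<le> (\<Sum>n\<in>insert 0 (lattice_rows X). \<Sum>m\<in>lattice_row X n. g (lattice_point n m))"
    by (intro sum_mono2) (auto intro!: sum_nonneg simp: g0 finite_lattice_rows)
  also have "\<dots> = (\<Sum>m\<in>lattice_row X 0. g (lattice_point 0 m)) + (\<Sum>n\<in>lattice_rows X - {0}. \<Sum>m\<in>lattice_row X n. g (lattice_point n m))"
    by (rule sum.insert_remove[OF finite_lattice_rows])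
  also have "(\<Sum>m\<in>lattice_row X 0. g (lattice_point 0 m)) \<le> 1/69"
  proof -
    have p: "lattice_point 0 0 = 1" "lattice_point 0 (-1) = -2" by (simp_all add: lattice_point_def row_offset_def complex_eq_iff)
    have "(\<Sum>m\<in>lattice_row X 0. g (lattice_point 0 m)) = (\<Sum>m\<in>lattice_row X 0 - {0, -1}. g (lattice_point 0 m))"
      by (intro sum.mono_neutral_right finite_lattice_row) (auto simp: p g_def)
    also have "\<dots> \<le> (\<Sum>m\<in>lattice_row X 0 - {0, -1}. 1 / (1 + 3 * real_of_int m) ^ 4)"
    proof (rule sum_mono)
      fix m assume "m \<in> lattice_row X 0 - {0, -1}"
      have "cmod (lattice_point 0 m) ^ 4 = ((cmod (lattice_point 0 m))\<^sup>2)\<^sup>2" by (simp flip: power_mult)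
      also have "\<dots> = ((1 + 3 * real_of_int m)\<^sup>2)\<^sup>2" unfolding cmod_lattice_point_sq by (simp add: row_offset_def row_height_sq_def)
      also have "\<dots> = (1 + 3 * real_of_int m) ^ 4" by (simp flip: power_mult)
      finally show "g (lattice_point 0 m) \<le> 1 / (1 + 3 * real_of_int m) ^ 4" by (simp add: g_def)
    qed
    also have "\<dots> \<le> 1/69" by (rule sum_row0_fourth_powers) (auto simp: finite_lattice_row)
    finally show ?thesis .
  qed
  also have "(\<Sum>n\<in>lattice_rows X - {0}. \<Sum>m\<in>lattice_row X n. g (lattice_point n m)) \<le> (\<Sum>n\<in>lattice_rows X - {0}. (4/27 * (47/100)) * (1 / (real_of_int n)\<^sup>2))"
  proof (rule sum_mono)
    fix n assume n: "n \<in> lattice_rows X - {0}"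
    hence "1 \<le> \<bar>n\<bar>" by simp linarith
    hence "1 \<le> \<bar>real_of_int n\<bar>" by linarith
    hence "1\<^sup>2 \<le> \<bar>real_of_int n\<bar>\<^sup>2" by (intro power_mono) auto
    hence n1: "1 \<le> (real_of_int n)\<^sup>2" by simp
    hence "row_height_sq n \<ge> 27/4" by (simp add: row_height_sq_def)
    hence y1: "row_height_sq n \<ge> 27/4" "row_height_sq n > 0" by linarith+
    have "(\<Sum>m\<in>lattice_row X n. g (lattice_point n m)) \<le> (\<Sum>m\<in>lattice_row X n. (1 / row_height_sq n) * (1 / ((row_offset n + 3 * real_of_int m)\<^sup>2 + 27/4)))"
    proof (rule sum_mono)
      fix m
      define x where "x = (row_offset n + 3 * real_of_int m)\<^sup>2"
      have x0: "x \<ge> 0" by (simp add: x_def)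
      have "row_height_sq n * (x + 27/4) \<le> (x + row_height_sq n) * (x + row_height_sq n)" using x0 y1 by (intro mult_mono) auto
      also have "\<dots> = ((cmod (lattice_point n m))\<^sup>2)\<^sup>2" unfolding cmod_lattice_point_sq by (simp add: x_def power2_eq_square)
      also have "\<dots> = cmod (lattice_point n m) ^ 4" by (simp flip: power_mult)
      finally have "1 / cmod (lattice_point n m) ^ 4 \<le> 1 / (row_height_sq n * (x + 27/4))"
        using x0 y1 lattice_point_cmod_pos[of n m] by (intro divide_left_mono mult_pos_pos zero_less_power) auto
      also have "\<dots> = (1 / row_height_sq n) * (1 / (x + 27/4))" by simp
      finally have "1 / cmod (lattice_point n m) ^ 4 \<le> (1 / row_height_sq n) * (1 / (x + 27/4))" .
      moreover have "g (lattice_point n m) \<le> 1 / cmod (lattice_point n m) ^ 4" by (simp add: g_def)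
      ultimately show "g (lattice_point n m) \<le> (1 / row_height_sq n) * (1 / ((row_offset n + 3 * real_of_int m)\<^sup>2 + 27/4))"
        unfolding x_def by (rule order_trans[rotated])
    qed
    also have "\<dots> = (1 / row_height_sq n) * (\<Sum>m\<in>lattice_row X n. 1 / ((row_offset n + 3 * real_of_int m)\<^sup>2 + 27/4))"
      by (rule sum_distrib_left[symmetric])
    also have "\<dots> \<le> (1 / row_height_sq n) * (47/100)"
      using y1 by (intro mult_left_mono sum_lattice_row_inverse_quadratic finite_lattice_row) auto
    also have "\<dots> = (4/27 * (47/100)) * (1 / (real_of_int n)\<^sup>2)" by (simp add: row_height_sq_def)
    finally show "(\<Sum>m\<in>lattice_row X n. g (lattice_point n m)) \<le> (4/27 * (47/100)) * (1 / (real_of_int n)\<^sup>2)" .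
  qed
  also have "(\<Sum>n\<in>lattice_rows X - {0}. (4/27 * (47/100)) * (1 / (real_of_int n)\<^sup>2)) = (4/27 * (47/100)) * (\<Sum>n\<in>lattice_rows X - {0}. 1 / (real_of_int n)\<^sup>2)"
    by (rule sum_distrib_left[symmetric])
  also have "\<dots> \<le> (4/27 * (47/100)) * (10/3)"
    by (intro mult_left_mono sum_lattice_rows_inverse_squares) simp
  also have "1/69 + (4/27 * (47/100)) * (10/3) \<le> (2466/10000 :: real)" by simp
  finally show ?thesis by simp
qed

lemma one_minus2_primary_upto: "X \<ge> 4 \<Longrightarrow> {1, -2} \<subseteq> primary_upto X"
proof -
  assume "X \<ge> 4"
  moreover have "lattice_point 0 0 = 1" "lattice_point 0 (-1) = -2" by (simp_all add: lattice_point_def row_offset_def complex_eq_iff)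
  hence "1 \<in> primary" "-2 \<in> primary" using lattice_point_primary by metis+
  ultimately show ?thesis by (simp add: primary_upto_def)
qed

text \<open>The exact values are 9/5 at z = 1 and -9/28 at z = -2, about 1.478 in total; the rest is
  at most 63/19 * 0.2466, about 0.818.\<close>

lemma Re_sum_E2:
  assumes "X \<ge> 4"
  shows "Re (\<Sum>z\<in>primary_upto X. E2 z) \<ge> 66/100"
proof -
  have "(\<Sum>z\<in>primary_upto X. E2 z) = (\<Sum>z\<in>{1, -2}. E2 z) + (\<Sum>z\<in>primary_upto X - {1, -2}. E2 z)"
    using sum.subset_diff[OF one_minus2_primary_upto[OF assms] finite_primary_upto] by (simp add: add.commute)
  hence "Re (\<Sum>z\<in>primary_upto X. E2 z) = Re (E2 1 + E2 (-2)) + Re (\<Sum>z\<in>primary_upto X - {1, -2}. E2 z)" by simp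
  also have "E2 1 + E2 (-2) = of_real (9/5 - 9/28)" by (simp add: E2_def D2_def)
  also have "Re (of_real (9/5 - 9/28)) = 9/5 - 9/28" by simp
  finally have 1: "Re (\<Sum>z\<in>primary_upto X. E2 z) = 9/5 - 9/28 + Re (\<Sum>z\<in>primary_upto X - {1, -2}. E2 z)" .
  have "\<bar>Re (\<Sum>z\<in>primary_upto X - {1, -2}. E2 z)\<bar> \<le> cmod (\<Sum>z\<in>primary_upto X - {1, -2}. E2 z)" by (rule abs_Re_le_cmod)
  also have "\<dots> \<le> (\<Sum>z\<in>primary_upto X - {1, -2}. 63/19 * (1 / cmod z ^ 4))"
  proof (rule sum_norm_le)
    fix z assume "z \<in> primary_upto X - {1, -2}"
    hence "(cmod z)\<^sup>2 \<ge> 7" using primary_cmod_sq_cases[of z] by (auto simp: primary_upto_def)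
    thus "cmod (E2 z) \<le> 63/19 * (1 / cmod z ^ 4)" using norm_E2_le[of z] by simp
  qed
  also have "\<dots> = 63/19 * (\<Sum>z\<in>primary_upto X - {1, -2}. 1 / cmod z ^ 4)" by (rule sum_distrib_left[symmetric])
  also have "\<dots> \<le> 63/19 * (2466/10000)" by (intro mult_left_mono sum_inverse_fourth_powers) simp
  finally show ?thesis using 1 by simp
qed

text \<open>The function 1/z^2 is the inverse square of z/|z| divided by the norm of z, so this is
  the twist by twice the angle. The absolutely convergent part contributes at least 0.66 to Re L and
  the cut-off term takes away 2c/3, which is at most 8/15.3 because sqrt 3 \<ge> 1.7; hence Re L >
  0.\<close>

theorem phi2_limit:
  "\<exists>L C. L \<noteq> 0 \<and> (\<forall>X\<ge>1. cmod ((\<Sum>z\<in>primary_upto X. 1 / z ^ 2) - L) \<le> C / sqrt X)"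
proof -
  obtain c where c: "c > 0" "c \<le> 4 / (3 * sqrt 3)"
    "\<And>X. X \<ge> 1 \<Longrightarrow> \<bar>(\<Sum>n\<in>lattice_rows X. sqrt (X - row_height_sq n)) - c * X\<bar> \<le> sqrt X"
    using sum_sqrt_rows by blast
  obtain C1 where C1: "\<And>X. X \<ge> 1 \<Longrightarrow> cmod ((\<Sum>z\<in>primary_upto X. D2 z) + of_real (2 / 3 * c)) \<le> C1 / sqrt X"
    using sum_D2[OF c(3)] by blast
  obtain C2 where C2: "\<And>z. z \<in> primary \<Longrightarrow> cmod (E2 z) \<le> C2 / cmod z ^ 4" using norm_E2_le' by blast
  obtain K where K: "K > 0" "\<And>T. finite T \<Longrightarrow> T \<subseteq> primary \<Longrightarrow> (\<Sum>z\<in>T. 1 / cmod z ^ 3) \<le> K"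
    using sum_inv_cube_bounded by blast
  have C20: "C2 \<ge> 0" using order_trans[OF norm_ge_zero C2[OF one_primary]] by simp
  define F where "F = (\<lambda>X. \<Sum>z\<in>primary_upto X. 1 / z ^ 2)"
  define D where "D = (\<lambda>X. (\<Sum>z\<in>primary_upto X. D2 z) + of_real (2 / 3 * c))"
  define E where "E = (\<lambda>X. \<Sum>z\<in>primary_upto X. E2 z)"
  have FDE: "F X = E X + D X - of_real (2 / 3 * c)" for X
  proof -
    have "F X = (\<Sum>z\<in>primary_upto X. E2 z + D2 z)" unfolding F_def by (intro sum.cong refl) (simp add: E2_def)
    thus ?thesis by (simp add: E_def D_def sum.distrib)
  qed
  have Ediff: "cmod (E X' - E X) \<le> C2 * K / sqrt X" if X: "1 \<le> X" "X \<le> X'" for X X'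
  proof -
    have sub: "primary_upto X \<subseteq> primary_upto X'" using X by (auto simp: primary_upto_def)
    have "E X' - E X = (\<Sum>z\<in>primary_upto X' - primary_upto X. E2 z)"
      unfolding E_def by (rule sum_diff[OF finite_primary_upto sub, symmetric])
    also have "cmod \<dots> \<le> (\<Sum>z\<in>primary_upto X' - primary_upto X. C2 / sqrt X * (1 / cmod z ^ 3))"
    proof (rule sum_norm_le)
      fix z assume z: "z \<in> primary_upto X' - primary_upto X"
      hence p: "z \<in> primary" "X \<le> (cmod z)\<^sup>2" by (auto simp: primary_upto_def)
      have sX: "sqrt X \<le> cmod z" using real_sqrt_le_mono[OF p(2)] by simp
      have c1: "cmod z \<ge> 1" by (rule primary_cmod_ge_1[OF p(1)])
      have s1: "sqrt X > 0" using X by simp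
      have "cmod (E2 z) \<le> C2 / cmod z ^ 4" by (rule C2[OF p(1)])
      also have "\<dots> = C2 / cmod z * (1 / cmod z ^ 3)" by (simp add: eval_nat_numeral)
      also have "\<dots> \<le> C2 / sqrt X * (1 / cmod z ^ 3)"
        using sX s1 c1 C20 by (intro mult_right_mono divide_left_mono mult_pos_pos) auto
      finally show "cmod (E2 z) \<le> C2 / sqrt X * (1 / cmod z ^ 3)" .
    qed
    also have "\<dots> = C2 / sqrt X * (\<Sum>z\<in>primary_upto X' - primary_upto X. 1 / cmod z ^ 3)" by (rule sum_distrib_left[symmetric])
    also have "\<dots> \<le> C2 / sqrt X * K"
    proof (intro mult_left_mono K(2))
      show "finite (primary_upto X' - primary_upto X)" by (simp add: finite_primary_upto)
      show "primary_upto X' - primary_upto X \<subseteq> primary" by (auto simp: primary_upto_def)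
    qed (use C20 X in simp)
    finally show ?thesis by simp
  qed
  have C10: "C1 \<ge> 0" using order_trans[OF norm_ge_zero C1[of 1]] by simp
  define C where "C = C2 * K + 2 * C1"
  have "cmod (F X' - F X) \<le> C / sqrt X" if X: "1 \<le> X" "X \<le> X'" for X X'
  proof -
    have d': "cmod (D X') \<le> C1 / sqrt X'" using C1[of X'] X by (simp add: D_def)
    have "C1 / sqrt X' \<le> C1 / sqrt X" using X C10 by (intro divide_left_mono mult_pos_pos) auto
    hence d: "cmod (D X') \<le> C1 / sqrt X" "cmod (D X) \<le> C1 / sqrt X" using d' C1[of X] X by (auto simp: D_def)
    have "F X' - F X = (E X' - E X) + (D X' - D X)" unfolding FDE by simp
    also have "cmod \<dots> \<le> C2 * K / sqrt X + (C1 / sqrt X + C1 / sqrt X)"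
      by (rule norm_triangle_mono[OF Ediff[OF X]]) (rule order_trans[OF norm_triangle_ineq4 add_mono[OF d]])
    also have "\<dots> = C / sqrt X" by (simp add: C_def add_divide_distrib)
    finally show ?thesis .
  qed
  then obtain L where L: "(\<lambda>n. F (real n)) \<longlonglongrightarrow> L" "\<And>X. X \<ge> 1 \<Longrightarrow> cmod (F X - L) \<le> C / sqrt X"
    using cauchy_limit[of F C] by blast
  have "Re L \<ge> 66/100 - 2 / 3 * c"
  proof (rule tendsto_lowerbound)
    have "filterlim (\<lambda>n. sqrt (real n)) at_top sequentially"
      by (rule filterlim_compose[OF sqrt_at_top filterlim_real_sequentially])
    hence "(\<lambda>n. C1 / sqrt (real n)) \<longlonglongrightarrow> 0"
      by (intro tendsto_divide_0[OF tendsto_const] filterlim_at_top_imp_at_infinity)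
    hence "(\<lambda>n. Re (F (real n)) + C1 / sqrt (real n)) \<longlonglongrightarrow> Re L + 0"
      by (intro tendsto_add tendsto_Re L(1))
    thus "(\<lambda>n. Re (F (real n)) + C1 / sqrt (real n)) \<longlonglongrightarrow> Re L" by simp
    show "\<forall>\<^sub>F n in sequentially. 66/100 - 2 / 3 * c \<le> Re (F (real n)) + C1 / sqrt (real n)"
    proof (rule eventually_sequentiallyI[of 4])
      fix n :: nat assume n: "n \<ge> 4"
      have "Re (E (real n)) \<ge> 66/100" unfolding E_def using n by (intro Re_sum_E2) simp
      moreover have "cmod (D (real n)) \<le> C1 / sqrt (real n)" unfolding D_def by (rule C1) (use n in simp)
      hence "\<bar>Re (D (real n))\<bar> \<le> C1 / sqrt (real n)" by (rule order_trans[OF abs_Re_le_cmod])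
      moreover have "Re (F (real n)) = Re (E (real n)) + Re (D (real n)) - 2 / 3 * c"
        unfolding FDE by (simp only: minus_complex.sel plus_complex.sel Re_complex_of_real)
      ultimately show "66/100 - 2 / 3 * c \<le> Re (F (real n)) + C1 / sqrt (real n)" by linarith
    qed
  qed simp
  moreover have "2 / 3 * c < 66/100"
  proof -
    have "(17/10)\<^sup>2 \<le> (3 :: real)" by (simp add: power2_eq_square)
    hence s: "sqrt 3 \<ge> 17/10" by (rule real_le_rsqrt)
    have "c \<le> 4 / (3 * sqrt 3)" by (rule c(2))
    also have "\<dots> \<le> 4 / (3 * (17/10))" using s by (intro divide_left_mono mult_left_mono mult_pos_pos) auto
    finally show ?thesis by simp
  qed
  ultimately have "Re L > 0" by linarith
  hence "L \<noteq> 0" by auto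
  thus ?thesis using L(2) unfolding F_def by blast
qed

section \<open>The twist by the angle\<close>

lemma alternating_decreasing:
  fixes u :: "nat \<Rightarrow> real"
  assumes "\<And>k. u k \<ge> 0" "\<And>k. a \<le> k \<Longrightarrow> u (Suc k) \<le> u k"
  shows "0 \<le> (\<Sum>i<n. (-1) ^ i * u (a + i)) \<and> (\<Sum>i<n. (-1) ^ i * u (a + i)) \<le> u a"
  using assms(2)
proof (induction n arbitrary: a)
  case (Suc n)
  have "(\<Sum>i<Suc n. (-1) ^ i * u (a + i)) = u a - (\<Sum>i<n. (-1) ^ i * u (Suc a + i))"
    unfolding sum.lessThan_Suc_shift by (simp add: sum_negf)
  moreover have "0 \<le> (\<Sum>i<n. (-1) ^ i * u (Suc a + i)) \<and> (\<Sum>i<n. (-1) ^ i * u (Suc a + i)) \<le> u (Suc a)"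
    using Suc.prems by (intro Suc.IH) simp
  moreover have "u (Suc a) \<le> u a" by (rule Suc.prems) simp
  ultimately show ?case by linarith
qed (simp add: assms(1))

text \<open>Read backwards this is the decreasing case; the factor \<open>(-1) ^ (n - 1)\<close>
  normalises the sign to that of the last and largest term.\<close>

lemma alternating_increasing:
  fixes u :: "nat \<Rightarrow> real"
  assumes "\<And>k. u k \<ge> 0" "\<And>k. a \<le> k \<Longrightarrow> Suc k < a + n \<Longrightarrow> u k \<le> u (Suc k)"
  shows "0 \<le> (\<Sum>i<n. (-1) ^ i * u (a + i)) * (-1) ^ (n - 1) \<and>
    (n > 0 \<longrightarrow> (\<Sum>i<n. (-1) ^ i * u (a + i)) * (-1) ^ (n - 1) \<le> u (a + n - 1))"
  using assms(2)
proof (induction n)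
  case (Suc n)
  show ?case
  proof (cases "n = 0")
    case True
    thus ?thesis using assms(1) by simp
  next
    case False
    define Sg where "Sg = (\<Sum>i<n. (-1) ^ i * u (a + i))"
    define S where "S = Sg * (-1) ^ (n - 1)"
    define e where "e = (-1 :: real) ^ n"
    have sq: "e * e = 1" unfolding e_def by (simp flip: power_mult_distrib)
    have e': "e = - ((-1 :: real) ^ (n - 1))" using False unfolding e_def by (cases n) auto
    have "(\<Sum>i<Suc n. (-1) ^ i * u (a + i)) * e = (Sg + e * u (a + n)) * e" by (simp add: Sg_def e_def)
    also have "\<dots> = Sg * e + (e * e) * u (a + n)" by (simp add: distrib_right)
    also have "\<dots> = u (a + n) - S" unfolding sq S_def e' by simp
    finally have "(\<Sum>i<Suc n. (-1) ^ i * u (a + i)) * (-1) ^ n = u (a + n) - S" by (simp only: e_def)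
    moreover have "0 \<le> S \<and> S \<le> u (a + n - 1)" using Suc.IH Suc.prems False by (simp add: S_def Sg_def)
    moreover have "u (a + n - 1) \<le> u (a + n)" using Suc.prems[of "a + n - 1"] False by simp
    ultimately show ?thesis by simp
  qed
qed simp

lemma sum_lessThan_plus:
  fixes f :: "nat \<Rightarrow> real"
  shows "(\<Sum>i<m + k. f i) = (\<Sum>i<m. f i) + (\<Sum>i<k. f (m + i))"
  by (induction k) (simp_all add: add_ac)

text \<open>Cut at the peak t into an increasing and a decreasing stretch, each with an alternating
  sum of size at most M. Only values from index a onward enter M, so a late starting point gives a
  small bound.\<close>

lemma alternating_unimodal:
  fixes u :: "nat \<Rightarrow> real"
  assumes nn: "\<And>k. u k \<ge> 0" and M: "\<And>k. a \<le> k \<Longrightarrow> u k \<le> M"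
    and inc: "\<And>k. Suc k \<le> t \<Longrightarrow> u k \<le> u (Suc k)" and dec: "\<And>k. t < k \<Longrightarrow> u (Suc k) \<le> u k"
  shows "\<bar>\<Sum>i<n. (-1) ^ i * u (a + i)\<bar> \<le> 2 * M"
proof -
  \<comment> \<open>The number of terms with index at most t, capped by n; natural subtraction makes
    it 0 when the sum starts beyond the peak.\<close>
  define m where "m = min n (Suc t - a)"
  have split: "(\<Sum>i<n. (-1) ^ i * u (a + i)) = (\<Sum>i<m. (-1) ^ i * u (a + i)) + (-1) ^ m * (\<Sum>i<n - m. (-1) ^ i * u (a + m + i))"
  proof -
    have "(\<Sum>i<m + (n - m). (-1) ^ i * u (a + i)) = (\<Sum>i<m. (-1) ^ i * u (a + i)) + (\<Sum>i<n - m. (-1) ^ (m + i) * u (a + (m + i)))"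
      by (rule sum_lessThan_plus)
    moreover have "m + (n - m) = n" by (simp add: m_def)
    ultimately show ?thesis by (simp add: power_add sum_distrib_left add_ac mult_ac)
  qed
  have M0: "M \<ge> 0" using nn[of a] M[of a] by simp
  have "\<bar>\<Sum>i<m. (-1) ^ i * u (a + i)\<bar> \<le> M"
  proof -
    have "\<bar>\<Sum>i<m. (-1) ^ i * u (a + i)\<bar> = \<bar>(\<Sum>i<m. (-1) ^ i * u (a + i)) * (-1) ^ (m - 1)\<bar>"
      by (simp add: abs_mult)
    also have "\<dots> \<le> M"
    proof (cases "m = 0")
      case False
      have "0 \<le> (\<Sum>i<m. (-1) ^ i * u (a + i)) * (-1) ^ (m - 1) \<and>
        (m > 0 \<longrightarrow> (\<Sum>i<m. (-1) ^ i * u (a + i)) * (-1) ^ (m - 1) \<le> u (a + m - 1))"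
        by (rule alternating_increasing[OF nn]) (rule inc, simp add: m_def)
      moreover have "u (a + m - 1) \<le> M" by (rule M) (use False in simp)
      ultimately show ?thesis using False by simp
    qed (simp add: M0)
    finally show ?thesis .
  qed
  moreover have "\<bar>(-1) ^ m * (\<Sum>i<n - m. (-1) ^ i * u (a + m + i))\<bar> \<le> M"
  proof -
    have "\<bar>(-1) ^ m * (\<Sum>i<n - m. (-1) ^ i * u (a + m + i))\<bar> = \<bar>\<Sum>i<n - m. (-1) ^ i * u (a + m + i)\<bar>"
      by (simp add: abs_mult)
    also have "\<dots> \<le> M"
    proof (cases "n - m = 0")
      case False
      hence "m = Suc t - a" by (auto simp: m_def)
      hence "t < a + m" by simp
      hence "0 \<le> (\<Sum>i<n - m. (-1) ^ i * u (a + m + i)) \<and> (\<Sum>i<n - m. (-1) ^ i * u (a + m + i)) \<le> u (a + m)"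
        by (intro alternating_decreasing[OF nn] dec) simp
      moreover have "u (a + m) \<le> M" by (rule M) simp
      ultimately show ?thesis by simp
    qed (simp add: M0)
    finally show ?thesis .
  qed
  ultimately show ?thesis unfolding split by linarith
qed

section \<open>The profile of a single row\<close>

text \<open>The absolute value of the real part of z/|z|^3 at a point with |Re z| = t and (Im z)^2 =
  Y.\<close>

definition psi :: "real \<Rightarrow> real \<Rightarrow> real" where
  "psi Y t = t / sqrt (t\<^sup>2 + Y) ^ 3"

lemma psi_nonneg: "t \<ge> 0 \<Longrightarrow> Y \<ge> 0 \<Longrightarrow> psi Y t \<ge> 0"
  by (simp add: psi_def)

lemma psi_sq:
  assumes "Y \<ge> 0" shows "(psi Y t)\<^sup>2 = t\<^sup>2 / (t\<^sup>2 + Y) ^ 3"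
proof -
  have "(sqrt (t\<^sup>2 + Y) ^ 3)\<^sup>2 = (sqrt (t\<^sup>2 + Y) ^ 2) ^ 3" by (simp flip: power_mult)
  also have "sqrt (t\<^sup>2 + Y) ^ 2 = t\<^sup>2 + Y" using assms by simp
  finally show ?thesis by (simp add: psi_def power_divide)
qed

lemma psi_le:
  assumes "t > 0" "Y \<ge> 0" shows "psi Y t \<le> 1 / (t\<^sup>2 + Y)"
proof -
  define r where "r = sqrt (t\<^sup>2 + Y)"
  have r: "r > 0" "r\<^sup>2 = t\<^sup>2 + Y" "t \<le> r"
    using assms by (auto simp: r_def add_pos_nonneg intro!: real_le_rsqrt)
  have "psi Y t = t / r ^ 3" by (simp add: psi_def r_def)
  also have "\<dots> \<le> r / r ^ 3" using r by (intro divide_right_mono) auto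
  also have "\<dots> = 1 / r\<^sup>2" using r(1) by (simp add: power2_eq_square power3_eq_cube)
  finally show ?thesis by (simp add: r)
qed

text \<open>With q = t^2 the square of psi is q/(q + Y)^3; this factors the cross-multiplied
  difference of two such values. The last factor is decreasing in q1 and q2 and vanishes at q1 = q2
  = Y/2, so psi rises up to t^2 = Y/2 and falls afterwards.\<close>

lemma psi_cross:
  fixes q1 q2 Y :: real
  shows "q2 * (q1 + Y) ^ 3 - q1 * (q2 + Y) ^ 3 = (q2 - q1) * (Y ^ 3 - 3 * Y * (q1 * q2) - q1 * q2 * (q1 + q2))"
  by (simp add: power3_eq_cube algebra_simps)

lemma psi_mono_aux:
  assumes t: "0 < s" "0 < t" "Y > 0" and le: "s\<^sup>2 * (t\<^sup>2 + Y) ^ 3 \<le> t\<^sup>2 * (s\<^sup>2 + Y) ^ 3"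
  shows "psi Y s \<le> psi Y t"
proof -
  have pos: "s\<^sup>2 + Y > 0" "t\<^sup>2 + Y > 0" using t by (auto intro: add_pos_pos)
  have "s\<^sup>2 / (s\<^sup>2 + Y) ^ 3 \<le> t\<^sup>2 / (t\<^sup>2 + Y) ^ 3"
    using le pos by (simp add: pos_le_divide_eq pos_divide_le_eq mult_ac)
  hence "(psi Y s)\<^sup>2 \<le> (psi Y t)\<^sup>2" using t by (simp add: psi_sq)
  thus ?thesis by (rule power2_le_imp_le) (use t in \<open>simp add: psi_nonneg\<close>)
qed

lemma psi_inc:
  assumes "0 < s" "s \<le> t" "Y > 0" "2 * t\<^sup>2 \<le> Y"
  shows "psi Y s \<le> psi Y t"
proof (rule psi_mono_aux)
  define q1 q2 where "q1 = s\<^sup>2" and "q2 = t\<^sup>2"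
  have q: "0 \<le> q1" "q1 \<le> q2" "2 * q2 \<le> Y" using assms by (auto simp: q1_def q2_def intro!: power_mono)
  have "q1 * q2 \<le> (Y / 2) * (Y / 2)" using q by (intro mult_mono) auto
  hence p: "q1 * q2 \<le> Y * Y / 4" by simp
  have p1: "3 * Y * (q1 * q2) \<le> 3 * Y * (Y * Y / 4)" using p assms by (intro mult_left_mono) auto
  have "q1 * q2 * (q1 + q2) \<le> (Y * Y / 4) * Y" using p q assms by (intro mult_mono) auto
  hence "0 \<le> Y ^ 3 - 3 * Y * (q1 * q2) - q1 * q2 * (q1 + q2)" using p1 by (simp add: power3_eq_cube)
  hence "0 \<le> (q2 - q1) * (Y ^ 3 - 3 * Y * (q1 * q2) - q1 * q2 * (q1 + q2))" using q by (intro mult_nonneg_nonneg) auto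
  hence "0 \<le> q2 * (q1 + Y) ^ 3 - q1 * (q2 + Y) ^ 3" unfolding psi_cross .
  thus "s\<^sup>2 * (t\<^sup>2 + Y) ^ 3 \<le> t\<^sup>2 * (s\<^sup>2 + Y) ^ 3" by (simp add: q1_def q2_def)
qed (use assms in auto)

lemma psi_dec:
  assumes "0 < s" "s \<le> t" "Y > 0" "Y \<le> 2 * s\<^sup>2"
  shows "psi Y t \<le> psi Y s"
proof (rule psi_mono_aux)
  define q1 q2 where "q1 = s\<^sup>2" and "q2 = t\<^sup>2"
  have q: "0 \<le> q1" "q1 \<le> q2" "Y \<le> 2 * q1" using assms by (auto simp: q1_def q2_def intro!: power_mono)
  have "(Y / 2) * (Y / 2) \<le> q1 * q2" using q assms by (intro mult_mono) auto
  hence p: "Y * Y / 4 \<le> q1 * q2" by simp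
  have p1: "3 * Y * (Y * Y / 4) \<le> 3 * Y * (q1 * q2)" using p assms by (intro mult_left_mono) auto
  have "(Y * Y / 4) * Y \<le> q1 * q2 * (q1 + q2)" using p q assms by (intro mult_mono) auto
  hence "Y ^ 3 - 3 * Y * (q1 * q2) - q1 * q2 * (q1 + q2) \<le> 0" using p1 by (simp add: power3_eq_cube)
  hence "(q2 - q1) * (Y ^ 3 - 3 * Y * (q1 * q2) - q1 * q2 * (q1 + q2)) \<le> 0" using q by (intro mult_nonneg_nonpos) auto
  hence "q2 * (q1 + Y) ^ 3 - q1 * (q2 + Y) ^ 3 \<le> 0" unfolding psi_cross .
  thus "t\<^sup>2 * (s\<^sup>2 + Y) ^ 3 \<le> s\<^sup>2 * (t\<^sup>2 + Y) ^ 3" by (simp add: q1_def q2_def)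
qed (use assms in auto)

text \<open>At the peak t^2 = Y/2 the value is 2/(3 sqrt 3) / Y, and 0.385 is a rational upper bound
  for 2/(3 sqrt 3). The inequality 27/4 q Y^2 \<le> (q + Y)^3 has equality there.\<close>

lemma psi_max:
  assumes "t > 0" "Y > 0" shows "psi Y t \<le> 385/1000 / Y"
proof -
  define q where "q = t\<^sup>2"
  have q: "q > 0" using assms by (simp add: q_def)
  have "(q + Y) ^ 3 - 27/4 * (q * Y\<^sup>2) = (q - Y / 2)\<^sup>2 * (q + 4 * Y)"
    by (simp add: power2_eq_square power3_eq_cube field_simps)
  moreover have "(q - Y / 2)\<^sup>2 * (q + 4 * Y) \<ge> 0" using q assms by simp
  ultimately have "27/4 * (q * Y\<^sup>2) \<le> (q + Y) ^ 3" by linarith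
  moreover have "q * Y\<^sup>2 \<ge> 0" using q by simp
  ultimately have le: "q * Y\<^sup>2 \<le> (385/1000)\<^sup>2 * (q + Y) ^ 3" by (simp add: power2_eq_square)
  have pos: "(q + Y) ^ 3 > 0" using q assms by simp
  have "(psi Y t)\<^sup>2 = q / (q + Y) ^ 3" using assms by (simp add: psi_sq q_def)
  also have "\<dots> \<le> (385/1000)\<^sup>2 / Y\<^sup>2"
    using le pos assms by (simp add: pos_le_divide_eq pos_divide_le_eq mult_ac)
  also have "\<dots> = (385/1000 / Y)\<^sup>2" by (simp add: power_divide)
  finally show ?thesis by (rule power2_le_imp_le) (use assms in simp)
qed

text \<open>Ordered by absolute value, the real parts of the points in a row alternate in sign.\<close>

definition row_abs :: "int \<Rightarrow> nat \<Rightarrow> real" where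
  "row_abs n k = (if even n then 1 + real (k mod 2) else 1/2 + 2 * real (k mod 2)) + 3 * real (k div 2)"

text \<open>The real parts come out in the order 1, -2, 4, -5, ... in an even row and -1/2, 5/2,
  -7/2, 11/2, ... in an odd one.\<close>

definition row_index :: "int \<Rightarrow> nat \<Rightarrow> int" where
  "row_index n k = (if even n then (if even k then int (k div 2) else - 1 - int (k div 2))
     else (if even k then - int (k div 2) else int (k div 2) + 1))"

definition row_sign :: "int \<Rightarrow> real" where "row_sign n = (if even n then 1 else -1)"

lemma x_row_index: "row_offset n + 3 * real_of_int (row_index n k) = row_sign n * (-1) ^ k * row_abs n k"
  by (cases "even n"; cases "even k") (simp_all add: row_offset_def row_index_def row_sign_def row_abs_def mod2_eq_if algebra_simps)

lemma row_abs_pos: "row_abs n k > 0" by (simp add: row_abs_def add_pos_nonneg)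

lemma row_abs_less_Suc: "row_abs n k < row_abs n (Suc k)"
proof (cases "even k")
  case True
  hence "k mod 2 = 0" "Suc k mod 2 = 1" "Suc k div 2 = k div 2" by presburger+
  thus ?thesis by (simp add: row_abs_def)
next
  case False
  hence "k mod 2 = 1" "Suc k mod 2 = 0" "Suc k div 2 = Suc (k div 2)" by presburger+
  thus ?thesis by (simp add: row_abs_def)
qed

lemma row_abs_mono: "j \<le> k \<Longrightarrow> row_abs n j \<le> row_abs n k"
  by (rule lift_Suc_mono_le) (simp add: less_imp_le[OF row_abs_less_Suc])

lemma row_abs_ge: "real k \<le> 2 * row_abs n k"
proof -
  have "real k = real (k mod 2) + 2 * real (k div 2)"
    by (metis mod_mult_div_eq of_nat_add of_nat_mult of_nat_numeral)
  moreover have "row_abs n k \<ge> real (k mod 2) + 3 * real (k div 2)" by (simp add: row_abs_def)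
  ultimately show ?thesis by simp
qed

lemma bij_row_index: "bij (row_index n)"
proof (rule bij_betw_imageI)
  show "inj (row_index n)"
  proof (rule injI)
    fix j k assume h: "row_index n j = row_index n k"
    have "even n \<or> odd n" by simp
    thus "j = k" using h unfolding row_index_def
      by (cases "even n"; cases "even j"; cases "even k"; simp; presburger)
  qed
  show "range (row_index n) = UNIV"
  proof (intro equalityI subsetI UNIV_I)
    fix m :: int
    have "\<exists>k. row_index n k = m"
    proof (cases "even n")
      case True
      show ?thesis
      proof (cases "m \<ge> 0")
        case True
        thus ?thesis using \<open>even n\<close> by (intro exI[of _ "2 * nat m"]) (simp add: row_index_def)
      next
        case False
        thus ?thesis using \<open>even n\<close> by (intro exI[of _ "2 * nat (- 1 - m) + 1"]) (simp add: row_index_def)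
      qed
    next
      case False
      show ?thesis
      proof (cases "m \<le> 0")
        case True
        thus ?thesis using \<open>\<not> even n\<close> by (intro exI[of _ "2 * nat (- m)"]) (simp add: row_index_def)
      next
        case False
        thus ?thesis using \<open>\<not> even n\<close> by (intro exI[of _ "2 * nat (m - 1) + 1"]) (simp add: row_index_def)
      qed
    qed
    thus "m \<in> range (row_index n)" by (metis rangeI)
  qed
qed

lemma down_closed_lessThan:
  fixes D :: "nat set"
  assumes "finite D" "\<And>j k. k \<in> D \<Longrightarrow> j \<le> k \<Longrightarrow> j \<in> D"
  shows "\<exists>b. D = {..<b}"
proof (cases "D = {}")
  case False
  have "D = {..<Suc (Max D)}"
  proof (intro equalityI subsetI)
    fix k assume "k \<in> D" thus "k \<in> {..<Suc (Max D)}" using Max_ge[OF assms(1)] by (simp add: less_Suc_eq_le)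
  next
    fix k assume "k \<in> {..<Suc (Max D)}"
    hence "k \<le> Max D" by simp
    thus "k \<in> D" by (rule assms(2)[OF Max_in[OF assms(1) False]])
  qed
  thus ?thesis by blast
qed (auto intro: exI[of _ 0])

lemma row_abs_initial_segment: "\<exists>b. {k. (row_abs n k)\<^sup>2 \<le> B} = {..<b}"
proof (rule down_closed_lessThan)
  have "{k. (row_abs n k)\<^sup>2 \<le> B} \<subseteq> {..nat \<lceil>2 * sqrt B\<rceil>}"
  proof
    fix k assume "k \<in> {k. (row_abs n k)\<^sup>2 \<le> B}"
    hence "(row_abs n k)\<^sup>2 \<le> B" by simp
    hence "\<bar>row_abs n k\<bar> \<le> sqrt B" by (rule abs_le_of_sq_le)
    hence "real k \<le> 2 * sqrt B" using row_abs_ge[of k n] by linarith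
    thus "k \<in> {..nat \<lceil>2 * sqrt B\<rceil>}" unfolding atMost_iff by linarith
  qed
  thus "finite {k. (row_abs n k)\<^sup>2 \<le> B}" by (rule finite_subset) simp
  fix j k assume "k \<in> {k. (row_abs n k)\<^sup>2 \<le> B}" "j \<le> k"
  moreover have "(row_abs n j)\<^sup>2 \<le> (row_abs n k)\<^sup>2" using row_abs_mono[OF \<open>j \<le> k\<close>] row_abs_pos[of n j] by (intro power_mono) auto
  ultimately show "j \<in> {k. (row_abs n k)\<^sup>2 \<le> B}" by simp
qed

definition row_count :: "int \<Rightarrow> real \<Rightarrow> nat" where
  "row_count n X = (SOME b. {k. (row_abs n k)\<^sup>2 \<le> X - row_height_sq n} = {..<b})"

lemma row_count: "(row_abs n k)\<^sup>2 \<le> X - row_height_sq n \<longleftrightarrow> k < row_count n X"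
proof -
  have "{k. (row_abs n k)\<^sup>2 \<le> X - row_height_sq n} = {..<row_count n X}"
    unfolding row_count_def by (rule someI_ex[OF row_abs_initial_segment])
  hence "k \<in> {k. (row_abs n k)\<^sup>2 \<le> X - row_height_sq n} \<longleftrightarrow> k \<in> {..<row_count n X}" by (simp only:)
  thus ?thesis by simp
qed

lemma lattice_row_row_index: "lattice_row X n = row_index n ` {..<row_count n X}"
proof -
  have e: "(row_offset n + 3 * real_of_int (row_index n k))\<^sup>2 = (row_abs n k)\<^sup>2" for k
    unfolding x_row_index by (simp add: power_mult_distrib row_sign_def flip: power_mult)
  have "m \<in> lattice_row X n \<longleftrightarrow> m \<in> row_index n ` {..<row_count n X}" for m
  proof -
    obtain k where k: "m = row_index n k" using bij_row_index[of n] by (metis bij_pointE)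
    have "m \<in> lattice_row X n \<longleftrightarrow> k < row_count n X" unfolding k lattice_row_def row_count[symmetric]
      by (simp only: mem_Collect_eq of_int_mult of_int_numeral e)
    also have "\<dots> \<longleftrightarrow> m \<in> row_index n ` {..<row_count n X}"
      using bij_row_index[of n] unfolding k by (auto simp: bij_def inj_eq)
    finally show ?thesis .
  qed
  thus ?thesis by blast
qed

section \<open>Row sums of the twist and their limit\<close>

text \<open>The direction z/|z| divided by the norm |z|^2.\<close>

definition phi1 :: "complex \<Rightarrow> complex" where "phi1 z = z / of_real (cmod z ^ 3)"

lemma Re_phi1_row_index: "Re (phi1 (lattice_point n (row_index n k))) = row_sign n * ((-1) ^ k * psi (row_height_sq n) (row_abs n k))"
proof -
  let ?z = "lattice_point n (row_index n k)"
  have "(cmod ?z)\<^sup>2 = (row_abs n k)\<^sup>2 + row_height_sq n"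
    unfolding cmod_lattice_point_sq of_int_mult of_int_numeral x_row_index by (simp add: power_mult_distrib row_sign_def flip: power_mult)
  hence c: "cmod ?z = sqrt ((row_abs n k)\<^sup>2 + row_height_sq n)" by (metis norm_ge_zero real_sqrt_unique)
  have "Re (phi1 ?z) = Re ?z / cmod ?z ^ 3" by (simp only: phi1_def Re_divide_of_real)
  also have "Re ?z = row_sign n * (-1) ^ k * row_abs n k" unfolding Re_lattice_point of_int_mult of_int_numeral x_row_index ..
  finally show ?thesis unfolding c by (simp add: psi_def)
qed

definition rowsum :: "real \<Rightarrow> int \<Rightarrow> real" where
  "rowsum X n = (\<Sum>m\<in>lattice_row X n. Re (phi1 (lattice_point n m)))"

lemma rowsum_eq: "rowsum X n = row_sign n * (\<Sum>k<row_count n X. (-1) ^ k * psi (row_height_sq n) (row_abs n k))"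
proof -
  have inj: "inj_on (row_index n) {..<row_count n X}" using bij_row_index[of n] by (auto simp: bij_def intro: inj_on_subset)
  show ?thesis unfolding rowsum_def lattice_row_row_index
    by (subst sum.reindex[OF inj]) (simp add: Re_phi1_row_index sum_distrib_left)
qed

text \<open>In the central row the terms are 1/t^2 and decrease throughout. In every other row they
  are unimodal along the enumeration by absolute value, with the peak where t^2 passes half the
  squared height.\<close>

lemma alternating_row:
  assumes M: "\<And>k. a \<le> k \<Longrightarrow> psi (row_height_sq n) (row_abs n k) \<le> M"
  shows "\<bar>\<Sum>i<l. (-1) ^ i * psi (row_height_sq n) (row_abs n (a + i))\<bar> \<le> 2 * M"
proof (cases "n = 0")
  case True
  define u where "u = (\<lambda>k. psi (row_height_sq n) (row_abs n k))"
  have u: "u k = 1 / (row_abs n k)\<^sup>2" for k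
    using row_abs_pos[of n k] True by (simp add: u_def psi_def row_height_sq_def power2_eq_square power3_eq_cube)
  have u0: "u k \<ge> 0" for k by (simp add: u)
  have dec: "u (Suc k) \<le> u k" for k
    unfolding u using row_abs_pos[of n k] row_abs_pos[of n "Suc k"] less_imp_le[OF row_abs_less_Suc[of n k]]
    by (intro divide_left_mono power_mono mult_pos_pos zero_less_power) auto
  have "0 \<le> (\<Sum>i<l. (-1) ^ i * u (a + i)) \<and> (\<Sum>i<l. (-1) ^ i * u (a + i)) \<le> u a"
    by (rule alternating_decreasing[where u = u, OF u0 dec])
  moreover have "u a \<le> M" "0 \<le> u a" using M[of a] u0 by (auto simp: u_def)
  ultimately show ?thesis by (simp add: u_def)
next
  case False
  have Y: "row_height_sq n > 0" using False by (simp add: row_height_sq_def)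
  obtain c where "{k. (row_abs n k)\<^sup>2 \<le> row_height_sq n / 2} = {..<c}" using row_abs_initial_segment by blast
  hence "k \<in> {k. (row_abs n k)\<^sup>2 \<le> row_height_sq n / 2} \<longleftrightarrow> k \<in> {..<c}" for k by (simp only:)
  hence c: "(row_abs n k)\<^sup>2 \<le> row_height_sq n / 2 \<longleftrightarrow> k < c" for k by simp
  show ?thesis
  \<comment> \<open>The indices below c lie on the rising side, so c - 1 is the last of them. For c
    = 0 natural subtraction gives 0: no rise is claimed and descent only from index 1 on, which is
    still correct.\<close>
  proof (rule alternating_unimodal[where t = "c - 1"])
    show "psi (row_height_sq n) (row_abs n k) \<ge> 0" for k using row_abs_pos[of n k] Y by (simp add: psi_nonneg)
    show "psi (row_height_sq n) (row_abs n k) \<le> M" if "a \<le> k" for k by (rule M[OF that])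
    show "psi (row_height_sq n) (row_abs n k) \<le> psi (row_height_sq n) (row_abs n (Suc k))" if "Suc k \<le> c - 1" for k
    proof (rule psi_inc[OF row_abs_pos less_imp_le[OF row_abs_less_Suc] Y])
      have "Suc k < c" using that by linarith
      thus "2 * (row_abs n (Suc k))\<^sup>2 \<le> row_height_sq n" using c[of "Suc k"] by simp
    qed
    show "psi (row_height_sq n) (row_abs n (Suc k)) \<le> psi (row_height_sq n) (row_abs n k)" if "c - 1 < k" for k
    proof (rule psi_dec[OF row_abs_pos less_imp_le[OF row_abs_less_Suc] Y])
      have "\<not> k < c" using that by linarith
      thus "row_height_sq n \<le> 2 * (row_abs n k)\<^sup>2" using c[of k] by simp
    qed
  qed
qed

text \<open>The points that enter between X and X' form a consecutive stretch of the enumeration,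
  all of squared modulus above X and at least the squared height of the row. The alternating bound
  therefore costs only twice one term, of size 1 / max X Y for squared height Y.\<close>

lemma rowsum_diff:
  assumes X: "1 \<le> X" "X \<le> X'"
  shows "\<bar>rowsum X' n - rowsum X n\<bar> \<le> 2 / max X (row_height_sq n)"
proof -
  define a where "a = row_count n X"
  have "row_count n X \<le> row_count n X'"
  proof (rule ccontr)
    assume "\<not> row_count n X \<le> row_count n X'"
    hence "row_count n X' < row_count n X" by simp
    hence "(row_abs n (row_count n X'))\<^sup>2 \<le> X - row_height_sq n" unfolding row_count .
    hence "(row_abs n (row_count n X'))\<^sup>2 \<le> X' - row_height_sq n" using X by linarith
    thus False unfolding row_count by simp
  qed
  then obtain l where l: "row_count n X' = a + l" using le_Suc_ex a_def by blast
  have "rowsum X' n - rowsum X n = row_sign n * (\<Sum>i<l. (-1) ^ (a + i) * psi (row_height_sq n) (row_abs n (a + i)))"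
    unfolding rowsum_eq l a_def[symmetric] sum_lessThan_plus by (simp add: algebra_simps)
  also have "(\<Sum>i<l. (-1) ^ (a + i) * psi (row_height_sq n) (row_abs n (a + i))) = (-1) ^ a * (\<Sum>i<l. (-1) ^ i * psi (row_height_sq n) (row_abs n (a + i)))"
    by (simp add: power_add sum_distrib_left mult.assoc)
  finally have "\<bar>rowsum X' n - rowsum X n\<bar> = \<bar>\<Sum>i<l. (-1) ^ i * psi (row_height_sq n) (row_abs n (a + i))\<bar>"
    by (simp add: abs_mult row_sign_def)
  also have "\<dots> \<le> 2 * (1 / max X (row_height_sq n))"
  proof (rule alternating_row)
    fix k assume k: "a \<le> k"
    hence "\<not> k < row_count n X" by (simp add: a_def)
    hence "X - row_height_sq n < (row_abs n k)\<^sup>2" using row_count[of n k X] by linarith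
    hence le: "max X (row_height_sq n) \<le> (row_abs n k)\<^sup>2 + row_height_sq n" by simp
    have "psi (row_height_sq n) (row_abs n k) \<le> 1 / ((row_abs n k)\<^sup>2 + row_height_sq n)" by (rule psi_le[OF row_abs_pos row_height_sq_nonneg])
    also have "\<dots> \<le> 1 / max X (row_height_sq n)"
      using le X by (intro divide_left_mono mult_pos_pos) auto
    finally show "psi (row_height_sq n) (row_abs n k) \<le> 1 / max X (row_height_sq n)" .
  qed
  finally show ?thesis by simp
qed

lemma rowsum_bound:
  assumes "n \<noteq> 0"
  shows "\<bar>rowsum X n\<bar> \<le> (2 * (385/1000) * (4/27)) * (1 / (real_of_int n)\<^sup>2)"
proof -
  have Y: "row_height_sq n > 0" using assms by (simp add: row_height_sq_def)
  have "\<bar>rowsum X n\<bar> = \<bar>\<Sum>i<row_count n X. (-1) ^ i * psi (row_height_sq n) (row_abs n (0 + i))\<bar>"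
    unfolding rowsum_eq by (simp add: abs_mult row_sign_def)
  also have "\<dots> \<le> 2 * (385/1000 / row_height_sq n)"
    by (rule alternating_row) (rule psi_max[OF row_abs_pos Y])
  also have "\<dots> = (2 * (385/1000) * (4/27)) * (1 / (real_of_int n)\<^sup>2)" by (simp add: row_height_sq_def)
  finally show ?thesis .
qed

text \<open>The first two terms are 1 - 1/4; the remaining alternating sum starts with a positive
  term and decreases, so it is nonnegative.\<close>

lemma rowsum_0:
  assumes "X \<ge> 4" shows "rowsum X 0 \<ge> 3/4"
proof -
  define u where "u = (\<lambda>k. psi (row_height_sq 0) (row_abs 0 k))"
  have u: "u k = 1 / (row_abs 0 k)\<^sup>2" for k
    using row_abs_pos[of 0 k] by (simp add: u_def psi_def row_height_sq_def power2_eq_square power3_eq_cube)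
  have dec: "u (Suc k) \<le> u k" for k
    unfolding u using row_abs_pos[of 0 k] row_abs_pos[of 0 "Suc k"] less_imp_le[OF row_abs_less_Suc[of 0 k]]
    by (intro divide_left_mono power_mono mult_pos_pos zero_less_power) auto
  have row_abs: "row_abs 0 (Suc 0) = 2" "row_abs 0 0 = 1" by (simp_all add: row_abs_def)
  hence "Suc 0 < row_count 0 X" unfolding row_count[symmetric] using assms by (simp add: row_height_sq_def)
  then obtain l where l: "row_count 0 X = 2 + l" using le_Suc_ex[of 2 "row_count 0 X"] by auto
  have "rowsum X 0 = (\<Sum>k<2 + l. (-1) ^ k * u k)" unfolding rowsum_eq l by (simp add: row_sign_def u_def)
  also have "\<dots> = (\<Sum>k<2. (-1) ^ k * u k) + (\<Sum>i<l. (-1) ^ (2 + i) * u (2 + i))" by (rule sum_lessThan_plus)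
  also have "(\<Sum>k<2. (-1) ^ k * u k) = u 0 - u 1" by (simp add: numeral_2_eq_2)
  also have "u 0 - u 1 = 3/4" by (simp add: u row_abs)
  also have "(\<Sum>i<l. (-1) ^ (2 + i) * u (2 + i)) = (\<Sum>i<l. (-1) ^ i * u (2 + i))"
    by (simp add: power_add)
  finally have "rowsum X 0 = 3/4 + (\<Sum>i<l. (-1) ^ i * u (2 + i))" .
  moreover have "0 \<le> (\<Sum>i<l. (-1) ^ i * u (2 + i))"
    using alternating_decreasing[where u = u and a = 2 and n = l] dec by (simp add: u)
  ultimately show ?thesis by linarith
qed

lemma sum_inverse_squares_tail:
  assumes "a \<ge> 1" shows "(\<Sum>i=a..K. 1 / (real i)\<^sup>2) \<le> 2 / real a"
proof (cases "a \<le> K")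
  case True
  have "(\<Sum>i=a..K. 1 / (real i)\<^sup>2) \<le> 2 / real a - 1 / real K"
    using True
  proof (induction K rule: dec_induct)
    case base
    have "1 / (real a)\<^sup>2 \<le> 1 / real a" using assms by (simp add: power2_eq_square divide_simps)
    thus ?case by simp
  next
    case (step K)
    have K: "real K \<ge> 1" using step assms by simp
    have "1 / (real (Suc K))\<^sup>2 \<le> 1 / (real K * (real K + 1))"
      using K by (intro divide_left_mono mult_pos_pos zero_less_power) (auto simp: power2_eq_square algebra_simps)
    also have "\<dots> = 1 / real K - 1 / real (Suc K)" using K by (simp add: divide_simps)
    finally show ?case using step by simp
  qed
  moreover have "1 / real K \<ge> 0" by simp
  ultimately show ?thesis by linarith
qed simp

lemma sum_lattice_rows_tail:
  assumes X: "X \<ge> 1"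
  shows "(\<Sum>n\<in>lattice_rows X' - lattice_rows X. 2 / row_height_sq n) \<le> 4 / sqrt X"
proof -
  \<comment> \<open>A row misses the disc of squared radius X when |n| exceeds r. Since 0.09 < 4/27,
    r is at least 0.3 sqrt X, which yields the final constant 4.\<close>
  define r where "r = sqrt (4 * X / 27)"
  have r0: "r > 0" using X by (simp add: r_def)
  define a where "a = nat \<lceil>r\<rceil>"
  have a: "a \<ge> 1" "real a \<ge> r" using r0 unfolding a_def by linarith+
  define K where "K = nat \<lfloor>sqrt X'\<rfloor>"
  have sub: "lattice_rows X' - lattice_rows X \<subseteq> int ` {a..K} \<union> (\<lambda>i. - int i) ` {a..K}"
  proof
    fix n assume n: "n \<in> lattice_rows X' - lattice_rows X"
    hence "X < row_height_sq n" by (simp add: lattice_rows_def)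
    hence "4 * X / 27 \<le> (real_of_int n)\<^sup>2" by (simp add: row_height_sq_def)
    hence "r \<le> \<bar>real_of_int n\<bar>" using real_sqrt_le_mono[of "4 * X / 27" "(real_of_int n)\<^sup>2"] by (simp add: r_def)
    hence 1: "a \<le> nat \<bar>n\<bar>" unfolding a_def by linarith
    have "n \<in> {- \<lfloor>sqrt X'\<rfloor>..\<lfloor>sqrt X'\<rfloor>}" using n lattice_rows_subset[of X'] by blast
    hence 2: "nat \<bar>n\<bar> \<le> K" unfolding K_def by auto
    define i where "i = nat \<bar>n\<bar>"
    have "n = int i \<or> n = - int i" by (auto simp: i_def)
    moreover have "i \<in> {a..K}" using 1 2 by (simp add: i_def)
    ultimately show "n \<in> int ` {a..K} \<union> (\<lambda>i. - int i) ` {a..K}" by blast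
  qed
  have f0: "1 / (real_of_int n)\<^sup>2 \<ge> 0" for n by simp
  have "(\<Sum>n\<in>lattice_rows X' - lattice_rows X. 1 / (real_of_int n)\<^sup>2)
      \<le> (\<Sum>n\<in>int ` {a..K} \<union> (\<lambda>i. - int i) ` {a..K}. 1 / (real_of_int n)\<^sup>2)"
    by (rule sum_mono2[OF _ sub]) auto
  also have "\<dots> \<le> (\<Sum>n\<in>int ` {a..K}. 1 / (real_of_int n)\<^sup>2) + (\<Sum>n\<in>(\<lambda>i. - int i) ` {a..K}. 1 / (real_of_int n)\<^sup>2)"
    using sum.union_inter[of "int ` {a..K}" "(\<lambda>i. - int i) ` {a..K}" "\<lambda>n. 1 / (real_of_int n)\<^sup>2"]
      sum_nonneg[of "int ` {a..K} \<inter> (\<lambda>i. - int i) ` {a..K}" "\<lambda>n. 1 / (real_of_int n)\<^sup>2"] by simp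
  also have "(\<Sum>n\<in>int ` {a..K}. 1 / (real_of_int n)\<^sup>2) = (\<Sum>i=a..K. 1 / (real i)\<^sup>2)"
    by (subst sum.reindex) (auto simp: inj_on_def)
  also have "(\<Sum>n\<in>(\<lambda>i. - int i) ` {a..K}. 1 / (real_of_int n)\<^sup>2) = (\<Sum>i=a..K. 1 / (real i)\<^sup>2)"
    by (subst sum.reindex) (auto simp: inj_on_def)
  also have "(\<Sum>i=a..K. 1 / (real i)\<^sup>2) + (\<Sum>i=a..K. 1 / (real i)\<^sup>2) \<le> 2 / real a + 2 / real a"
    by (intro add_mono sum_inverse_squares_tail a)
  also have "\<dots> = 4 / real a" by simp
  also have "\<dots> \<le> 4 / r" using a r0 by (intro divide_left_mono mult_pos_pos) auto
  finally have 1: "(\<Sum>n\<in>lattice_rows X' - lattice_rows X. 1 / (real_of_int n)\<^sup>2) \<le> 4 / r" .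
  have "(\<Sum>n\<in>lattice_rows X' - lattice_rows X. 2 / row_height_sq n) = 8/27 * (\<Sum>n\<in>lattice_rows X' - lattice_rows X. 1 / (real_of_int n)\<^sup>2)"
    unfolding sum_distrib_left by (intro sum.cong refl) (simp add: row_height_sq_def)
  also have "\<dots> \<le> 8/27 * (4 / r)" using 1 by (intro mult_left_mono) auto
  also have "\<dots> \<le> 4 / sqrt X"
  proof -
    have "(3/10)\<^sup>2 * X \<le> 4 * X / 27" using X by (simp add: power2_eq_square)
    hence "sqrt ((3/10)\<^sup>2 * X) \<le> r" unfolding r_def by (rule real_sqrt_le_mono)
    hence r: "3/10 * sqrt X \<le> r" by (simp add: real_sqrt_mult)
    have "32/27 / r \<le> 32/27 / (3/10 * sqrt X)" using r r0 X by (intro divide_left_mono mult_pos_pos) auto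
    also have "\<dots> \<le> 4 / sqrt X" using X by (simp add: divide_simps)
    finally show ?thesis by simp
  qed
  finally show ?thesis .
qed

lemma cnj_primary_upto: "cnj ` primary_upto X = primary_upto X"
proof -
  have "cnj z \<in> primary_upto X" if "z \<in> primary_upto X" for z using that by (simp add: primary_upto_def cnj_primary)
  moreover from this have "z \<in> cnj ` primary_upto X" if "z \<in> primary_upto X" for z
    using that by (intro image_eqI[of _ _ "cnj z"]) simp_all
  ultimately show ?thesis by blast
qed

text \<open>Conjugation symmetry makes the sums real, so only real parts of rows matter. Passing
  from X to X' changes each of the at most 3 sqrt X rows inside the disc by at most 2/X, and the
  rows outside contribute at most 4 / sqrt X. For the sign, the central row gives at least 3/4 and
  all others together at most 0.4.\<close>

theorem phi1_limit:
  "\<exists>L C. L \<noteq> 0 \<and> (\<forall>X\<ge>1. cmod ((\<Sum>z\<in>primary_upto X. phi1 z) - L) \<le> C / sqrt X)"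
proof -
  define F where "F = (\<lambda>X. \<Sum>z\<in>primary_upto X. phi1 z)"
  have ReF: "Re (F X) = (\<Sum>n\<in>lattice_rows X. rowsum X n)" for X
    by (simp add: F_def rowsum_def sum_primary_upto)
  have ImF: "Im (F X) = 0" for X
  proof -
    have "F X = (\<Sum>z\<in>cnj ` primary_upto X. phi1 z)" by (simp only: F_def cnj_primary_upto)
    also have "\<dots> = (\<Sum>z\<in>primary_upto X. phi1 (cnj z))" by (subst sum.reindex) (auto simp: inj_on_def)
    also have "\<dots> = cnj (F X)" by (simp add: F_def phi1_def)
    finally have "Im (F X) = Im (cnj (F X))" by (rule arg_cong)
    thus ?thesis by simp
  qed
  have diff: "cmod (F X' - F X) \<le> 10 / sqrt X" if X: "1 \<le> X" "X \<le> X'" for X X'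
  proof -
    have sub: "lattice_rows X \<subseteq> lattice_rows X'" using X by (auto simp: lattice_rows_def)
    have "(\<Sum>n\<in>lattice_rows X. rowsum X n) = (\<Sum>n\<in>lattice_rows X'. rowsum X n)"
      using sub by (intro sum.mono_neutral_left finite_lattice_rows) (auto simp: rowsum_def lattice_row_empty)
    hence "Re (F X') - Re (F X) = (\<Sum>n\<in>lattice_rows X'. rowsum X' n - rowsum X n)"
      unfolding ReF by (simp add: sum_subtractf)
    hence "\<bar>Re (F X') - Re (F X)\<bar> \<le> (\<Sum>n\<in>lattice_rows X'. 2 / max X (row_height_sq n))"
      using order_trans[OF sum_abs sum_mono[OF rowsum_diff[OF X]]] by simp
    also have "\<dots> = (\<Sum>n\<in>lattice_rows X. 2 / max X (row_height_sq n)) + (\<Sum>n\<in>lattice_rows X' - lattice_rows X. 2 / max X (row_height_sq n))"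
      using sum.subset_diff[OF sub finite_lattice_rows] by (simp add: add.commute)
    also have "(\<Sum>n\<in>lattice_rows X. 2 / max X (row_height_sq n)) = (\<Sum>n\<in>lattice_rows X. 2 / X)"
      by (intro sum.cong refl) (simp add: lattice_rows_def max_def)
    also have "\<dots> = real (card (lattice_rows X)) * (2 / X)" by simp
    also have "\<dots> \<le> (3 * sqrt X) * (2 / X)" using X by (intro mult_right_mono card_lattice_rows_le) auto
    also have "\<dots> = 6 / sqrt X"
    proof -
      have "sqrt X > 0" "sqrt X * sqrt X = X" using X by simp_all
      thus ?thesis using X by (simp add: divide_simps)
    qed
    also have "(\<Sum>n\<in>lattice_rows X' - lattice_rows X. 2 / max X (row_height_sq n)) = (\<Sum>n\<in>lattice_rows X' - lattice_rows X. 2 / row_height_sq n)"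
      by (intro sum.cong refl) (simp add: lattice_rows_def max_def)
    also have "\<dots> \<le> 4 / sqrt X" by (rule sum_lattice_rows_tail[OF X(1)])
    finally have "\<bar>Re (F X') - Re (F X)\<bar> \<le> 10 / sqrt X" by simp
    moreover have "cmod (F X' - F X) = \<bar>Re (F X') - Re (F X)\<bar>"
      by (simp add: cmod_def ImF)
    ultimately show ?thesis by simp
  qed
  obtain L where L: "(\<lambda>n. F (real n)) \<longlonglongrightarrow> L" "\<And>X. X \<ge> 1 \<Longrightarrow> cmod (F X - L) \<le> 10 / sqrt X"
    using cauchy_limit[of F 10] diff by blast
  have "Re L \<ge> 1/3"
  proof (rule tendsto_lowerbound)
    show "(\<lambda>n. Re (F (real n))) \<longlonglongrightarrow> Re L" by (intro tendsto_Re L(1))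
    show "\<forall>\<^sub>F n in sequentially. 1/3 \<le> Re (F (real n))"
    proof (rule eventually_sequentiallyI[of 4])
      fix n :: nat assume n: "n \<ge> 4"
      define X where "X = real n"
      have X: "X \<ge> 4" using n by (simp add: X_def)
      have "0 \<in> lattice_rows X" using X by (simp add: lattice_rows_def row_height_sq_def)
      hence "Re (F X) = rowsum X 0 + (\<Sum>n\<in>lattice_rows X - {0}. rowsum X n)"
        unfolding ReF by (intro sum.remove finite_lattice_rows)
      moreover have "\<bar>\<Sum>n\<in>lattice_rows X - {0}. rowsum X n\<bar> \<le> (\<Sum>n\<in>lattice_rows X - {0}. (2 * (385/1000) * (4/27)) * (1 / (real_of_int n)\<^sup>2))"
        by (rule order_trans[OF sum_abs sum_mono]) (rule rowsum_bound, simp)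
      moreover have "(\<Sum>n\<in>lattice_rows X - {0}. (2 * (385/1000) * (4/27)) * (1 / (real_of_int n)\<^sup>2)) \<le> (2 * (385/1000) * (4/27)) * (10/3)"
        unfolding sum_distrib_left[symmetric] by (intro mult_left_mono sum_lattice_rows_inverse_squares) simp
      moreover have "(2 * (385/1000) * (4/27)) * (10/3) \<le> (4/10 :: real)" by simp
      ultimately show "1/3 \<le> Re (F (real n))" using rowsum_0[OF X] unfolding X_def by linarith
    qed
  qed simp
  hence "L \<noteq> 0" by auto
  thus ?thesis using L(2) unfolding F_def by blast
qed

section \<open>Mertens-type estimates\<close>

definition prime_powers_upto :: "real \<Rightarrow> (complex \<times> nat) set" where
  "prime_powers_upto X = {(\<pi>, k). \<pi> \<in> pprimes \<and> k \<ge> 1 \<and> real (enorm \<pi>) ^ k \<le> X}"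

definition pprimes_upto :: "real \<Rightarrow> complex set" where
  "pprimes_upto X = {\<pi> \<in> pprimes. real (enorm \<pi>) \<le> X}"

lemma primary_upto_enorm: "z \<in> primary_upto X \<longleftrightarrow> z \<in> primary \<and> real (enorm z) \<le> X"
  using of_nat_enorm[OF primary_eisenstein, of z] by (auto simp: primary_upto_def)

lemma pprimes_upto_subset: "pprimes_upto X \<subseteq> primary_upto X"
  using pprimes_primary by (auto simp: pprimes_upto_def primary_upto_enorm)

lemma finite_pprimes_upto: "finite (pprimes_upto X)" by (rule finite_subset[OF pprimes_upto_subset finite_primary_upto])

lemma enorm_ge_2: "\<pi> \<in> pprimes \<Longrightarrow> real (enorm \<pi>) \<ge> 2"
  using pprimes_enorm[of \<pi>] by simp

lemma prime_powers_upto_subset: "prime_powers_upto X \<subseteq> pprimes_upto X \<times> {1..nat \<lfloor>X\<rfloor>}"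
proof
  fix x assume "x \<in> prime_powers_upto X"
  then obtain \<pi> k where x: "x = (\<pi>, k)" "\<pi> \<in> pprimes" "k \<ge> 1" "real (enorm \<pi>) ^ k \<le> X" by (auto simp: prime_powers_upto_def)
  have N: "real (enorm \<pi>) \<ge> 2" by (rule enorm_ge_2[OF x(2)])
  have "real (enorm \<pi>) \<le> real (enorm \<pi>) ^ k" using N x(3) by (intro self_le_power) auto
  hence "real (enorm \<pi>) \<le> X" using x(4) by linarith
  hence 1: "\<pi> \<in> pprimes_upto X" using x by (simp add: pprimes_upto_def)
  have "real k \<le> 2 ^ k" using of_nat_less_two_power[of k, where 'a = real] by simp
  also have "\<dots> \<le> real (enorm \<pi>) ^ k" using N by (intro power_mono) auto
  finally have "real k \<le> X" using x(4) by linarith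
  hence "k \<le> nat \<lfloor>X\<rfloor>" by linarith
  thus "x \<in> pprimes_upto X \<times> {1..nat \<lfloor>X\<rfloor>}" using 1 x by simp
qed

lemma finite_prime_powers_upto: "finite (prime_powers_upto X)"
  by (rule finite_subset[OF prime_powers_upto_subset]) (simp add: finite_pprimes_upto)

lemma prime_powers_dvd_subset:
  assumes "z \<in> primary_upto X" shows "prime_powers_dvd z \<subseteq> prime_powers_upto X"
proof
  fix x assume "x \<in> prime_powers_dvd z"
  then obtain \<pi> k where x: "x = (\<pi>, k)" "\<pi> \<in> pprimes" "k \<ge> 1" "\<pi> ^ k pdvd z" by (auto simp: prime_powers_dvd_def)
  have p: "\<pi> \<in> primary" by (rule pprimes_primary[OF x(2)])
  have z: "z \<in> primary" "real (enorm z) \<le> X" using assms by (auto simp: primary_upto_enorm)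
  have "enorm (\<pi> ^ k) dvd enorm z" by (rule pdvd_enorm[OF x(4) primary_power[OF p]])
  hence "enorm \<pi> ^ k \<le> enorm z" using enorm_pos[OF z(1)] by (intro dvd_imp_le) (simp_all add: enorm_power[OF p])
  hence "real (enorm \<pi> ^ k) \<le> real (enorm z)" by (simp only: of_nat_le_iff)
  hence "real (enorm \<pi>) ^ k \<le> X" using z(2) unfolding of_nat_power by linarith
  thus "x \<in> prime_powers_upto X" using x by (simp add: prime_powers_upto_def)
qed

lemma multiples_primary_upto:
  assumes d: "d \<in> primary"
  shows "{z \<in> primary_upto X. d pdvd z} = (\<lambda>e. d * e) ` primary_upto (X / real (enorm d))"
proof -
  have N: "real (enorm d) > 0" using enorm_pos[OF d] by simp
  have le: "real (enorm (d * e)) \<le> X \<longleftrightarrow> real (enorm e) \<le> X / real (enorm d)" if "e \<in> primary" for e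
    using that N by (simp add: enorm_mult primary_eisenstein d pos_le_divide_eq mult.commute)
  show ?thesis
  proof (intro equalityI subsetI)
    fix z assume "z \<in> {z \<in> primary_upto X. d pdvd z}"
    then obtain e where e: "e \<in> primary" "z = d * e" "real (enorm z) \<le> X" by (auto simp: pdvd_def primary_upto_enorm)
    hence "e \<in> primary_upto (X / real (enorm d))" using le[of e] by (simp add: primary_upto_enorm)
    thus "z \<in> (\<lambda>e. d * e) ` primary_upto (X / real (enorm d))" using e(2) by (rule rev_image_eqI)
  next
    fix z assume "z \<in> (\<lambda>e. d * e) ` primary_upto (X / real (enorm d))"
    then obtain e where e: "e \<in> primary" "real (enorm e) \<le> X / real (enorm d)" "z = d * e" by (auto simp: primary_upto_enorm)
    show "z \<in> {z \<in> primary_upto X. d pdvd z}"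
      using e le[of e] primary_mult[OF d e(1)] by (auto simp: primary_upto_enorm pdvd_def)
  qed
qed

text \<open>Insert log N z as the sum of log N\<pi> over the prime powers dividing z, exchange the
  sums, and parametrise the multiples of \<pi>^k as \<pi>^k e with e primary of norm at most X /
  N\<pi>^k.\<close>

lemma convolution_identity:
  fixes \<phi> :: "complex \<Rightarrow> complex"
  assumes mult: "\<And>z w. z \<in> primary \<Longrightarrow> w \<in> primary \<Longrightarrow> \<phi> (z * w) = \<phi> z * \<phi> w" and one: "\<phi> 1 = 1"
  shows "(\<Sum>z\<in>primary_upto X. \<phi> z * of_real (ln (real (enorm z)))) =
    (\<Sum>(\<pi>, k)\<in>prime_powers_upto X. of_real (ln (real (enorm \<pi>))) * (\<phi> \<pi> ^ k * (\<Sum>e\<in>primary_upto (X / real (enorm \<pi>) ^ k). \<phi> e)))"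
proof -
  have pow: "\<phi> (\<pi> ^ k) = \<phi> \<pi> ^ k" if "\<pi> \<in> primary" for \<pi> k
    by (induction k) (simp_all add: one mult primary_power that)
  have "(\<Sum>z\<in>primary_upto X. \<phi> z * of_real (ln (real (enorm z)))) =
     (\<Sum>z\<in>primary_upto X. \<Sum>x\<in>prime_powers_upto X. if fst x ^ snd x pdvd z then of_real (ln (real (enorm (fst x)))) * \<phi> z else 0)"
  proof (rule sum.cong[OF refl])
    fix z assume z: "z \<in> primary_upto X"
    hence zp: "z \<in> primary" by (simp add: primary_upto_enorm)
    have "ln (real (enorm z)) = (\<Sum>(\<pi>, k)\<in>prime_powers_dvd z. ln (real (enorm \<pi>)))"
      using log_norm_sum[OF zp] by simp
    also have "\<dots> = (\<Sum>x\<in>prime_powers_dvd z. ln (real (enorm (fst x))))" by (simp add: case_prod_unfold)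
    also have "prime_powers_dvd z = {x \<in> prime_powers_upto X. fst x ^ snd x pdvd z}"
      using prime_powers_dvd_subset[OF z] by (auto simp: prime_powers_dvd_def prime_powers_upto_def)
    also have "(\<Sum>x\<in>{x \<in> prime_powers_upto X. fst x ^ snd x pdvd z}. ln (real (enorm (fst x)))) =
        (\<Sum>x\<in>prime_powers_upto X. if fst x ^ snd x pdvd z then ln (real (enorm (fst x))) else 0)"
      by (rule sum.inter_filter[OF finite_prime_powers_upto])
    finally have "ln (real (enorm z)) = (\<Sum>x\<in>prime_powers_upto X. if fst x ^ snd x pdvd z then ln (real (enorm (fst x))) else 0)" .
    hence "\<phi> z * of_real (ln (real (enorm z))) = \<phi> z * of_real (\<Sum>x\<in>prime_powers_upto X. if fst x ^ snd x pdvd z then ln (real (enorm (fst x))) else 0)"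
      by (simp only:)
    also have "\<dots> = (\<Sum>x\<in>prime_powers_upto X. \<phi> z * of_real (if fst x ^ snd x pdvd z then ln (real (enorm (fst x))) else 0))"
      by (simp only: of_real_sum sum_distrib_left)
    also have "\<dots> = (\<Sum>x\<in>prime_powers_upto X. if fst x ^ snd x pdvd z then of_real (ln (real (enorm (fst x)))) * \<phi> z else 0)"
      by (intro sum.cong refl) simp
    finally show "\<phi> z * of_real (ln (real (enorm z))) = (\<Sum>x\<in>prime_powers_upto X. if fst x ^ snd x pdvd z then of_real (ln (real (enorm (fst x)))) * \<phi> z else 0)" .
  qed
  also have "\<dots> = (\<Sum>x\<in>prime_powers_upto X. \<Sum>z\<in>primary_upto X. if fst x ^ snd x pdvd z then of_real (ln (real (enorm (fst x)))) * \<phi> z else 0)"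
    by (rule sum.swap)
  also have "\<dots> = (\<Sum>x\<in>prime_powers_upto X. of_real (ln (real (enorm (fst x)))) * (\<phi> (fst x) ^ snd x * (\<Sum>e\<in>primary_upto (X / real (enorm (fst x)) ^ snd x). \<phi> e)))"
  proof (rule sum.cong[OF refl])
    fix x assume "x \<in> prime_powers_upto X"
    then obtain \<pi> k where x: "x = (\<pi>, k)" "\<pi> \<in> pprimes" by (auto simp: prime_powers_upto_def)
    have p: "\<pi> \<in> primary" by (rule pprimes_primary[OF x(2)])
    have pk: "\<pi> ^ k \<in> primary" by (rule primary_power[OF p])
    have inj: "inj_on (\<lambda>e. \<pi> ^ k * e) A" for A using primary_nonzero[OF pk] by (auto simp: inj_on_def)
    have "(\<Sum>z\<in>primary_upto X. if \<pi> ^ k pdvd z then of_real (ln (real (enorm \<pi>))) * \<phi> z else 0) =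
       (\<Sum>z\<in>{z \<in> primary_upto X. \<pi> ^ k pdvd z}. of_real (ln (real (enorm \<pi>))) * \<phi> z)"
      by (rule sum.inter_filter[OF finite_primary_upto, symmetric])
    also have "\<dots> = (\<Sum>e\<in>primary_upto (X / real (enorm (\<pi> ^ k))). of_real (ln (real (enorm \<pi>))) * \<phi> (\<pi> ^ k * e))"
      unfolding multiples_primary_upto[OF pk] by (subst sum.reindex[OF inj]) simp
    also have "\<dots> = (\<Sum>e\<in>primary_upto (X / real (enorm \<pi>) ^ k). of_real (ln (real (enorm \<pi>))) * (\<phi> \<pi> ^ k * \<phi> e))"
      by (rule sum.cong) (simp_all add: enorm_power[OF p] mult pk pow[OF p] primary_upto_enorm)
    also have "\<dots> = of_real (ln (real (enorm \<pi>))) * (\<phi> \<pi> ^ k * (\<Sum>e\<in>primary_upto (X / real (enorm \<pi>) ^ k). \<phi> e))"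
      by (simp only: sum_distrib_left)
    finally show "(\<Sum>z\<in>primary_upto X. if fst x ^ snd x pdvd z then of_real (ln (real (enorm (fst x)))) * \<phi> z else 0) =
       of_real (ln (real (enorm (fst x)))) * (\<phi> (fst x) ^ snd x * (\<Sum>e\<in>primary_upto (X / real (enorm (fst x)) ^ snd x). \<phi> e))"
      by (simp only: x fst_conv snd_conv)
  qed
  finally show ?thesis by (simp add: case_prod_unfold)
qed

section \<open>Partial summation and elementary estimates\<close>

text \<open>The alternative n = 0 is split off because the boundary terms A 0 f 0 - A 0 f 1 need not
  cancel there.\<close>

lemma abel_summation:
  fixes A f :: "nat \<Rightarrow> 'a::comm_ring_1"
  shows "(\<Sum>k=1..n. (A k - A (k - 1)) * f k) = A n * f n - A 0 * f 1 - (\<Sum>k=1..<n. A k * (f (Suc k) - f k))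
     \<or> n = 0"
proof (induction n)
  case (Suc n)
  show ?case
  proof (cases "n = 0")
    case False
    have "(\<Sum>k=1..Suc n. (A k - A (k - 1)) * f k) = (\<Sum>k=1..n. (A k - A (k - 1)) * f k) + (A (Suc n) - A n) * f (Suc n)"
      by simp
    also have "(\<Sum>k=1..n. (A k - A (k - 1)) * f k) = A n * f n - A 0 * f 1 - (\<Sum>k=1..<n. A k * (f (Suc k) - f k))"
      using Suc False by simp
    also have "(\<Sum>k=1..<n. A k * (f (Suc k) - f k)) = (\<Sum>k=1..<Suc n. A k * (f (Suc k) - f k)) - A n * (f (Suc n) - f n)"
      using False by simp
    finally show ?thesis by (simp add: algebra_simps)
  qed (simp add: algebra_simps)
qed simp

lemma ln_Suc_diff: "k \<ge> 1 \<Longrightarrow> 0 \<le> ln (real (Suc k)) - ln (real k)" "k \<ge> 1 \<Longrightarrow> ln (real (Suc k)) - ln (real k) \<le> 1 / real k"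
proof -
  assume k: "k \<ge> 1"
  have "ln (real (Suc k)) - ln (real k) = ln (real (Suc k) / real k)" using k by (simp add: ln_div)
  also have "real (Suc k) / real k = 1 + 1 / real k" using k by (simp add: field_simps)
  also have "ln (1 + 1 / real k) \<le> 1 / real k" by (rule ln_add_one_self_le_self) simp
  finally show "ln (real (Suc k)) - ln (real k) \<le> 1 / real k" .
qed simp

lemma ln_le_sqrt: "x \<ge> 1 \<Longrightarrow> ln x \<le> sqrt x"
proof -
  assume x: "x \<ge> 1"
  have "ln x = 2 * (2 * ln (sqrt (sqrt x)))" using x by (simp add: ln_sqrt)
  also have "\<dots> \<le> 2 * (2 * (sqrt (sqrt x) - 1))"
    using x by (intro mult_left_mono ln_le_minus_one) auto
  also have "\<dots> \<le> sqrt x"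
  proof -
    define u where "u = sqrt (sqrt x)"
    have "sqrt x = u\<^sup>2" using x by (simp add: u_def)
    moreover have "0 \<le> (u - 2)\<^sup>2" by simp
    hence "2 * (2 * (u - 1)) \<le> u\<^sup>2" by (simp add: power2_eq_square algebra_simps)
    ultimately show ?thesis by (simp add: u_def)
  qed
  finally show ?thesis .
qed

lemma inv_powr_bounded: "\<exists>Z\<ge>0. \<forall>A. finite A \<longrightarrow> 0 \<notin> A \<longrightarrow> (\<Sum>k\<in>A. 1 / (real k * sqrt (real k))) \<le> Z"
proof -
  have s: "summable (\<lambda>k. real k powr (-3/2))" by (subst summable_real_powr_iff) simp
  have "(\<Sum>k\<in>A. 1 / (real k * sqrt (real k))) \<le> (\<Sum>k. real k powr (-3/2))" if A: "finite A" "0 \<notin> A" for A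
  proof -
    have "(\<Sum>k\<in>A. 1 / (real k * sqrt (real k))) = (\<Sum>k\<in>A. real k powr (-3/2))"
    proof (rule sum.cong[OF refl])
      fix k assume "k \<in> A"
      hence k: "real k > 0" using A(2) by (cases k) auto
      have "real k powr (3/2) = real k powr (1 + 1/2)" by simp
      also have "\<dots> = real k powr 1 * real k powr (1/2)" by (rule powr_add)
      also have "\<dots> = real k * sqrt (real k)" using k by (simp add: powr_half_sqrt)
      finally show "1 / (real k * sqrt (real k)) = real k powr (-3/2)" by (simp add: powr_minus_divide)
    qed
    also have "\<dots> \<le> (\<Sum>k. real k powr (-3/2))" by (rule sum_le_suminf[OF s A(1)]) simp
    finally show ?thesis .
  qed
  moreover have "(\<Sum>k. real k powr (-3/2)) \<ge> 0" by (rule suminf_nonneg[OF s]) simp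
  ultimately show ?thesis by blast
qed

lemma sum_primary_upto_nat:
  fixes \<phi> :: "complex \<Rightarrow> 'a::comm_ring_1"
  defines "F \<equiv> (\<lambda>k :: nat. \<Sum>z\<in>primary_upto (real k). \<phi> z)"
  shows "(\<Sum>z\<in>primary_upto (real n). \<phi> z * f (enorm z)) = (\<Sum>k=1..n. (F k - F (k - 1)) * f k)"
proof (induction n)
  case 0
  have "primary_upto (real 0) = {}"
  proof (rule equals0I)
    fix z assume "z \<in> primary_upto (real 0)"
    hence "z \<in> primary" "enorm z = 0" by (simp_all add: primary_upto_enorm)
    thus False using enorm_pos[of z] by simp
  qed
  thus ?case by simp
next
  case (Suc n)
  have sub: "primary_upto (real n) \<subseteq> primary_upto (real (Suc n))" by (auto simp: primary_upto_enorm)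
  have enorm: "enorm z = Suc n" if "z \<in> primary_upto (real (Suc n)) - primary_upto (real n)" for z
    using that by (auto simp: primary_upto_enorm)
  have "(\<Sum>z\<in>primary_upto (real (Suc n)). \<phi> z * f (enorm z)) =
     (\<Sum>z\<in>primary_upto (real (Suc n)) - primary_upto (real n). \<phi> z * f (enorm z)) + (\<Sum>z\<in>primary_upto (real n). \<phi> z * f (enorm z))"
    by (rule sum.subset_diff[OF sub finite_primary_upto])
  also have "(\<Sum>z\<in>primary_upto (real (Suc n)) - primary_upto (real n). \<phi> z * f (enorm z)) = (\<Sum>z\<in>primary_upto (real (Suc n)) - primary_upto (real n). \<phi> z * f (Suc n))"
    by (intro sum.cong refl) (simp add: enorm)
  also have "\<dots> = (F (Suc n) - F n) * f (Suc n)"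
    unfolding F_def sum_distrib_right[symmetric] by (simp only: sum_diff[OF finite_primary_upto sub])
  finally show ?case unfolding Suc by simp
qed

section \<open>Chebyshev bounds for primes\<close>

lemma prime_prod_dvd:
  fixes m :: nat
  assumes "finite A" "\<And>p. p \<in> A \<Longrightarrow> prime p \<and> p dvd m"
  shows "\<Prod>A dvd m"
  using assms
proof (induction A rule: finite_induct)
  case (insert p A)
  have "coprime (\<Prod>A) p" using insert by (intro coprime_prod_prime) auto
  hence "coprime p (\<Prod>A)" by (simp add: coprime_commute)
  hence "p * \<Prod>A dvd m" using insert by (intro divides_mult) auto
  thus ?case using insert by simp
qed simp

definition theta :: "nat \<Rightarrow> real" where
  "theta n = (\<Sum>p\<in>{p. prime p \<and> p \<le> n}. ln (real p))"

lemma finite_primes_le: "finite {p :: nat. prime p \<and> p \<le> n}"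
  by (rule finite_subset[of _ "{..n}"]) auto

text \<open>All primes in (m, 2m] divide the central binomial coefficient, which is at most 4^m; the
  logarithm of 2 is rounded up to 1.\<close>

lemma theta_double: "theta (2 * m) \<le> theta m + 2 * real m"
proof -
  define A where "A = {p. prime p \<and> m < p \<and> p \<le> 2 * m}"
  have fin: "finite A" by (rule finite_subset[of _ "{..2 * m}"]) (auto simp: A_def)
  have "\<Prod>A dvd (2 * m) choose m"
  proof (rule prime_prod_dvd[OF fin])
    fix p assume "p \<in> A"
    hence p: "prime p" "m < p" "p \<le> 2 * m" by (auto simp: A_def)
    have "p dvd fact (2 * m)" using p by (simp add: prime_dvd_fact_iff)
    moreover have "fact m * fact (2 * m - m) * ((2 * m) choose m) = (fact (2 * m) :: nat)"
      by (rule binomial_fact_lemma) simp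
    ultimately have "p dvd fact m * fact (2 * m - m) * ((2 * m) choose m)" by simp
    moreover have "\<not> p dvd fact m" "\<not> p dvd fact (2 * m - m)" using p by (simp_all add: prime_dvd_fact_iff)
    ultimately have "p dvd (2 * m) choose m" using p(1) by (simp add: prime_dvd_mult_iff)
    thus "prime p \<and> p dvd (2 * m) choose m" using p by simp
  qed
  hence "\<Prod>A \<le> (2 * m) choose m" by (rule dvd_imp_le) simp
  also have "\<dots> \<le> 2 ^ (2 * m)" by (rule binomial_le_pow2)
  finally have "real (\<Prod>A) \<le> real (2 ^ (2 * m))" by (simp only: of_nat_le_iff)
  hence le: "(\<Prod>p\<in>A. real p) \<le> 2 ^ (2 * m)" by simp
  have pos: "\<And>p. p \<in> A \<Longrightarrow> real p > 0" by (auto simp: A_def prime_gt_0_nat)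
  have "(\<Sum>p\<in>A. ln (real p)) = ln (\<Prod>p\<in>A. real p)" using pos by (simp add: ln_prod[OF fin])
  also have "\<dots> \<le> ln (2 ^ (2 * m))" using le pos by (intro ln_mono prod_pos) auto
  also have "\<dots> = real (2 * m) * ln 2" by (simp add: ln_realpow)
  also have "\<dots> \<le> real (2 * m) * 1" using ln_le_minus_one[of 2] by (intro mult_left_mono) auto
  finally have 1: "(\<Sum>p\<in>A. ln (real p)) \<le> 2 * real m" by simp
  have e: "{p. prime p \<and> p \<le> 2 * m} = {p. prime p \<and> p \<le> m} \<union> A" by (auto simp: A_def)
  have "theta (2 * m) = theta m + (\<Sum>p\<in>A. ln (real p))"
    unfolding theta_def e by (rule sum.union_disjoint[OF finite_primes_le fin]) (auto simp: A_def)
  thus ?thesis using 1 by simp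
qed

lemma theta_mono: "m \<le> n \<Longrightarrow> theta m \<le> theta n"
  unfolding theta_def by (intro sum_mono2 finite_primes_le) (auto simp: prime_ge_1_nat)

text \<open>Halving with m = (n + 1) div 2 gives \<theta>(n) \<le> 6m + 2m = 8m \<le> 4n + 4, which
  is at most 6n once n \<ge> 2.\<close>

theorem theta_le: "theta n \<le> 6 * real n"
proof (induction n rule: less_induct)
  case (less n)
  show ?case
  proof (cases "n \<le> 2")
    case True
    have "{p. prime p \<and> p \<le> n} \<subseteq> {2}" using True by (auto dest: prime_ge_2_nat)
    hence "theta n \<le> (\<Sum>p\<in>{2}. ln (real p))" unfolding theta_def by (intro sum_mono2) auto
    hence t: "theta n \<le> 1" using ln_le_minus_one[of 2] by simp
    show ?thesis
    proof (cases "n = 0")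
      case True
      hence e: "{p. prime p \<and> p \<le> n} = {}" by (auto dest: prime_gt_0_nat)
      show ?thesis unfolding theta_def e by simp
    qed (use t in simp)
  next
    case False
    define m where "m = (n + 1) div 2"
    have m: "m < n" "n \<le> 2 * m" "2 * m \<le> n + 1" using False unfolding m_def by presburger+
    have "theta n \<le> theta (2 * m)" by (rule theta_mono[OF m(2)])
    also have "\<dots> \<le> theta m + 2 * real m" by (rule theta_double)
    also have "\<dots> \<le> 8 * real m" using less.IH[OF m(1)] by simp
    also have "\<dots> \<le> 4 * real n + 4" using m(3) by linarith
    also have "\<dots> \<le> 6 * real n" using False by simp
    finally show ?thesis .
  qed
qed

text \<open>Partial summation from the Chebyshev bound. The exponent 1/2 is what the Mertens
  argument calls for: an error of relative size (X / N\<pi>)^(-1/2) at \<pi>, weighted with log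
  N\<pi> / N\<pi>, sums to O(1).\<close>

lemma sum_ln_sqrt_primes: "\<exists>C. \<forall>n\<ge>1. (\<Sum>p\<in>{p. prime p \<and> p \<le> n}. ln (real p) / sqrt (real p)) \<le> C * sqrt (real n)"
proof -
  define f where "f = (\<lambda>k :: nat. 1 / sqrt (real k))"
  have f_diff: "f k - f (Suc k) \<le> 1 / (real k * sqrt (real k))" if "k \<ge> 1" for k
  proof -
    define u v where "u = sqrt (real k)" and "v = sqrt (real (Suc k))"
    have u: "u > 0" "v > 0" "u \<le> v" "u * u = real k" "v * v = real k + 1" using that by (auto simp: u_def v_def)
    have "u * v \<ge> u * u" using u by (intro mult_left_mono) auto
    have vu: "(v - u) * (v + u) = 1" using u by (simp add: algebra_simps)
    have le: "u * (v - u) \<le> 1"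
    proof -
      have "u * (v - u) \<le> (v + u) * (v - u)" using u by (intro mult_right_mono) auto
      thus ?thesis using vu by (simp add: mult.commute)
    qed
    have "f k = 1 / u" "f (Suc k) = 1 / v" by (simp_all add: f_def u_def v_def)
    hence "f k - f (Suc k) = (v - u) / (u * v)" using u by (simp add: diff_frac_eq)
    also have "\<dots> \<le> (v - u) / (u * u)" using u \<open>u * v \<ge> u * u\<close> by (intro divide_left_mono mult_pos_pos) auto
    also have "\<dots> = u * (v - u) / (u * u * u)" using u by simp
    also have "\<dots> \<le> 1 / (u * u * u)" using le u by (intro divide_right_mono) auto
    also have "\<dots> = 1 / (real k * sqrt (real k))" unfolding u(4) by (simp add: u_def)
    finally show ?thesis .
  qed
  have sum_inv: "(\<Sum>k=1..n. 1 / sqrt (real k)) \<le> 2 * sqrt (real n)" for n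
  proof (induction n)
    case (Suc n)
    define u v where "u = sqrt (real n)" and "v = sqrt (real (Suc n))"
    have u: "u \<ge> 0" "v > 0" "u \<le> v" "u * u = real n" "v * v = real n + 1" by (auto simp: u_def v_def)
    have "1 = (v - u) * (v + u)" using u by (simp add: algebra_simps)
    also have "\<dots> \<le> (v - u) * (2 * v)" using u by (intro mult_left_mono) auto
    finally have "1 / v \<le> 2 * (v - u)" using u by (simp add: pos_divide_le_eq mult_ac)
    moreover have "(\<Sum>k=1..Suc n. 1 / sqrt (real k)) = (\<Sum>k=1..n. 1 / sqrt (real k)) + 1 / v"
      by (simp add: v_def)
    ultimately show ?case using Suc by (simp add: u_def v_def)
  qed simp
  have prim: "(\<Sum>p\<in>{p. prime p \<and> p \<le> n}. ln (real p) * f p) = (\<Sum>k=1..n. (theta k - theta (k - 1)) * f k)" for n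
  proof (induction n)
    case 0
    have e: "{p :: nat. prime p \<and> p \<le> 0} = {}" by (auto dest: prime_gt_0_nat)
    show ?case unfolding e by simp
  next
    case (Suc n)
    define c where "c = (if prime (Suc n) then ln (real (Suc n)) else 0)"
    have step: "(\<Sum>p\<in>{p. prime p \<and> p \<le> Suc n}. g p) = (\<Sum>p\<in>{p. prime p \<and> p \<le> n}. g p) + (if prime (Suc n) then g (Suc n) else 0)" for g :: "nat \<Rightarrow> real"
    proof (cases "prime (Suc n)")
      case True
      have e: "{p. prime p \<and> p \<le> Suc n} = insert (Suc n) {p. prime p \<and> p \<le> n}" using True by (auto simp: le_Suc_eq)
      show ?thesis unfolding e using True finite_primes_le[of n] by simp
    next
      case False
      have e: "{p. prime p \<and> p \<le> Suc n} = {p. prime p \<and> p \<le> n}" using False by (auto simp: le_Suc_eq)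
      show ?thesis unfolding e using False by simp
    qed
    have "theta (Suc n) - theta n = c" unfolding theta_def step c_def by simp
    moreover have "(if prime (Suc n) then ln (real (Suc n)) * f (Suc n) else 0) = c * f (Suc n)" by (simp add: c_def)
    ultimately show ?case unfolding step Suc by simp
  qed
  have "(\<Sum>p\<in>{p. prime p \<and> p \<le> n}. ln (real p) / sqrt (real p)) \<le> 18 * sqrt (real n)" if n: "n \<ge> 1" for n
  proof -
    have t0: "theta 0 = 0"
    proof -
      have e: "{p :: nat. prime p \<and> p \<le> 0} = {}" by (auto dest: prime_gt_0_nat)
      show ?thesis unfolding theta_def e by simp
    qed
    have tn: "theta k \<ge> 0" for k unfolding theta_def by (intro sum_nonneg) (auto dest: prime_ge_1_nat)
    have "(\<Sum>p\<in>{p. prime p \<and> p \<le> n}. ln (real p) / sqrt (real p)) = (\<Sum>k=1..n. (theta k - theta (k - 1)) * f k)"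
      unfolding prim[symmetric] by (simp add: f_def)
    also have "\<dots> = theta n * f n - theta 0 * f 1 - (\<Sum>k=1..<n. theta k * (f (Suc k) - f k))"
      using abel_summation[where A = theta and f = f and n = n] n by simp
    also have "\<dots> = theta n * f n + (\<Sum>k=1..<n. theta k * (f k - f (Suc k)))"
    proof -
      have "(\<Sum>k=1..<n. theta k * (f (Suc k) - f k)) = - (\<Sum>k=1..<n. theta k * (f k - f (Suc k)))"
        unfolding sum_negf[symmetric] by (intro sum.cong refl) (simp add: algebra_simps)
      thus ?thesis by (simp add: t0)
    qed
    also have "\<dots> \<le> 6 * sqrt (real n) + (\<Sum>k=1..n. 6 * (1 / sqrt (real k)))"
    proof (rule add_mono)
      have "theta n * f n \<le> 6 * real n * f n" by (intro mult_right_mono theta_le) (simp add: f_def)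
      also have "\<dots> = 6 * sqrt (real n)"
      proof -
        have "real n = sqrt (real n) * sqrt (real n)" by simp
        hence "real n * f n = sqrt (real n)" using n by (simp add: f_def divide_simps)
        thus ?thesis by simp
      qed
      finally show "theta n * f n \<le> 6 * sqrt (real n)" .
      have "(\<Sum>k=1..<n. theta k * (f k - f (Suc k))) \<le> (\<Sum>k=1..<n. 6 * (1 / sqrt (real k)))"
      proof (rule sum_mono)
        fix k assume "k \<in> {1..<n}"
        hence k: "k \<ge> 1" by simp
        have "theta k * (f k - f (Suc k)) \<le> theta k * (1 / (real k * sqrt (real k)))"
          by (intro mult_left_mono f_diff[OF k] tn)
        also have "\<dots> \<le> (6 * real k) * (1 / (real k * sqrt (real k)))" by (intro mult_right_mono theta_le) simp
        also have "\<dots> = 6 * (1 / sqrt (real k))" using k by simp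
        finally show "theta k * (f k - f (Suc k)) \<le> 6 * (1 / sqrt (real k))" .
      qed
      also have "\<dots> \<le> (\<Sum>k=1..n. 6 * (1 / sqrt (real k)))" by (intro sum_mono2) auto
      finally show "(\<Sum>k=1..<n. theta k * (f k - f (Suc k))) \<le> (\<Sum>k=1..n. 6 * (1 / sqrt (real k)))" .
    qed
    also have "(\<Sum>k=1..n. 6 * (1 / sqrt (real k))) = 6 * (\<Sum>k=1..n. 1 / sqrt (real k))" by (rule sum_distrib_left[symmetric])
    also have "6 * sqrt (real n) + 6 * (\<Sum>k=1..n. 1 / sqrt (real k)) \<le> 18 * sqrt (real n)" using sum_inv[of n] by linarith
    finally show ?thesis .
  qed
  thus ?thesis by blast
qed

section \<open>Sums over primary primes and over the rational primes below them\<close>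

definition split_upto :: "real \<Rightarrow> nat set" where "split_upto X = {p. prime p \<and> p mod 3 = 1 \<and> real p \<le> X}"

definition inert_upto :: "real \<Rightarrow> nat set" where "inert_upto X = {q. prime q \<and> q mod 3 = 2 \<and> real q ^ 2 \<le> X}"

lemma finite_split_upto: "finite (split_upto X)"
proof (rule finite_subset)
  show "split_upto X \<subseteq> {..nat \<lfloor>X\<rfloor>}" by (auto simp: split_upto_def le_nat_floor)
qed simp

lemma inert_upto_subset: "inert_upto X \<subseteq> {1..nat \<lfloor>sqrt X\<rfloor>}"
proof
  fix q assume "q \<in> inert_upto X"
  hence q: "prime q" "(real q)\<^sup>2 \<le> X" by (auto simp: inert_upto_def)
  have "\<bar>real q\<bar> \<le> sqrt X" by (rule abs_le_of_sq_le[OF q(2)])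
  hence "q \<le> nat \<lfloor>sqrt X\<rfloor>" by (simp add: le_nat_floor)
  thus "q \<in> {1..nat \<lfloor>sqrt X\<rfloor>}" using prime_ge_1_nat[OF q(1)] by simp
qed

lemma finite_inert_upto: "finite (inert_upto X)" by (rule finite_subset[OF inert_upto_subset]) simp

lemma sum_pprimes_upto:
  fixes f :: "complex \<Rightarrow> 'a::comm_monoid_add"
  shows "(\<Sum>\<pi>\<in>pprimes_upto X. f \<pi>) = (\<Sum>p\<in>split_upto X. f (pi_of p) + f (cnj (pi_of p))) + (\<Sum>q\<in>inert_upto X. f (- of_nat q))"
proof -
  let ?A = "pi_of ` split_upto X" and ?B = "(\<lambda>p. cnj (pi_of p)) ` split_upto X" and ?C = "(\<lambda>q. - of_nat q) ` inert_upto X"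
  have P: "pi_of p \<in> primary \<and> enorm (pi_of p) = p \<and> prime p \<and> p mod 3 = 1" if "p \<in> split_upto X" for p
    using that pi_of(1,2)[of p] by (simp add: split_upto_def)
  have eq: "pprimes_upto X = (?A \<union> ?B) \<union> ?C"
  proof (intro equalityI subsetI)
    fix z assume "z \<in> pprimes_upto X"
    hence z: "z \<in> split_primes \<or> z \<in> inert_primes" "real (enorm z) \<le> X" by (auto simp: pprimes_upto_def pprimes_def)
    from z(1) show "z \<in> (?A \<union> ?B) \<union> ?C"
    proof
      assume s: "z \<in> split_primes"
      hence "enorm z \<in> split_upto X" using split_primesD(2,3)[OF s] z(2) by (simp add: split_upto_def)
      thus ?thesis using split_primesD(4)[OF s] by blast
    next
      assume "z \<in> inert_primes"
      then obtain q where q: "z = - of_nat q" "prime q" "q mod 3 = 2" "enorm z = q ^ 2" by (rule inert_primesD)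
      hence "q \<in> inert_upto X" using z(2) by (simp add: inert_upto_def)
      thus ?thesis using q(1) by blast
    qed
  next
    fix z assume "z \<in> (?A \<union> ?B) \<union> ?C"
    thus "z \<in> pprimes_upto X"
    proof (elim UnE)
      assume "z \<in> ?A"
      then obtain p where p: "p \<in> split_upto X" "z = pi_of p" by blast
      thus ?thesis using P[OF p(1)] by (auto simp: pprimes_upto_def pprimes_def split_primes_def split_upto_def)
    next
      assume "z \<in> ?B"
      then obtain p where p: "p \<in> split_upto X" "z = cnj (pi_of p)" by blast
      thus ?thesis using P[OF p(1)] by (auto simp: pprimes_upto_def pprimes_def split_primes_def split_upto_def enorm_cnj)
    next
      assume "z \<in> ?C"
      then obtain q where q: "q \<in> inert_upto X" "z = - of_nat q" by blast
      thus ?thesis by (auto simp: pprimes_upto_def pprimes_def inert_primes_def inert_upto_def inert_primary)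
    qed
  qed
  have inj1: "inj_on pi_of (split_upto X)"
  proof (rule inj_onI)
    fix p p' assume "p \<in> split_upto X" "p' \<in> split_upto X" "pi_of p = pi_of p'"
    thus "p = p'" using P[of p] P[of p'] by metis
  qed
  have inj2: "inj_on (\<lambda>p. cnj (pi_of p)) (split_upto X)"
    using inj1 by (auto simp: inj_on_def)
  have inj3: "inj_on (\<lambda>q. - of_nat q :: complex) (inert_upto X)" by (auto simp: inj_on_def)
  have disj1: "?A \<inter> ?B = {}"
  proof (rule equals0I)
    fix z assume "z \<in> ?A \<inter> ?B"
    then obtain p p' where p: "p \<in> split_upto X" "z = pi_of p" "p' \<in> split_upto X" "z = cnj (pi_of p')" by blast
    have "enorm z = p" using P[OF p(1)] p(2) by simp
    moreover have "enorm z = p'" using P[OF p(3)] p(4) by (simp add: enorm_cnj)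
    ultimately have "pi_of p = cnj (pi_of p)" using p by simp
    thus False using pi_of_neq_cnj[of p] P[OF p(1)] by simp
  qed
  have disj2: "(?A \<union> ?B) \<inter> ?C = {}"
  proof (rule equals0I)
    fix z assume z: "z \<in> (?A \<union> ?B) \<inter> ?C"
    then obtain q where q: "q \<in> inert_upto X" "z = - of_nat q" by blast
    have e: "enorm z = q ^ 2" unfolding q(2) by (rule inert_primary(2))
    from z obtain p where "p \<in> split_upto X" "z = pi_of p \<or> z = cnj (pi_of p)" by blast
    hence "prime (enorm z)" using P[of p] by (auto simp: enorm_cnj)
    hence "prime (q ^ 2)" unfolding e .
    thus False by (simp add: prime_power_iff)
  qed
  have "(\<Sum>\<pi>\<in>pprimes_upto X. f \<pi>) = (\<Sum>\<pi>\<in>?A \<union> ?B. f \<pi>) + (\<Sum>\<pi>\<in>?C. f \<pi>)"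
    unfolding eq by (rule sum.union_disjoint) (simp_all add: finite_split_upto finite_inert_upto disj2)
  also have "(\<Sum>\<pi>\<in>?A \<union> ?B. f \<pi>) = (\<Sum>\<pi>\<in>?A. f \<pi>) + (\<Sum>\<pi>\<in>?B. f \<pi>)"
    by (rule sum.union_disjoint) (simp_all add: finite_split_upto disj1)
  also have "(\<Sum>\<pi>\<in>?A. f \<pi>) = (\<Sum>p\<in>split_upto X. f (pi_of p))" by (simp add: sum.reindex[OF inj1])
  also have "(\<Sum>\<pi>\<in>?B. f \<pi>) = (\<Sum>p\<in>split_upto X. f (cnj (pi_of p)))" by (simp add: sum.reindex[OF inj2])
  also have "(\<Sum>\<pi>\<in>?C. f \<pi>) = (\<Sum>q\<in>inert_upto X. f (- of_nat q))" by (simp add: sum.reindex[OF inj3])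
  finally show ?thesis by (simp add: sum.distrib)
qed

lemma split_upto_enorm: "p \<in> split_upto X \<Longrightarrow> enorm (pi_of p) = p" "p \<in> split_upto X \<Longrightarrow> pi_of p \<in> primary"
  "p \<in> split_upto X \<Longrightarrow> prime p \<and> p mod 3 = 1"
  using pi_of(1,2)[of p] by (auto simp: split_upto_def)

text \<open>Each split prime is counted twice, through \<pi> and its conjugate. An inert prime q has
  norm q^2 and contributes at most 2, and at most sqrt n of them occur.\<close>

lemma sum_pprimes_upto_sqrt: "\<exists>C>0. \<forall>n\<ge>1. (\<Sum>\<pi>\<in>pprimes_upto (real n). ln (real (enorm \<pi>)) / sqrt (real (enorm \<pi>))) \<le> C * sqrt (real n)"
proof -
  obtain C0 where C0: "\<And>n. n \<ge> 1 \<Longrightarrow> (\<Sum>p\<in>{p. prime p \<and> p \<le> n}. ln (real p) / sqrt (real p)) \<le> C0 * sqrt (real n)"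
    using sum_ln_sqrt_primes by blast
  have "(\<Sum>\<pi>\<in>pprimes_upto (real n). ln (real (enorm \<pi>)) / sqrt (real (enorm \<pi>))) \<le> (2 * \<bar>C0\<bar> + 2) * sqrt (real n)" if n: "n \<ge> 1" for n
  proof -
    have "(\<Sum>p\<in>split_upto (real n). ln (real p) / sqrt (real p)) \<le> (\<Sum>p\<in>{p. prime p \<and> p \<le> n}. ln (real p) / sqrt (real p))"
      by (rule sum_mono2[OF finite_primes_le]) (auto simp: split_upto_def intro!: divide_nonneg_nonneg ln_ge_zero dest: prime_ge_1_nat)
    also have "\<dots> \<le> C0 * sqrt (real n)" by (rule C0[OF n])
    also have "\<dots> \<le> \<bar>C0\<bar> * sqrt (real n)" by (intro mult_right_mono) auto
    finally have 1: "(\<Sum>p\<in>split_upto (real n). ln (real p) / sqrt (real p)) \<le> \<bar>C0\<bar> * sqrt (real n)" .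
    have "(\<Sum>q\<in>inert_upto (real n). ln (real (q ^ 2)) / sqrt (real (q ^ 2))) \<le> (\<Sum>q\<in>inert_upto (real n). 2)"
    proof (rule sum_mono)
      fix q assume "q \<in> inert_upto (real n)"
      hence q: "real q > 0" by (auto simp: inert_upto_def prime_gt_0_nat)
      have "ln (real (q ^ 2)) = 2 * ln (real q)" using q by (simp add: ln_realpow)
      also have "\<dots> \<le> 2 * real q" using ln_le_minus_one[OF q] by simp
      finally show "ln (real (q ^ 2)) / sqrt (real (q ^ 2)) \<le> 2" using q by (simp add: pos_divide_le_eq)
    qed
    also have "\<dots> = 2 * real (card (inert_upto (real n)))" by simp
    also have "\<dots> \<le> 2 * real (card {1..nat \<lfloor>sqrt (real n)\<rfloor>})"
      by (intro mult_left_mono of_nat_mono card_mono inert_upto_subset) auto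
    also have "\<dots> \<le> 2 * sqrt (real n)" by simp
    finally have 2: "(\<Sum>q\<in>inert_upto (real n). ln (real (q ^ 2)) / sqrt (real (q ^ 2))) \<le> 2 * sqrt (real n)" .
    have "(\<Sum>\<pi>\<in>pprimes_upto (real n). ln (real (enorm \<pi>)) / sqrt (real (enorm \<pi>))) =
      (\<Sum>p\<in>split_upto (real n). ln (real p) / sqrt (real p) + ln (real p) / sqrt (real p)) + (\<Sum>q\<in>inert_upto (real n). ln (real (q ^ 2)) / sqrt (real (q ^ 2)))"
      unfolding sum_pprimes_upto by (intro arg_cong2[of _ _ _ _ "(+)"] sum.cong refl) (simp_all only: enorm_cnj split_upto_enorm inert_primary(2))
    also have "\<dots> = (\<Sum>p\<in>split_upto (real n). ln (real p) / sqrt (real p)) + (\<Sum>p\<in>split_upto (real n). ln (real p) / sqrt (real p)) + (\<Sum>q\<in>inert_upto (real n). ln (real (q ^ 2)) / sqrt (real (q ^ 2)))"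
      by (simp only: sum.distrib)
    also have "\<dots> \<le> \<bar>C0\<bar> * sqrt (real n) + \<bar>C0\<bar> * sqrt (real n) + 2 * sqrt (real n)"
      by (intro add_mono 1 2)
    finally show ?thesis by (simp add: algebra_simps)
  qed
  thus ?thesis by (intro exI[of _ "2 * \<bar>C0\<bar> + 2"]) simp
qed

lemma geometric_tail:
  fixes x :: real assumes "0 \<le> x" "x \<le> 1/2"
  shows "(\<Sum>k\<in>{2..m}. x ^ k) \<le> 2 * x\<^sup>2"
proof -
  have "(\<Sum>k\<in>{2..Suc m}. x ^ k) + 2 * x ^ (m + 2) \<le> 2 * x\<^sup>2" for m
  proof (induction m)
    case (Suc m)
    have "2 * x * x ^ (m + 2) \<le> 1 * x ^ (m + 2)" using assms by (intro mult_right_mono) auto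
    thus ?case using Suc by simp
  qed (simp add: power2_eq_square)
  moreover have "x ^ (m' + 2) \<ge> 0" for m' using assms by simp
  ultimately have "(\<Sum>k\<in>{2..Suc m'}. x ^ k) \<le> 2 * x\<^sup>2" for m' by (smt (verit))
  thus ?thesis by (cases m) auto
qed

text \<open>The geometric series leaves 2 log N / N^2 for a prime of norm N, and log N \<le> sqrt N
  turns this into 2/|\<pi>|^3, a convergent lattice sum.\<close>

lemma higher_powers_bounded:
  "\<exists>K\<ge>0. \<forall>X. (\<Sum>x\<in>{x \<in> prime_powers_upto X. snd x \<ge> 2}. ln (real (enorm (fst x))) / real (enorm (fst x)) ^ snd x) \<le> K"
proof -
  obtain K where K: "K > 0" "\<And>T. finite T \<Longrightarrow> T \<subseteq> primary \<Longrightarrow> (\<Sum>z\<in>T. 1 / cmod z ^ 3) \<le> K"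
    using sum_inv_cube_bounded by blast
  have "(\<Sum>x\<in>{x \<in> prime_powers_upto X. snd x \<ge> 2}. ln (real (enorm (fst x))) / real (enorm (fst x)) ^ snd x) \<le> 2 * K" for X
  proof -
    define m where "m = nat \<lfloor>X\<rfloor>"
    have sub: "{x \<in> prime_powers_upto X. snd x \<ge> 2} \<subseteq> pprimes_upto X \<times> {2..m}" using prime_powers_upto_subset[of X] by (auto simp: m_def)
    have l0: "ln (real (enorm \<pi>)) \<ge> 0" if "\<pi> \<in> pprimes_upto X" for \<pi>
      using enorm_ge_2[of \<pi>] that by (simp add: pprimes_upto_def)
    have "(\<Sum>x\<in>{x \<in> prime_powers_upto X. snd x \<ge> 2}. ln (real (enorm (fst x))) / real (enorm (fst x)) ^ snd x)
        \<le> (\<Sum>x\<in>pprimes_upto X \<times> {2..m}. ln (real (enorm (fst x))) / real (enorm (fst x)) ^ snd x)"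
      using l0 by (intro sum_mono2 finite_cartesian_product finite_pprimes_upto sub) auto
    also have "\<dots> = (\<Sum>\<pi>\<in>pprimes_upto X. \<Sum>k\<in>{2..m}. ln (real (enorm \<pi>)) / real (enorm \<pi>) ^ k)"
      by (simp add: sum.cartesian_product case_prod_unfold)
    also have "\<dots> \<le> (\<Sum>\<pi>\<in>pprimes_upto X. 2 * (1 / cmod \<pi> ^ 3))"
    proof (rule sum_mono)
      fix \<pi> assume \<pi>: "\<pi> \<in> pprimes_upto X"
      define N where "N = real (enorm \<pi>)"
      have N: "N \<ge> 2" using enorm_ge_2[of \<pi>] \<pi> by (simp add: pprimes_upto_def N_def)
      have "\<pi> \<in> primary" using \<pi> pprimes_primary by (simp add: pprimes_upto_def)
      hence NC: "N = (cmod \<pi>)\<^sup>2" using of_nat_enorm[OF primary_eisenstein, of \<pi>] by (simp add: N_def)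
      have c: "cmod \<pi> > 0" using N NC by (cases "cmod \<pi> = 0") auto
      have "(\<Sum>k\<in>{2..m}. ln N / N ^ k) = ln N * (\<Sum>k\<in>{2..m}. (1 / N) ^ k)"
        by (simp add: sum_distrib_left power_inverse divide_inverse)
      also have "\<dots> \<le> ln N * (2 * (1 / N)\<^sup>2)"
        using N by (intro mult_left_mono geometric_tail) (auto simp: divide_simps)
      also have "\<dots> \<le> sqrt N * (2 * (1 / N)\<^sup>2)" using N by (intro mult_right_mono ln_le_sqrt) auto
      also have "sqrt N = cmod \<pi>" using c by (simp add: NC)
      also have "cmod \<pi> * (2 * (1 / N)\<^sup>2) = 2 * (1 / cmod \<pi> ^ 3)"
        using c by (simp add: NC power2_eq_square power3_eq_cube field_simps)
      finally show "(\<Sum>k\<in>{2..m}. ln (real (enorm \<pi>)) / real (enorm \<pi>) ^ k) \<le> 2 * (1 / cmod \<pi> ^ 3)" by (simp add: N_def)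
    qed
    also have "\<dots> = 2 * (\<Sum>\<pi>\<in>pprimes_upto X. 1 / cmod \<pi> ^ 3)" by (rule sum_distrib_left[symmetric])
    also have "\<dots> \<le> 2 * K"
    proof (intro mult_left_mono K(2) finite_pprimes_upto)
      show "pprimes_upto X \<subseteq> primary" using pprimes_primary by (auto simp: pprimes_upto_def)
    qed simp
    finally show ?thesis .
  qed
  thus ?thesis using K(1) by (intro exI[of _ "2 * K"]) simp
qed

lemma sum_prime_powers_upto_split:
  fixes f :: "complex \<Rightarrow> nat \<Rightarrow> 'a::comm_monoid_add"
  shows "(\<Sum>(\<pi>, k)\<in>prime_powers_upto X. f \<pi> k) = (\<Sum>\<pi>\<in>pprimes_upto X. f \<pi> 1) + (\<Sum>x\<in>{x \<in> prime_powers_upto X. snd x \<ge> 2}. f (fst x) (snd x))"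
proof -
  have eq: "prime_powers_upto X = (\<lambda>\<pi>. (\<pi>, 1)) ` pprimes_upto X \<union> {x \<in> prime_powers_upto X. snd x \<ge> 2}"
  proof (intro equalityI subsetI)
    fix x assume x: "x \<in> prime_powers_upto X"
    obtain \<pi> k where pk: "x = (\<pi>, k)" by (cases x)
    show "x \<in> (\<lambda>\<pi>. (\<pi>, 1)) ` pprimes_upto X \<union> {x \<in> prime_powers_upto X. snd x \<ge> 2}"
    proof (cases "k = 1")
      case True
      hence "\<pi> \<in> pprimes_upto X" using x by (simp add: pk prime_powers_upto_def pprimes_upto_def)
      thus ?thesis using True by (auto simp: pk)
    next
      case False
      hence "k \<ge> 2" using x by (simp add: pk prime_powers_upto_def)
      thus ?thesis using x by (simp add: pk)
    qed
  next
    fix x assume "x \<in> (\<lambda>\<pi>. (\<pi>, 1)) ` pprimes_upto X \<union> {x \<in> prime_powers_upto X. snd x \<ge> 2}"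
    thus "x \<in> prime_powers_upto X" by (auto simp: prime_powers_upto_def pprimes_upto_def)
  qed
  have inj: "inj_on (\<lambda>\<pi>. (\<pi>, 1 :: nat)) (pprimes_upto X)" by (auto simp: inj_on_def)
  have fin2: "finite {x \<in> prime_powers_upto X. snd x \<ge> 2}" using finite_prime_powers_upto[of X] by simp
  have "(\<Sum>(\<pi>, k)\<in>prime_powers_upto X. f \<pi> k) = (\<Sum>x\<in>prime_powers_upto X. f (fst x) (snd x))" by (simp add: case_prod_unfold)
  also have "\<dots> = (\<Sum>x\<in>(\<lambda>\<pi>. (\<pi>, 1)) ` pprimes_upto X. f (fst x) (snd x)) + (\<Sum>x\<in>{x \<in> prime_powers_upto X. snd x \<ge> 2}. f (fst x) (snd x))"
    by (subst eq, rule sum.union_disjoint[OF _ fin2]) (auto simp: finite_pprimes_upto)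
  also have "(\<Sum>x\<in>(\<lambda>\<pi>. (\<pi>, 1)) ` pprimes_upto X. f (fst x) (snd x)) = (\<Sum>\<pi>\<in>pprimes_upto X. f \<pi> 1)"
    by (subst sum.reindex[OF inj]) (simp add: o_def)
  finally show ?thesis .
qed

section \<open>Mertens estimates with and without twist\<close>

text \<open>Subtracting the limit L from the partial sums leaves their increments unchanged but
  makes them O(k^(-1/2)). Partial summation against log then has a bounded boundary term and a
  convergent remainder.\<close>

lemma log_sum_bounded:
  fixes \<phi> :: "complex \<Rightarrow> complex"
  assumes lim: "\<And>X. X \<ge> 1 \<Longrightarrow> cmod ((\<Sum>z\<in>primary_upto X. \<phi> z) - L) \<le> C / sqrt X"
  shows "\<exists>C'. \<forall>n\<ge>1. cmod (\<Sum>z\<in>primary_upto (real n). \<phi> z * of_real (ln (real (enorm z)))) \<le> C'"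
proof -
  obtain Z where Z: "Z \<ge> 0" "\<And>A. finite A \<Longrightarrow> 0 \<notin> A \<Longrightarrow> (\<Sum>k\<in>A. 1 / (real k * sqrt (real k))) \<le> Z"
    using inv_powr_bounded by blast
  have C0: "C \<ge> 0" using order_trans[OF norm_ge_zero lim[of 1]] by simp
  define A where "A = (\<lambda>k :: nat. (\<Sum>z\<in>primary_upto (real k). \<phi> z) - L)"
  have A: "cmod (A k) \<le> C / sqrt (real k)" if "k \<ge> 1" for k unfolding A_def using that by (intro lim) simp
  define f where "f = (\<lambda>k :: nat. complex_of_real (ln (real k)))"
  have "cmod (\<Sum>z\<in>primary_upto (real n). \<phi> z * of_real (ln (real (enorm z)))) \<le> C + C * Z" if n: "n \<ge> 1" for n
  proof -
    have "(\<Sum>z\<in>primary_upto (real n). \<phi> z * of_real (ln (real (enorm z)))) = (\<Sum>k=1..n. (A k - A (k - 1)) * f k)"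
      using sum_primary_upto_nat[of \<phi> f n] by (simp add: A_def f_def)
    also have "\<dots> = A n * f n - A 0 * f 1 - (\<Sum>k=1..<n. A k * (f (Suc k) - f k))"
      using abel_summation[where A = A and f = f and n = n] n by simp
    also have "\<dots> = A n * f n - (\<Sum>k=1..<n. A k * (f (Suc k) - f k))" by (simp add: f_def)
    finally have e: "(\<Sum>z\<in>primary_upto (real n). \<phi> z * of_real (ln (real (enorm z)))) = A n * f n - (\<Sum>k=1..<n. A k * (f (Suc k) - f k))" .
    have 1: "cmod (A n * f n) \<le> C"
    proof -
      have l: "0 \<le> ln (real n)" "ln (real n) \<le> sqrt (real n)" using n by (auto intro: ln_le_sqrt)
      have "cmod (A n * f n) = cmod (A n) * ln (real n)" using l by (simp add: norm_mult f_def)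
      also have "\<dots> \<le> C / sqrt (real n) * sqrt (real n)" using A[OF n] l C0 by (intro mult_mono) auto
      also have "\<dots> = C" using n by simp
      finally show ?thesis .
    qed
    have "cmod (\<Sum>k=1..<n. A k * (f (Suc k) - f k)) \<le> (\<Sum>k=1..<n. C * (1 / (real k * sqrt (real k))))"
    proof (rule sum_norm_le)
      fix k assume "k \<in> {1..<n}"
      hence k: "k \<ge> 1" by simp
      have "f (Suc k) - f k = of_real (ln (real (Suc k)) - ln (real k))" by (simp add: f_def)
      hence "cmod (f (Suc k) - f k) = ln (real (Suc k)) - ln (real k)"
        using ln_Suc_diff(1)[OF k] by (simp only: norm_of_real abs_of_nonneg)
      hence "cmod (A k * (f (Suc k) - f k)) \<le> C / sqrt (real k) * (1 / real k)"
        unfolding norm_mult using A[OF k] ln_Suc_diff[OF k] C0 by (intro mult_mono) auto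
      thus "cmod (A k * (f (Suc k) - f k)) \<le> C * (1 / (real k * sqrt (real k)))" by (simp add: mult.commute)
    qed
    also have "\<dots> = C * (\<Sum>k=1..<n. 1 / (real k * sqrt (real k)))" by (rule sum_distrib_left[symmetric])
    also have "\<dots> \<le> C * Z" using C0 by (intro mult_left_mono Z(2)) auto
    finally show ?thesis unfolding e by (rule order_trans[OF norm_triangle_ineq4 add_mono[OF 1]])
  qed
  thus ?thesis by blast
qed

text \<open>In $\sum_z \varphi(z) \log N z = \sum_{\pi, k} \varphi(\pi)^k \log N\pi \sum_e \varphi(e)$ the left-hand side is
  bounded and each inner sum is close to $L \ne 0$.\<close>

theorem mertens_twisted:
  fixes \<phi> :: "complex \<Rightarrow> complex"
  assumes mult: "\<And>z w. z \<in> primary \<Longrightarrow> w \<in> primary \<Longrightarrow> \<phi> (z * w) = \<phi> z * \<phi> w" and one: "\<phi> 1 = 1"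
  assumes norm: "\<And>z. z \<in> primary \<Longrightarrow> cmod (\<phi> z) = 1 / real (enorm z)"
  assumes lim: "\<And>X. X \<ge> 1 \<Longrightarrow> cmod ((\<Sum>z\<in>primary_upto X. \<phi> z) - L) \<le> C / sqrt X" and L: "L \<noteq> 0"
  shows "\<exists>C'. \<forall>n\<ge>1. cmod (\<Sum>\<pi>\<in>pprimes_upto (real n). of_real (ln (real (enorm \<pi>))) * \<phi> \<pi>) \<le> C'"
proof -
  obtain CS where CS: "\<And>n. n \<ge> 1 \<Longrightarrow> cmod (\<Sum>z\<in>primary_upto (real n). \<phi> z * of_real (ln (real (enorm z)))) \<le> CS"
    using log_sum_bounded[OF lim] by blast
  obtain CT where CT: "\<And>n. n \<ge> 1 \<Longrightarrow> (\<Sum>\<pi>\<in>pprimes_upto (real n). ln (real (enorm \<pi>)) / sqrt (real (enorm \<pi>))) \<le> CT * sqrt (real n)"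
    using sum_pprimes_upto_sqrt by blast
  obtain K where K: "K \<ge> 0" "\<And>X. (\<Sum>x\<in>{x \<in> prime_powers_upto X. snd x \<ge> 2}. ln (real (enorm (fst x))) / real (enorm (fst x)) ^ snd x) \<le> K"
    using higher_powers_bounded by blast
  have C0: "C \<ge> 0" using order_trans[OF norm_ge_zero lim[of 1]] by simp
  define F where "F = (\<lambda>X. \<Sum>z\<in>primary_upto X. \<phi> z)"
  define B where "B = cmod L + C"
  have FB: "cmod (F X) \<le> B" if "X \<ge> 1" for X
  proof -
    have "cmod (F X) \<le> cmod L + cmod (F X - L)" using norm_triangle_ineq[of L "F X - L"] by simp
    moreover have "cmod (F X - L) \<le> C / sqrt X" unfolding F_def by (rule lim[OF that])
    moreover have "C / sqrt X \<le> C / 1" using that C0 by (intro divide_left_mono) auto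
    ultimately show ?thesis by (simp add: B_def)
  qed
  define C' where "C' = (CS + C * CT + B * K) / cmod L"
  have "cmod (\<Sum>\<pi>\<in>pprimes_upto (real n). of_real (ln (real (enorm \<pi>))) * \<phi> \<pi>) \<le> C'" if n: "n \<ge> 1" for n
  proof -
    let ?X = "real n"
    define V where "V = (\<Sum>\<pi>\<in>pprimes_upto ?X. of_real (ln (real (enorm \<pi>))) * \<phi> \<pi>)"
    define S where "S = (\<Sum>z\<in>primary_upto ?X. \<phi> z * of_real (ln (real (enorm z))))"
    define R where "R = (\<Sum>x\<in>{x \<in> prime_powers_upto ?X. snd x \<ge> 2}. of_real (ln (real (enorm (fst x)))) * (\<phi> (fst x) ^ snd x * F (?X / real (enorm (fst x)) ^ snd x)))"
    \<comment> \<open>The error of replacing each inner sum by L. At a prime of norm N it is at most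
      C sqrt(N/X), weighted by log N / N, so D is controlled by the sum of log N / sqrt N divided by
      sqrt X.\<close>
    define D where "D = (\<Sum>\<pi>\<in>pprimes_upto ?X. of_real (ln (real (enorm \<pi>))) * (\<phi> \<pi> * (F (?X / real (enorm \<pi>)) - L)))"
    have "S = (\<Sum>\<pi>\<in>pprimes_upto ?X. of_real (ln (real (enorm \<pi>))) * (\<phi> \<pi> ^ 1 * F (?X / real (enorm \<pi>) ^ 1))) + R"
      unfolding S_def R_def F_def
      by (rule trans[OF convolution_identity[where \<phi> = \<phi>, OF mult one] sum_prime_powers_upto_split[where f = "\<lambda>\<pi> k. of_real (ln (real (enorm \<pi>))) * (\<phi> \<pi> ^ k * (\<Sum>z\<in>primary_upto (?X / real (enorm \<pi>) ^ k). \<phi> z))"]])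
    also have "(\<Sum>\<pi>\<in>pprimes_upto ?X. of_real (ln (real (enorm \<pi>))) * (\<phi> \<pi> ^ 1 * F (?X / real (enorm \<pi>) ^ 1))) = D + L * V"
      unfolding D_def V_def sum_distrib_left sum.distrib[symmetric] by (intro sum.cong refl) (simp add: algebra_simps)
    finally have "L * V = S - D - R" by simp
    hence "cmod L * cmod V = cmod (S - D - R)" by (simp flip: norm_mult)
    also have "\<dots> \<le> cmod S + cmod D + cmod R"
      by (intro order_trans[OF norm_triangle_ineq4] add_mono norm_triangle_ineq4 order_refl)
    also have "cmod S \<le> CS" unfolding S_def by (rule CS[OF n])
    also have "cmod D \<le> C * CT"
    proof -
      have "cmod D \<le> (\<Sum>\<pi>\<in>pprimes_upto ?X. C / sqrt ?X * (ln (real (enorm \<pi>)) / sqrt (real (enorm \<pi>))))"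
        unfolding D_def
      proof (rule sum_norm_le)
        fix \<pi> assume \<pi>: "\<pi> \<in> pprimes_upto ?X"
        define N where "N = real (enorm \<pi>)"
        have N: "N \<ge> 2" "N \<le> ?X" using enorm_ge_2[of \<pi>] \<pi> by (auto simp: pprimes_upto_def N_def)
        have p: "\<pi> \<in> primary" using \<pi> pprimes_primary by (simp add: pprimes_upto_def)
        have X1: "?X / N \<ge> 1" using N by simp
        have "cmod (of_real (ln N) * (\<phi> \<pi> * (F (?X / N) - L))) = ln N * (1 / N * cmod (F (?X / N) - L))"
          using N norm[OF p] by (simp add: norm_mult N_def)
        also have "\<dots> \<le> ln N * (1 / N * (C / sqrt (?X / N)))"
          unfolding F_def using N by (intro mult_left_mono lim X1) auto
        also have "\<dots> = C / sqrt ?X * (ln N * (sqrt N / N))" by (simp add: real_sqrt_divide mult_ac)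
        also have "sqrt N / N = 1 / sqrt N" using N by (simp add: real_div_sqrt divide_simps)
        finally show "cmod (of_real (ln (real (enorm \<pi>))) * (\<phi> \<pi> * (F (?X / real (enorm \<pi>)) - L)))
           \<le> C / sqrt ?X * (ln (real (enorm \<pi>)) / sqrt (real (enorm \<pi>)))" by (simp add: N_def)
      qed
      also have "\<dots> = C / sqrt ?X * (\<Sum>\<pi>\<in>pprimes_upto ?X. ln (real (enorm \<pi>)) / sqrt (real (enorm \<pi>)))" by (rule sum_distrib_left[symmetric])
      also have "\<dots> \<le> C / sqrt ?X * (CT * sqrt ?X)" using C0 by (intro mult_left_mono CT n) auto
      also have "\<dots> = C * CT" using n by simp
      finally show ?thesis .
    qed
    also have "cmod R \<le> B * K"
    proof -
      have "cmod R \<le> (\<Sum>x\<in>{x \<in> prime_powers_upto ?X. snd x \<ge> 2}. B * (ln (real (enorm (fst x))) / real (enorm (fst x)) ^ snd x))"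
        unfolding R_def
      proof (rule sum_norm_le)
        fix x assume "x \<in> {x \<in> prime_powers_upto ?X. snd x \<ge> 2}"
        then obtain \<pi> k where x: "x = (\<pi>, k)" "\<pi> \<in> pprimes" "real (enorm \<pi>) ^ k \<le> ?X" by (auto simp: prime_powers_upto_def)
        define N where "N = real (enorm \<pi>)"
        have N: "N \<ge> 2" using enorm_ge_2[OF x(2)] by (simp add: N_def)
        have "N ^ k > 0" using N by simp
        hence X1: "?X / N ^ k \<ge> 1" using x(3) by (simp add: N_def)
        have "cmod (of_real (ln N) * (\<phi> \<pi> ^ k * F (?X / N ^ k))) = ln N * ((1 / N) ^ k * cmod (F (?X / N ^ k)))"
          using N norm[OF pprimes_primary[OF x(2)]] by (simp add: norm_mult norm_power N_def)
        also have "\<dots> \<le> ln N * ((1 / N) ^ k * B)" using N by (intro mult_left_mono FB X1) auto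
        also have "\<dots> = B * (ln N / N ^ k)" by (simp add: power_inverse divide_inverse)
        finally show "cmod (of_real (ln (real (enorm (fst x)))) * (\<phi> (fst x) ^ snd x * F (?X / real (enorm (fst x)) ^ snd x)))
          \<le> B * (ln (real (enorm (fst x))) / real (enorm (fst x)) ^ snd x)" by (simp add: x N_def)
      qed
      also have "\<dots> = B * (\<Sum>x\<in>{x \<in> prime_powers_upto ?X. snd x \<ge> 2}. ln (real (enorm (fst x))) / real (enorm (fst x)) ^ snd x)"
        by (rule sum_distrib_left[symmetric])
      also have "\<dots> \<le> B * K" using C0 by (intro mult_left_mono K(2)) (simp add: B_def)
      finally show ?thesis .
    qed
    finally have "cmod L * cmod V \<le> CS + C * CT + B * K" by simp
    hence "cmod V \<le> C'" using L by (simp add: C'_def pos_le_divide_eq mult.commute)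
    thus ?thesis by (simp add: V_def)
  qed
  thus ?thesis by blast
qed

lemma sqrt_le_self: "x \<ge> 1 \<Longrightarrow> sqrt x \<le> (x :: real)"
  by (rule real_le_lsqrt) (auto intro: self_le_power)

text \<open>Partial summation with the counting function cX + O(sqrt X): the boundary term gives c n
  log n, and the remaining sum as well as the errors are O(n).\<close>

lemma card_log_sum:
  assumes c: "c > 0" "\<And>X. X \<ge> 1 \<Longrightarrow> \<bar>real (card (primary_upto X)) - c * X\<bar> \<le> 4 * sqrt X" and n: "n \<ge> 1"
  shows "\<bar>(\<Sum>z\<in>primary_upto (real n). ln (real (enorm z))) - c * (real n * ln (real n))\<bar> \<le> (c + 8) * real n"
proof -
  define A where "A = (\<lambda>k :: nat. real (card (primary_upto (real k))))"
  define f where "f = (\<lambda>k :: nat. ln (real k))"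
  have A: "A k \<le> (c + 4) * real k" if "k \<ge> 1" for k
  proof -
    have "A k \<le> c * real k + 4 * sqrt (real k)" using c(2)[of "real k"] that by (simp add: A_def)
    also have "\<dots> \<le> c * real k + 4 * real k" using that by (intro add_left_mono mult_left_mono sqrt_le_self) auto
    finally show ?thesis by (simp add: algebra_simps)
  qed
  have "(\<Sum>z\<in>primary_upto (real n). ln (real (enorm z))) = (\<Sum>k=1..n. (A k - A (k - 1)) * f k)"
    using sum_primary_upto_nat[of "\<lambda>_. 1 :: real" f n] by (simp add: A_def f_def)
  also have "\<dots> = A n * f n - (\<Sum>k=1..<n. A k * (f (Suc k) - f k))"
    using abel_summation[where A = A and f = f and n = n] n by (simp add: f_def)
  finally have T: "(\<Sum>z\<in>primary_upto (real n). ln (real (enorm z))) = A n * f n - (\<Sum>k=1..<n. A k * (f (Suc k) - f k))" .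
  have S0: "(\<Sum>k=1..<n. A k * (f (Suc k) - f k)) \<ge> 0"
  proof (rule sum_nonneg)
    fix k assume "k \<in> {1..<n}"
    thus "A k * (f (Suc k) - f k) \<ge> 0" using ln_Suc_diff(1)[of k] by (intro mult_nonneg_nonneg) (simp_all add: A_def f_def)
  qed
  have "(\<Sum>k=1..<n. A k * (f (Suc k) - f k)) \<le> (\<Sum>k=1..<n. c + 4)"
  proof (rule sum_mono)
    fix k assume "k \<in> {1..<n}"
    hence k: "k \<ge> 1" by simp
    have "A k * (f (Suc k) - f k) \<le> ((c + 4) * real k) * (1 / real k)"
      unfolding f_def using A[OF k] ln_Suc_diff[OF k] c(1) by (intro mult_mono) auto
    thus "A k * (f (Suc k) - f k) \<le> c + 4" using k by simp
  qed
  also have "\<dots> = real (n - 1) * (c + 4)" by simp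
  also have "\<dots> \<le> real n * (c + 4)" using c(1) by (intro mult_right_mono) auto
  finally have S1: "(\<Sum>k=1..<n. A k * (f (Suc k) - f k)) \<le> real n * (c + 4)" .
  have l: "0 \<le> ln (real n)" "ln (real n) \<le> sqrt (real n)" using n by (auto intro: ln_le_sqrt)
  have "\<bar>A n - c * real n\<bar> * ln (real n) \<le> (4 * sqrt (real n)) * sqrt (real n)"
    unfolding A_def using c(2)[of "real n"] n l by (intro mult_mono) auto
  hence "\<bar>(A n - c * real n) * ln (real n)\<bar> \<le> 4 * real n" using l(1) by (simp add: abs_mult mult.assoc)
  hence 1: "\<bar>A n * f n - c * (real n * ln (real n))\<bar> \<le> 4 * real n" by (simp add: f_def algebra_simps)
  have "(c + 8) * real n = real n * (c + 4) + 4 * real n" by (simp add: algebra_simps)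
  thus ?thesis unfolding T using S0 S1 1 by linarith
qed

lemma convolution_card:
  "(\<Sum>z\<in>primary_upto X. ln (real (enorm z))) =
   (\<Sum>\<pi>\<in>pprimes_upto X. ln (real (enorm \<pi>)) * real (card (primary_upto (X / real (enorm \<pi>))))) +
   (\<Sum>x\<in>{x \<in> prime_powers_upto X. snd x \<ge> 2}. ln (real (enorm (fst x))) * real (card (primary_upto (X / real (enorm (fst x)) ^ snd x))))"
proof -
  let ?f = "\<lambda>\<pi> k. ln (real (enorm \<pi>)) * real (card (primary_upto (X / real (enorm \<pi>) ^ k)))"
  have "complex_of_real (\<Sum>z\<in>primary_upto X. ln (real (enorm z))) = complex_of_real (\<Sum>(\<pi>, k)\<in>prime_powers_upto X. ?f \<pi> k)"
    using convolution_identity[where \<phi> = "\<lambda>_. 1" and X = X] by (simp add: case_prod_unfold)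
  hence "(\<Sum>z\<in>primary_upto X. ln (real (enorm z))) = (\<Sum>(\<pi>, k)\<in>prime_powers_upto X. ?f \<pi> k)" by (simp only: of_real_eq_iff)
  also have "\<dots> = (\<Sum>\<pi>\<in>pprimes_upto X. ?f \<pi> 1) + (\<Sum>x\<in>{x \<in> prime_powers_upto X. snd x \<ge> 2}. ?f (fst x) (snd x))"
    by (rule sum_prime_powers_upto_split[where f = ?f])
  finally show ?thesis by simp
qed

text \<open>In the untwisted case the sum of 1/N z diverges, so the constant function 1 is used in
  the convolution, with the count cX/N\<pi> as main term of the inner sums. Comparing with c n log n
  and dividing by c n gives the estimate.\<close>

theorem mertens_primary:
  "\<exists>C. \<forall>n\<ge>1. \<bar>(\<Sum>\<pi>\<in>pprimes_upto (real n). ln (real (enorm \<pi>)) / real (enorm \<pi>)) - ln (real n)\<bar> \<le> C"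
proof -
  obtain c where c: "c > 0" "\<And>X. X \<ge> 1 \<Longrightarrow> \<bar>real (card (primary_upto X)) - c * X\<bar> \<le> 4 * sqrt X"
    using card_primary_upto by blast
  obtain CT where CT: "\<And>n. n \<ge> 1 \<Longrightarrow> (\<Sum>\<pi>\<in>pprimes_upto (real n). ln (real (enorm \<pi>)) / sqrt (real (enorm \<pi>))) \<le> CT * sqrt (real n)"
    using sum_pprimes_upto_sqrt by blast
  obtain K where K: "K \<ge> 0" "\<And>X. (\<Sum>x\<in>{x \<in> prime_powers_upto X. snd x \<ge> 2}. ln (real (enorm (fst x))) / real (enorm (fst x)) ^ snd x) \<le> K"
    using higher_powers_bounded by blast
  define D where "D = 4 * CT + (c + 4) * K + (c + 8)"
  have "\<bar>(\<Sum>\<pi>\<in>pprimes_upto (real n). ln (real (enorm \<pi>)) / real (enorm \<pi>)) - ln (real n)\<bar> \<le> D / c" if n: "n \<ge> 1" for n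
  proof -
    define M where "M = (\<Sum>\<pi>\<in>pprimes_upto (real n). ln (real (enorm \<pi>)) / real (enorm \<pi>))"
    define V where "V = (\<Sum>\<pi>\<in>pprimes_upto (real n). ln (real (enorm \<pi>)) * real (card (primary_upto (real n / real (enorm \<pi>)))))"
    define R where "R = (\<Sum>x\<in>{x \<in> prime_powers_upto (real n). snd x \<ge> 2}. ln (real (enorm (fst x))) * real (card (primary_upto (real n / real (enorm (fst x)) ^ snd x))))"
    have T: "(\<Sum>z\<in>primary_upto (real n). ln (real (enorm z))) = V + R" unfolding V_def R_def by (rule convolution_card)
    have 1: "\<bar>V + R - c * (real n * ln (real n))\<bar> \<le> (c + 8) * real n" using card_log_sum[OF c n] unfolding T .
    have "\<bar>V - c * real n * M\<bar> = \<bar>\<Sum>\<pi>\<in>pprimes_upto (real n). ln (real (enorm \<pi>)) * (real (card (primary_upto (real n / real (enorm \<pi>)))) - c * (real n / real (enorm \<pi>)))\<bar>"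
      unfolding V_def M_def sum_distrib_left sum_subtractf[symmetric] by (simp add: algebra_simps)
    also have "\<dots> \<le> (\<Sum>\<pi>\<in>pprimes_upto (real n). 4 * sqrt (real n) * (ln (real (enorm \<pi>)) / sqrt (real (enorm \<pi>))))"
    proof (rule order_trans[OF sum_abs sum_mono])
      fix \<pi> assume \<pi>: "\<pi> \<in> pprimes_upto (real n)"
      define N where "N = real (enorm \<pi>)"
      have N: "N \<ge> 2" "N \<le> real n" using enorm_ge_2[of \<pi>] \<pi> by (auto simp: pprimes_upto_def N_def)
      have "\<bar>ln N * (real (card (primary_upto (real n / N))) - c * (real n / N))\<bar> = ln N * \<bar>real (card (primary_upto (real n / N))) - c * (real n / N)\<bar>"
        using N by (simp add: abs_mult)
      also have "\<dots> \<le> ln N * (4 * sqrt (real n / N))" using N by (intro mult_left_mono c(2)) auto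
      also have "\<dots> = 4 * sqrt (real n) * (ln N / sqrt N)" by (simp add: real_sqrt_divide)
      finally show "\<bar>ln (real (enorm \<pi>)) * (real (card (primary_upto (real n / real (enorm \<pi>)))) - c * (real n / real (enorm \<pi>)))\<bar>
        \<le> 4 * sqrt (real n) * (ln (real (enorm \<pi>)) / sqrt (real (enorm \<pi>)))" by (simp add: N_def)
    qed
    also have "\<dots> = 4 * sqrt (real n) * (\<Sum>\<pi>\<in>pprimes_upto (real n). ln (real (enorm \<pi>)) / sqrt (real (enorm \<pi>)))" by (rule sum_distrib_left[symmetric])
    also have "\<dots> \<le> 4 * sqrt (real n) * (CT * sqrt (real n))" by (intro mult_left_mono CT n) auto
    also have "\<dots> = 4 * CT * real n" by simp
    finally have 2: "\<bar>V - c * real n * M\<bar> \<le> 4 * CT * real n" .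
    have R: "0 \<le> ln (real (enorm (fst x))) * real (card (primary_upto (real n / real (enorm (fst x)) ^ snd x)))"
      "ln (real (enorm (fst x))) * real (card (primary_upto (real n / real (enorm (fst x)) ^ snd x))) \<le> (c + 4) * real n * (ln (real (enorm (fst x))) / real (enorm (fst x)) ^ snd x)"
      if "x \<in> {x \<in> prime_powers_upto (real n). snd x \<ge> 2}" for x
    proof -
      obtain \<pi> k where x: "x = (\<pi>, k)" "\<pi> \<in> pprimes" "real (enorm \<pi>) ^ k \<le> real n" using \<open>x \<in> _\<close> by (auto simp: prime_powers_upto_def)
      define N where "N = real (enorm \<pi>)"
      have N: "N \<ge> 2" using enorm_ge_2[OF x(2)] by (simp add: N_def)
      have "N ^ k > 0" using N by simp
      hence X1: "real n / N ^ k \<ge> 1" using x(3) by (simp add: N_def)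
      have "real (card (primary_upto (real n / N ^ k))) \<le> c * (real n / N ^ k) + 4 * sqrt (real n / N ^ k)"
        using c(2)[OF X1] by linarith
      also have "\<dots> \<le> c * (real n / N ^ k) + 4 * (real n / N ^ k)"
        using X1 by (intro add_left_mono mult_left_mono sqrt_le_self) auto
      finally have "ln N * real (card (primary_upto (real n / N ^ k))) \<le> ln N * (c * (real n / N ^ k) + 4 * (real n / N ^ k))"
        using N by (intro mult_left_mono) auto
      also have "\<dots> = (c + 4) * real n * (ln N / N ^ k)" by (simp add: algebra_simps add_divide_distrib)
      finally show "ln (real (enorm (fst x))) * real (card (primary_upto (real n / real (enorm (fst x)) ^ snd x))) \<le> (c + 4) * real n * (ln (real (enorm (fst x))) / real (enorm (fst x)) ^ snd x)"
        by (simp add: x N_def)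
      show "0 \<le> ln (real (enorm (fst x))) * real (card (primary_upto (real n / real (enorm (fst x)) ^ snd x)))"
        using N by (simp add: x N_def)
    qed
    have R0: "R \<ge> 0" unfolding R_def by (rule sum_nonneg) (rule R(1))
    have "R \<le> (\<Sum>x\<in>{x \<in> prime_powers_upto (real n). snd x \<ge> 2}. (c + 4) * real n * (ln (real (enorm (fst x))) / real (enorm (fst x)) ^ snd x))"
      unfolding R_def by (rule sum_mono) (rule R(2))
    also have "\<dots> = (c + 4) * real n * (\<Sum>x\<in>{x \<in> prime_powers_upto (real n). snd x \<ge> 2}. ln (real (enorm (fst x))) / real (enorm (fst x)) ^ snd x)"
      by (rule sum_distrib_left[symmetric])
    also have "\<dots> \<le> (c + 4) * real n * K" using c(1) by (intro mult_left_mono K(2)) auto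
    finally have R1: "R \<le> (c + 4) * real n * K" .
    have "\<bar>c * real n * M - c * (real n * ln (real n))\<bar> \<le> 4 * CT * real n + (c + 4) * real n * K + (c + 8) * real n"
      using 1 2 R0 R1 by linarith
    also have "\<dots> = D * real n" by (simp add: D_def algebra_simps)
    also have "c * real n * M - c * (real n * ln (real n)) = (c * (M - ln (real n))) * real n" by (simp add: algebra_simps)
    finally have "\<bar>c * (M - ln (real n))\<bar> * real n \<le> D * real n" by (simp add: abs_mult)
    hence "\<bar>c * (M - ln (real n))\<bar> \<le> D" using n by simp
    hence "c * \<bar>M - ln (real n)\<bar> \<le> D" using c(1) by (simp add: abs_mult)
    thus ?thesis using c(1) by (simp add: M_def pos_le_divide_eq mult.commute)
  qed
  thus ?thesis by blast
qed

section \<open>Transfer to rational primes and their angles\<close>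

lemma inert_sum_bounded: "\<exists>Z\<ge>0. \<forall>X. (\<Sum>q\<in>inert_upto X. ln (real (q ^ 2)) / real (q ^ 2)) \<le> Z"
proof -
  obtain Z where Z: "Z \<ge> 0" "\<And>A. finite A \<Longrightarrow> 0 \<notin> A \<Longrightarrow> (\<Sum>k\<in>A. 1 / (real k * sqrt (real k))) \<le> Z"
    using inv_powr_bounded by blast
  have "(\<Sum>q\<in>inert_upto X. ln (real (q ^ 2)) / real (q ^ 2)) \<le> 2 * Z" for X
  proof -
    have "(\<Sum>q\<in>inert_upto X. ln (real (q ^ 2)) / real (q ^ 2)) \<le> (\<Sum>q\<in>inert_upto X. 2 * (1 / (real q * sqrt (real q))))"
    proof (rule sum_mono)
      fix q assume "q \<in> inert_upto X"
      hence q: "real q \<ge> 1" by (auto simp: inert_upto_def dest: prime_ge_1_nat)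
      define s where "s = sqrt (real q)"
      have s: "s > 0" "real q = s * s" using q by (auto simp: s_def)
      have "ln (real (q ^ 2)) = 2 * ln (real q)" by (simp add: ln_realpow)
      also have "\<dots> \<le> 2 * s" unfolding s_def using q by (intro mult_left_mono ln_le_sqrt) auto
      finally have "ln (real (q ^ 2)) / real (q ^ 2) \<le> 2 * s / real (q ^ 2)" by (intro divide_right_mono) auto
      also have "\<dots> = 2 * (1 / (real q * s))" unfolding of_nat_power s(2) using s(1) by (simp add: power2_eq_square)
      finally show "ln (real (q ^ 2)) / real (q ^ 2) \<le> 2 * (1 / (real q * sqrt (real q)))" by (simp add: s_def)
    qed
    also have "\<dots> = 2 * (\<Sum>q\<in>inert_upto X. 1 / (real q * sqrt (real q)))" by (rule sum_distrib_left[symmetric])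
    also have "\<dots> \<le> 2 * Z" by (intro mult_left_mono Z(2) finite_inert_upto) (auto simp: inert_upto_def)
    finally show ?thesis .
  qed
  thus ?thesis using Z(1) by (intro exI[of _ "2 * Z"]) simp
qed

lemma mertens_split_primes:
  "\<exists>C. \<forall>n\<ge>1. \<bar>2 * (\<Sum>p\<in>split_upto (real n). ln (real p) / real p) - ln (real n)\<bar> \<le> C"
proof -
  obtain C where C: "\<And>n. n \<ge> 1 \<Longrightarrow> \<bar>(\<Sum>\<pi>\<in>pprimes_upto (real n). ln (real (enorm \<pi>)) / real (enorm \<pi>)) - ln (real n)\<bar> \<le> C"
    using mertens_primary by blast
  obtain Z where Z: "\<And>X. (\<Sum>q\<in>inert_upto X. ln (real (q ^ 2)) / real (q ^ 2)) \<le> Z" using inert_sum_bounded by blast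
  have "\<bar>2 * (\<Sum>p\<in>split_upto (real n). ln (real p) / real p) - ln (real n)\<bar> \<le> C + Z" if n: "n \<ge> 1" for n
  proof -
    have "(\<Sum>\<pi>\<in>pprimes_upto (real n). ln (real (enorm \<pi>)) / real (enorm \<pi>)) =
      (\<Sum>p\<in>split_upto (real n). ln (real p) / real p + ln (real p) / real p) + (\<Sum>q\<in>inert_upto (real n). ln (real (q ^ 2)) / real (q ^ 2))"
      unfolding sum_pprimes_upto by (intro arg_cong2[of _ _ _ _ "(+)"] sum.cong refl) (simp_all only: enorm_cnj split_upto_enorm inert_primary(2))
    moreover have "(\<Sum>p\<in>split_upto (real n). ln (real p) / real p + ln (real p) / real p) = 2 * (\<Sum>p\<in>split_upto (real n). ln (real p) / real p)"
      by (simp only: sum.distrib mult_2)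
    moreover have "(\<Sum>q\<in>inert_upto (real n). ln (real (q ^ 2)) / real (q ^ 2)) \<ge> 0"
    proof (rule sum_nonneg)
      fix q assume "q \<in> inert_upto (real n)"
      hence "real q \<ge> 1" by (auto simp: inert_upto_def dest: prime_ge_1_nat)
      hence "real (q ^ 2) \<ge> 1" by (simp only: of_nat_power one_le_power)
      thus "ln (real (q ^ 2)) / real (q ^ 2) \<ge> 0" by (intro divide_nonneg_nonneg ln_ge_zero) auto
    qed
    ultimately show ?thesis using C[OF n] Z[of "real n"] by linarith
  qed
  thus ?thesis by blast
qed

text \<open>The two conjugate primes above a split p are paired so that only a real quantity h p
  remains. Inert primes have norm q^2, and their total contribution is bounded.\<close>

lemma twisted_split_primes:
  fixes \<phi> :: "complex \<Rightarrow> complex" and h :: "nat \<Rightarrow> real"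
  assumes bound: "\<And>n. n \<ge> 1 \<Longrightarrow> cmod (\<Sum>\<pi>\<in>pprimes_upto (real n). of_real (ln (real (enorm \<pi>))) * \<phi> \<pi>) \<le> C'"
    and norm: "\<And>z. z \<in> primary \<Longrightarrow> cmod (\<phi> z) = 1 / real (enorm z)"
    and pair: "\<And>p. prime p \<Longrightarrow> p mod 3 = 1 \<Longrightarrow> \<phi> (pi_of p) + \<phi> (cnj (pi_of p)) = of_real (2 * h p / real p)"
  shows "\<exists>C. \<forall>n\<ge>1. \<bar>\<Sum>p\<in>split_upto (real n). ln (real p) / real p * h p\<bar> \<le> C"
proof -
  obtain Z where Z: "\<And>X. (\<Sum>q\<in>inert_upto X. ln (real (q ^ 2)) / real (q ^ 2)) \<le> Z" using inert_sum_bounded by blast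
  have "\<bar>\<Sum>p\<in>split_upto (real n). ln (real p) / real p * h p\<bar> \<le> (C' + Z) / 2" if n: "n \<ge> 1" for n
  proof -
    define E where "E = (\<Sum>q\<in>inert_upto (real n). of_real (ln (real (q ^ 2))) * \<phi> (- of_nat q))"
    have "(\<Sum>\<pi>\<in>pprimes_upto (real n). of_real (ln (real (enorm \<pi>))) * \<phi> \<pi>) =
       (\<Sum>p\<in>split_upto (real n). of_real (ln (real p)) * \<phi> (pi_of p) + of_real (ln (real p)) * \<phi> (cnj (pi_of p))) + E"
      unfolding sum_pprimes_upto E_def by (intro arg_cong2[of _ _ _ _ "(+)"] sum.cong refl) (simp_all only: enorm_cnj split_upto_enorm inert_primary(2))
    also have "(\<Sum>p\<in>split_upto (real n). of_real (ln (real p)) * \<phi> (pi_of p) + of_real (ln (real p)) * \<phi> (cnj (pi_of p))) =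
       (\<Sum>p\<in>split_upto (real n). of_real (2 * (ln (real p) / real p * h p)))"
    proof (rule sum.cong[OF refl])
      fix p assume "p \<in> split_upto (real n)"
      hence p: "prime p" "p mod 3 = 1" by (auto simp: split_upto_def)
      have "of_real (ln (real p)) * \<phi> (pi_of p) + of_real (ln (real p)) * \<phi> (cnj (pi_of p)) = of_real (ln (real p)) * of_real (2 * h p / real p)"
        unfolding pair[OF p, symmetric] by (rule distrib_left[symmetric])
      thus "of_real (ln (real p)) * \<phi> (pi_of p) + of_real (ln (real p)) * \<phi> (cnj (pi_of p)) = of_real (2 * (ln (real p) / real p * h p))"
        by simp
    qed
    also have "\<dots> = of_real (2 * (\<Sum>p\<in>split_upto (real n). ln (real p) / real p * h p))" by (simp only: of_real_sum sum_distrib_left)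
    finally have e: "complex_of_real (2 * (\<Sum>p\<in>split_upto (real n). ln (real p) / real p * h p)) = (\<Sum>\<pi>\<in>pprimes_upto (real n). of_real (ln (real (enorm \<pi>))) * \<phi> \<pi>) - E" by simp
    have "cmod E \<le> (\<Sum>q\<in>inert_upto (real n). ln (real (q ^ 2)) / real (q ^ 2))"
      unfolding E_def
    proof (rule sum_norm_le)
      fix q assume "q \<in> inert_upto (real n)"
      hence q: "prime q" "q mod 3 = 2" by (auto simp: inert_upto_def)
      have "cmod (\<phi> (- of_nat q)) = 1 / real (q ^ 2)" using norm[OF inert_primary(1)[OF q(2)]] by (simp only: inert_primary(2))
      moreover have "ln (real (q ^ 2)) \<ge> 0" using prime_ge_1_nat[OF q(1)] by (simp add: ln_realpow)
      ultimately show "cmod (of_real (ln (real (q ^ 2))) * \<phi> (- of_nat q)) \<le> ln (real (q ^ 2)) / real (q ^ 2)"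
        unfolding norm_mult norm_of_real by simp
    qed
    hence "cmod E \<le> Z" using Z[of "real n"] by linarith
    hence "cmod ((\<Sum>\<pi>\<in>pprimes_upto (real n). of_real (ln (real (enorm \<pi>))) * \<phi> \<pi>) - E) \<le> C' + Z"
      by (intro order_trans[OF norm_triangle_ineq4] add_mono bound n)
    hence "\<bar>2 * (\<Sum>p\<in>split_upto (real n). ln (real p) / real p * h p)\<bar> \<le> C' + Z" unfolding e[symmetric] norm_of_real .
    thus ?thesis by argo
  qed
  thus ?thesis by blast
qed

text \<open>The cosine of the argument of \<open>pi_of p\<close>; conjugate primes share it, so the
  choice between them does not matter.\<close>

definition angle_cos :: "nat \<Rightarrow> real" where "angle_cos p = Re (pi_of p) / sqrt (real p)"

lemma cmod_pi_of:
  assumes "prime p" "p mod 3 = 1"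
  shows "(cmod (pi_of p))\<^sup>2 = real p" "cmod (pi_of p) = sqrt (real p)"
proof -
  show 1: "(cmod (pi_of p))\<^sup>2 = real p"
    using of_nat_enorm[OF primary_eisenstein[OF pi_of(1)[OF assms]]] pi_of(2)[OF assms] by simp
  show "cmod (pi_of p) = sqrt (real p)" unfolding 1[symmetric] by simp
qed

lemma abs_angle_cos_le: "prime p \<Longrightarrow> p mod 3 = 1 \<Longrightarrow> \<bar>angle_cos p\<bar> \<le> 1"
  using abs_Re_le_cmod[of "pi_of p"] cmod_pi_of(2)[of p] prime_gt_0_nat[of p] by (simp add: angle_cos_def abs_divide)

lemma mertens_angle_cos:
  "\<exists>C. \<forall>n\<ge>1. \<bar>\<Sum>p\<in>split_upto (real n). ln (real p) / real p * angle_cos p\<bar> \<le> C"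
proof -
  obtain L C where L: "L \<noteq> 0" "\<And>X. X \<ge> 1 \<Longrightarrow> cmod ((\<Sum>z\<in>primary_upto X. phi1 z) - L) \<le> C / sqrt X"
    using phi1_limit by blast
  have norm: "cmod (phi1 z) = 1 / real (enorm z)" if "z \<in> primary" for z
  proof -
    have c: "cmod z > 0" using primary_nonzero[OF that] by simp
    show ?thesis using c unfolding of_nat_enorm[OF primary_eisenstein[OF that]] phi1_def
      by (simp add: norm_divide norm_mult power2_eq_square power3_eq_cube)
  qed
  have mult: "phi1 (z * w) = phi1 z * phi1 w" for z w by (simp add: phi1_def norm_mult power_mult_distrib)
  have one: "phi1 1 = 1" by (simp add: phi1_def)
  obtain C' where C': "\<And>n. n \<ge> 1 \<Longrightarrow> cmod (\<Sum>\<pi>\<in>pprimes_upto (real n). of_real (ln (real (enorm \<pi>))) * phi1 \<pi>) \<le> C'"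
    using mertens_twisted[OF mult one norm L(2,1)] by blast
  show ?thesis
  proof (rule twisted_split_primes[OF C' norm])
    fix p :: nat assume p: "prime p" "p mod 3 = 1"
    have c: "cmod (pi_of p) ^ 3 = sqrt (real p) * real p"
      unfolding cmod_pi_of(2)[OF p] power3_eq_cube by simp
    have "phi1 (pi_of p) + phi1 (cnj (pi_of p)) = (pi_of p + cnj (pi_of p)) / of_real (cmod (pi_of p) ^ 3)"
      by (simp add: phi1_def add_divide_distrib)
    also have "\<dots> = of_real (2 * Re (pi_of p)) / of_real (sqrt (real p) * real p)" unfolding c by (simp only: complex_add_cnj)
    also have "\<dots> = of_real (2 * angle_cos p / real p)" unfolding of_real_divide[symmetric] by (simp add: angle_cos_def)
    finally show "phi1 (pi_of p) + phi1 (cnj (pi_of p)) = of_real (2 * angle_cos p / real p)" .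
  qed
qed

text \<open>The weight is the cosine of twice the angle, and the values of 1/z^2 at the two
  conjugate primes above p add up to 2/p times it.\<close>

lemma mertens_angle_cos2:
  "\<exists>C. \<forall>n\<ge>1. \<bar>\<Sum>p\<in>split_upto (real n). ln (real p) / real p * (2 * (angle_cos p)\<^sup>2 - 1)\<bar> \<le> C"
proof -
  obtain L C where L: "L \<noteq> 0" "\<And>X. X \<ge> 1 \<Longrightarrow> cmod ((\<Sum>z\<in>primary_upto X. 1 / z ^ 2) - L) \<le> C / sqrt X"
    using phi2_limit by blast
  have norm: "cmod (1 / z ^ 2) = 1 / real (enorm z)" if "z \<in> primary" for z
    unfolding of_nat_enorm[OF primary_eisenstein[OF that]] by (simp add: norm_divide norm_power)
  have mult: "1 / (z * w) ^ 2 = 1 / z ^ 2 * (1 / w ^ 2)" for z w :: complex by (simp add: power_mult_distrib)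
  have one: "1 / 1 ^ 2 = (1 :: complex)" by simp
  obtain C' where C': "\<And>n. n \<ge> 1 \<Longrightarrow> cmod (\<Sum>\<pi>\<in>pprimes_upto (real n). of_real (ln (real (enorm \<pi>))) * (1 / \<pi> ^ 2)) \<le> C'"
    using mertens_twisted[where \<phi> = "\<lambda>z. 1 / z ^ 2", OF mult one norm L(2,1)] by blast
  show ?thesis
  proof (rule twisted_split_primes[where \<phi> = "\<lambda>z. 1 / z ^ 2", OF C' norm])
    fix p :: nat assume p: "prime p" "p mod 3 = 1"
    define z where "z = pi_of p"
    have z0: "z \<noteq> 0" unfolding z_def by (rule primary_nonzero[OF pi_of(1)[OF p]])
    have n: "(Re z)\<^sup>2 + (Im z)\<^sup>2 = real p" using cmod_pi_of(1)[OF p] by (simp add: z_def cmod_power2)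
    have zc: "z * cnj z = of_real (real p)" unfolding complex_mult_cnj n by simp
    have rp: "real p > 0" using prime_gt_0_nat[OF p(1)] by simp
    have "1 / z ^ 2 + 1 / (cnj z) ^ 2 = ((cnj z)\<^sup>2 + z\<^sup>2) / (z * cnj z)\<^sup>2"
      using z0 by (simp add: field_simps)
    also have "(cnj z)\<^sup>2 + z\<^sup>2 = of_real (2 * (2 * (Re z)\<^sup>2 - real p))"
      unfolding n[symmetric] by (simp add: complex_eq_iff power2_eq_square algebra_simps)
    also have "of_real (2 * (2 * (Re z)\<^sup>2 - real p)) / (z * cnj z)\<^sup>2 = of_real (2 * (2 * (Re z)\<^sup>2 - real p) / (real p)\<^sup>2)"
      unfolding zc by simp
    also have "2 * (2 * (Re z)\<^sup>2 - real p) / (real p)\<^sup>2 = 2 * (2 * (angle_cos p)\<^sup>2 - 1) / real p"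
      using rp by (simp add: angle_cos_def z_def power_divide power2_eq_square divide_simps)
    finally show "1 / (pi_of p) ^ 2 + 1 / (cnj (pi_of p)) ^ 2 = of_real (2 * (2 * (angle_cos p)\<^sup>2 - 1) / real p)"
      by (simp only: z_def)
  qed
qed

section \<open>Primes with a large excess\<close>

definition biased :: "nat \<Rightarrow> real \<Rightarrow> nat \<Rightarrow> nat set" where
  "biased K \<epsilon> Y = {p. prime p \<and> p mod 3 = 1 \<and> Y < p \<and> p \<le> K * Y \<and> - angle_cos p \<ge> \<epsilon>}"

lemma angle_cos_interval_sums:
  assumes C: "\<And>n. n \<ge> 1 \<Longrightarrow> \<bar>\<Sum>p\<in>split_upto (real n). w p\<bar> \<le> (C :: real)" and "1 \<le> Y" "Y \<le> Z"
  shows "\<bar>\<Sum>p\<in>split_upto (real Z) - split_upto (real Y). w p\<bar> \<le> 2 * C"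
proof -
  have sub: "split_upto (real Y) \<subseteq> split_upto (real Z)" using assms(3) by (auto simp: split_upto_def)
  show ?thesis using C[of Y] C[of Z] assms(2,3) unfolding sum_diff[OF finite_split_upto sub] by linarith
qed

text \<open>With weights $\log p / p$, the function $\cos^2\theta - \cos\theta$ has mean $1/2$, while it is at most
  $2 \max(-\cos\theta, 0)$.\<close>

theorem biased_primes_dense:
  "\<exists>K\<ge>1. \<exists>\<epsilon>>0. \<epsilon> \<le> 1 \<and> (\<forall>Y\<ge>1. (\<Sum>p\<in>biased K \<epsilon> Y. ln (real p) / real p) \<ge> 1/2)"
proof -
  obtain C0 where C0: "\<And>n. n \<ge> 1 \<Longrightarrow> \<bar>2 * (\<Sum>p\<in>split_upto (real n). ln (real p) / real p) - ln (real n)\<bar> \<le> C0"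
    using mertens_split_primes by blast
  obtain C1 where C1: "\<And>n. n \<ge> 1 \<Longrightarrow> \<bar>\<Sum>p\<in>split_upto (real n). ln (real p) / real p * angle_cos p\<bar> \<le> C1"
    using mertens_angle_cos by blast
  obtain C2 where C2: "\<And>n. n \<ge> 1 \<Longrightarrow> \<bar>\<Sum>p\<in>split_upto (real n). ln (real p) / real p * (2 * (angle_cos p)\<^sup>2 - 1)\<bar> \<le> C2"
    using mertens_angle_cos2 by blast
  have C_nonneg: "C0 \<ge> 0" "C1 \<ge> 0" "C2 \<ge> 0"
    using C0[of 1] C1[of 1] C2[of 1] by linarith+
  \<comment> \<open>Chosen so that B/2 - C0 - 2 C2 - 4 C1 is at least 4, which makes the weighted
    sum of max(-cos, 0) at least 1. As log K \<ge> B, the interval (Y, KY] is long enough for its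
    total weight to outgrow all error constants.\<close>
  define B where "B = 8 * (1 + C0 + C1 + C2)"
  define K where "K = nat \<lceil>exp B\<rceil>"
  have "B \<ge> 0" using C_nonneg by (simp add: B_def)
  have eB: "exp B \<le> real K" unfolding K_def by (simp add: real_nat_ceiling_ge)
  have K1: "real K \<ge> 1" using eB \<open>B \<ge> 0\<close> order_trans[OF _ eB, of 1] by simp
  have lnK: "ln (real K) \<ge> B" using eB K1 by (simp add: ln_ge_iff)
  \<comment> \<open>An upper bound for the total weight of the interval. With \<epsilon> = 1/(2W)
    the primes whose -cos lies below \<epsilon> account for at most 1/2 of the sum.\<close>
  define W where "W = ln (real K) / 2 + C0"
  have W: "W \<ge> 1" using lnK C_nonneg by (simp add: W_def B_def)
  define \<epsilon> where "\<epsilon> = 1 / (2 * W)"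
  have eps: "\<epsilon> > 0" "\<epsilon> \<le> 1" using W by (auto simp: \<epsilon>_def divide_simps)
  have "(\<Sum>p\<in>biased K \<epsilon> Y. ln (real p) / real p) \<ge> 1/2" if Y: "Y \<ge> 1" for Y
  proof -
    define S where "S = split_upto (real (K * Y)) - split_upto (real Y)"
    define w where "w = (\<lambda>p. ln (real p) / real p)"
    define m where "m = (\<lambda>p. max (- angle_cos p) 0)"
    have KY: "Y \<le> K * Y" "1 \<le> K * Y" using K1 Y by auto
    have sub: "split_upto (real Y) \<subseteq> split_upto (real (K * Y))" unfolding split_upto_def of_nat_le_iff using order_trans[OF _ KY(1)] by blast
    have fin: "finite S" by (simp add: S_def finite_split_upto)
    have w0: "w p \<ge> 0" if "p \<in> S" for p
      using that by (auto simp: w_def S_def split_upto_def intro!: divide_nonneg_nonneg ln_ge_zero dest: prime_ge_1_nat)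
    have cos1: "\<bar>angle_cos p\<bar> \<le> 1" if "p \<in> S" for p
      using that abs_angle_cos_le by (auto simp: S_def split_upto_def)
    have Sw: "sum w S = (\<Sum>p\<in>split_upto (real (K * Y)). w p) - (\<Sum>p\<in>split_upto (real Y). w p)"
      unfolding S_def by (rule sum_diff[OF finite_split_upto sub])
    have lnKY: "ln (real (K * Y)) = ln (real K) + ln (real Y)" using K1 Y by (simp add: ln_mult)
    have w1: "sum w S \<le> W" "sum w S \<ge> ln (real K) / 2 - C0"
      using C0[OF KY(2)] C0[OF Y] unfolding Sw lnKY W_def unfolding w_def by linarith+
    have s1: "\<bar>\<Sum>p\<in>S. w p * angle_cos p\<bar> \<le> 2 * C1"
      unfolding S_def w_def by (rule angle_cos_interval_sums[OF C1 Y KY(1)])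
    have s2: "\<bar>\<Sum>p\<in>S. w p * (2 * (angle_cos p)\<^sup>2 - 1)\<bar> \<le> 2 * C2"
      unfolding S_def w_def by (rule angle_cos_interval_sums[OF C2 Y KY(1)])
    \<comment> \<open>Twice cos^2 - cos, written through the cosine of the double angle so that each
      piece is one of the three available Mertens sums.\<close>
    have "(\<Sum>p\<in>S. w p * (2 * (angle_cos p)\<^sup>2 - 1)) + sum w S - 2 * (\<Sum>p\<in>S. w p * angle_cos p)
        = (\<Sum>p\<in>S. w p * (2 * (angle_cos p)\<^sup>2 - 1) + w p - 2 * (w p * angle_cos p))"
      by (simp only: sum.distrib sum_subtractf sum_distrib_left)
    also have "\<dots> \<le> (\<Sum>p\<in>S. 4 * (w p * m p))"
    proof (rule sum_mono)
      fix p assume p: "p \<in> S"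
      define x where "x = angle_cos p"
      have x: "\<bar>x\<bar> \<le> 1" using cos1[OF p] by (simp add: x_def)
      have "2 * x\<^sup>2 - 1 + 1 - 2 * x \<le> 4 * max (- x) 0"
      proof (cases "x \<ge> 0")
        case True
        hence "x * x \<le> 1 * x" using x by (intro mult_right_mono) auto
        thus ?thesis using True by (simp add: power2_eq_square)
      next
        case False
        hence "(- x) * (- x) \<le> 1 * (- x)" using x by (intro mult_right_mono) auto
        thus ?thesis using False by (simp add: power2_eq_square)
      qed
      hence "w p * (2 * x\<^sup>2 - 1 + 1 - 2 * x) \<le> w p * (4 * max (- x) 0)" by (intro mult_left_mono w0 p)
      thus "w p * (2 * (angle_cos p)\<^sup>2 - 1) + w p - 2 * (w p * angle_cos p) \<le> 4 * (w p * m p)"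
        by (simp add: x_def m_def algebra_simps)
    qed
    also have "\<dots> = 4 * (\<Sum>p\<in>S. w p * m p)" by (rule sum_distrib_left[symmetric])
    finally have "4 * (\<Sum>p\<in>S. w p * m p) \<ge> B / 2 - C0 - 2 * C2 - 4 * C1" using s1 s2 w1 lnK by argo
    hence big: "(\<Sum>p\<in>S. w p * m p) \<ge> 1" using C_nonneg unfolding B_def by argo
    have "(\<Sum>p\<in>S. w p * m p) \<le> (\<Sum>p\<in>S. \<epsilon> * w p + (if - angle_cos p \<ge> \<epsilon> then w p else 0))"
    proof (rule sum_mono)
      fix p assume p: "p \<in> S"
      show "w p * m p \<le> \<epsilon> * w p + (if - angle_cos p \<ge> \<epsilon> then w p else 0)"
      proof (cases "- angle_cos p \<ge> \<epsilon>")
        case True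
        have "w p * m p \<le> w p * 1" using cos1[OF p] by (intro mult_left_mono w0 p) (auto simp: m_def)
        moreover have "\<epsilon> * w p \<ge> 0" using eps w0[OF p] by simp
        ultimately show ?thesis using True by simp
      next
        case False
        hence "w p * m p \<le> w p * \<epsilon>" using eps by (intro mult_left_mono w0 p) (auto simp: m_def)
        thus ?thesis using False by (simp add: mult.commute)
      qed
    qed
    also have "\<dots> = \<epsilon> * sum w S + (\<Sum>p\<in>S. if - angle_cos p \<ge> \<epsilon> then w p else 0)"
      by (simp only: sum.distrib sum_distrib_left)
    also have "(\<Sum>p\<in>S. if - angle_cos p \<ge> \<epsilon> then w p else 0) = sum w {p \<in> S. - angle_cos p \<ge> \<epsilon>}"
      by (rule sum.inter_filter[OF fin, symmetric])
    also have "{p \<in> S. - angle_cos p \<ge> \<epsilon>} = biased K \<epsilon> Y"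
      by (auto simp: S_def split_upto_def biased_def simp del: of_nat_mult)
    finally have "1 \<le> \<epsilon> * sum w S + sum w (biased K \<epsilon> Y)" using big by linarith
    moreover have "\<epsilon> * sum w S \<le> \<epsilon> * W" using eps w1 by (intro mult_left_mono) auto
    moreover have "\<epsilon> * W = 1/2" using W by (simp add: \<epsilon>_def)
    ultimately show ?thesis unfolding w_def by linarith
  qed
  moreover have "K \<ge> 1" using K1 by simp
  ultimately show ?thesis using eps by blast
qed

section \<open>Products over the biased primes\<close>

lemma finite_biased: "finite (biased K \<epsilon> Y)"
  by (rule finite_subset[of _ "{..K * Y}"]) (auto simp: biased_def)

text \<open>The excess is -2 Re \<pi> - 2 \<ge> 2 \<epsilon> sqrt p - 2. One of the two copies of
  \<epsilon> sqrt p, being at least 148, absorbs the constant 2.\<close>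

lemma biased_gain_prime:
  assumes p: "p \<in> biased K \<epsilon> Y" and \<epsilon>: "\<epsilon> > 0" and Y: "sqrt (real Y) \<ge> 148 / \<epsilon>"
  shows "gain_prime \<epsilon> p"
proof -
  have pp: "prime p" "p mod 3 = 1" "Y < p" "- angle_cos p \<ge> \<epsilon>" using p by (auto simp: biased_def)
  have "sqrt (real Y) \<le> sqrt (real p)" using pp(3) by simp
  hence s: "sqrt (real p) \<ge> 148 / \<epsilon>" using Y by linarith
  hence es: "\<epsilon> * sqrt (real p) \<ge> 148" using \<epsilon> by (simp add: pos_divide_le_eq mult.commute)
  have sp: "sqrt (real p) > 0" using prime_gt_0_nat[OF pp(1)] by simp
  have "- Re (pi_of p) = - angle_cos p * sqrt (real p)" using sp by (simp add: angle_cos_def)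
  also have "\<dots> \<ge> \<epsilon> * sqrt (real p)" using pp(4) sp by (intro mult_right_mono) auto
  finally have "- Re (pi_of p) \<ge> \<epsilon> * sqrt (real p)" .
  hence "real (nu p) \<ge> real p + \<epsilon> * sqrt (real p)" using pi_of(3)[OF pp(1,2)] es by linarith
  thus ?thesis using pp(1) s by (simp add: gain_prime_def)
qed

lemma prod_biased_le: "real (\<Prod>(biased K \<epsilon> Y)) \<le> exp (6 * real (K * Y))"
proof -
  let ?P = "biased K \<epsilon> Y"
  have pos: "real p > 0" if "p \<in> ?P" for p using that prime_gt_0_nat[of p] by (simp add: biased_def)
  have "real (\<Prod>?P) = (\<Prod>p\<in>?P. exp (ln (real p)))" using pos by simp
  also have "\<dots> = exp (\<Sum>p\<in>?P. ln (real p))" by (rule exp_sum[OF finite_biased, symmetric])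
  also have "(\<Sum>p\<in>?P. ln (real p)) \<le> theta (K * Y)"
    unfolding theta_def
    by (rule sum_mono2[OF finite_primes_le]) (auto simp: biased_def intro!: ln_ge_zero dest: prime_ge_1_nat)
  also have "theta (K * Y) \<le> 6 * real (K * Y)" by (rule theta_le)
  finally show ?thesis by simp
qed

lemma exp_half_le: "0 \<le> x \<Longrightarrow> x \<le> 1 \<Longrightarrow> exp (x / 2) \<le> 1 + (x :: real)"
proof -
  assume x: "0 \<le> x" "x \<le> 1"
  have "exp (x / 2) \<le> 1 + x / 2 + (x / 2)\<^sup>2" using x by (intro exp_bound) auto
  also have "(x / 2)\<^sup>2 \<le> x / 2"
  proof -
    have "(x / 2) * (x / 2) \<le> (x / 2) * 1" using x by (intro mult_left_mono) auto
    thus ?thesis by (simp add: power2_eq_square)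
  qed
  finally show ?thesis by simp
qed

text \<open>For Y < p \<le> KY the density weight log p / p is at most log(KY) / sqrt Y times
  p^(-1/2), so a total weight of 1/2 forces the sum of p^(-1/2) to be at least sqrt Y / (2 log(KY)).
  With Y of order log N this logarithm is the source of log log N in the theorem. The factor 1600 is
  twice 800, because exp(x/2) \<le> 1 + x is used for the individual factors.\<close>

lemma prod_gain_ge:
  assumes \<epsilon>: "0 < \<epsilon>" "\<epsilon> \<le> 1" and Y: "Y \<ge> 1" and K: "K * Y \<ge> 2"
    and dense: "(\<Sum>p\<in>biased K \<epsilon> Y. ln (real p) / real p) \<ge> 1/2"
  shows "(\<Prod>p\<in>biased K \<epsilon> Y. gain_factor \<epsilon> p) \<ge> exp (\<epsilon> / 3200 * (sqrt (real Y) / ln (real (K * Y))))"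
proof -
  let ?P = "biased K \<epsilon> Y"
  have l: "ln (real (K * Y)) > 0" using K by (intro ln_gt_zero) linarith
  have "1/2 * (sqrt (real Y) / ln (real (K * Y))) \<le> (\<Sum>p\<in>?P. ln (real p) / real p) * (sqrt (real Y) / ln (real (K * Y)))"
    using l by (intro mult_right_mono dense) auto
  also have "\<dots> = (\<Sum>p\<in>?P. ln (real p) / real p * (sqrt (real Y) / ln (real (K * Y))))" by (rule sum_distrib_right)
  also have "\<dots> \<le> (\<Sum>p\<in>?P. 1 / sqrt (real p))"
  proof (rule sum_mono)
    fix p assume "p \<in> ?P"
    hence p: "1 \<le> real p" "real Y \<le> real p" "real p \<le> real (K * Y)"
      by (auto simp: biased_def dest: prime_ge_1_nat simp del: of_nat_mult)
    have "ln (real p) / real p * (sqrt (real Y) / ln (real (K * Y))) \<le> ln (real (K * Y)) / real p * (sqrt (real p) / ln (real (K * Y)))"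
      using p l by (intro mult_mono divide_right_mono ln_mono real_sqrt_le_mono) auto
    also have "\<dots> = sqrt (real p) / real p" using l by simp
    also have "\<dots> = 1 / sqrt (real p)" using p by (simp add: divide_simps)
    finally show "ln (real p) / real p * (sqrt (real Y) / ln (real (K * Y))) \<le> 1 / sqrt (real p)" .
  qed
  finally have "\<epsilon> / 1600 * (1/2 * (sqrt (real Y) / ln (real (K * Y)))) \<le> \<epsilon> / 1600 * (\<Sum>p\<in>?P. 1 / sqrt (real p))"
    using \<epsilon> by (intro mult_left_mono) auto
  also have "\<dots> = (\<Sum>p\<in>?P. \<epsilon> / (800 * sqrt (real p)) / 2)" by (simp add: sum_distrib_left)
  finally have "exp (\<epsilon> / 3200 * (sqrt (real Y) / ln (real (K * Y)))) \<le> exp (\<Sum>p\<in>?P. \<epsilon> / (800 * sqrt (real p)) / 2)" by simp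
  also have "\<dots> = (\<Prod>p\<in>?P. exp (\<epsilon> / (800 * sqrt (real p)) / 2))" by (rule exp_sum[OF finite_biased])
  also have "\<dots> \<le> (\<Prod>p\<in>?P. gain_factor \<epsilon> p)"
  proof (rule prod_mono, intro conjI)
    fix p assume "p \<in> ?P"
    hence "1 \<le> real p" by (auto simp: biased_def dest: prime_ge_1_nat)
    hence "sqrt (real p) \<ge> 1" by simp
    hence "\<epsilon> \<le> 800 * sqrt (real p)" "0 < 800 * sqrt (real p)" using \<epsilon> by linarith+
    hence "\<epsilon> / (800 * sqrt (real p)) \<le> 1" "0 \<le> \<epsilon> / (800 * sqrt (real p))" using \<epsilon> by auto
    thus "exp (\<epsilon> / (800 * sqrt (real p)) / 2) \<le> gain_factor \<epsilon> p" unfolding gain_factor_def by (intro exp_half_le)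
  qed simp
  finally show ?thesis .
qed

lemma card_cubes_le:
  assumes "A \<subseteq> {int n ^ 3 | n. n \<in> {1..N}}" shows "card A \<le> N"
proof -
  have "A \<subseteq> (\<lambda>n. int n ^ 3) ` {1..N}" using assms by blast
  hence "card A \<le> card {1..N}" by (rule surj_card_le[rotated]) simp
  thus ?thesis by simp
qed

lemma ln_ln_3_pos: "ln (ln (3::real)) > 0"
  using ln3_gt_1 by simp

section \<open>Choice of the range of primes and conclusion\<close>

lemma large_range_bound:
  assumes K: "K \<ge> 1" and \<epsilon>: "0 < \<epsilon>" "\<epsilon> \<le> 1"
    and dense: "\<And>Y. Y \<ge> 1 \<Longrightarrow> (\<Sum>p\<in>biased K \<epsilon> Y. ln (real p) / real p) \<ge> 1/2"
    and N: "ln (real N) \<ge> 6 * real K * ((148 / \<epsilon>)\<^sup>2 + 2)"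
    and A: "A \<subseteq> {int n ^ 3 | n. n \<in> {1..N}}" and B: "Bh_set 3 g A"
  shows "exp (\<epsilon> / (3200 * sqrt (12 * real K)) * (sqrt (ln (real N)) / ln (ln (real N)))) * real (card A) ^ 9 \<le> 1536 * real g * real N ^ 9"
proof -
  define l where "l = ln (real N)"
  \<comment> \<open>The largest admissible choice: the product of the primes used is at most
    exp(6KY), which must not exceed N. The hypothesis on log N makes Y at least (148/\<epsilon>)^2,
    as gain primes demand.\<close>
  define Y where "Y = nat \<lfloor>l / (6 * real K)\<rfloor>"
  have k: "6 * real K > 0" using K by simp
  have lk: "l / (6 * real K) \<ge> (148 / \<epsilon>)\<^sup>2 + 2" using N k by (simp add: l_def pos_le_divide_eq mult.commute)
  have q: "(148 / \<epsilon>)\<^sup>2 \<ge> 1" using \<epsilon> by (intro one_le_power) (simp add: pos_le_divide_eq)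
  have nn: "l / (6 * real K) \<ge> 0" using lk q by linarith
  have Y: "real Y \<le> l / (6 * real K)" "real Y > l / (6 * real K) - 1"
    using nn unfolding Y_def by linarith+
  have Yb: "real Y \<ge> (148 / \<epsilon>)\<^sup>2" "real Y \<ge> 2" using Y(2) lk q by linarith+
  have half: "l / (12 * real K) = l / (6 * real K) / 2" by simp
  \<comment> \<open>Rounding down costs at most a factor 2, whence 12 in place of 6 under the root
    in the final constant.\<close>
  have Yl: "real Y \<ge> l / (12 * real K)" unfolding half using Y(2) lk q by argo
  have KY: "6 * real (K * Y) \<le> l" using Y(1) k by (simp add: pos_le_divide_eq mult_ac)
  have "real 1 * real 2 \<le> real K * real Y" using K Yb(2) by (intro mult_mono) auto
  hence KY2: "real (K * Y) \<ge> 2" by simp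
  have l0: "l > 0" using KY KY2 by linarith
  have N0: "real N > 0"
  proof (rule ccontr)
    assume "\<not> ?thesis" hence "N = 0" by simp
    thus False using l0 by (simp add: l_def)
  qed
  have sY: "sqrt (real Y) \<ge> 148 / \<epsilon>" by (rule real_le_rsqrt[OF Yb(1)])
  have "real (\<Prod>(biased K \<epsilon> Y)) \<le> exp (6 * real (K * Y))" by (rule prod_biased_le)
  also have "\<dots> \<le> exp l" using KY by simp
  also have "\<dots> = real N" using N0 by (simp add: l_def)
  finally have Q: "\<Prod>(biased K \<epsilon> Y) \<le> N" by (simp only: of_nat_le_iff)
  have Y1: "Y \<ge> 1" using Yb(2) by simp
  have KY2': "K * Y \<ge> 2" using KY2 by linarith
  have ll: "0 < ln (real (K * Y))" using KY2 by (intro ln_gt_zero) linarith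
  have ll': "ln (real (K * Y)) \<le> ln l"
  proof (rule ln_mono)
    show "real (K * Y) \<le> l" "real (K * Y) > 0" using KY KY2 by linarith+
  qed
  have "sqrt l / sqrt (12 * real K) = sqrt (l / (12 * real K))" by (rule real_sqrt_divide[symmetric])
  also have "\<dots> \<le> sqrt (real Y)" using Yl by simp
  finally have "sqrt l / sqrt (12 * real K) / ln l \<le> sqrt (real Y) / ln (real (K * Y))"
    using ll ll' l0 by (intro frac_le) auto
  hence "\<epsilon> / 3200 * (sqrt l / sqrt (12 * real K) / ln l) \<le> \<epsilon> / 3200 * (sqrt (real Y) / ln (real (K * Y)))"
    using \<epsilon> by (intro mult_left_mono) auto
  moreover have "\<epsilon> / 3200 * (sqrt l / sqrt (12 * real K) / ln l) = \<epsilon> / (3200 * sqrt (12 * real K)) * (sqrt l / ln l)"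
    by simp
  ultimately have "exp (\<epsilon> / (3200 * sqrt (12 * real K)) * (sqrt l / ln l)) \<le> exp (\<epsilon> / 3200 * (sqrt (real Y) / ln (real (K * Y))))"
    by (simp only: exp_le_cancel_iff)
  also have "\<dots> \<le> (\<Prod>p\<in>biased K \<epsilon> Y. gain_factor \<epsilon> p)"
    by (rule prod_gain_ge[OF \<epsilon> Y1 KY2' dense[OF Y1]])
  finally have "exp (\<epsilon> / (3200 * sqrt (12 * real K)) * (sqrt l / ln l)) * real (card A) ^ 9
      \<le> (\<Prod>p\<in>biased K \<epsilon> Y. gain_factor \<epsilon> p) * real (card A) ^ 9" by (rule mult_right_mono) simp
  also have "\<dots> \<le> 1536 * real g * real N ^ 9"
    by (rule Bh_cubes_bound[OF \<epsilon> finite_biased _ Q A B]) (use biased_gain_prime[OF _ \<epsilon>(1) sY] in blast)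
  finally show ?thesis by (simp add: l_def)
qed

theorem theorem1p7:
  "\<exists>c>0::real. \<exists>C>0::real. \<forall>N\<ge>3::nat. \<forall>g\<ge>1::nat. \<forall>A::int set.
     A \<subseteq> {int n ^ 3 | n. n \<in> {1..N}} \<longrightarrow> Bh_set 3 g A \<longrightarrow>
     real (card A) \<le> C * (real g powr (1 / 9) * real N
       * exp (- c * (ln (real N) powr (1 / 2) / ln (ln (real N)))))"
proof -
  obtain K \<epsilon> where K: "K \<ge> 1" and \<epsilon>: "\<epsilon> > 0" "\<epsilon> \<le> 1"
    and dense: "\<And>Y. Y \<ge> 1 \<Longrightarrow> (\<Sum>p\<in>biased K \<epsilon> Y. ln (real p) / real p) \<ge> 1/2"
    using biased_primes_dense by blast
  define d where "d = \<epsilon> / (3200 * sqrt (12 * real K))"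
  \<comment> \<open>The bound is for the ninth power of the cardinality; taking ninth roots divides
    the exponent by 9.\<close>
  define c where "c = d / 9"
  define M where "M = 6 * real K * ((148 / \<epsilon>)\<^sup>2 + 2)"
  \<comment> \<open>For log N < M, the range where the prime argument does not apply, B bounds the
    quotient in the exponent: numerator below sqrt M, denominator at least log log 3, which is
    positive. The trivial bound card A \<le> N then suffices with the constant exp(c B).\<close>
  define B where "B = sqrt M / ln (ln 3)"
  have c0: "c > 0" using K \<epsilon> by (simp add: c_def d_def)
  have "real (card A) \<le> (1536 + exp (c * B)) * (real g powr (1 / 9) * real N
       * exp (- c * (ln (real N) powr (1 / 2) / ln (ln (real N)))))"
    if N: "N \<ge> 3" and g: "g \<ge> 1" and A: "A \<subseteq> {int n ^ 3 | n. n \<in> {1..N}}" and Bh: "Bh_set 3 g A" for N g :: nat and A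
  proof -
    define t where "t = sqrt (ln (real N)) / ln (ln (real N))"
    define G where "G = real g powr (1 / 9)"
    define R where "R = G * real N * exp (- c * t)"
    have l3: "ln 3 \<le> ln (real N)" using N by simp
    have "ln (3::real) > 0" by simp
    have pw: "ln (real N) powr (1/2) = sqrt (ln (real N))" using l3 \<open>ln (3::real) > 0\<close> by (intro powr_half_sqrt) linarith
    have ll: "ln (ln (real N)) \<ge> ln (ln 3)" using l3 N by (intro ln_mono) auto
    have G9: "G ^ 9 = real g" using g by (simp add: G_def powr_power)
    have G1: "G \<ge> 1" using g by (simp add: G_def ge_one_powr_ge_zero)
    have R0: "R \<ge> 0" using G1 by (simp add: R_def)
    have "real (card A) \<le> (1536 + exp (c * B)) * R"
    proof (cases "ln (real N) \<ge> M")
      case True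
      have "exp (d * t) * real (card A) ^ 9 \<le> 1536 * real g * real N ^ 9"
        using large_range_bound[OF K \<epsilon> dense True[unfolded M_def] A Bh] by (simp only: d_def t_def)
      hence "exp (- (d * t)) * (exp (d * t) * real (card A) ^ 9) \<le> exp (- (d * t)) * (1536 * real g * real N ^ 9)"
        by (intro mult_left_mono) auto
      hence "real (card A) ^ 9 \<le> 1536 * (real g * real N ^ 9 * exp (- (d * t)))"
        by (simp add: exp_minus field_simps)
      also have "exp (- (d * t)) = exp (- c * t) ^ 9" unfolding exp_of_nat_mult[symmetric] by (simp add: c_def)
      also have "real g * real N ^ 9 * exp (- c * t) ^ 9 = R ^ 9" by (simp only: R_def power_mult_distrib G9)
      \<comment> \<open>The constant is enlarged to a ninth power so that the root can be taken
        exactly.\<close>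
      also have "1536 * R ^ 9 \<le> 1536 ^ 9 * R ^ 9" using R0 by (intro mult_right_mono) auto
      also have "\<dots> = (1536 * R) ^ 9" by (rule power_mult_distrib[symmetric])
      finally have "real (card A) ^ Suc 8 \<le> (1536 * R) ^ Suc 8" by simp
      hence "real (card A) \<le> 1536 * R" by (rule power_le_imp_le_base) (use R0 in simp)
      also have "\<dots> \<le> (1536 + exp (c * B)) * R" using R0 by (intro mult_right_mono) auto
      finally show ?thesis .
    next
      case False
      have "t \<le> B" unfolding t_def B_def
        using False ll ln_ln_3_pos l3 \<open>ln (3::real) > 0\<close> by (intro frac_le) auto
      hence "c * t \<le> c * B" using c0 by simp
      hence "1 \<le> exp (c * B) * exp (- c * t)" by (simp flip: exp_add)
      hence "1 \<le> G * (exp (c * B) * exp (- c * t))" using G1 mult_mono[OF G1, of 1] by simp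
      hence "1 * real N \<le> (G * (exp (c * B) * exp (- c * t))) * real N" by (intro mult_right_mono) auto
      also have "\<dots> = exp (c * B) * R" by (simp add: R_def)
      also have "\<dots> \<le> (1536 + exp (c * B)) * R" using R0 by (intro mult_right_mono) auto
      finally show ?thesis using card_cubes_le[OF A] by simp
    qed
    thus ?thesis unfolding R_def G_def t_def pw .
  qed
  moreover have "1536 + exp (c * B) > 0" by (simp add: add_pos_pos)
  ultimately show ?thesis using c0 by blast
qed

end
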